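(* The following hold. (i) For all gd-sets $X,Y,Z$, $$\Box_{\preceq}(Y,X)\le\Box(X,Y),\qquad \Box_{\preceq}(Z,X)\le\Box_{\preceq}(Z,Y)+\Box_{\preceq}(Y,X),$$ and $\Box_{\preceq}(Y,X)=0$ if and only if $Y\preceq X$. Moreover, if gd-sets $X_n,Y_n$ $(n\ge1)$, $X,Y$ and numbers $\delta_n\ge0$ satisfy $\delta_n\to0$, $Y_n\preceq_{\delta_n}X_n$ for all $n$, $\Box(X_n,X)\to0$ and $\Box(Y_n,Y)\to0$, then $Y\preceq X$. (ii) Let $(X_n,d_n,\mu_n)$ $(n\ge1)$ and $(Y,d_Y,\nu)$ be qm-spaces. Suppose there are Borel sets $A_n\subset X_n$, Borel maps $p_n\colon A_n\to Y$ and numbers $\varepsilon_n\ge0$ such that $\varepsilon_n\to0$, $\mu_n(A_n)\to1$, $(p_n)_*(\mu_n|_{A_n})\to\nu$ weakly as finite Borel measures on $Y$, and $$d_Y(p_n(x),p_n(y))\le d_n(x,y)+\varepsilon_n\qquad(x,y\in A_n).$$ Let $\mathcal L$ be a monoidal family with $\mathcal{TB}\subset\mathcal L\subset\operatorname{Lip}_1^+(\mathbb R)$. Then $\operatorname{Rep}^+(Y)$ belongs to every subsequential weak limit of the pyramids in $\mathcal L\circ\mathcal D$ generated by $\operatorname{Rep}^+(X_n)$; that is, whenever a subsequence of these generated pyramids converges weakly to a pyramid $\mathcal P$ in $\mathcal L\circ\mathcal D$, one has $\operatorname{Rep}^+(Y)\in\mathcal P$. (iii) (a) Let $\mathcal P_n\to\mathcal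 P$ weakly be pyramids in $\operatorname{Lip}_1^+(\mathbb R)\circ\mathcal D$. For every $\kappa\in(0,1)$, $$\operatorname{ObsDiam}(\mathcal P;-\kappa)=\lim_{\varepsilon\downarrow0}\liminf_{n\to\infty}\operatorname{ObsDiam}(\mathcal P_n;-(\kappa+\varepsilon))=\lim_{\varepsilon\downarrow0}\limsup_{n\to\infty}\operatorname{ObsDiam}(\mathcal P_n;-(\kappa+\varepsilon))$$ in $[0,+\infty]$, where $0<\varepsilon<1-\kappa$. (b) Let $\mathcal P_n\to\mathcal P$ weakly be pyramids in $\mathcal{TB}\circ\mathcal D$. For every positive integer $N$ and $\kappa_0,\dots,\kappa_N\in(0,1)$, $$\operatorname{Sep}(\mathcal P;\kappa_0,\dots,\kappa_N)=\lim_{\varepsilon\downarrow0}\liminf_{n\to\infty}\operatorname{Sep}(\mathcal P_n;\kappa_0-\varepsilon,\dots,\kappa_N-\varepsilon)=\lim_{\varepsilon\downarrow0}\limsup_{n\to\infty}\operatorname{Sep}(\mathcal P_n;\kappa_0-\varepsilon,\dots,\kappa_N-\varepsilon)$$ in $[0,+\infty]$, where $0<\varepsilon<\min_{0\le j\le N}\kappa_j$.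
   Context: **gd-sets and domination.** A gd-set is a triple $(X,F_X,\mu_X)$, written $X$, where $F_X$ is a nonempty family of functions $X\to\mathbb R$ such that $d_{F_X}(x,x')=\sup_{f\in F_X}|f(x)-f(x')|$ is a complete separable metric on $X$, and $\mu_X$ is a Borel probability measure on $(X,d_{F_X})$ with full support. $\overline{F_X}$ is the pointwise closure of $F_X$ in $\mathbb R^X$. A Borel map $u\colon X\to Y$ is a domination if $u_*\mu_X=\mu_Y$ and $F_Y\circ u\subset\overline{F_X}$; write $Y\preceq X$ if such $u$ exists. $\mathcal D$ is the category of (isomorphism classes of) gd-sets with dominations as morphisms. **Box distances.** $\mathcal T(\mu,\nu)$ denotes the set of couplings of $\mu,\nu$. For closed $S\subset X\times Y$ put $d^S_\infty(h,k)=\sup_{S}|h-k|$ for functions on $X\times Y$, and let $(d^S_\infty)_H$ be the induced Hausdorff pseudometric on families of functions; both are $0$ if $S=\varnothing$. The box distance $\Box(X,Y)$ is the infimum of $\eta\ge0$ for which there are $\pi\in\mathcal T(\mu_X,\mu_Y)$ and a closed $S\subset X\times Y$ with $1-\pi(S)\le\eta$ and $2(d^S_\infty)_H(\overline{F_X}\circ\mathrm{pr}_1,\overline{F_Y}\circ\mathrm{pr}_2)\le\eta$. It is a metric on isomorphism classes of gd-sets. For $\varepsilon\ge0$, $Y\preceq_\varepsilon X$ means that there are $\pi\in\mathcal T(\mu_X,\mu_Y)$ and a closed $S\subset X\times Y$ with $\pi(S)\ge1-\varepsilon$ and $$2\sup_{g\in\overline{F_Y}}\inf_{f\in\overline{F_X}}\sup_{(x,y)\in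 S}|g(y)-f(x)|\le\varepsilon,$$ the innermost supremum being $0$ if $S=\varnothing$. The one-sided box distance is $\Box_\preceq(Y,X)=\inf\{\varepsilon\ge0\mid Y\preceq_\varepsilon X\}$. **qm-spaces.** A qm-space $(X,d_X,\mu_X)$ consists of a set $X$, a function $d_X\colon X\times X\to[0,+\infty)$ with $d_X(x,x)=0$ and the triangle inequality (not necessarily symmetric) such that $d_X^{\mathrm s}(x,y)=\max\{d_X(x,y),d_X(y,x)\}$ is a complete separable metric, and a Borel probability measure $\mu_X$ on $(X,d_X^{\mathrm s})$ with full support. Topological notions on $X$ refer to $d_X^{\mathrm s}$. Put $\operatorname{Lip}_1^+(X)=\{f\colon X\to\mathbb R\mid f(y)-f(x)\le d_X(x,y)\ \forall x,y\}$ and let $\operatorname{Rep}^+(X)$ be the gd-set $(X,\operatorname{Lip}_1^+(X),\mu_X)$. **Monoidal families.** Let $\operatorname{Lip}_1(\mathbb R)$ be the set of $1$-Lipschitz functions $\mathbb R\to\mathbb R$. A pointwise closed $\mathcal L\subset\operatorname{Lip}_1(\mathbb R)$ is monoidal if it contains the identity and is closed under composition. $\operatorname{Lip}_1^+(\mathbb R)$ denotes the nondecreasing $1$-Lipschitz functions $\mathbb R\to\mathbb R$, and $$\mathcal{TB}=\{t\mapsto\max\{l,\min\{t+c,u\}\}\mid c\in\mathbb R,\ l\in[-\infty,+\infty),\ u\in(-\infty,+\infty],\ l\le u\}.$$ For a monoidal $\mathcal L\supset\mathcal{TB}$, an $\mathcal L$-gd-set is a gd-set $X$ with $\mathcal L\circ\overline{F_X}\subset\overline{F_X}$,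 and $\mathcal L\circ\mathcal D$ is the full subcategory of $\mathcal D$ of $\mathcal L$-gd-sets. **Pyramids.** A pyramid in $\mathcal L\circ\mathcal D$ is a nonempty family $\mathcal P$ of (isomorphism classes of) $\mathcal L$-gd-sets that is closed with respect to $\Box$ in $\mathcal L\circ\mathcal D$, downward closed ($X\in\mathcal P$, $Y\in\mathcal L\circ\mathcal D$, $Y\preceq X$ imply $Y\in\mathcal P$), and directed (for $X,Y\in\mathcal P$ there is $Z\in\mathcal P$ with $X\preceq Z$, $Y\preceq Z$). The pyramid generated by $X\in\mathcal L\circ\mathcal D$ is $\{Y\in\mathcal L\circ\mathcal D\mid Y\preceq X\}$. Weak convergence $\mathcal P_n\to\mathcal P$ is sequential Painlevé–Kuratowski convergence with respect to $\Box$: for every $X\in\mathcal P$, $\inf_{Y\in\mathcal P_n}\Box(X,Y)\to0$, and for every $X\in(\mathcal L\circ\mathcal D)\setminus\mathcal P$, $\liminf_n\inf_{Y\in\mathcal P_n}\Box(X,Y)>0$. **Observable diameter.** For a Borel probability measure $\nu$ on $\mathbb R$ and $\alpha\in(0,1)$, $\operatorname{PartDiam}(\nu;\alpha)=\inf\{\operatorname{diam}B\mid B\subset\mathbb R\text{ Borel},\ \nu(B)\ge\alpha\}$. For a gd-set $X$ and $\kappa\in(0,1)$, $\operatorname{ObsDiam}(X;-\kappa)=\sup_{f\in\overline{F_X}}\operatorname{PartDiam}(f_*\mu_X;1-\kappa)$; for a nonempty family $\mathcal E$, $\operatorname{ObsDiam}(\mathcal E;-\kappa)=\sup_{X\in\mathcal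 E}\operatorname{ObsDiam}(X;-\kappa)$. **Multi-directed separation.** For nonempty $A,B\subset X$, $\sigma^{\to}(X;A,B)=\sup_{f\in\overline{F_X}}\inf_{a\in A,b\in B}(f(b)-f(a))$. For a gd-set $X$, $\operatorname{Sep}(X;\kappa_0,\dots,\kappa_N)$ is the supremum of $\min_{0\le i<j\le N}\sigma^{\to}(X;A_i,A_j)$ over all tuples $(A_0,\dots,A_N)$ of pairwise disjoint Borel subsets of $X$ with $\mu_X(A_i)\ge\kappa_i$ for all $i$; it is $0$ if there is no such tuple. For a nonempty family $\mathcal E$, $\operatorname{Sep}(\mathcal E;\kappa_0,\dots,\kappa_N)=\sup_{X\in\mathcal E}\operatorname{Sep}(X;\kappa_0,\dots,\kappa_N)$. *)

theory Defs
  imports "HOL-Probability.Probability"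
begin

section \<open>gd-sets and domination\<close>

text \<open>
  The underlying set of a gd-set is a subset of the ambient type. Real functions on it
  are represented by elements of \<^term>\<open>extensional (pts X)\<close>, so that equality of functions on
  \<^term>\<open>pts X\<close> is equality in HOL.
\<close>

record 'a gdset =
  pts :: "'a set"
  obs :: "('a \<Rightarrow> real) set"
  msr :: "'a measure"

definition borel_on :: "'a topology \<Rightarrow> 'a measure" where
  "borel_on T = sigma (topspace T) {U. openin T U}"

text \<open>
  The value 0 off the carrier is needed because the locale \<^locale>\<open>Metric_space\<close> requires
  nonnegativity and symmetry on the whole type.
\<close>

definition gd_dist :: "'a gdset \<Rightarrow> 'a \<Rightarrow> 'a \<Rightarrow> real" where
  "gd_dist X x y = (if x \<in> pts X \<and> y \<in> pts X then (SUP f\<in>obs X. \<bar>f x - f y\<bar>) else 0)"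

definition gd_top :: "'a gdset \<Rightarrow> 'a topology" where
  "gd_top X = Metric_space.mtopology (pts X) (gd_dist X)"

definition full_support_prob :: "'a topology \<Rightarrow> 'a measure \<Rightarrow> bool" where
  "full_support_prob T M \<longleftrightarrow>
     prob_space M \<and> space M = topspace T \<and> sets M = sets (borel_on T) \<and>
     (\<forall>U. openin T U \<and> U \<noteq> {} \<longrightarrow> measure M U > 0)"

text \<open>The \<^const>\<open>bdd_above\<close> clause says that the supremum defining the distance is finite.\<close>

definition gd_set :: "'a gdset \<Rightarrow> bool" where
  "gd_set X \<longleftrightarrow>
     obs X \<noteq> {} \<and> obs X \<subseteq> extensional (pts X) \<and>
     (\<forall>x\<in>pts X. \<forall>y\<in>pts X. bdd_above ((\<lambda>f. \<bar>f x - f y\<bar>) ` obs X)) \<and>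
     Metric_space (pts X) (gd_dist X) \<and>
     Metric_space.mcomplete (pts X) (gd_dist X) \<and>
     separable_space (gd_top X) \<and>
     full_support_prob (gd_top X) (msr X)"

definition gd_closure :: "'a gdset \<Rightarrow> ('a \<Rightarrow> real) set" where
  "gd_closure X = product_topology (\<lambda>_. euclideanreal) (pts X) closure_of obs X"

definition domination :: "'a gdset \<Rightarrow> 'b gdset \<Rightarrow> ('a \<Rightarrow> 'b) \<Rightarrow> bool" where
  "domination X Y u \<longleftrightarrow>
     u \<in> msr X \<rightarrow>\<^sub>M msr Y \<and> distr (msr X) (msr Y) u = msr Y \<and>
     (\<forall>g\<in>obs Y. compose (pts X) g u \<in> gd_closure X)"

text \<open>\<open>dominated Y X\<close> is $Y \preceq X$.\<close>

definition dominated :: "'b gdset \<Rightarrow> 'a gdset \<Rightarrow> bool" where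
  "dominated Y X \<longleftrightarrow> (\<exists>u. domination X Y u)"

text \<open>Isomorphism in the category of gd-sets and dominations.\<close>

definition gd_iso :: "'a gdset \<Rightarrow> 'b gdset \<Rightarrow> bool" where
  "gd_iso X Y \<longleftrightarrow>
     (\<exists>u v. domination X Y u \<and> domination Y X v \<and>
            (\<forall>x\<in>pts X. v (u x) = x) \<and> (\<forall>y\<in>pts Y. u (v y) = y))"


section \<open>Box distances\<close>

definition gd_prod_top :: "'a gdset \<Rightarrow> 'b gdset \<Rightarrow> ('a \<times> 'b) topology" where
  "gd_prod_top X Y = prod_topology (gd_top X) (gd_top Y)"

definition couplings :: "'a gdset \<Rightarrow> 'b gdset \<Rightarrow> ('a \<times> 'b) measure set" where
  "couplings X Y =
     {p. prob_space p \<and> space p = pts X \<times> pts Y \<and>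
         sets p = sets (borel_on (gd_prod_top X Y)) \<and>
         distr p (msr X) fst = msr X \<and> distr p (msr Y) snd = msr Y}"

text \<open>
  Suprema of distances are taken in \<^typ>\<open>ennreal\<close>: they may be infinite, and the supremum over
  the empty set is 0.
\<close>

definition sup_dist :: "'c set \<Rightarrow> ('c \<Rightarrow> real) \<Rightarrow> ('c \<Rightarrow> real) \<Rightarrow> ennreal" where
  "sup_dist S h k = (SUP z\<in>S. ennreal \<bar>h z - k z\<bar>)"

definition hausdorff_dist ::
  "('f \<Rightarrow> 'f \<Rightarrow> ennreal) \<Rightarrow> 'f set \<Rightarrow> 'f set \<Rightarrow> ennreal" where
  "hausdorff_dist d H K =
     max (SUP h\<in>H. INF k\<in>K. d h k) (SUP k\<in>K. INF h\<in>H. d h k)"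

definition gd_box :: "'a gdset \<Rightarrow> 'b gdset \<Rightarrow> real" where
  "gd_box X Y = Inf {\<eta>. 0 \<le> \<eta> \<and>
     (\<exists>p\<in>couplings X Y. \<exists>S. closedin (gd_prod_top X Y) S \<and> 1 - measure p S \<le> \<eta> \<and>
        2 * hausdorff_dist (sup_dist S)
              ((\<lambda>f. f \<circ> fst) ` gd_closure X) ((\<lambda>g. g \<circ> snd) ` gd_closure Y)
          \<le> ennreal \<eta>)}"

text \<open>\<open>dominated_upto \<epsilon> Y X\<close> is $Y \preceq_\varepsilon X$.\<close>

definition dominated_upto :: "real \<Rightarrow> 'b gdset \<Rightarrow> 'a gdset \<Rightarrow> bool" where
  "dominated_upto \<epsilon> Y X \<longleftrightarrow>
     (\<exists>p\<in>couplings X Y. \<exists>S. closedin (gd_prod_top X Y) S \<and> measure p S \<ge> 1 - \<epsilon> \<and>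
        2 * (SUP g\<in>gd_closure Y. INF f\<in>gd_closure X. SUP (x, y)\<in>S. ennreal \<bar>g y - f x\<bar>)
          \<le> ennreal \<epsilon>)"

definition box_le :: "'b gdset \<Rightarrow> 'a gdset \<Rightarrow> real" where
  "box_le Y X = Inf {\<epsilon>. 0 \<le> \<epsilon> \<and> dominated_upto \<epsilon> Y X}"


section \<open>qm-spaces\<close>

record 'a qmspace =
  qpts :: "'a set"
  qdist :: "'a \<Rightarrow> 'a \<Rightarrow> real"
  qmsr :: "'a measure"

definition qm_symdist :: "'a qmspace \<Rightarrow> 'a \<Rightarrow> 'a \<Rightarrow> real" where
  "qm_symdist X x y =
     (if x \<in> qpts X \<and> y \<in> qpts X then max (qdist X x y) (qdist X y x) else 0)"

definition qm_top :: "'a qmspace \<Rightarrow> 'a topology" where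
  "qm_top X = Metric_space.mtopology (qpts X) (qm_symdist X)"

definition qm_space :: "'a qmspace \<Rightarrow> bool" where
  "qm_space X \<longleftrightarrow>
     (\<forall>x\<in>qpts X. \<forall>y\<in>qpts X. 0 \<le> qdist X x y) \<and>
     (\<forall>x\<in>qpts X. qdist X x x = 0) \<and>
     (\<forall>x\<in>qpts X. \<forall>y\<in>qpts X. \<forall>z\<in>qpts X. qdist X x z \<le> qdist X x y + qdist X y z) \<and>
     Metric_space (qpts X) (qm_symdist X) \<and>
     Metric_space.mcomplete (qpts X) (qm_symdist X) \<and>
     separable_space (qm_top X) \<and>
     full_support_prob (qm_top X) (qmsr X)"

definition Lip1p :: "'a qmspace \<Rightarrow> ('a \<Rightarrow> real) set" where
  "Lip1p X = {f \<in> extensional (qpts X). \<forall>x\<in>qpts X. \<forall>y\<in>qpts X. f y - f x \<le> qdist X x y}"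

definition Rep_plus :: "'a qmspace \<Rightarrow> 'a gdset" where
  "Rep_plus X = \<lparr>pts = qpts X, obs = Lip1p X, msr = qmsr X\<rparr>"

text \<open>Weak convergence of finite Borel measures on a topological space.\<close>

definition weakly_converges_on ::
  "'a topology \<Rightarrow> (nat \<Rightarrow> 'a measure) \<Rightarrow> 'a measure \<Rightarrow> bool" where
  "weakly_converges_on T M N \<longleftrightarrow>
     (\<forall>\<phi>. continuous_map T euclideanreal \<phi> \<and> bounded (\<phi> ` topspace T) \<longrightarrow>
        (\<lambda>n. \<integral>y. \<phi> y \<partial>M n) \<longlonglongrightarrow> (\<integral>y. \<phi> y \<partial>N))"


section \<open>Monoidal families\<close>

definition Lip1_R :: "(real \<Rightarrow> real) set" where
  "Lip1_R = {\<phi>. 1-lipschitz_on UNIV \<phi>}"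

definition Lip1p_R :: "(real \<Rightarrow> real) set" where
  "Lip1p_R = {\<phi> \<in> Lip1_R. mono \<phi>}"

definition TB :: "(real \<Rightarrow> real) set" where
  "TB = {\<lambda>t. real_of_ereal (max l (min (ereal (t + c)) u)) | (c::real) (l::ereal) (u::ereal).
           l < \<infinity> \<and> - \<infinity> < u \<and> l \<le> u}"

text \<open>
  The topology of the type \<^typ>\<open>real \<Rightarrow> real\<close> is the product topology, so \<^const>\<open>closed\<close> means
  pointwise closed.
\<close>

definition monoidal :: "(real \<Rightarrow> real) set \<Rightarrow> bool" where
  "monoidal L \<longleftrightarrow>
     L \<subseteq> Lip1_R \<and> closed L \<and> (\<lambda>t. t) \<in> L \<and> (\<forall>\<phi>\<in>L. \<forall>\<psi>\<in>L. \<phi> \<circ> \<psi> \<in> L)"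

definition L_gd_set :: "(real \<Rightarrow> real) set \<Rightarrow> 'a gdset \<Rightarrow> bool" where
  "L_gd_set L X \<longleftrightarrow>
     gd_set X \<and> (\<forall>\<phi>\<in>L. \<forall>f\<in>gd_closure X. compose (pts X) \<phi> f \<in> gd_closure X)"


section \<open>Pyramids\<close>

text \<open>
  A complete separable metric space has at most continuum many points, so every gd-set is
  isomorphic to one whose underlying set is a subset of \<^typ>\<open>real\<close>; the type only
  supplies the points, and its topology plays no role. A family of isomorphism classes of
  gd-sets is represented by the set of all gd-sets over \<^typ>\<open>real\<close> that lie in one of the
  classes. Pyramids are automatically closed under isomorphism, being downward closed.
\<close>

definition LD :: "(real \<Rightarrow> real) set \<Rightarrow> real gdset set" where
  "LD L = {X. L_gd_set L X}"

text \<open>Membership of the isomorphism class of a gd-set over an arbitrary type.\<close>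

definition class_in :: "'a gdset \<Rightarrow> real gdset set \<Rightarrow> bool" where
  "class_in X P \<longleftrightarrow> (\<exists>Z\<in>P. gd_iso Z X)"

definition pyramid :: "(real \<Rightarrow> real) set \<Rightarrow> real gdset set \<Rightarrow> bool" where
  "pyramid L P \<longleftrightarrow>
     P \<noteq> {} \<and> P \<subseteq> LD L \<and>
     (\<forall>X\<in>LD L. (\<forall>\<epsilon>>0. \<exists>Y\<in>P. gd_box X Y < \<epsilon>) \<longrightarrow> X \<in> P) \<and>
     (\<forall>X\<in>P. \<forall>Y\<in>LD L. dominated Y X \<longrightarrow> Y \<in> P) \<and>
     (\<forall>X\<in>P. \<forall>Y\<in>P. \<exists>Z\<in>P. dominated X Z \<and> dominated Y Z)"

definition generated_pyramid :: "(real \<Rightarrow> real) set \<Rightarrow> 'a gdset \<Rightarrow> real gdset set" where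
  "generated_pyramid L X = {Y \<in> LD L. dominated Y X}"

definition pyramid_conv ::
  "(real \<Rightarrow> real) set \<Rightarrow> (nat \<Rightarrow> real gdset set) \<Rightarrow> real gdset set \<Rightarrow> bool" where
  "pyramid_conv L P Q \<longleftrightarrow>
     (\<forall>X\<in>Q. (\<lambda>n. INF Y\<in>P n. gd_box X Y) \<longlonglongrightarrow> 0) \<and>
     (\<forall>X\<in>LD L - Q. liminf (\<lambda>n. ereal (INF Y\<in>P n. gd_box X Y)) > 0)"


section \<open>Observable diameter\<close>

text \<open>The library's \<^const>\<open>diameter\<close> is a junk value on unbounded sets.\<close>

definition ediam :: "real set \<Rightarrow> ennreal" where
  "ediam B = (SUP s\<in>B. SUP t\<in>B. ennreal \<bar>s - t\<bar>)"

definition PartDiam :: "real measure \<Rightarrow> real \<Rightarrow> ennreal" where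
  "PartDiam \<nu> \<alpha> = Inf {ediam B | B. B \<in> sets borel \<and> measure \<nu> B \<ge> \<alpha>}"

text \<open>\<open>ObsDiam X \<kappa>\<close> is $\mathrm{ObsDiam}(X;-\kappa)$.\<close>

definition ObsDiam :: "'a gdset \<Rightarrow> real \<Rightarrow> ennreal" where
  "ObsDiam X \<kappa> = (SUP f\<in>gd_closure X. PartDiam (distr (msr X) borel f) (1 - \<kappa>))"

definition ObsDiam_family :: "'a gdset set \<Rightarrow> real \<Rightarrow> ennreal" where
  "ObsDiam_family E \<kappa> = (SUP X\<in>E. ObsDiam X \<kappa>)"


section \<open>Multi-directed separation\<close>

definition dsep :: "'a gdset \<Rightarrow> 'a set \<Rightarrow> 'a set \<Rightarrow> ereal" where
  "dsep X A B = (SUP f\<in>gd_closure X. INF a\<in>A. INF b\<in>B. ereal (f b - f a))"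

text \<open>Only the values of \<open>\<kappa>\<close> and \<open>A\<close> at indices up to \<open>N\<close> matter; \<open>N\<close> is positive.\<close>

definition sep_tuples :: "'a gdset \<Rightarrow> nat \<Rightarrow> (nat \<Rightarrow> real) \<Rightarrow> (nat \<Rightarrow> 'a set) set" where
  "sep_tuples X N \<kappa> =
     {A. disjoint_family_on A {..N} \<and> (\<forall>i\<le>N. A i \<in> sets (msr X) \<and> measure (msr X) (A i) \<ge> \<kappa> i)}"

definition Sep :: "'a gdset \<Rightarrow> nat \<Rightarrow> (nat \<Rightarrow> real) \<Rightarrow> ereal" where
  "Sep X N \<kappa> =
     (if sep_tuples X N \<kappa> = {} then 0
      else SUP A\<in>sep_tuples X N \<kappa>. Min {dsep X (A i) (A j) | i j. i < j \<and> j \<le> N})"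

definition Sep_family :: "'a gdset set \<Rightarrow> nat \<Rightarrow> (nat \<Rightarrow> real) \<Rightarrow> ereal" where
  "Sep_family E N \<kappa> = (SUP X\<in>E. Sep X N \<kappa>)"

end

theory Submission
  imports Defs
begin

text \<open>
  No disintegration is used. Couplings are glued approximately, by matching the integrals of finitely many bump
  functions on the common factor; this gives the triangle inequality. If the one-sided box distance from \<open>Y\<close> to \<open>X\<close>
  vanishes, a dense sequence of observables of \<open>Y\<close> is matched by observables of \<open>X\<close> with the same joint law,
  and since \<open>Y\<close> is complete these determine a domination.

  If it is less than \<open>e\<close>, the observables of \<open>X\<close> that are close to one of \<open>Y\<close> define a gd-set
  dominated by \<open>X\<close> at box distance at most \<open>e\<close> from \<open>Y\<close>. Hence membership in a weak limit of pyramids needs only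
  one-sided approximations; for (ii) they are the extensions \<open>x \<mapsto> inf (g (p a) + d a x)\<close> of observables \<open>g\<close>.

  For (iii), finitely many uniformly bounded observables along the sequence have joint laws converging along a
  subsequence, and the limit law together with \<open>L\<close> defines a member of the limit pyramid. Clamping makes
  the observables in the definition of separation bounded; for the partial diameter a compression onto
  finitely many short intervals is needed.
\<close>

section \<open>Observables of a gd-set\<close>

text \<open>The bump functions are tents about a dense sequence. They are continuous, so their
  integrals pass to weak limits, and finitely many of them carry almost all of the mass. The same
  coupling device therefore also turns the weak convergence in (ii) and the convergence of joint
  laws in (iii) into couplings concentrated near the diagonal. Observables are 1-Lipschitz for the
  distance that they define, so those bounded at one point form a sequentially compact family;
  limits of matched observables exist although the couplings themselves need not converge. In (iii)
  the observables live on different spaces and can be compared only through their laws. Clamping to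
  \<open>[0, s]\<close> keeps two sets separated by \<open>s\<close>, but it piles up the outer mass
  at the two ends and may thereby shrink a partial diameter. This is why (a) works with all
  nondecreasing 1-Lipschitz maps: each flat piece of the compression carries mass at most
  \<open>1 / N\<close>, and a set of small diameter in the image meets few enough of them that the
  loss is at most \<open>3 / N\<close>.\<close>

lemma gd_metric: "gd_set X \<Longrightarrow> Metric_space (pts X) (gd_dist X)"
  by (simp add: gd_set_def)

lemma gd_prob: "gd_set X \<Longrightarrow> prob_space (msr X)"
  by (simp add: gd_set_def full_support_prob_def)

lemma gd_topspace [simp]: "gd_set X \<Longrightarrow> topspace (gd_top X) = pts X"
  by (simp add: gd_top_def Metric_space.topspace_mtopology gd_metric)

lemma gd_space [simp]: "gd_set X \<Longrightarrow> space (msr X) = pts X"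
  by (metis gd_set_def full_support_prob_def gd_topspace)

lemma gd_nonempty: "gd_set X \<Longrightarrow> pts X \<noteq> {}"
  using prob_space.not_empty[OF gd_prob, of X] by simp

lemma obs_nonempty: "gd_set X \<Longrightarrow> obs X \<noteq> {}"
  by (simp add: gd_set_def)

lemma obs_extensional: "gd_set X \<Longrightarrow> f \<in> obs X \<Longrightarrow> f \<in> extensional (pts X)"
  by (auto simp: gd_set_def)

lemma obs_le_dist:
  "gd_set X \<Longrightarrow> f \<in> obs X \<Longrightarrow> x \<in> pts X \<Longrightarrow> y \<in> pts X \<Longrightarrow> \<bar>f x - f y\<bar> \<le> gd_dist X x y"
  unfolding gd_set_def gd_dist_def by (auto intro!: cSUP_upper)

lemma gd_dist_least:
  assumes "gd_set X" "x \<in> pts X" "y \<in> pts X" "\<And>f. f \<in> obs X \<Longrightarrow> \<bar>f x - f y\<bar> \<le> c"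
  shows "gd_dist X x y \<le> c"
  using assms obs_nonempty[OF assms(1)] unfolding gd_dist_def by (auto intro!: cSUP_least)

lemma gd_dist_commute: "gd_set X \<Longrightarrow> gd_dist X x y = gd_dist X y x"
  by (rule Metric_space.commute[OF gd_metric])

lemma gd_dist_nonneg: "gd_set X \<Longrightarrow> 0 \<le> gd_dist X x y"
  by (rule Metric_space.nonneg[OF gd_metric])

lemma gd_dist_self: "gd_set X \<Longrightarrow> x \<in> pts X \<Longrightarrow> gd_dist X x x = 0"
  by (rule Metric_space.mdist_zero[OF gd_metric])

lemma gd_dist_triangle:
  "gd_set X \<Longrightarrow> x \<in> pts X \<Longrightarrow> y \<in> pts X \<Longrightarrow> z \<in> pts X \<Longrightarrow>
    gd_dist X x z \<le> gd_dist X x y + gd_dist X y z"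
  by (rule Metric_space.triangle[OF gd_metric])

lemma gd_openin:
  assumes "gd_set X"
  shows "openin (gd_top X) U \<longleftrightarrow>
    U \<subseteq> pts X \<and> (\<forall>x\<in>U. \<exists>r>0. \<forall>y\<in>pts X. gd_dist X x y < r \<longrightarrow> y \<in> U)"
proof -
  interpret Metric_space "pts X" "gd_dist X" by (rule gd_metric) fact
  show ?thesis
    unfolding gd_top_def openin_mtopology by (fastforce simp: subset_iff)
qed

lemma gd_sets:
  assumes "gd_set X"
  shows "sets (msr X) = sigma_sets (pts X) {U. openin (gd_top X) U}"
proof -
  have "sets (msr X) = sets (borel_on (gd_top X))"
    using assms unfolding gd_set_def full_support_prob_def by blast
  also have "\<dots> = sigma_sets (pts X) {U. openin (gd_top X) U}"
    unfolding borel_on_def gd_topspace[OF assms]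
    by (rule sets_measure_of) (use openin_subset[of "gd_top X"] gd_topspace[OF assms] in auto)
  finally show ?thesis .
qed

lemma gd_open_measurable: "gd_set X \<Longrightarrow> openin (gd_top X) U \<Longrightarrow> U \<in> sets (msr X)"
  by (simp add: gd_sets sigma_sets.Basic)

lemma gd_full_support:
  assumes "gd_set X" "openin (gd_top X) U" "x \<in> U"
  shows "0 < measure (msr X) U"
  using assms unfolding gd_set_def full_support_prob_def by blast

lemma gd_dense:
  assumes "gd_set X"
  obtains c :: "nat \<Rightarrow> 'a"
  where "\<And>n. c n \<in> pts X" "\<And>x e. x \<in> pts X \<Longrightarrow> 0 < e \<Longrightarrow> \<exists>n. gd_dist X (c n) x < e"
proof -
  interpret Metric_space "pts X" "gd_dist X" by (rule gd_metric) fact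
  obtain C where C: "countable C" "C \<subseteq> pts X" "mtopology closure_of C = pts X"
    using assms gd_topspace[OF assms] unfolding gd_set_def separable_space_def gd_top_def by auto
  have d: "\<exists>y\<in>C. gd_dist X y x < e" if "x \<in> pts X" "0 < e" for x e
    using that C(3) unfolding metric_closure_of by (fastforce simp: commute)
  have "C \<noteq> {}" using d[of _ 1] gd_nonempty[OF assms] by auto
  show thesis
    by (rule that[of "from_nat_into C"])
      (use C d \<open>C \<noteq> {}\<close> from_nat_into[of C] from_nat_into_surj[of C] in blast)+
qed

lemma gd_Lipschitz_measurable:
  assumes X: "gd_set X" and h: "\<And>x y. x \<in> pts X \<Longrightarrow> y \<in> pts X \<Longrightarrow> h x - h y \<le> C * gd_dist X x y"
  shows "h \<in> borel_measurable (msr X)"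
proof (rule borel_measurableI_greater)
  fix a :: real
  have "openin (gd_top X) {x \<in> pts X. a < h x}"
    unfolding gd_openin[OF X]
  proof (intro conjI ballI)
    fix x assume x: "x \<in> {x \<in> pts X. a < h x}"
    \<comment> \<open>Dividing by \<open>\<bar>C\<bar> + 1\<close> instead of \<open>C\<close> keeps
      the radius positive whatever the sign of \<open>C\<close>.\<close>
    have "y \<in> {x \<in> pts X. a < h x}" if y: "y \<in> pts X" "gd_dist X x y < (h x - a) / (\<bar>C\<bar> + 1)" for y
    proof -
      have "C * gd_dist X x y \<le> (\<bar>C\<bar> + 1) * gd_dist X x y"
        by (intro mult_right_mono) (auto simp: gd_dist_nonneg[OF X])
      also have "\<dots> < h x - a" using y by (simp add: field_simps)
      finally show ?thesis using h[of x y] x y by auto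
    qed
    then show "\<exists>r>0. \<forall>y\<in>pts X. gd_dist X x y < r \<longrightarrow> y \<in> {x \<in> pts X. a < h x}"
      using x by (intro exI[of _ "(h x - a) / (\<bar>C\<bar> + 1)"]) auto
  qed auto
  then show "{x \<in> space (msr X). a < h x} \<in> sets (msr X)"
    using X by (simp add: gd_open_measurable)
qed

lemma gd_dist_Lipschitz:
  assumes X: "gd_set X" and c: "c \<in> pts X" "x \<in> pts X" "y \<in> pts X"
  shows "gd_dist X c x - gd_dist X c y \<le> gd_dist X x y"
  using gd_dist_triangle[OF X c(1) c(3) c(2)] gd_dist_commute[OF X] by simp

lemma gd_dist_measurable:
  assumes X: "gd_set X" and c: "c \<in> pts X"
  shows "gd_dist X c \<in> borel_measurable (msr X)"
  by (rule gd_Lipschitz_measurable[OF X, of _ 1]) (use gd_dist_Lipschitz[OF X c] in auto)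

section \<open>The pointwise closure of the observables: approximation and sequential
  compactness\<close>

lemma gd_closure_iff_approx:
  assumes X: "gd_set X"
  shows "f \<in> gd_closure X \<longleftrightarrow> f \<in> extensional (pts X) \<and>
    (\<forall>K e. finite K \<and> K \<subseteq> pts X \<and> 0 < e \<longrightarrow> (\<exists>g\<in>obs X. \<forall>x\<in>K. \<bar>g x - f x\<bar> < e))"
proof safe
  let ?T = "product_topology (\<lambda>_. euclideanreal) (pts X)"
  assume f: "f \<in> gd_closure X"
  then show "f \<in> extensional (pts X)"
    by (auto simp: gd_closure_def in_closure_of PiE_def)
  fix K and e :: real assume K: "finite K" "K \<subseteq> pts X" and e: "0 < e"
  let ?U = "Pi\<^sub>E (pts X) (\<lambda>x. if x \<in> K then ball (f x) e else UNIV)"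
  have "openin ?T ?U"
  proof (rule product_topology_basis)
    show "finite {i. (if i \<in> K then ball (f i) e else UNIV) \<noteq> topspace euclideanreal}"
      by (rule finite_subset[OF _ K(1)]) auto
  qed auto
  moreover have "f \<in> ?U"
    using \<open>f \<in> extensional (pts X)\<close> e by (auto simp: PiE_def)
  ultimately obtain g where "g \<in> obs X" "g \<in> ?U"
    using f unfolding gd_closure_def in_closure_of by blast
  then show "\<exists>g\<in>obs X. \<forall>x\<in>K. \<bar>g x - f x\<bar> < e"
    using K by (intro bexI[of _ g]) (auto simp: PiE_def Pi_def dist_real_def abs_minus_commute)
next
  let ?T = "product_topology (\<lambda>_. euclideanreal) (pts X)"
  assume f: "f \<in> extensional (pts X)"
    and *: "\<forall>K e. finite K \<and> K \<subseteq> pts X \<and> 0 < e \<longrightarrow> (\<exists>g\<in>obs X. \<forall>x\<in>K. \<bar>g x - f x\<bar> < e)"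
  show "f \<in> gd_closure X"
    unfolding gd_closure_def in_closure_of
  proof (intro conjI allI impI)
    show "f \<in> topspace ?T" using f by (auto simp: PiE_def)
    fix S assume S: "f \<in> S \<and> openin ?T S"
    then obtain U where U: "finite {i \<in> pts X. U i \<noteq> UNIV}" "\<And>i. i \<in> pts X \<Longrightarrow> open (U i)"
      "f \<in> Pi\<^sub>E (pts X) U" "Pi\<^sub>E (pts X) U \<subseteq> S"
      unfolding openin_product_topology_alt by force
    define K where "K = {i \<in> pts X. U i \<noteq> UNIV}"
    have "\<forall>i\<in>K. \<exists>e>0. ball (f i) e \<subseteq> U i"
      using U unfolding K_def open_contains_ball by (auto simp: PiE_def Pi_def)
    then obtain e where e: "\<And>i. i \<in> K \<Longrightarrow> 0 < e i \<and> ball (f i) (e i) \<subseteq> U i" by metis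
    \<comment> \<open>Inserting 1 keeps the minimum meaningful when no coordinate is
      constrained.\<close>
    define e' where "e' = Min (insert 1 (e ` K))"
    have "finite K" using U(1) K_def by simp
    then have e': "0 < e'" "\<And>i. i \<in> K \<Longrightarrow> e' \<le> e i" using e by (auto simp: e'_def)
    obtain g where g: "g \<in> obs X" "\<forall>x\<in>K. \<bar>g x - f x\<bar> < e'"
      using * \<open>finite K\<close> e'(1) K_def by blast
    have "g \<in> Pi\<^sub>E (pts X) U"
    proof (rule PiE_I)
      fix x assume x: "x \<in> pts X"
      show "g x \<in> U x"
      proof (cases "x \<in> K")
        case True
        then have "g x \<in> ball (f x) (e x)"
          using g(2) e'(2)[OF True] by (force simp: dist_real_def abs_minus_commute)
        then show ?thesis using e[OF True] by auto
      next
        case False then show ?thesis using x by (auto simp: K_def)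
      qed
    next
      fix x assume "x \<notin> pts X" then show "g x = undefined"
        using obs_extensional[OF X g(1)] by (simp add: extensional_def)
    qed
    then show "\<exists>y. y \<in> obs X \<and> y \<in> S" using g(1) U(4) by auto
  qed
qed

lemma gd_closure_extensional: "gd_set X \<Longrightarrow> f \<in> gd_closure X \<Longrightarrow> f \<in> extensional (pts X)"
  by (simp add: gd_closure_iff_approx)

lemma obs_subset_closure: "gd_set X \<Longrightarrow> f \<in> obs X \<Longrightarrow> f \<in> gd_closure X"
  by (auto simp: gd_closure_iff_approx obs_extensional intro!: bexI[of _ f])

lemma gd_closure_nonempty: "gd_set X \<Longrightarrow> gd_closure X \<noteq> {}"
  using obs_nonempty obs_subset_closure by blast

lemma closure_le_dist:
  assumes X: "gd_set X" and f: "f \<in> gd_closure X" and x: "x \<in> pts X" "y \<in> pts X"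
  shows "\<bar>f x - f y\<bar> \<le> gd_dist X x y"
proof (rule field_le_epsilon)
  fix e :: real assume e: "0 < e"
  obtain g where g: "g \<in> obs X" "\<bar>g x - f x\<bar> < e/2" "\<bar>g y - f y\<bar> < e/2"
    using f[unfolded gd_closure_iff_approx[OF X]] x e
    by (metis half_gt_zero finite.emptyI finite_insert insert_subset empty_subsetI insertI1 insertI2)
  show "\<bar>f x - f y\<bar> \<le> gd_dist X x y + e"
    using obs_le_dist[OF X g(1) x] g(2,3) by linarith
qed

lemma closure_measurable:
  assumes "gd_set X" "f \<in> gd_closure X"
  shows "f \<in> borel_measurable (msr X)"
  by (rule gd_Lipschitz_measurable[where C=1]) (use assms closure_le_dist[OF assms] in \<open>auto simp: abs_le_iff\<close>)

lemma gd_closure_limit: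
  assumes X: "gd_set X" and fs: "\<And>n. fs n \<in> gd_closure X" and f: "f \<in> extensional (pts X)"
    and lim: "\<And>x. x \<in> pts X \<Longrightarrow> (\<lambda>n::nat. fs n x) \<longlonglongrightarrow> f x"
  shows "f \<in> gd_closure X"
  unfolding gd_closure_iff_approx[OF X]
proof (intro conjI f allI impI, elim conjE)
  fix K and e :: real assume K: "finite K" "K \<subseteq> pts X" and e: "0 < e"
  have "eventually (\<lambda>n. \<bar>fs n x - f x\<bar> < e/2) sequentially" if "x \<in> K" for x
    using tendstoD[OF lim[of x], of "e/2"] that K(2) e by (auto simp: dist_real_def)
  then have "eventually (\<lambda>n. \<forall>x\<in>K. \<bar>fs n x - f x\<bar> < e/2) sequentially"
    using K(1) by (simp add: eventually_ball_finite_distrib)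
  then obtain n where n: "\<forall>x\<in>K. \<bar>fs n x - f x\<bar> < e/2"
    using eventually_happens trivial_limit_sequentially by blast
  obtain g where g: "g \<in> obs X" "\<forall>x\<in>K. \<bar>g x - fs n x\<bar> < e/2"
    using fs[of n, unfolded gd_closure_iff_approx[OF X]] K e half_gt_zero by blast
  show "\<exists>g\<in>obs X. \<forall>x\<in>K. \<bar>g x - f x\<bar> < e"
  proof (intro bexI[OF _ g(1)] ballI)
    fix x assume "x \<in> K"
    then have "\<bar>g x - fs n x\<bar> < e/2" "\<bar>fs n x - f x\<bar> < e/2" using g n by auto
    then show "\<bar>g x - f x\<bar> < e" by linarith
  qed
qed

text \<open>Observables are equi-Lipschitz, so convergence on a dense sequence suffices.\<close>

lemma Lipschitz_limit_dense:
  assumes X: "gd_set X" and c: "\<And>n. c n \<in> pts X" "\<And>x e. x \<in> pts X \<Longrightarrow> 0 < e \<Longrightarrow> \<exists>n::nat. gd_dist X (c n) x < e"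
    and f: "\<And>n::nat. fs n \<in> gd_closure X" and conv: "\<And>j. convergent (\<lambda>n. fs n (c j))"
  obtains h where "h \<in> gd_closure X" "\<And>x. x \<in> pts X \<Longrightarrow> (\<lambda>n. fs n x) \<longlonglongrightarrow> h x"
proof -
  have "Cauchy (\<lambda>n. fs n x)" if x: "x \<in> pts X" for x
  proof (rule metric_CauchyI)
    fix e :: real assume e: "0 < e"
    obtain j where j: "gd_dist X (c j) x < e/3" using c(2)[OF x, of "e/3"] e by auto
    obtain N where N: "\<And>m n. N \<le> m \<Longrightarrow> N \<le> n \<Longrightarrow> dist (fs m (c j)) (fs n (c j)) < e/3"
      using convergent_Cauchy[OF conv[of j]] e unfolding Cauchy_def by (metis zero_less_divide_iff zero_less_numeral)
    show "\<exists>M. \<forall>m\<ge>M. \<forall>n\<ge>M. dist (fs m x) (fs n x) < e"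
    proof (intro exI allI impI)
      fix m n assume "N \<le> m" "N \<le> n"
      then have "\<bar>fs m (c j) - fs n (c j)\<bar> < e/3" using N by (simp add: dist_real_def)
      moreover have "\<bar>fs m (c j) - fs m x\<bar> < e/3" "\<bar>fs n (c j) - fs n x\<bar> < e/3"
        using closure_le_dist[OF X f c(1) x] j by (meson le_less_trans)+
      ultimately show "dist (fs m x) (fs n x) < e" unfolding dist_real_def by linarith
    qed
  qed
  then have lim: "(\<lambda>n. fs n x) \<longlonglongrightarrow> lim (\<lambda>n. fs n x)" if "x \<in> pts X" for x
    using that Cauchy_convergent convergent_LIMSEQ_iff by blast
  define h where "h = restrict (\<lambda>x. lim (\<lambda>n. fs n x)) (pts X)"
  have "(\<lambda>n. fs n x) \<longlonglongrightarrow> h x" if "x \<in> pts X" for x using lim[OF that] that by (simp add: h_def)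
  moreover from this have "h \<in> gd_closure X"
    by (intro gd_closure_limit[OF X f]) (auto simp: h_def)
  ultimately show thesis using that by blast
qed

text \<open>The product topology on an uncountable set is not first countable, so sequences do not
  suffice in general. Here they do: observables that approximate \<open>f\<close> on the first
  points of a dense sequence converge on that sequence, and the Lipschitz bound carries the
  convergence to every point.\<close>

lemma gd_closure_limit_of_obs:
  assumes X: "gd_set X" and f: "f \<in> gd_closure X"
  obtains fs where "\<And>n::nat. fs n \<in> obs X" "\<And>x. x \<in> pts X \<Longrightarrow> (\<lambda>n. fs n x) \<longlonglongrightarrow> f x"
proof -
  obtain c where c: "\<And>n::nat. c n \<in> pts X" "\<And>x e. x \<in> pts X \<Longrightarrow> 0 < e \<Longrightarrow> \<exists>n. gd_dist X (c n) x < e"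
    by (rule gd_dense[OF X]) blast
  have "\<exists>g\<in>obs X. \<forall>x\<in>c ` {..n}. \<bar>g x - f x\<bar> < 1 / Suc n" for n
    using f[unfolded gd_closure_iff_approx[OF X], THEN conjunct2, rule_format, of "c ` {..n}" "1 / Suc n"] c(1)
    by auto
  then obtain fs where fs: "\<And>n. fs n \<in> obs X" "\<And>n x. x \<in> c ` {..n} \<Longrightarrow> \<bar>fs n x - f x\<bar> < 1 / Suc n"
    by metis
  have l: "(\<lambda>n. fs n (c j)) \<longlonglongrightarrow> f (c j)" for j
  proof (rule LIM_zero_cancel, rule Lim_null_comparison)
    show "eventually (\<lambda>n. norm (fs n (c j) - f (c j)) \<le> 1 / Suc n) sequentially"
      using eventually_ge_at_top[of j]
    proof eventually_elim
      case (elim n)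
      then have "c j \<in> c ` {..n}" by auto
      then show ?case using fs(2)[of "c j" n] by simp
    qed
    show "(\<lambda>n. 1 / real (Suc n)) \<longlonglongrightarrow> 0" using LIMSEQ_inverse_real_of_nat by (simp add: divide_inverse)
  qed
  obtain h where h: "h \<in> gd_closure X" "\<And>x. x \<in> pts X \<Longrightarrow> (\<lambda>n. fs n x) \<longlonglongrightarrow> h x"
    using Lipschitz_limit_dense[OF X c, where fs=fs] fs(1) obs_subset_closure[OF X] l convergent_def by metis
  have hf: "h (c j) = f (c j)" for j
    using LIMSEQ_unique[OF h(2)[OF c(1)] l] .
  have "h x = f x" if x: "x \<in> pts X" for x
  proof (rule ccontr)
    assume "h x \<noteq> f x"
    then obtain j where j: "gd_dist X (c j) x < \<bar>h x - f x\<bar> / 2" using c(2)[OF x, of "\<bar>h x - f x\<bar> / 2"] by auto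
    show False
      using closure_le_dist[OF X h(1) c(1) x, of j] closure_le_dist[OF X f c(1) x, of j] j hf[of j] by (smt (verit) field_sum_of_halves)
  qed
  then show thesis using that[of fs] fs(1) h(2) by simp
qed

text \<open>An Arzela-Ascoli argument for countably many sequences of observables at once.
  Boundedness at one point gives boundedness at every point by the Lipschitz bound; the values on a
  dense sequence then lie in a product of compact intervals over \<open>nat\<close>, which is
  metrizable and hence sequentially compact.\<close>

lemma gd_closure_compact:
  assumes X: "gd_set X" and f: "\<And>i n. fs i n \<in> gd_closure X"
    and bd: "\<And>i. \<exists>x\<in>pts X. bounded (range (\<lambda>n. fs i n x))"
  obtains r :: "nat \<Rightarrow> nat" and h :: "nat \<Rightarrow> 'a \<Rightarrow> real"
  where "strict_mono r" "\<And>i. h i \<in> gd_closure X"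
    "\<And>i x. x \<in> pts X \<Longrightarrow> (\<lambda>n. fs i (r n) x) \<longlonglongrightarrow> h i x"
proof -
  obtain c where c: "\<And>n::nat. c n \<in> pts X" "\<And>x e. x \<in> pts X \<Longrightarrow> 0 < e \<Longrightarrow> \<exists>n. gd_dist X (c n) x < e"
    by (rule gd_dense[OF X]) blast
  have "\<exists>B. \<forall>n. \<bar>fs i n x\<bar> \<le> B" if x: "x \<in> pts X" for i x
  proof -
    obtain y B where y: "y \<in> pts X" "\<And>n. \<bar>fs i n y\<bar> \<le> B"
      using bd[of i] unfolding bounded_iff by auto
    have "\<bar>fs i n x\<bar> \<le> B + gd_dist X x y" for n
      using closure_le_dist[OF X f x y(1), of i n] y(2)[of n] by linarith
    then show ?thesis by blast
  qed
  \<comment> \<open>One index \<open>k\<close> codes the pair of an observable index and a dense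
    point, so that a single subsequence serves all \<open>i\<close>.\<close>
  then have "\<forall>k. \<exists>B. \<forall>n. \<bar>fs (fst (prod_decode k)) n (c (snd (prod_decode k)))\<bar> \<le> B"
    using c(1) by blast
  then have "\<exists>B. \<forall>k n. \<bar>fs (fst (prod_decode k)) n (c (snd (prod_decode k)))\<bar> \<le> B k"
    by (rule choice)
  then obtain B where B: "\<And>k n. \<bar>fs (fst (prod_decode k)) n (c (snd (prod_decode k)))\<bar> \<le> B k" by blast
  define v where "v n = (\<lambda>k. fs (fst (prod_decode k)) n (c (snd (prod_decode k))))" for n
  have "seq_compact (Pi\<^sub>E UNIV (\<lambda>k. {- B k .. B k}))"
    unfolding seq_compact_eq_compact using compactin_PiE[of "\<lambda>_. euclideanreal" UNIV "\<lambda>k. {- B k .. B k}"]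
    by (simp add: euclidean_product_topology)
  moreover have "v n \<in> Pi\<^sub>E UNIV (\<lambda>k. {- B k .. B k})" for n
    using B unfolding v_def by (auto simp: abs_le_iff minus_le_iff)
  ultimately obtain l r where r: "strict_mono (r :: nat \<Rightarrow> nat)" "(v \<circ> r) \<longlonglongrightarrow> l"
    unfolding seq_compact_def by metis
  have co: "continuous_on UNIV (\<lambda>x::nat\<Rightarrow>real. x k)" for k by (rule continuous_on_product_coordinates)
  have vl: "(\<lambda>n. v (r n) k) \<longlonglongrightarrow> l k" for k
    using continuous_on_tendsto_compose[OF co r(2)] by (simp add: o_def)
  have "convergent (\<lambda>n. fs i (r n) (c j))" for i j
    using vl[of "prod_encode (i, j)"] by (auto simp: v_def convergent_def)
  then have "\<exists>h. h \<in> gd_closure X \<and> (\<forall>x\<in>pts X. (\<lambda>n. fs i (r n) x) \<longlonglongrightarrow> h x)" for i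
    using Lipschitz_limit_dense[OF X c, where fs="\<lambda>n. fs i (r n)"] f by metis
  then obtain h where "\<And>i. h i \<in> gd_closure X \<and> (\<forall>x\<in>pts X. (\<lambda>n. fs i (r n) x) \<longlonglongrightarrow> h i x)"
    by metis
  then show thesis using that r(1) by blast
qed

section \<open>Couplings and the box distances\<close>

lemma gd_ball_open: "gd_set X \<Longrightarrow> openin (gd_top X) {y \<in> pts X. gd_dist X x y < r}"
  if "x \<in> pts X" for X
  unfolding gd_openin
proof (intro conjI ballI)
  assume X: "gd_set X"
  fix y assume y: "y \<in> {y \<in> pts X. gd_dist X x y < r}"
  show "\<exists>s>0. \<forall>z\<in>pts X. gd_dist X y z < s \<longrightarrow> z \<in> {y \<in> pts X. gd_dist X x y < r}"
  proof (intro exI[of _ "r - gd_dist X x y"] conjI ballI impI)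
    fix z assume "z \<in> pts X" "gd_dist X y z < r - gd_dist X x y"
    then show "z \<in> {y \<in> pts X. gd_dist X x y < r}"
      using gd_dist_triangle[OF X that, of y z] y by auto
  qed (use y in auto)
qed auto

lemma gd_prod_topspace: "gd_set X \<Longrightarrow> gd_set Y \<Longrightarrow> topspace (gd_prod_top X Y) = pts X \<times> pts Y"
  by (simp add: gd_prod_top_def)

lemma sets_borel_on: "sets (borel_on T) = sigma_sets (topspace T) {U. openin T U}"
  unfolding borel_on_def by (rule sets_measure_of) (use openin_subset in auto)

lemma space_borel_on: "space (borel_on T) = topspace T"
  unfolding borel_on_def by (rule space_measure_of) (use openin_subset in auto)

text \<open>Separability makes every open set of the product a countable union of products of balls.
  Couplings, which are defined on the Borel sets of the product topology, can thus be handled with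
  the product \<sigma>-algebra.\<close>

lemma sets_gd_prod:
  assumes X: "gd_set X" and Y: "gd_set Y"
  shows "sets (borel_on (gd_prod_top X Y)) = sets (msr X \<Otimes>\<^sub>M msr Y)"
proof
  obtain c where c: "\<And>n::nat. c n \<in> pts X" "\<And>x e. x \<in> pts X \<Longrightarrow> 0 < e \<Longrightarrow> \<exists>n. gd_dist X (c n) x < e"
    by (rule gd_dense[OF X]) blast
  obtain d where d: "\<And>n::nat. d n \<in> pts Y" "\<And>y e. y \<in> pts Y \<Longrightarrow> 0 < e \<Longrightarrow> \<exists>n. gd_dist Y (d n) y < e"
    by (rule gd_dense[OF Y]) blast
  define B where "B = (\<lambda>(i, j, k::nat). {x \<in> pts X. gd_dist X (c i) x < 1 / Suc k} \<times> {y \<in> pts Y. gd_dist Y (d j) y < 1 / Suc k})"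
  have B: "B t \<in> sets (msr X \<Otimes>\<^sub>M msr Y)" for t
    unfolding B_def split_beta
    by (intro pair_measureI gd_open_measurable gd_ball_open X Y c(1) d(1))
  have "U \<in> sets (msr X \<Otimes>\<^sub>M msr Y)" if U: "openin (gd_prod_top X Y) U" for U
  proof -
    have "U = (\<Union>t\<in>{t. B t \<subseteq> U}. B t)"
    proof (intro equalityI subsetI)
      fix z assume z: "z \<in> U"
      then obtain x y where xy: "z = (x, y)" by force
      obtain V W where VW: "openin (gd_top X) V" "openin (gd_top Y) W" "x \<in> V" "y \<in> W" "V \<times> W \<subseteq> U"
        using U[unfolded gd_prod_top_def openin_prod_topology_alt, rule_format, of x y] z xy by auto
      obtain r where r: "r > 0" "\<And>u. u \<in> pts X \<Longrightarrow> gd_dist X x u < r \<Longrightarrow> u \<in> V"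
        using VW(1,3) unfolding gd_openin[OF X] by blast
      obtain s where s: "s > 0" "\<And>u. u \<in> pts Y \<Longrightarrow> gd_dist Y y u < s \<Longrightarrow> u \<in> W"
        using VW(2,4) unfolding gd_openin[OF Y] by blast
      have xp: "x \<in> pts X" "y \<in> pts Y" using VW(1-4) unfolding gd_openin[OF X] gd_openin[OF Y] by auto
      obtain k where k: "1 / real (Suc k) < min r s / 2"
        using r s by (metis half_gt_zero min_less_iff_conj nat_approx_posE)
      obtain i where i: "gd_dist X (c i) x < 1 / Suc k" using c(2)[OF xp(1), of "1 / Suc k"] by auto
      obtain j where j: "gd_dist Y (d j) y < 1 / Suc k" using d(2)[OF xp(2), of "1 / Suc k"] by auto
      have "B (i, j, k) \<subseteq> V \<times> W"
      proof (intro subsetI)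
        fix w assume w: "w \<in> B (i, j, k)"
        then obtain u v where uv: "w = (u, v)" "u \<in> pts X" "v \<in> pts Y"
          "gd_dist X (c i) u < 1 / Suc k" "gd_dist Y (d j) v < 1 / Suc k"
          by (auto simp: B_def)
        have "gd_dist X x u < r"
          using gd_dist_triangle[OF X xp(1) c(1) uv(2), of i] gd_dist_commute[OF X, of x "c i"] uv i k by linarith
        moreover have "gd_dist Y y v < s"
          using gd_dist_triangle[OF Y xp(2) d(1) uv(3), of j] gd_dist_commute[OF Y, of y "d j"] uv j k by linarith
        ultimately show "w \<in> V \<times> W" using r s uv by auto
      qed
      then have "B (i, j, k) \<subseteq> U" using VW by blast
      moreover have "z \<in> B (i, j, k)" using xy i j xp by (auto simp: B_def)
      ultimately show "z \<in> (\<Union>t\<in>{t. B t \<subseteq> U}. B t)" by blast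
    qed auto
    moreover have "(\<Union>t\<in>{t. B t \<subseteq> U}. B t) \<in> sets (msr X \<Otimes>\<^sub>M msr Y)"
      using B by (intro sets.countable_UN') auto
    ultimately show ?thesis by simp
  qed
  then have "{U. openin (gd_prod_top X Y) U} \<subseteq> sets (msr X \<Otimes>\<^sub>M msr Y)" by auto
  from sets.sigma_sets_subset[OF this]
  show "sets (borel_on (gd_prod_top X Y)) \<subseteq> sets (msr X \<Otimes>\<^sub>M msr Y)"
    unfolding sets_borel_on gd_prod_topspace[OF X Y] by (simp add: space_pair_measure X Y)
next
  let ?B = "borel_on (gd_prod_top X Y)"
  have sp: "space ?B = pts X \<times> pts Y" by (simp add: space_borel_on gd_prod_topspace X Y)
  have op: "openin (gd_prod_top X Y) U \<Longrightarrow> U \<in> sets ?B" for U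
    by (simp add: sets_borel_on sigma_sets.Basic)
  have 1: "fst \<in> ?B \<rightarrow>\<^sub>M msr X"
  proof (rule measurable_sigma_sets[OF gd_sets[OF X]])
    fix U assume U: "U \<in> {U. openin (gd_top X) U}"
    then have "fst -` U \<inter> space ?B = U \<times> pts Y"
      using openin_subset[of "gd_top X" U] X by (auto simp: sp)
    moreover have "openin (gd_prod_top X Y) (U \<times> pts Y)"
      using U Y openin_topspace[of "gd_top Y"] by (auto simp: gd_prod_top_def openin_prod_Times_iff)
    ultimately show "fst -` U \<inter> space ?B \<in> sets ?B" using op by simp
  qed (use sp openin_subset[of "gd_top X"] X in auto)
  have 2: "snd \<in> ?B \<rightarrow>\<^sub>M msr Y"
  proof (rule measurable_sigma_sets[OF gd_sets[OF Y]])
    fix U assume U: "U \<in> {U. openin (gd_top Y) U}"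
    then have "snd -` U \<inter> space ?B = pts X \<times> U"
      using openin_subset[of "gd_top Y" U] Y by (auto simp: sp)
    moreover have "openin (gd_prod_top X Y) (pts X \<times> U)"
      using U X openin_topspace[of "gd_top X"] by (auto simp: gd_prod_top_def openin_prod_Times_iff)
    ultimately show "snd -` U \<inter> space ?B \<in> sets ?B" using op by simp
  qed (use sp openin_subset[of "gd_top Y"] Y in auto)
  have 3: "(\<lambda>z. z) \<in> ?B \<rightarrow>\<^sub>M (msr X \<Otimes>\<^sub>M msr Y)"
    by (rule measurable_pair) (use 1 2 in \<open>simp_all add: o_def\<close>)
  show "sets (msr X \<Otimes>\<^sub>M msr Y) \<subseteq> sets ?B"
  proof
    fix A assume A: "A \<in> sets (msr X \<Otimes>\<^sub>M msr Y)"
    then have "A \<subseteq> space ?B" using sets.sets_into_space[OF A] by (simp add: space_pair_measure X Y sp)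
    then show "A \<in> sets ?B" using measurable_sets[OF 3 A] by (simp add: Int_absorb2)
  qed
qed

lemma couplingD:
  assumes X: "gd_set X" and Y: "gd_set Y" and p: "p \<in> couplings X Y"
  shows "prob_space p" "sets p = sets (msr X \<Otimes>\<^sub>M msr Y)" "space p = pts X \<times> pts Y"
    "fst \<in> p \<rightarrow>\<^sub>M msr X" "snd \<in> p \<rightarrow>\<^sub>M msr Y"
    "distr p (msr X) fst = msr X" "distr p (msr Y) snd = msr Y"
proof -
  show s: "sets p = sets (msr X \<Otimes>\<^sub>M msr Y)"
    using p sets_gd_prod[OF X Y] by (simp add: couplings_def)
  show "prob_space p" "space p = pts X \<times> pts Y" "distr p (msr X) fst = msr X" "distr p (msr Y) snd = msr Y"
    using p by (simp_all add: couplings_def)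
  show "fst \<in> p \<rightarrow>\<^sub>M msr X" "snd \<in> p \<rightarrow>\<^sub>M msr Y"
    unfolding measurable_cong_sets[OF s refl] by simp_all
qed

text \<open>All couplings constructed below arise as the joint law of two maps on some auxiliary
  probability space, which can be chosen to fit the situation.\<close>

lemma coupling_push:
  assumes X: "gd_set X" and Y: "gd_set Y" and M: "prob_space M"
    and a: "a \<in> M \<rightarrow>\<^sub>M msr X" "distr M (msr X) a = msr X"
    and b: "b \<in> M \<rightarrow>\<^sub>M msr Y" "distr M (msr Y) b = msr Y"
  shows "distr M (borel_on (gd_prod_top X Y)) (\<lambda>w. (a w, b w)) \<in> couplings X Y"
    and "(\<lambda>w. (a w, b w)) \<in> M \<rightarrow>\<^sub>M borel_on (gd_prod_top X Y)"
proof -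
  let ?B = "borel_on (gd_prod_top X Y)"
  have "(\<lambda>w. (a w, b w)) \<in> M \<rightarrow>\<^sub>M (msr X \<Otimes>\<^sub>M msr Y)" using a b by simp
  then show m: "(\<lambda>w. (a w, b w)) \<in> M \<rightarrow>\<^sub>M ?B"
    by (simp add: measurable_cong_sets[OF refl sets_gd_prod[OF X Y]])
  have f: "fst \<in> ?B \<rightarrow>\<^sub>M msr X" "snd \<in> ?B \<rightarrow>\<^sub>M msr Y"
    unfolding measurable_cong_sets[OF sets_gd_prod[OF X Y] refl] by simp_all
  show "distr M ?B (\<lambda>w. (a w, b w)) \<in> couplings X Y"
    unfolding couplings_def
    by (simp add: prob_space.prob_space_distr[OF M m] distr_distr[OF f(1) m] distr_distr[OF f(2) m] o_def a b
        space_borel_on gd_prod_topspace[OF X Y])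
qed

text \<open>The independent coupling. It keeps the sets under the infima that define the box
  distances from being empty.\<close>

lemma coupling_exists:
  assumes X: "gd_set X" and Y: "gd_set Y"
  shows "couplings X Y \<noteq> {}"
proof -
  interpret X: prob_space "msr X" by (rule gd_prob[OF X])
  interpret Y: prob_space "msr Y" by (rule gd_prob[OF Y])
  interpret P: pair_prob_space "msr X" "msr Y" ..
  have "distr (msr X \<Otimes>\<^sub>M msr Y) (msr X) fst = msr X"
    using Y.distr_pair_fst[of "msr X"] by (simp add: Y.emeasure_space_1)
  moreover have "distr (msr X \<Otimes>\<^sub>M msr Y) (msr Y) snd = msr Y"
  proof (rule measure_eqI)
    fix A assume "A \<in> sets (distr (msr X \<Otimes>\<^sub>M msr Y) (msr Y) snd)"
    then have A: "A \<in> sets (msr Y)" by simp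
    have "snd -` A \<inter> space (msr X \<Otimes>\<^sub>M msr Y) = space (msr X) \<times> A"
      using sets.sets_into_space[OF A] by (auto simp: space_pair_measure)
    then show "emeasure (distr (msr X \<Otimes>\<^sub>M msr Y) (msr Y) snd) A = emeasure (msr Y) A"
      using A by (simp add: emeasure_distr Y.emeasure_pair_measure_Times X.emeasure_space_1)
  qed simp
  ultimately show ?thesis
    using coupling_push[OF X Y P.prob_space_axioms, of fst snd] by auto
qed

text \<open>One half of the Hausdorff condition, with real numbers and with an attained infimum. The
  other half is the same condition for \<open>S\<inverse>\<close> with the two families
  exchanged.\<close>

definition near :: "('a \<times> 'b) set \<Rightarrow> real \<Rightarrow> ('a \<Rightarrow> real) set \<Rightarrow> ('b \<Rightarrow> real) set \<Rightarrow> bool" where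
  "near S c F G \<longleftrightarrow> (\<forall>f\<in>F. \<exists>g\<in>G. \<forall>(x, y)\<in>S. \<bar>f x - g y\<bar> \<le> c)"

lemma near_imp_le:
  assumes "near S c F G" "0 \<le> c"
  shows "(SUP f\<in>F. INF g\<in>G. SUP z\<in>S. ennreal \<bar>f (fst z) - g (snd z)\<bar>) \<le> ennreal c"
proof (rule SUP_least)
  fix f assume "f \<in> F"
  then obtain g where g: "g \<in> G" "\<And>x y. (x, y) \<in> S \<Longrightarrow> \<bar>f x - g y\<bar> \<le> c"
    using assms unfolding near_def by blast
  show "(INF g\<in>G. SUP z\<in>S. ennreal \<bar>f (fst z) - g (snd z)\<bar>) \<le> ennreal c"
    by (rule INF_lower2[OF g(1)], rule SUP_least) (use g in \<open>auto intro: ennreal_leI\<close>)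
qed

text \<open>The infimum over \<open>G\<close> need not be attained, hence the strictly larger
  constant \<open>c'\<close>. The loss disappears in the infima that define the box
  distances.\<close>

lemma le_imp_near:
  assumes "(SUP f\<in>F. INF g\<in>G. SUP z\<in>S. ennreal \<bar>f (fst z) - g (snd z)\<bar>) \<le> ennreal c" "0 \<le> c" "c < c'"
  shows "near S c' F G"
  unfolding near_def
proof
  fix f assume "f \<in> F"
  then have "(INF g\<in>G. SUP z\<in>S. ennreal \<bar>f (fst z) - g (snd z)\<bar>) \<le> ennreal c"
    using assms(1) unfolding SUP_le_iff by blast
  also have "\<dots> < ennreal c'" using assms(2,3) by (simp add: ennreal_less_iff)
  finally obtain g where g: "g \<in> G" "(SUP z\<in>S. ennreal \<bar>f (fst z) - g (snd z)\<bar>) < ennreal c'"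
    unfolding INF_less_iff by blast
  have "\<bar>f x - g y\<bar> \<le> c'" if "(x, y) \<in> S" for x y
  proof -
    have "ennreal \<bar>f x - g y\<bar> \<le> (SUP z\<in>S. ennreal \<bar>f (fst z) - g (snd z)\<bar>)"
      by (rule SUP_upper2[OF that]) simp
    then have "ennreal \<bar>f x - g y\<bar> \<le> ennreal c'" using g(2) by auto
    then show ?thesis using assms by (simp add: ennreal_le_iff2)
  qed
  then show "\<exists>g\<in>G. \<forall>(x, y)\<in>S. \<bar>f x - g y\<bar> \<le> c'" using g(1) by blast
qed

lemma SUP_prod_flip:
  "(SUP z\<in>S\<inverse>. ennreal \<bar>f (fst z) - g (snd z)\<bar>) = (SUP (x, y)\<in>S. ennreal \<bar>f y - g x\<bar>)"
  by (intro antisym SUP_least) (auto intro!: SUP_upper2)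

lemma ennreal_double_le: "0 \<le> e \<Longrightarrow> 2 * a \<le> ennreal e \<longleftrightarrow> a \<le> ennreal (e / 2)"
proof (cases a)
  case (real r)
  moreover have "2 * ennreal r = ennreal (2 * r)" using real by (simp add: ennreal_mult)
  moreover assume "0 \<le> e"
  ultimately show ?thesis by (simp add: field_simps)
next
  case top then show ?thesis by (simp add: ennreal_mult_top top_unique)
qed

lemma dominated_upto_near:
  assumes e: "0 \<le> e"
  shows "near (S\<inverse>) (e/2) (gd_closure Y) (gd_closure X) \<Longrightarrow>
      2 * (SUP g\<in>gd_closure Y. INF f\<in>gd_closure X. SUP (x, y)\<in>S. ennreal \<bar>g y - f x\<bar>) \<le> ennreal e"
    and "2 * (SUP g\<in>gd_closure Y. INF f\<in>gd_closure X. SUP (x, y)\<in>S. ennreal \<bar>g y - f x\<bar>) \<le> ennreal e \<Longrightarrow>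
      e < e' \<Longrightarrow> near (S\<inverse>) (e'/2) (gd_closure Y) (gd_closure X)"
  using near_imp_le[of "S\<inverse>" "e/2" "gd_closure Y" "gd_closure X"]
    le_imp_near[where F="gd_closure Y" and G="gd_closure X" and S="S\<inverse>" and c="e/2" and c'="e'/2"] e
  unfolding ennreal_double_le[OF e] SUP_prod_flip by auto

lemma hausdorff_near:
  assumes e: "0 \<le> e"
  shows "near S (e/2) (gd_closure X) (gd_closure Y) \<Longrightarrow> near (S\<inverse>) (e/2) (gd_closure Y) (gd_closure X) \<Longrightarrow>
      2 * hausdorff_dist (sup_dist S) ((\<lambda>f. f \<circ> fst) ` gd_closure X) ((\<lambda>g. g \<circ> snd) ` gd_closure Y) \<le> ennreal e"
    and "2 * hausdorff_dist (sup_dist S) ((\<lambda>f. f \<circ> fst) ` gd_closure X) ((\<lambda>g. g \<circ> snd) ` gd_closure Y) \<le> ennreal e \<Longrightarrow>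
      e < e' \<Longrightarrow> near S (e'/2) (gd_closure X) (gd_closure Y) \<and> near (S\<inverse>) (e'/2) (gd_closure Y) (gd_closure X)"
proof -
  have *: "hausdorff_dist (sup_dist S) ((\<lambda>f. f \<circ> fst) ` gd_closure X) ((\<lambda>g. g \<circ> snd) ` gd_closure Y) =
    max (SUP f\<in>gd_closure X. INF g\<in>gd_closure Y. SUP z\<in>S. ennreal \<bar>f (fst z) - g (snd z)\<bar>)
        (SUP g\<in>gd_closure Y. INF f\<in>gd_closure X. SUP (x, y)\<in>S. ennreal \<bar>g y - f x\<bar>)"
    unfolding hausdorff_dist_def sup_dist_def image_image comp_def
    by (simp add: split_beta abs_minus_commute)
  show "near S (e/2) (gd_closure X) (gd_closure Y) \<Longrightarrow> near (S\<inverse>) (e/2) (gd_closure Y) (gd_closure X) \<Longrightarrow>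
      2 * hausdorff_dist (sup_dist S) ((\<lambda>f. f \<circ> fst) ` gd_closure X) ((\<lambda>g. g \<circ> snd) ` gd_closure Y) \<le> ennreal e"
    using near_imp_le[of S "e/2" "gd_closure X" "gd_closure Y"] dominated_upto_near(1)[OF e, where S=S and Y=Y and X=X] e
    unfolding * ennreal_double_le[OF e] by auto
  show "near S (e'/2) (gd_closure X) (gd_closure Y) \<and> near (S\<inverse>) (e'/2) (gd_closure Y) (gd_closure X)"
    if "2 * hausdorff_dist (sup_dist S) ((\<lambda>f. f \<circ> fst) ` gd_closure X) ((\<lambda>g. g \<circ> snd) ` gd_closure Y) \<le> ennreal e" "e < e'"
    using le_imp_near[where F="gd_closure X" and G="gd_closure Y" and S=S and c="e/2" and c'="e'/2"]
      dominated_upto_near(2)[OF e, where S=S and Y=Y and X=X and e'=e'] e that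
    unfolding * ennreal_double_le[OF e] by auto
qed

lemma near_empty: "gd_set Y \<Longrightarrow> near {} c F (gd_closure Y)"
  using gd_closure_nonempty[of Y] by (auto simp: near_def)

lemma gd_boxI:
  assumes "p \<in> couplings X Y" "closedin (gd_prod_top X Y) S" "1 - measure p S \<le> e" "0 \<le> e"
    "near S (e/2) (gd_closure X) (gd_closure Y)" "near (S\<inverse>) (e/2) (gd_closure Y) (gd_closure X)"
  shows "gd_box X Y \<le> e"
  unfolding gd_box_def using assms hausdorff_near(1)[of e S X Y]
  by (intro cInf_lower) (auto intro!: bdd_belowI[of _ 0])

lemma gd_boxD:
  assumes X: "gd_set X" and Y: "gd_set Y" and "gd_box X Y < e"
  obtains p S where "p \<in> couplings X Y" "closedin (gd_prod_top X Y) S" "1 - e \<le> measure p S" "0 < e"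
    "near S (e/2) (gd_closure X) (gd_closure Y)" "near (S\<inverse>) (e/2) (gd_closure Y) (gd_closure X)"
proof -
  let ?A = "{\<eta>. 0 \<le> \<eta> \<and>
     (\<exists>p\<in>couplings X Y. \<exists>S. closedin (gd_prod_top X Y) S \<and> 1 - measure p S \<le> \<eta> \<and>
        2 * hausdorff_dist (sup_dist S)
              ((\<lambda>f. f \<circ> fst) ` gd_closure X) ((\<lambda>g. g \<circ> snd) ` gd_closure Y)
          \<le> ennreal \<eta>)}"
  obtain p where p: "p \<in> couplings X Y" using coupling_exists[OF X Y] by blast
  \<comment> \<open>Over the empty relation every supremum is 0, so 1 is always admissible and
    \<open>Inf\<close> is taken over a nonempty set.\<close>
  have "2 * hausdorff_dist (sup_dist {}) ((\<lambda>f. f \<circ> fst) ` gd_closure X) ((\<lambda>g. g \<circ> snd) ` gd_closure Y) \<le> ennreal 1"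
    by (rule hausdorff_near(1)) (use near_empty[OF X] near_empty[OF Y] in auto)
  then have "1 \<in> ?A" using p by (auto intro!: bexI[of _ p] exI[of _ "{}"])
  then have ne: "?A \<noteq> {}" by blast
  have "Inf ?A < e" using assms(3) unfolding gd_box_def .
  from cInf_lessD[OF ne this] have "\<exists>\<eta>\<in>?A. \<eta> < e" .
  then obtain \<eta> p S where *: "0 \<le> \<eta>" "\<eta> < e" "p \<in> couplings X Y" "closedin (gd_prod_top X Y) S" "1 - measure p S \<le> \<eta>"
    "2 * hausdorff_dist (sup_dist S) ((\<lambda>f. f \<circ> fst) ` gd_closure X) ((\<lambda>g. g \<circ> snd) ` gd_closure Y) \<le> ennreal \<eta>"
    by blast
  show thesis using that[OF *(3,4)] hausdorff_near(2)[OF *(1) *(6) *(2)] * by auto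
qed

lemma gd_box_nonneg:
  assumes "gd_set X" "gd_set Y"
  shows "0 \<le> gd_box X Y"
proof (rule leI, rule notI)
  assume "gd_box X Y < 0"
  then show False by (rule gd_boxD[OF assms]) simp
qed

lemma dominated_uptoI:
  assumes "p \<in> couplings X Y" "closedin (gd_prod_top X Y) S" "1 - measure p S \<le> e" "0 \<le> e"
    "near (S\<inverse>) (e/2) (gd_closure Y) (gd_closure X)"
  shows "dominated_upto e Y X"
  unfolding dominated_upto_def using assms dominated_upto_near(1)[of e S Y X] by force

lemma dominated_uptoD:
  assumes "dominated_upto e Y X" "0 \<le> e" "e < e'"
  obtains p S where "p \<in> couplings X Y" "closedin (gd_prod_top X Y) S" "1 - e' \<le> measure p S"
    "near (S\<inverse>) (e'/2) (gd_closure Y) (gd_closure X)"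
proof -
  obtain p S where p: "p \<in> couplings X Y" "closedin (gd_prod_top X Y) S" "1 - e \<le> measure p S"
    and le: "2 * (SUP g\<in>gd_closure Y. INF f\<in>gd_closure X. SUP (x, y)\<in>S. ennreal \<bar>g y - f x\<bar>) \<le> ennreal e"
    using assms(1) unfolding dominated_upto_def by blast
  show thesis
    by (rule that[OF p(1,2) _ dominated_upto_near(2)[OF assms(2) le assms(3)]]) (use p(3) assms(3) in simp)
qed

lemma box_le_le: "dominated_upto e Y X \<Longrightarrow> 0 \<le> e \<Longrightarrow> box_le Y X \<le> e"
  unfolding box_le_def by (intro cInf_lower) (auto intro!: bdd_belowI[of _ 0])

lemma box_leD:
  assumes X: "gd_set X" and Y: "gd_set Y" and "box_le Y X < e"
  obtains p S where "p \<in> couplings X Y" "closedin (gd_prod_top X Y) S" "1 - e \<le> measure p S" "0 < e"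
    "near (S\<inverse>) (e/2) (gd_closure Y) (gd_closure X)"
proof -
  obtain p where p: "p \<in> couplings X Y" using coupling_exists[OF X Y] by blast
  have "dominated_upto 1 Y X"
    by (rule dominated_uptoI[OF p, of "{}"]) (use near_empty[OF X] in auto)
  then have ne: "{\<epsilon>. 0 \<le> \<epsilon> \<and> dominated_upto \<epsilon> Y X} \<noteq> {}"
    using zero_le_one by blast
  have "\<exists>d\<in>{\<epsilon>. 0 \<le> \<epsilon> \<and> dominated_upto \<epsilon> Y X}. d < e"
    using cInf_lessD[OF ne] assms(3) unfolding box_le_def by blast
  then obtain d where d: "0 \<le> d" "d < e" "dominated_upto d Y X" by auto
  show thesis by (rule dominated_uptoD[OF d(3,1,2)]) (use that d in auto)
qed

lemma box_le_nonneg: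
  assumes "gd_set X" "gd_set Y"
  shows "0 \<le> box_le Y X"
proof (rule leI, rule notI)
  assume "box_le Y X < 0"
  then show False by (rule box_leD[OF assms]) simp
qed

lemma closed_measurable:
  assumes X: "gd_set X" and Y: "gd_set Y" and p: "p \<in> couplings X Y" and S: "closedin (gd_prod_top X Y) S"
  shows "S \<in> sets p"
proof -
  have sp: "space p = topspace (gd_prod_top X Y)" using couplingD(3)[OF X Y p] gd_prod_topspace[OF X Y] by simp
  have "openin (gd_prod_top X Y) (topspace (gd_prod_top X Y) - S)" using S by blast
  then have "topspace (gd_prod_top X Y) - S \<in> sets p"
    using p by (simp add: couplings_def sets_borel_on sigma_sets.Basic)
  then have "space p - (topspace (gd_prod_top X Y) - S) \<in> sets p" by (rule sets.compl_sets)
  moreover have "space p - (topspace (gd_prod_top X Y) - S) = S"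
    using sp closedin_subset[OF S] by auto
  ultimately show ?thesis by simp
qed

text \<open>Observables are 1-Lipschitz in each factor, so a non-strict bound passes to limits.
  Closed relations can thus be obtained at the very end by taking closures.\<close>

lemma le_on_closure_of:
  assumes X: "gd_set X" and Y: "gd_set Y" and f: "f \<in> gd_closure X" and g: "g \<in> gd_closure Y"
    and le: "\<And>x y. (x, y) \<in> T \<Longrightarrow> \<bar>f x - g y\<bar> \<le> c" and T: "T \<subseteq> pts X \<times> pts Y"
    and xy: "(x, y) \<in> gd_prod_top X Y closure_of T"
  shows "\<bar>f x - g y\<bar> \<le> c"
proof (rule ccontr)
  assume n: "\<not> \<bar>f x - g y\<bar> \<le> c"
  define d where "d = (\<bar>f x - g y\<bar> - c) / 2"
  have d: "0 < d" using n by (simp add: d_def)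
  have p: "x \<in> pts X" "y \<in> pts Y"
    using xy closure_of_subset_topspace[of "gd_prod_top X Y" T] gd_prod_topspace[OF X Y] by auto
  let ?U = "{u \<in> pts X. gd_dist X x u < d} \<times> {v \<in> pts Y. gd_dist Y y v < d}"
  have "openin (gd_prod_top X Y) ?U"
    unfolding gd_prod_top_def openin_prod_Times_iff
    using gd_ball_open[OF p(1) X, of d] gd_ball_open[OF p(2) Y, of d] by simp
  moreover have "(x, y) \<in> ?U" using p d X Y by (simp add: gd_dist_self)
  moreover have "\<And>W. (x, y) \<in> W \<Longrightarrow> openin (gd_prod_top X Y) W \<Longrightarrow> \<exists>z. z \<in> T \<and> z \<in> W"
    using xy unfolding in_closure_of by simp
  ultimately obtain z where "z \<in> T" "z \<in> ?U" by meson
  then obtain u v where uv: "(u, v) \<in> T" "u \<in> pts X" "v \<in> pts Y" "gd_dist X x u < d" "gd_dist Y y v < d" by auto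
  have "\<bar>f x - f u\<bar> < d" "\<bar>g y - g v\<bar> < d" "\<bar>f u - g v\<bar> \<le> c"
    using closure_le_dist[OF X f p(1) uv(2)] closure_le_dist[OF Y g p(2) uv(3)] uv le by auto
  moreover have "\<bar>f x - g y\<bar> \<le> \<bar>f x - f u\<bar> + \<bar>g y - g v\<bar> + \<bar>f u - g v\<bar>" by linarith
  moreover have "2 * d = \<bar>f x - g y\<bar> - c" by (simp add: d_def)
  ultimately show False by linarith
qed

text \<open>Approximate \<open>f\<close> by observables. The functions matched with them are bounded
  at \<open>y0\<close>, because one pair \<open>(x0, y0)\<close> lies in \<open>T\<close>, so a
  subsequence converges to a match for \<open>f\<close>. Closeness then has to be verified only for
  the generating observables; an empty \<open>T\<close> offers no such pair and is treated
  apart.\<close>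

lemma near_obs_closure:
  assumes X: "gd_set X" and Y: "gd_set Y" and T: "T \<subseteq> pts X \<times> pts Y" and n: "near T c (obs X) (gd_closure Y)"
  shows "near T c (gd_closure X) (gd_closure Y)"
proof (cases "T = {}")
  case True then show ?thesis using near_empty[OF Y] by simp
next
  case False
  then obtain x0 y0 where xy0: "(x0, y0) \<in> T" by force
  then have p0: "x0 \<in> pts X" "y0 \<in> pts Y" using T by auto
  show ?thesis
    unfolding near_def
  proof
    fix f assume f: "f \<in> gd_closure X"
    obtain fs where fs: "\<And>n::nat. fs n \<in> obs X" "\<And>x. x \<in> pts X \<Longrightarrow> (\<lambda>n. fs n x) \<longlonglongrightarrow> f x"
      by (rule gd_closure_limit_of_obs[OF X f]) blast
    have "\<forall>k. \<exists>g. g \<in> gd_closure Y \<and> (\<forall>x y. (x, y) \<in> T \<longrightarrow> \<bar>fs k x - g y\<bar> \<le> c)"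
      using n fs(1) unfolding near_def by blast
    then obtain gs where gs: "\<And>k. gs k \<in> gd_closure Y" "\<And>k x y. (x, y) \<in> T \<Longrightarrow> \<bar>fs k x - gs k y\<bar> \<le> c" by metis
    obtain B where B: "\<And>k. \<bar>fs k x0\<bar> \<le> B"
      using convergent_imp_Bseq[of "\<lambda>k. fs k x0"] fs(2)[OF p0(1)] unfolding convergent_def Bseq_def by auto
    have "\<bar>gs k y0\<bar> \<le> B + c" for k using gs(2)[OF xy0, of k] B[of k] by linarith
    then have "\<exists>y\<in>pts Y. bounded (range (\<lambda>k. gs k y))"
      using p0 by (auto simp: bounded_iff intro!: bexI[of _ y0])
    then obtain r h where r: "strict_mono (r::nat\<Rightarrow>nat)" and h: "\<And>i::nat. h i \<in> gd_closure Y"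
      "\<And>i y. y \<in> pts Y \<Longrightarrow> (\<lambda>k. gs (r k) y) \<longlonglongrightarrow> h i y"
      using gd_closure_compact[OF Y, where fs="\<lambda>i. gs"] gs(1) by metis
    have "\<bar>f x - h 0 y\<bar> \<le> c" if xy: "(x, y) \<in> T" for x y
    proof -
      have p: "x \<in> pts X" "y \<in> pts Y" using T xy by auto
      have "(\<lambda>k. \<bar>fs (r k) x - gs (r k) y\<bar>) \<longlonglongrightarrow> \<bar>f x - h 0 y\<bar>"
        using LIMSEQ_subseq_LIMSEQ[OF fs(2)[OF p(1)] r] h(2)[OF p(2)]
        by (intro tendsto_rabs tendsto_diff) (auto simp: o_def)
      then show ?thesis by (rule LIMSEQ_le_const2) (use gs(2)[OF xy] in auto)
    qed
    then show "\<exists>g\<in>gd_closure Y. \<forall>(x, y)\<in>T. \<bar>f x - g y\<bar> \<le> c" using h(1)[of 0] by blast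
  qed
qed

lemma near_closure_of:
  assumes X: "gd_set X" and Y: "gd_set Y" and T: "T \<subseteq> pts X \<times> pts Y"
  shows "near T c (gd_closure X) (gd_closure Y) \<Longrightarrow> near (gd_prod_top X Y closure_of T) c (gd_closure X) (gd_closure Y)"
    and "near (T\<inverse>) c (gd_closure Y) (gd_closure X) \<Longrightarrow>
      near ((gd_prod_top X Y closure_of T)\<inverse>) c (gd_closure Y) (gd_closure X)"
proof -
  assume n: "near T c (gd_closure X) (gd_closure Y)"
  show "near (gd_prod_top X Y closure_of T) c (gd_closure X) (gd_closure Y)"
    unfolding near_def
  proof
    fix f assume f: "f \<in> gd_closure X"
    then obtain g where g: "g \<in> gd_closure Y" "\<And>x y. (x, y) \<in> T \<Longrightarrow> \<bar>f x - g y\<bar> \<le> c"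
      using n unfolding near_def by blast
    then show "\<exists>g\<in>gd_closure Y. \<forall>(x, y)\<in>gd_prod_top X Y closure_of T. \<bar>f x - g y\<bar> \<le> c"
      using le_on_closure_of[OF X Y f g(1) _ T] by blast
  qed
next
  assume n: "near (T\<inverse>) c (gd_closure Y) (gd_closure X)"
  show "near ((gd_prod_top X Y closure_of T)\<inverse>) c (gd_closure Y) (gd_closure X)"
    unfolding near_def
  proof
    fix g assume g: "g \<in> gd_closure Y"
    then obtain f where f: "f \<in> gd_closure X" "\<And>x y. (x, y) \<in> T \<Longrightarrow> \<bar>f x - g y\<bar> \<le> c"
      using n unfolding near_def by (metis (mono_tags, lifting) abs_minus_commute case_prodD converse_iff)
    show "\<exists>f\<in>gd_closure X. \<forall>(y, x)\<in>(gd_prod_top X Y closure_of T)\<inverse>. \<bar>g y - f x\<bar> \<le> c"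
      using le_on_closure_of[OF X Y f(1) g f(2) T] by (intro bexI[OF _ f(1)]) (auto simp: abs_minus_commute)
  qed
qed

text \<open>A coupling presented as the joint law of two maps \<open>a\<close> and \<open>b\<close>
  on a probability space \<open>M\<close>. Bounds on the box distances may then be checked on a
  measurable event of \<open>M\<close> instead of a closed subset of the product.\<close>

locale gd_pair =
  fixes X :: "'a gdset" and Y :: "'b gdset" and M :: "'w measure" and a b
  assumes X: "gd_set X" and Y: "gd_set Y" and M: "prob_space M"
    and a: "a \<in> M \<rightarrow>\<^sub>M msr X" "distr M (msr X) a = msr X"
    and b: "b \<in> M \<rightarrow>\<^sub>M msr Y" "distr M (msr Y) b = msr Y"
begin

text \<open>The image of a measurable event need not be measurable. Its closure is, and its preimage
  contains the event.\<close>

lemma closure_of_image: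
  assumes E: "E \<in> sets M"
  defines "T \<equiv> (\<lambda>w. (a w, b w)) ` E"
  shows "T \<subseteq> pts X \<times> pts Y"
    "measure M E \<le> measure (distr M (borel_on (gd_prod_top X Y)) (\<lambda>w. (a w, b w))) (gd_prod_top X Y closure_of T)"
proof -
  interpret prob_space M by (rule M)
  note c = coupling_push[OF X Y M a b]
  let ?p = "distr M (borel_on (gd_prod_top X Y)) (\<lambda>w. (a w, b w))" and ?S = "gd_prod_top X Y closure_of T"
  show T: "T \<subseteq> pts X \<times> pts Y"
    using sets.sets_into_space[OF E] measurable_space[OF a(1)] measurable_space[OF b(1)] X Y
    by (auto simp: T_def)
  have "?S \<in> sets ?p" by (rule closed_measurable[OF X Y c(1)]) simp
  then have "measure ?p ?S = measure M ((\<lambda>w. (a w, b w)) -` ?S \<inter> space M)"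
    by (intro measure_distr[OF c(2)]) simp
  moreover have "E \<subseteq> (\<lambda>w. (a w, b w)) -` ?S \<inter> space M"
    using closure_of_subset[of T "gd_prod_top X Y"] T gd_prod_topspace[OF X Y] sets.sets_into_space[OF E]
    by (auto simp: T_def)
  moreover have "(\<lambda>w. (a w, b w)) -` ?S \<inter> space M \<in> sets M"
    using measurable_sets[OF c(2)] \<open>?S \<in> sets ?p\<close> by simp
  ultimately show "measure M E \<le> measure ?p ?S" by (simp add: finite_measure_mono)
qed

lemma dominated_upto_pair:
  assumes E: "E \<in> sets M" "1 - e \<le> measure M E" and e: "0 \<le> e"
    and n: "\<And>g. g \<in> obs Y \<Longrightarrow> \<exists>f\<in>gd_closure X. \<forall>w\<in>E. \<bar>f (a w) - g (b w)\<bar> \<le> e/2"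
  shows "dominated_upto e Y X"
proof -
  let ?T = "(\<lambda>w. (a w, b w)) ` E"
  have "near (?T\<inverse>) (e/2) (obs Y) (gd_closure X)"
    unfolding near_def using n by (fastforce simp: abs_minus_commute)
  then have "near (?T\<inverse>) (e/2) (gd_closure Y) (gd_closure X)"
    by (rule near_obs_closure[OF Y X, rotated]) (use closure_of_image(1)[OF E(1)] in auto)
  then show ?thesis
    using closure_of_image[OF E(1)] E(2)
    by (intro dominated_uptoI[OF coupling_push(1)[OF X Y M a b], of "gd_prod_top X Y closure_of ?T"] near_closure_of X Y)
       (auto simp: e)
qed

lemma box_le_pair:
  assumes "E \<in> sets M" "1 - e \<le> measure M E" "0 \<le> e"
    and "\<And>g. g \<in> obs Y \<Longrightarrow> \<exists>f\<in>gd_closure X. \<forall>w\<in>E. \<bar>f (a w) - g (b w)\<bar> \<le> e/2"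
  shows "box_le Y X \<le> e"
  using dominated_upto_pair[OF assms] assms by (intro box_le_le) auto

lemma gd_box_pair:
  assumes E: "E \<in> sets M" "1 - e \<le> measure M E" and e: "0 \<le> e"
    and n1: "\<And>f. f \<in> obs X \<Longrightarrow> \<exists>g\<in>gd_closure Y. \<forall>w\<in>E. \<bar>f (a w) - g (b w)\<bar> \<le> e/2"
    and n2: "\<And>g. g \<in> obs Y \<Longrightarrow> \<exists>f\<in>gd_closure X. \<forall>w\<in>E. \<bar>f (a w) - g (b w)\<bar> \<le> e/2"
  shows "gd_box X Y \<le> e"
proof -
  let ?T = "(\<lambda>w. (a w, b w)) ` E"
  have "near (?T\<inverse>) (e/2) (obs Y) (gd_closure X)"
    unfolding near_def using n2 by (fastforce simp: abs_minus_commute)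
  then have 1: "near (?T\<inverse>) (e/2) (gd_closure Y) (gd_closure X)"
    by (rule near_obs_closure[OF Y X, rotated]) (use closure_of_image(1)[OF E(1)] in auto)
  have "near ?T (e/2) (obs X) (gd_closure Y)"
    unfolding near_def using n1 by fastforce
  then have 2: "near ?T (e/2) (gd_closure X) (gd_closure Y)"
    by (rule near_obs_closure[OF X Y, rotated]) (use closure_of_image(1)[OF E(1)] in auto)
  show ?thesis
    using closure_of_image[OF E(1)] E(2) 1 2
    by (intro gd_boxI[OF coupling_push(1)[OF X Y M a b], of "gd_prod_top X Y closure_of ?T"] near_closure_of X Y)
       (auto simp: e)
qed

end

lemma coupling_gd_pair:
  assumes "gd_set X" "gd_set Y" "p \<in> couplings X Y"
  shows "gd_pair X Y p fst snd"
  by (intro gd_pair.intro couplingD[OF assms] assms)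

lemma box_le_le_gd_box:
  assumes X: "gd_set X" and Y: "gd_set Y"
  shows "box_le Y X \<le> gd_box X Y"
proof (rule field_le_epsilon)
  fix d :: real assume "0 < d"
  then have lt: "gd_box X Y < gd_box X Y + d" by simp
  obtain p S where p: "p \<in> couplings X Y" "closedin (gd_prod_top X Y) S" "1 - (gd_box X Y + d) \<le> measure p S"
    "0 < gd_box X Y + d" "near (S\<inverse>) ((gd_box X Y + d)/2) (gd_closure Y) (gd_closure X)"
    by (rule gd_boxD[OF X Y lt]) blast
  then show "box_le Y X \<le> gd_box X Y + d"
    by (intro box_le_le dominated_uptoI[OF p(1,2)]) auto
qed

text \<open>The definition orders the two factors; reading a coupling of \<open>X\<close> and
  \<open>Y\<close> through the pair \<open>snd\<close>, \<open>fst\<close> exchanges them. Applied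
  in both directions this gives symmetry.\<close>

lemma gd_box_commute_le:
  assumes X: "gd_set X" and Y: "gd_set Y"
  shows "gd_box Y X \<le> gd_box X Y"
proof (rule field_le_epsilon)
  fix d :: real assume "0 < d"
  then have lt: "gd_box X Y < gd_box X Y + d" by simp
  obtain p S where p: "p \<in> couplings X Y" "closedin (gd_prod_top X Y) S" "1 - (gd_box X Y + d) \<le> measure p S"
    "0 < gd_box X Y + d" "near S ((gd_box X Y + d)/2) (gd_closure X) (gd_closure Y)"
    "near (S\<inverse>) ((gd_box X Y + d)/2) (gd_closure Y) (gd_closure X)"
    by (rule gd_boxD[OF X Y lt]) blast
  interpret gd_pair Y X p snd fst
    by (intro gd_pair.intro couplingD[OF X Y p(1)] X Y)
  show "gd_box Y X \<le> gd_box X Y + d"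
  proof (rule gd_box_pair)
    show "S \<in> sets p" by (rule closed_measurable[OF _ _ p(1,2)]) fact+
    fix g assume "g \<in> obs Y"
    then have "g \<in> gd_closure Y" using obs_subset_closure \<open>gd_set Y\<close> by blast
    then obtain f where "f \<in> gd_closure X" "\<forall>(y, x)\<in>S\<inverse>. \<bar>g y - f x\<bar> \<le> (gd_box X Y + d)/2"
      using p(6) unfolding near_def by blast
    then show "\<exists>f\<in>gd_closure X. \<forall>w\<in>S. \<bar>g (snd w) - f (fst w)\<bar> \<le> (gd_box X Y + d)/2" by fastforce
  next
    fix f assume "f \<in> obs X"
    then have "f \<in> gd_closure X" using obs_subset_closure \<open>gd_set X\<close> by blast
    then obtain g where "g \<in> gd_closure Y" "\<forall>(x, y)\<in>S. \<bar>f x - g y\<bar> \<le> (gd_box X Y + d)/2"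
      using p(5) unfolding near_def by blast
    then show "\<exists>g\<in>gd_closure Y. \<forall>w\<in>S. \<bar>g (snd w) - f (fst w)\<bar> \<le> (gd_box X Y + d)/2"
      by (fastforce simp: abs_minus_commute)
  qed (use p in auto)
qed

section \<open>Soft couplings and the triangle inequality\<close>

lemma (in prob_space) prob_Int_ge:
  assumes "A \<in> events" "B \<in> events"
  shows "prob A + prob B - 1 \<le> prob (A \<inter> B)"
proof -
  have "prob A \<le> prob ((A \<inter> B) \<union> (space M - B))"
    using assms sets.sets_into_space[OF assms(1)] by (intro finite_measure_mono) auto
  also have "\<dots> \<le> prob (A \<inter> B) + prob (space M - B)"
    using assms by (intro measure_Un_le) auto
  finally show ?thesis using prob_compl[OF assms(2)] by simp
qed

section \<open>Couplings that respect a partition of unity\<close>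

lemma soft_coupling_marginal:
  fixes N :: "'b measure"
  assumes N: "prob_space N" and I: "finite I"
    and meas: "\<And>i. i \<in> I \<Longrightarrow> \<psi> i \<in> borel_measurable N" and nn: "\<And>i y. i \<in> I \<Longrightarrow> y \<in> space N \<Longrightarrow> 0 \<le> \<psi> i y"
    and le: "\<And>i y. i \<in> I \<Longrightarrow> y \<in> space N \<Longrightarrow> \<psi> i y \<le> 1" and u: "\<And>i. i \<in> I \<Longrightarrow> 0 \<le> (u i :: real)"
  shows "(\<integral>\<^sup>+ y. ennreal (\<Sum>i\<in>I. u i * \<psi> i y) \<partial>N) = ennreal (\<Sum>i\<in>I. u i * (\<integral>y. \<psi> i y \<partial>N))"
proof -
  interpret prob_space N by (rule N)
  have int: "integrable N (\<psi> i)" if "i \<in> I" for i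
    using that nn le by (intro integrable_const_bound[where B=1] AE_I2 meas) (auto simp: abs_le_iff intro: order_trans[of _ 0])
  have "(\<integral>\<^sup>+ y. ennreal (\<Sum>i\<in>I. u i * \<psi> i y) \<partial>N) = ennreal (\<integral>y. (\<Sum>i\<in>I. u i * \<psi> i y) \<partial>N)"
    by (intro nn_integral_eq_integral Bochner_Integration.integrable_sum integrable_mult_right int AE_I2 sum_nonneg mult_nonneg_nonneg u nn)
  also have "(\<integral>y. (\<Sum>i\<in>I. u i * \<psi> i y) \<partial>N) = (\<Sum>i\<in>I. u i * (\<integral>y. \<psi> i y \<partial>N))"
    by (subst Bochner_Integration.integral_sum) (auto intro: int)
  finally show ?thesis .
qed

text \<open>The coupling has density \<open>\<Sum>i j. q i j * \<xi> i x / a i * \<psi> j y / b j\<close> with respect to the product measure, where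
  \<open>a\<close> and \<open>b\<close> are the integrals of the partitions of unity \<open>\<xi>\<close> and \<open>\<psi>\<close> and \<open>q\<close> is a maximal
  coupling of the weights \<open>a\<close> and \<open>b\<close>. The junk value 0 of a division by 0 is the intended one.\<close>

lemma soft_coupling_partition:
  fixes M :: "'a measure" and N :: "'b measure" and \<xi> :: "'i \<Rightarrow> 'a \<Rightarrow> real" and \<psi> :: "'i \<Rightarrow> 'b \<Rightarrow> real"
  assumes M: "prob_space M" and N: "prob_space N" and I: "finite I" and J: "J \<subseteq> I"
    and cm [measurable]: "\<And>i. i \<in> I \<Longrightarrow> \<xi> i \<in> borel_measurable M"
    and pm [measurable]: "\<And>i. i \<in> I \<Longrightarrow> \<psi> i \<in> borel_measurable N"
    and cn: "\<And>i x. i \<in> I \<Longrightarrow> x \<in> space M \<Longrightarrow> 0 \<le> \<xi> i x" and pn: "\<And>i y. i \<in> I \<Longrightarrow> y \<in> space N \<Longrightarrow> 0 \<le> \<psi> i y"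
    and c1: "\<And>x. x \<in> space M \<Longrightarrow> (\<Sum>i\<in>I. \<xi> i x) = 1" and p1: "\<And>y. y \<in> space N \<Longrightarrow> (\<Sum>i\<in>I. \<psi> i y) = 1"
  obtains K where "prob_space K" "sets K = sets (M \<Otimes>\<^sub>M N)" "distr K M fst = M" "distr K N snd = N"
    "\<And>E. E \<in> sets (M \<Otimes>\<^sub>M N) \<Longrightarrow>
      (\<And>x y i. i \<in> J \<Longrightarrow> x \<in> space M \<Longrightarrow> y \<in> space N \<Longrightarrow> 0 < \<xi> i x \<Longrightarrow> 0 < \<psi> i y \<Longrightarrow> (x, y) \<in> E) \<Longrightarrow>
      (\<Sum>i\<in>J. min (\<integral>x. \<xi> i x \<partial>M) (\<integral>y. \<psi> i y \<partial>N)) \<le> measure K E"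
proof -
  interpret M: prob_space M by (rule M)
  interpret N: prob_space N by (rule N)
  interpret P: pair_prob_space M N ..
  have cl: "\<xi> i x \<le> 1" if "i \<in> I" "x \<in> space M" for i x
    using member_le_sum[of i I "\<lambda>i. \<xi> i x"] that cn c1[OF that(2)] I by auto
  have pl: "\<psi> i x \<le> 1" if "i \<in> I" "x \<in> space N" for i x
    using member_le_sum[of i I "\<lambda>i. \<psi> i x"] that pn p1[OF that(2)] I by auto
  have ci: "integrable M (\<xi> i)" if "i \<in> I" for i
    using that cn cl by (intro M.integrable_const_bound[where B=1] AE_I2 cm) (auto simp: abs_le_iff intro: order_trans[of _ 0])
  have pi: "integrable N (\<psi> i)" if "i \<in> I" for i
    using that pn pl by (intro N.integrable_const_bound[where B=1] AE_I2 pm) (auto simp: abs_le_iff intro: order_trans[of _ 0])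
  define a where "a i = (\<integral>x. \<xi> i x \<partial>M)" for i
  define b where "b i = (\<integral>y. \<psi> i y \<partial>N)" for i
  define c where "c i = min (a i) (b i)" for i
  define s where "s = 1 - (\<Sum>i\<in>I. c i)"
  \<comment> \<open>The common mass \<open>c\<close> stays on the diagonal. The excesses
    \<open>a i - c i\<close> and the deficits \<open>b j - c j\<close> have the same total
    \<open>s\<close> and are coupled independently; if \<open>s = 0\<close> they all vanish, so the
    division by 0 gives the right value.\<close>
  define q where "q i j = (if i = j then c i else 0) + (a i - c i) * (b j - c j) / s" for i j
  have a0: "0 \<le> a i" if "i \<in> I" for i unfolding a_def using cn that by (intro integral_nonneg_AE AE_I2) auto
  have b0: "0 \<le> b i" if "i \<in> I" for i unfolding b_def using pn that by (intro integral_nonneg_AE AE_I2) auto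
  have "(\<Sum>i\<in>I. a i) = (\<integral>x. (\<Sum>i\<in>I. \<xi> i x) \<partial>M)" unfolding a_def by (intro Bochner_Integration.integral_sum[symmetric] ci)
  also have "\<dots> = (\<integral>x. 1 \<partial>M)" by (intro Bochner_Integration.integral_cong) (auto simp: c1)
  finally have a1: "(\<Sum>i\<in>I. a i) = 1" by (simp add: M.prob_space)
  have "(\<Sum>i\<in>I. b i) = (\<integral>x. (\<Sum>i\<in>I. \<psi> i x) \<partial>N)" unfolding b_def by (intro Bochner_Integration.integral_sum[symmetric] pi)
  also have "\<dots> = (\<integral>x. 1 \<partial>N)" by (intro Bochner_Integration.integral_cong) (auto simp: p1)
  finally have b1: "(\<Sum>i\<in>I. b i) = 1" by (simp add: N.prob_space)
  have c0: "0 \<le> c i" "c i \<le> a i" "c i \<le> b i" if "i \<in> I" for i using a0 b0 that by (auto simp: c_def)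
  have sa: "(\<Sum>i\<in>I. a i - c i) = s" and sb: "(\<Sum>i\<in>I. b i - c i) = s"
    by (simp_all add: sum_subtractf a1 b1 s_def)
  have s0: "0 \<le> s" unfolding sa[symmetric] using c0 by (intro sum_nonneg) auto
  have q0: "0 \<le> q i j" if "i \<in> I" "j \<in> I" for i j
    using c0 that s0 by (auto simp: q_def intro!: add_nonneg_nonneg divide_nonneg_nonneg mult_nonneg_nonneg)
  have z: "a i = c i" "b i = c i" if "s = 0" "i \<in> I" for i
    using sum_nonneg_eq_0_iff[of I "\<lambda>i. a i - c i"] sum_nonneg_eq_0_iff[of I "\<lambda>i. b i - c i"] sa sb that c0 I by auto
  have row: "(\<Sum>j\<in>I. q i j) = a i" if "i \<in> I" for i
  proof -
    have "(\<Sum>j\<in>I. q i j) = c i + (\<Sum>j\<in>I. (a i - c i) * (b j - c j) / s)"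
      using that I by (simp add: q_def sum.distrib)
    also have "(\<Sum>j\<in>I. (a i - c i) * (b j - c j) / s) = (a i - c i) * s / s"
      unfolding sb[symmetric] sum_distrib_left sum_divide_distrib ..
    finally show ?thesis using z(1)[OF _ that] by (cases "s = 0") auto
  qed
  have col: "(\<Sum>i\<in>I. q i j) = b j" if "j \<in> I" for j
  proof -
    have "(\<Sum>i\<in>I. q i j) = c j + (\<Sum>i\<in>I. (a i - c i) * (b j - c j) / s)"
      using that I by (simp add: q_def sum.distrib)
    also have "(\<Sum>i\<in>I. (a i - c i) * (b j - c j) / s) = s * (b j - c j) / s"
      unfolding sa[symmetric] sum_distrib_right sum_divide_distrib ..
    finally show ?thesis using z(2)[OF _ that] by (cases "s = 0") auto
  qed
  have qa: "q i j = 0" if "i \<in> I" "j \<in> I" "a i = 0" for i j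
    using c0[OF that(1)] that by (auto simp: q_def)
  have qb: "q i j = 0" if "i \<in> I" "j \<in> I" "b j = 0" for i j
    using c0[OF that(2)] that by (auto simp: q_def)
  define w where "w x y = (\<Sum>i\<in>I. \<Sum>j\<in>I. q i j * (\<xi> i x / a i) * (\<psi> j y / b j))" for x y
  have "0 \<le> w x y" if "x \<in> space M" "y \<in> space N" for x y
    unfolding w_def using that q0 a0 b0 cn pn
    by (intro sum_nonneg mult_nonneg_nonneg divide_nonneg_nonneg) auto
  have [measurable]: "(\<lambda>z. w (fst z) (snd z)) \<in> borel_measurable (M \<Otimes>\<^sub>M N)"
    unfolding w_def by (intro borel_measurable_sum borel_measurable_times borel_measurable_divide) auto
  have wy: "(\<integral>\<^sup>+ y. ennreal (w x y) \<partial>N) = ennreal (\<Sum>i\<in>I. (\<xi> i x / a i) * a i)" if x: "x \<in> space M" for x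
  proof -
    have "(\<integral>\<^sup>+ y. ennreal (w x y) \<partial>N) = (\<integral>\<^sup>+ y. ennreal (\<Sum>j\<in>I. (\<Sum>i\<in>I. q i j * (\<xi> i x / a i) / b j) * \<psi> j y) \<partial>N)"
      unfolding w_def by (subst sum.swap) (simp add: sum_distrib_right)
    also have "\<dots> = ennreal (\<Sum>j\<in>I. (\<Sum>i\<in>I. q i j * (\<xi> i x / a i) / b j) * b j)"
      unfolding b_def using x
      by (intro soft_coupling_marginal N I pm pn pl sum_nonneg divide_nonneg_nonneg mult_nonneg_nonneg)
         (auto simp: q0 a0 b0[unfolded b_def] cn)
    also have "(\<Sum>j\<in>I. (\<Sum>i\<in>I. q i j * (\<xi> i x / a i) / b j) * b j) = (\<Sum>j\<in>I. \<Sum>i\<in>I. (\<xi> i x / a i) * q i j)"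
      using qb by (auto simp: sum_distrib_right intro!: sum.cong)
    also have "\<dots> = (\<Sum>i\<in>I. \<Sum>j\<in>I. (\<xi> i x / a i) * q i j)" by (rule sum.swap)
    also have "\<dots> = (\<Sum>i\<in>I. (\<xi> i x / a i) * a i)"
      by (intro sum.cong refl) (simp only: sum_distrib_left[symmetric] row)
    finally show ?thesis .
  qed
  have wx: "(\<integral>\<^sup>+ x. ennreal (w x y) \<partial>M) = ennreal (\<Sum>j\<in>I. (\<psi> j y / b j) * b j)" if y: "y \<in> space N" for y
  proof -
    have "(\<integral>\<^sup>+ x. ennreal (w x y) \<partial>M) = (\<integral>\<^sup>+ x. ennreal (\<Sum>i\<in>I. (\<Sum>j\<in>I. q i j * (\<psi> j y / b j) / a i) * \<xi> i x) \<partial>M)"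
      unfolding w_def sum_distrib_right
      by (intro nn_integral_cong arg_cong[where f=ennreal] sum.cong refl) (simp add: mult_ac)
    also have "\<dots> = ennreal (\<Sum>i\<in>I. (\<Sum>j\<in>I. q i j * (\<psi> j y / b j) / a i) * a i)"
      unfolding a_def using y
      by (intro soft_coupling_marginal M I cm cn cl sum_nonneg divide_nonneg_nonneg mult_nonneg_nonneg)
         (auto simp: q0 b0 a0[unfolded a_def] pn)
    also have "(\<Sum>i\<in>I. (\<Sum>j\<in>I. q i j * (\<psi> j y / b j) / a i) * a i) = (\<Sum>i\<in>I. \<Sum>j\<in>I. (\<psi> j y / b j) * q i j)"
      using qa by (auto simp: sum_distrib_right intro!: sum.cong)
    also have "\<dots> = (\<Sum>j\<in>I. \<Sum>i\<in>I. (\<psi> j y / b j) * q i j)" by (rule sum.swap)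
    also have "\<dots> = (\<Sum>j\<in>I. (\<psi> j y / b j) * b j)"
      by (intro sum.cong refl) (simp only: sum_distrib_left[symmetric] col)
    finally show ?thesis .
  qed
  \<comment> \<open>A cell with integral 0 vanishes almost everywhere, so cancelling
    \<open>a i\<close> against the division by \<open>a i\<close> costs only a null set.\<close>
  have ax: "AE x in M. (\<Sum>i\<in>I. (\<xi> i x / a i) * a i) = 1"
  proof -
    have "AE x in M. \<forall>i\<in>I. a i = 0 \<longrightarrow> \<xi> i x = 0"
    proof (rule AE_finite_allI[OF I])
      fix i assume i: "i \<in> I"
      show "AE x in M. a i = 0 \<longrightarrow> \<xi> i x = 0"
        using integral_nonneg_eq_0_iff_AE[OF ci[OF i]] cn[OF i] by (auto simp: a_def)
    qed
    with AE_space show ?thesis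
    proof eventually_elim
      fix x assume x: "x \<in> space M" and *: "\<forall>i\<in>I. a i = 0 \<longrightarrow> \<xi> i x = 0"
      have "(\<Sum>i\<in>I. (\<xi> i x / a i) * a i) = (\<Sum>i\<in>I. \<xi> i x)" using * by (intro sum.cong) auto
      then show "(\<Sum>i\<in>I. (\<xi> i x / a i) * a i) = 1" using c1[OF x] by simp
    qed
  qed
  have ay: "AE y in N. (\<Sum>j\<in>I. (\<psi> j y / b j) * b j) = 1"
  proof -
    have "AE x in N. \<forall>i\<in>I. b i = 0 \<longrightarrow> \<psi> i x = 0"
    proof (rule AE_finite_allI[OF I])
      fix i assume i: "i \<in> I"
      show "AE x in N. b i = 0 \<longrightarrow> \<psi> i x = 0"
        using integral_nonneg_eq_0_iff_AE[OF pi[OF i]] pn[OF i] by (auto simp: b_def)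
    qed
    with AE_space show ?thesis
    proof eventually_elim
      fix x assume x: "x \<in> space N" and *: "\<forall>i\<in>I. b i = 0 \<longrightarrow> \<psi> i x = 0"
      have "(\<Sum>i\<in>I. (\<psi> i x / b i) * b i) = (\<Sum>i\<in>I. \<psi> i x)" using * by (intro sum.cong) auto
      then show "(\<Sum>i\<in>I. (\<psi> i x / b i) * b i) = 1" using p1[OF x] by simp
    qed
  qed
  define K where "K = density (M \<Otimes>\<^sub>M N) (\<lambda>z. ennreal (w (fst z) (snd z)))"
  have sK: "sets K = sets (M \<Otimes>\<^sub>M N)" by (simp add: K_def)
  have spK: "space K = space M \<times> space N" by (simp add: K_def space_pair_measure)
  have fK: "fst \<in> K \<rightarrow>\<^sub>M M" "snd \<in> K \<rightarrow>\<^sub>M N" by (simp_all add: K_def)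
  have eK: "emeasure K E = (\<integral>\<^sup>+ z. ennreal (w (fst z) (snd z)) * indicator E z \<partial>(M \<Otimes>\<^sub>M N))"
    if "E \<in> sets (M \<Otimes>\<^sub>M N)" for E
    unfolding K_def by (rule emeasure_density) (use that in auto)
  have d1: "distr K M fst = M"
  proof (rule measure_eqI)
    fix A assume "A \<in> sets (distr K M fst)"
    then have A [measurable]: "A \<in> sets M" by simp
    have "fst -` A \<inter> space K = A \<times> space N" using sets.sets_into_space[OF A] by (auto simp: spK)
    then have "emeasure (distr K M fst) A = emeasure K (A \<times> space N)" by (simp add: emeasure_distr[OF fK(1) A])
    also have "\<dots> = (\<integral>\<^sup>+ z. ennreal (w (fst z) (snd z)) * indicator (A \<times> space N) z \<partial>(M \<Otimes>\<^sub>M N))"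
      by (rule eK) simp
    also have "\<dots> = (\<integral>\<^sup>+ x. \<integral>\<^sup>+ y. ennreal (w x y) * indicator (A \<times> space N) (x, y) \<partial>N \<partial>M)"
      by (subst N.nn_integral_fst[symmetric]) auto
    also have "\<dots> = (\<integral>\<^sup>+ x. ennreal (\<Sum>i\<in>I. (\<xi> i x / a i) * a i) * indicator A x \<partial>M)"
    proof (intro nn_integral_cong)
      fix x assume x: "x \<in> space M"
      have "(\<integral>\<^sup>+ y. ennreal (w x y) * indicator (A \<times> space N) (x, y) \<partial>N) = (\<integral>\<^sup>+ y. ennreal (w x y) * indicator A x \<partial>N)"
        by (intro nn_integral_cong) (auto simp: indicator_def)
      also have "\<dots> = (\<integral>\<^sup>+ y. ennreal (w x y) \<partial>N) * indicator A x"
        by (auto simp: indicator_def)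
      finally show "(\<integral>\<^sup>+ y. ennreal (w x y) * indicator (A \<times> space N) (x, y) \<partial>N)
        = ennreal (\<Sum>i\<in>I. (\<xi> i x / a i) * a i) * indicator A x" using wy[OF x] by simp
    qed
    also have "\<dots> = (\<integral>\<^sup>+ x. indicator A x \<partial>M)"
      by (rule nn_integral_cong_AE) (use ax in eventually_elim, simp)
    also have "\<dots> = emeasure M A" by simp
    finally show "emeasure (distr K M fst) A = emeasure M A" .
  qed simp
  have d2: "distr K N snd = N"
  proof (rule measure_eqI)
    fix A assume "A \<in> sets (distr K N snd)"
    then have A [measurable]: "A \<in> sets N" by simp
    have "snd -` A \<inter> space K = space M \<times> A" using sets.sets_into_space[OF A] by (auto simp: spK)
    then have "emeasure (distr K N snd) A = emeasure K (space M \<times> A)" by (simp add: emeasure_distr[OF fK(2) A])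
    also have "\<dots> = (\<integral>\<^sup>+ z. ennreal (w (fst z) (snd z)) * indicator (space M \<times> A) z \<partial>(M \<Otimes>\<^sub>M N))"
      by (rule eK) simp
    also have "\<dots> = (\<integral>\<^sup>+ y. \<integral>\<^sup>+ x. ennreal (w x y) * indicator (space M \<times> A) (x, y) \<partial>M \<partial>N)"
      by (subst P.nn_integral_snd[symmetric]) auto
    also have "\<dots> = (\<integral>\<^sup>+ y. ennreal (\<Sum>j\<in>I. (\<psi> j y / b j) * b j) * indicator A y \<partial>N)"
    proof (intro nn_integral_cong)
      fix y assume y: "y \<in> space N"
      have "(\<integral>\<^sup>+ x. ennreal (w x y) * indicator (space M \<times> A) (x, y) \<partial>M) = (\<integral>\<^sup>+ x. ennreal (w x y) * indicator A y \<partial>M)"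
        by (intro nn_integral_cong) (auto simp: indicator_def)
      also have "\<dots> = (\<integral>\<^sup>+ x. ennreal (w x y) \<partial>M) * indicator A y"
        by (auto simp: indicator_def)
      finally show "(\<integral>\<^sup>+ x. ennreal (w x y) * indicator (space M \<times> A) (x, y) \<partial>M)
        = ennreal (\<Sum>j\<in>I. (\<psi> j y / b j) * b j) * indicator A y" using wx[OF y] by simp
    qed
    also have "\<dots> = (\<integral>\<^sup>+ x. indicator A x \<partial>N)"
      by (rule nn_integral_cong_AE) (use ay in eventually_elim, simp)
    also have "\<dots> = emeasure N A" by simp
    finally show "emeasure (distr K N snd) A = emeasure N A" .
  qed simp
  have pK: "prob_space K"
  proof
    have "fst -` space M \<inter> space K = space K" using spK by auto
    then show "emeasure K (space K) = 1"
      using emeasure_distr[OF fK(1) sets.top] M.emeasure_space_1 by (simp add: d1)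
  qed
  have "(\<Sum>i\<in>J. c i) \<le> measure K E"
    if E [measurable]: "E \<in> sets (M \<Otimes>\<^sub>M N)"
      and *: "\<And>x y i. i \<in> J \<Longrightarrow> x \<in> space M \<Longrightarrow> y \<in> space N \<Longrightarrow> 0 < \<xi> i x \<Longrightarrow> 0 < \<psi> i y \<Longrightarrow> (x, y) \<in> E" for E
  proof -
    \<comment> \<open>The part of the density that comes from the diagonal entries over
      \<open>J\<close>. Off \<open>E\<close> no cell in \<open>J\<close> is positive at both points,
      so \<open>v\<close> vanishes there, while its total integral is the sum of the
      \<open>c i\<close>.\<close>
    define v where "v x y = (\<Sum>i\<in>J. (c i / a i / b i * \<xi> i x) * \<psi> i y)" for x y
    have fJ: "finite J" using J I finite_subset by auto
    have v_le: "v x y \<le> w x y * indicator E (x, y)" if xy: "x \<in> space M" "y \<in> space N" for x y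
    proof (cases "(x, y) \<in> E")
      case True
      have "v x y \<le> (\<Sum>i\<in>I. (c i / a i / b i * \<xi> i x) * \<psi> i y)"
        unfolding v_def using J I c0 a0 b0 cn pn xy
        by (intro sum_mono2) (auto intro!: mult_nonneg_nonneg divide_nonneg_nonneg)
      also have "\<dots> \<le> w x y"
        unfolding w_def
      proof (rule sum_mono)
        fix i assume i: "i \<in> I"
        have "(c i / a i / b i * \<xi> i x) * \<psi> i y = c i * (\<xi> i x / a i) * (\<psi> i y / b i)" by (simp add: field_simps)
        also have "\<dots> \<le> q i i * (\<xi> i x / a i) * (\<psi> i y / b i)"
          using i c0 a0 b0 cn pn xy s0
          by (intro mult_right_mono) (auto simp: q_def)
        also have "\<dots> \<le> (\<Sum>j\<in>I. q i j * (\<xi> i x / a i) * (\<psi> j y / b j))"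
          using i q0 a0 b0 cn pn xy I
          by (intro member_le_sum[of i I "\<lambda>j. q i j * (\<xi> i x / a i) * (\<psi> j y / b j)"])
             (auto intro!: mult_nonneg_nonneg divide_nonneg_nonneg)
        finally show "(c i / a i / b i * \<xi> i x) * \<psi> i y \<le> (\<Sum>j\<in>I. q i j * (\<xi> i x / a i) * (\<psi> j y / b j))" .
      qed
      finally show ?thesis using True by simp
    next
      case False
      have zero: "c i / a i / b i * \<xi> i x * \<psi> i y = 0" if i: "i \<in> J" for i
      proof -
        have "i \<in> I" using J i by auto
        have "\<xi> i x = 0 \<or> \<psi> i y = 0"
          using *[OF i xy] False cn[OF \<open>i \<in> I\<close> xy(1)] pn[OF \<open>i \<in> I\<close> xy(2)] by force
        then show ?thesis by auto
      qed
      have "v x y = 0" unfolding v_def by (rule sum.neutral) (use zero in blast)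
      then show ?thesis using False by simp
    qed
    have [measurable]: "(\<lambda>z. v (fst z) (snd z)) \<in> borel_measurable (M \<Otimes>\<^sub>M N)"
      unfolding v_def using J by (intro borel_measurable_sum borel_measurable_times borel_measurable_divide) auto
    have "ennreal (\<Sum>i\<in>J. c i) = ennreal (\<Sum>i\<in>J. (c i / a i / b i * b i) * a i)"
    proof (intro arg_cong[where f=ennreal] sum.cong refl)
      fix i assume "i \<in> J"
      then have "i \<in> I" using J by auto
      then show "c i = (c i / a i / b i * b i) * a i"
        using c0[OF \<open>i \<in> I\<close>] by (cases "a i = 0"; cases "b i = 0") auto
    qed
    also have "\<dots> = (\<integral>\<^sup>+ x. ennreal (\<Sum>i\<in>J. (c i / a i / b i * b i) * \<xi> i x) \<partial>M)"
      unfolding a_def using J c0 a0 b0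
      by (intro soft_coupling_marginal[symmetric] M fJ cm cn cl mult_nonneg_nonneg divide_nonneg_nonneg)
         (auto simp: a_def)
    also have "\<dots> = (\<integral>\<^sup>+ x. \<integral>\<^sup>+ y. ennreal (v x y) \<partial>N \<partial>M)"
    proof (intro nn_integral_cong)
      fix x assume x: "x \<in> space M"
      have "(\<integral>\<^sup>+ y. ennreal (v x y) \<partial>N) = ennreal (\<Sum>i\<in>J. (c i / a i / b i * \<xi> i x) * b i)"
        unfolding v_def b_def using J c0 a0 b0 cn x
        by (intro soft_coupling_marginal N fJ pm pn pl mult_nonneg_nonneg divide_nonneg_nonneg)
           (auto simp: b_def)
      also have "(\<Sum>i\<in>J. (c i / a i / b i * \<xi> i x) * b i) = (\<Sum>i\<in>J. (c i / a i / b i * b i) * \<xi> i x)"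
        by (intro sum.cong refl) (simp only: mult_ac)
      finally show "ennreal (\<Sum>i\<in>J. (c i / a i / b i * b i) * \<xi> i x) = (\<integral>\<^sup>+ y. ennreal (v x y) \<partial>N)" ..
    qed
    also have "\<dots> = (\<integral>\<^sup>+ z. ennreal (v (fst z) (snd z)) \<partial>(M \<Otimes>\<^sub>M N))"
      by (subst N.nn_integral_fst[symmetric]) auto
    also have "\<dots> \<le> emeasure K E"
      unfolding eK[OF E]
    proof (intro nn_integral_mono)
      fix z assume z: "z \<in> space (M \<Otimes>\<^sub>M N)"
      then have "ennreal (v (fst z) (snd z)) \<le> ennreal (w (fst z) (snd z) * indicator E z)"
        using v_le[of "fst z" "snd z"] by (intro ennreal_leI) (auto simp: space_pair_measure)
      then show "ennreal (v (fst z) (snd z)) \<le> ennreal (w (fst z) (snd z)) * indicator E z"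
        by (auto simp: indicator_def split: if_splits)
    qed
    finally show ?thesis
      using pK by (simp add: finite_measure.emeasure_eq_measure prob_space.finite_measure)
  qed
  then show thesis using that[OF pK sK d1 d2] by (simp add: c_def a_def b_def)
qed

text \<open>A subpartition is completed by its remainder as cell number \<open>m\<close>. The
  remainder says nothing about where a point lies, so the bound sums over the first \<open>m\<close>
  cells only.\<close>

lemma soft_coupling:
  fixes M :: "'a measure" and N :: "'b measure" and \<xi> :: "nat \<Rightarrow> 'a \<Rightarrow> real" and \<psi> :: "nat \<Rightarrow> 'b \<Rightarrow> real"
  assumes M: "prob_space M" and N: "prob_space N"
    and cm: "\<And>i. \<xi> i \<in> borel_measurable M" and pm: "\<And>i. \<psi> i \<in> borel_measurable N"
    and cn: "\<And>i x. x \<in> space M \<Longrightarrow> 0 \<le> \<xi> i x" and pn: "\<And>i y. y \<in> space N \<Longrightarrow> 0 \<le> \<psi> i y"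
    and c1: "\<And>x. x \<in> space M \<Longrightarrow> (\<Sum>i<m. \<xi> i x) \<le> 1" and p1: "\<And>y. y \<in> space N \<Longrightarrow> (\<Sum>i<m. \<psi> i y) \<le> 1"
  obtains K where "prob_space K" "sets K = sets (M \<Otimes>\<^sub>M N)" "distr K M fst = M" "distr K N snd = N"
    "\<And>E. E \<in> sets (M \<Otimes>\<^sub>M N) \<Longrightarrow>
      (\<And>x y i. i < m \<Longrightarrow> x \<in> space M \<Longrightarrow> y \<in> space N \<Longrightarrow> 0 < \<xi> i x \<Longrightarrow> 0 < \<psi> i y \<Longrightarrow> (x, y) \<in> E) \<Longrightarrow>
      (\<Sum>i<m. min (\<integral>x. \<xi> i x \<partial>M) (\<integral>y. \<psi> i y \<partial>N)) \<le> measure K E"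
proof -
  define \<xi>' where "\<xi>' i = (if i < m then \<xi> i else (\<lambda>x. 1 - (\<Sum>i<m. \<xi> i x)))" for i
  define \<psi>' where "\<psi>' i = (if i < m then \<psi> i else (\<lambda>x. 1 - (\<Sum>i<m. \<psi> i x)))" for i
  have s: "(\<Sum>i<Suc m. \<xi>' i x) = 1" "(\<Sum>i<Suc m. \<psi>' i y) = 1" for x y
    by (simp_all add: \<xi>'_def \<psi>'_def)
  have m': "\<xi>' i \<in> borel_measurable M" "\<psi>' i \<in> borel_measurable N" for i
    by (cases "i < m"; simp add: \<xi>'_def \<psi>'_def cm pm borel_measurable_diff borel_measurable_sum)+
  obtain K where K: "prob_space K" "sets K = sets (M \<Otimes>\<^sub>M N)" "distr K M fst = M" "distr K N snd = N"
    "\<And>E. E \<in> sets (M \<Otimes>\<^sub>M N) \<Longrightarrow>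
      (\<And>x y i. i \<in> {..<m} \<Longrightarrow> x \<in> space M \<Longrightarrow> y \<in> space N \<Longrightarrow> 0 < \<xi>' i x \<Longrightarrow> 0 < \<psi>' i y \<Longrightarrow> (x, y) \<in> E) \<Longrightarrow>
      (\<Sum>i\<in>{..<m}. min (\<integral>x. \<xi>' i x \<partial>M) (\<integral>y. \<psi>' i y \<partial>N)) \<le> measure K E"
  proof (rule soft_coupling_partition[OF M N, of "{..<Suc m}" "{..<m}" \<xi>' \<psi>'])
    show "0 \<le> \<xi>' i x" if "x \<in> space M" for i x using that cn c1 by (simp add: \<xi>'_def)
    show "0 \<le> \<psi>' i x" if "x \<in> space N" for i x using that pn p1 by (simp add: \<psi>'_def)
  qed (use m' s in auto)
  show thesis by (rule that[OF K(1-4)]) (use K(5) in \<open>auto simp: \<xi>'_def \<psi>'_def\<close>)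
qed

text \<open>Tents of radius \<open>e\<close> about the points \<open>c i\<close>, normalised by
  their sum. Cutting the denominator off at 1/2 keeps the cells continuous everywhere; the price is
  that they add up to 1 only where some tent is high.\<close>

definition soft_cell :: "('b \<Rightarrow> 'b \<Rightarrow> real) \<Rightarrow> real \<Rightarrow> (nat \<Rightarrow> 'b) \<Rightarrow> nat \<Rightarrow> nat \<Rightarrow> 'b \<Rightarrow> real" where
  "soft_cell D e c m i y = max 0 (1 - D (c i) y / e) / max (1/2) (\<Sum>j<m. max 0 (1 - D (c j) y / e))"

lemma soft_cell_nonneg: "0 \<le> soft_cell D e c m i y"
  unfolding soft_cell_def by (intro divide_nonneg_nonneg) auto

lemma soft_cell_pos: "0 < soft_cell D e c m i y \<Longrightarrow> 0 < e \<Longrightarrow> D (c i) y < e"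
  by (auto simp: soft_cell_def max_def field_simps split: if_splits)

lemma soft_cell_sum: "(\<Sum>i<m. soft_cell D e c m i y) =
    (\<Sum>j<m. max 0 (1 - D (c j) y / e)) / max (1/2) (\<Sum>j<m. max 0 (1 - D (c j) y / e))"
  by (simp add: soft_cell_def sum_divide_distrib)

lemma soft_cell_sum_le: "(\<Sum>i<m. soft_cell D e c m i y) \<le> 1"
  unfolding soft_cell_sum by (auto simp: divide_le_eq_1 max_def)

text \<open>Within \<open>e / 2\<close> of a centre the tent there has height at least 1/2, so the
  cut-off of the denominator is inactive.\<close>

lemma soft_cell_sum_eq:
  assumes "i < m" "D (c i) y < e / 2" "0 < e"
  shows "(\<Sum>i<m. soft_cell D e c m i y) = 1"
proof -
  have "1/2 \<le> max 0 (1 - D (c i) y / e)" using assms by (auto simp: field_simps max_def)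
  also have "\<dots> \<le> (\<Sum>j<m. max 0 (1 - D (c j) y / e))"
    using assms by (intro member_le_sum[of i "{..<m}" "\<lambda>j. max 0 (1 - D (c j) y / e)"]) auto
  finally show ?thesis unfolding soft_cell_sum by (simp add: max_def)
qed

lemma soft_cell_measurable:
  assumes [measurable]: "\<And>j. D (c j) \<in> borel_measurable N"
  shows "soft_cell D e c m i \<in> borel_measurable N"
  unfolding soft_cell_def[abs_def] by measurable

text \<open>The cells add up to 1 on the union of the balls of radius \<open>e / 2\<close> about the
  first \<open>m\<close> centres. These unions increase to the whole space, so continuity from below
  yields a finite \<open>m\<close>.\<close>

lemma soft_cells_exhaust:
  fixes N :: "'b measure"
  assumes N: "prob_space N" and D: "\<And>j. D (c j) \<in> borel_measurable N"
    and c: "\<And>y e. y \<in> space N \<Longrightarrow> 0 < e \<Longrightarrow> \<exists>j. D (c j) y < (e::real)" and e: "0 < e" and d: "0 < d"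
  obtains m where "1 - d \<le> (\<Sum>i<m. \<integral>y. soft_cell D e c m i y \<partial>N)"
proof -
  interpret prob_space N by (rule N)
  note [measurable] = D
  define U where "U m = {y \<in> space N. \<exists>i<m. D (c i) y < e / 2}" for m
  have [measurable]: "U m \<in> sets N" for m unfolding U_def by measurable
  have "(\<lambda>m. prob (U m)) \<longlonglongrightarrow> prob (\<Union>m. U m)"
    by (rule finite_Lim_measure_incseq) (auto simp: U_def incseq_def intro: order_less_le_trans)
  moreover have "(\<Union>m. U m) = space N"
    using c[of _ "e/2"] e by (auto simp: U_def)
  ultimately have "(\<lambda>m. prob (U m)) \<longlonglongrightarrow> 1" by (simp add: prob_space)
  then have "eventually (\<lambda>m. 1 - d < prob (U m)) sequentially"
    by (rule order_tendstoD) (use d in simp)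
  then obtain m where m: "1 - d < prob (U m)" using eventually_happens trivial_limit_sequentially by blast
  have sm: "soft_cell D e c m i \<in> borel_measurable N" for i by (rule soft_cell_measurable) (rule D)
  have si: "integrable N (soft_cell D e c m i)" if "i < m" for i
  proof (rule integrable_const_bound[where B=1])
    have "soft_cell D e c m i y \<le> 1" for y
      using member_le_sum[of i "{..<m}" "\<lambda>i. soft_cell D e c m i y"] that soft_cell_nonneg[of D e c m _ y]
        soft_cell_sum_le[of D e c m y] by (auto intro: order_trans)
    then show "AE y in N. norm (soft_cell D e c m i y) \<le> 1" using soft_cell_nonneg[of D e c m i] by simp
  qed (rule sm)
  have "prob (U m) = (\<integral>y. indicator (U m) y \<partial>N)" by simp
  also have "\<dots> \<le> (\<integral>y. (\<Sum>i<m. soft_cell D e c m i y) \<partial>N)"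
  proof (intro integral_mono Bochner_Integration.integrable_sum si)
    show "indicator (U m) y \<le> (\<Sum>i<m. soft_cell D e c m i y)" for y
    proof (cases "y \<in> U m")
      case True
      then obtain i where "i < m" "D (c i) y < e / 2" by (auto simp: U_def)
      then show ?thesis using soft_cell_sum_eq[of i m D c y e] e by (simp add: indicator_def)
    qed (simp add: sum_nonneg soft_cell_nonneg)
  qed (auto simp: integrable_indicator_iff emeasure_eq_measure)
  also have "\<dots> = (\<Sum>i<m. \<integral>y. soft_cell D e c m i y \<partial>N)"
    by (rule Bochner_Integration.integral_sum) (use si in auto)
  finally show thesis using that[of m] m by linarith
qed

text \<open>The couplings \<open>p1\<close> and \<open>p2\<close> are themselves coupled, with the
  cells of \<open>Y\<close> evaluated at the second coordinate of \<open>p1\<close> and at the first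
  coordinate of \<open>p2\<close>. Both coordinates have law \<open>msr Y\<close>, so the integrals
  of each cell agree and, up to mass \<open>d\<close>, the two points of \<open>Y\<close> share a
  cell. They are then less than \<open>2 * d\<close> apart, which every observable of
  \<open>Y\<close> respects.\<close>

lemma box_le_triangle:
  assumes X: "gd_set X" and Y: "gd_set Y" and Z: "gd_set Z"
  shows "box_le Z X \<le> box_le Z Y + box_le Y X"
proof (rule field_le_epsilon)
  fix d' :: real assume "0 < d'"
  \<comment> \<open>Six parts: one \<open>d\<close> each in \<open>e1\<close> and \<open>e2\<close>,
    and \<open>4 * d\<close> because an observable of \<open>Y\<close> may change by
    \<open>2 * d\<close> between the two coordinates and the box distance doubles this.\<close>
  define d where "d = d' / 6"
  have d: "0 < d" using \<open>0 < d'\<close> by (simp add: d_def)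
  define e1 where "e1 = box_le Y X + d"
  define e2 where "e2 = box_le Z Y + d"
  have lt: "box_le Y X < e1" "box_le Z Y < e2" using d by (auto simp: e1_def e2_def)
  obtain p1 S1 where p1: "p1 \<in> couplings X Y" "closedin (gd_prod_top X Y) S1" "1 - e1 \<le> measure p1 S1" "0 < e1"
    "near (S1\<inverse>) (e1/2) (gd_closure Y) (gd_closure X)" by (rule box_leD[OF X Y lt(1)]) blast
  obtain p2 S2 where p2: "p2 \<in> couplings Y Z" "closedin (gd_prod_top Y Z) S2" "1 - e2 \<le> measure p2 S2" "0 < e2"
    "near (S2\<inverse>) (e2/2) (gd_closure Z) (gd_closure Y)" by (rule box_leD[OF Y Z lt(2)]) blast
  note c1 = couplingD[OF X Y p1(1)] and c2 = couplingD[OF Y Z p2(1)]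
  have S: "S1 \<in> sets p1" "S2 \<in> sets p2"
    by (rule closed_measurable[OF X Y p1(1,2)], rule closed_measurable[OF Y Z p2(1,2)])
  obtain c where c: "\<And>n::nat. c n \<in> pts Y" "\<And>y e. y \<in> pts Y \<Longrightarrow> 0 < e \<Longrightarrow> \<exists>n. gd_dist Y (c n) y < e"
    by (rule gd_dense[OF Y]) blast
  have Dm: "gd_dist Y (c j) \<in> borel_measurable (msr Y)" for j by (rule gd_dist_measurable[OF Y c(1)])
  obtain m where m: "1 - d \<le> (\<Sum>i<m. \<integral>y. soft_cell (gd_dist Y) d c m i y \<partial>msr Y)"
    by (rule soft_cells_exhaust[of "msr Y" "gd_dist Y" c d d]) (use gd_prob[OF Y] Dm c d Y in auto)
  define \<psi> where "\<psi> = soft_cell (gd_dist Y) d c m"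
  have \<psi>m [measurable]: "\<psi> i \<in> borel_measurable (msr Y)" for i unfolding \<psi>_def by (rule soft_cell_measurable) (rule Dm)
  note [measurable] = c1(4,5) c2(4,5) S
  obtain K where K: "prob_space K" "sets K = sets (p1 \<Otimes>\<^sub>M p2)" "distr K p1 fst = p1" "distr K p2 snd = p2"
    "\<And>E. E \<in> sets (p1 \<Otimes>\<^sub>M p2) \<Longrightarrow>
      (\<And>x y i. i < m \<Longrightarrow> x \<in> space p1 \<Longrightarrow> y \<in> space p2 \<Longrightarrow> 0 < \<psi> i (snd x) \<Longrightarrow> 0 < \<psi> i (fst y) \<Longrightarrow> (x, y) \<in> E) \<Longrightarrow>
      (\<Sum>i<m. min (\<integral>x. \<psi> i (snd x) \<partial>p1) (\<integral>y. \<psi> i (fst y) \<partial>p2)) \<le> measure K E"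
    by (rule soft_coupling[OF c1(1) c2(1), of "\<lambda>i x. \<psi> i (snd x)" "\<lambda>i y. \<psi> i (fst y)" m])
       (auto simp: \<psi>_def soft_cell_nonneg soft_cell_sum_le intro!: measurable_compose[OF c1(5)] measurable_compose[OF c2(4)] \<psi>m[unfolded \<psi>_def])
  interpret K: prob_space K by (rule K(1))
  have spK: "space K = space p1 \<times> space p2" using sets_eq_imp_space_eq[OF K(2)] by (simp add: space_pair_measure)
  have fK: "fst \<in> K \<rightarrow>\<^sub>M p1" "snd \<in> K \<rightarrow>\<^sub>M p2" unfolding measurable_cong_sets[OF K(2) refl] by simp_all
  define E0 where "E0 = {z \<in> space K. \<exists>i\<in>{..<m}. 0 < \<psi> i (snd (fst z)) \<and> 0 < \<psi> i (fst (snd z))}"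
  define E1 where "E1 = fst -` S1 \<inter> space K"
  define E2 where "E2 = snd -` S2 \<inter> space K"
  have [measurable]: "(\<lambda>z. \<psi> i (snd (fst z))) \<in> borel_measurable K" "(\<lambda>z. \<psi> i (fst (snd z))) \<in> borel_measurable K" for i
    by (rule measurable_compose[OF measurable_compose[OF fK(1) c1(5)] \<psi>m],
        rule measurable_compose[OF measurable_compose[OF fK(2) c2(4)] \<psi>m])
  have E: "E0 \<in> sets K" "E1 \<in> sets K" "E2 \<in> sets K"
    unfolding E0_def E1_def E2_def using measurable_sets[OF fK(1) S(1)] measurable_sets[OF fK(2) S(2)] by measurable
  have "(\<integral>x. \<psi> i (snd x) \<partial>p1) = (\<integral>y. \<psi> i y \<partial>msr Y)" "(\<integral>y. \<psi> i (fst y) \<partial>p2) = (\<integral>y. \<psi> i y \<partial>msr Y)" for i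
    using integral_distr[OF c1(5) \<psi>m, of i] integral_distr[OF c2(4) \<psi>m, of i] c1(7) c2(6) by simp_all
  moreover have "(\<Sum>i<m. min (\<integral>x. \<psi> i (snd x) \<partial>p1) (\<integral>y. \<psi> i (fst y) \<partial>p2)) \<le> measure K E0"
    by (rule K(5)) (use E(1) K(2) in \<open>auto simp: E0_def spK\<close>)
  ultimately have "1 - d \<le> measure K E0" using m by (simp add: \<psi>_def)
  moreover have "measure K E1 = measure p1 S1"
    using measure_distr[OF fK(1) S(1)] K(3) by (simp add: E1_def)
  moreover have "measure K E2 = measure p2 S2"
    using measure_distr[OF fK(2) S(2)] K(4) by (simp add: E2_def)
  ultimately have mE: "1 - (e1 + e2 + 4 * d) \<le> measure K (E0 \<inter> (E1 \<inter> E2))"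
    using K.prob_Int_ge[of E0 "E1 \<inter> E2"] K.prob_Int_ge[of E1 E2] E p1(3) p2(3) d by auto
  interpret XZ: gd_pair X Z K "fst \<circ> fst" "snd \<circ> snd"
  proof (rule gd_pair.intro[OF X Z K(1)])
    show "fst \<circ> fst \<in> K \<rightarrow>\<^sub>M msr X" "snd \<circ> snd \<in> K \<rightarrow>\<^sub>M msr Z"
      using fK c1(4) c2(5) by (auto intro: measurable_comp)
    show "distr K (msr X) (fst \<circ> fst) = msr X"
      using distr_distr[OF c1(4) fK(1)] c1(6) K(3) by simp
    show "distr K (msr Z) (snd \<circ> snd) = msr Z"
      using distr_distr[OF c2(5) fK(2)] c2(7) K(4) by simp
  qed
  have "box_le Z X \<le> e1 + e2 + 4 * d"
  proof (rule XZ.box_le_pair[OF _ mE])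
    show "E0 \<inter> (E1 \<inter> E2) \<in> sets K" using E by auto
    show "0 \<le> e1 + e2 + 4 * d" using p1(4) p2(4) d by simp
    fix h assume "h \<in> obs Z"
    then have "h \<in> gd_closure Z" using obs_subset_closure[OF Z] by blast
    then obtain g where g: "g \<in> gd_closure Y" "\<And>y z. (y, z) \<in> S2 \<Longrightarrow> \<bar>h z - g y\<bar> \<le> e2/2"
      using p2(5) unfolding near_def by blast
    obtain f where f: "f \<in> gd_closure X" "\<And>x y. (x, y) \<in> S1 \<Longrightarrow> \<bar>g y - f x\<bar> \<le> e1/2"
      using p1(5) g(1) unfolding near_def by blast
    show "\<exists>f\<in>gd_closure X. \<forall>w\<in>E0 \<inter> (E1 \<inter> E2). \<bar>f ((fst \<circ> fst) w) - h ((snd \<circ> snd) w)\<bar> \<le> (e1 + e2 + 4 * d)/2"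
    proof (intro bexI[OF _ f(1)] ballI)
      fix w assume w: "w \<in> E0 \<inter> (E1 \<inter> E2)"
      obtain x y y' z where xyz: "w = ((x, y), (y', z))" by (metis prod.collapse)
      have p: "y \<in> pts Y" "y' \<in> pts Y" using w xyz c1(3) c2(3) by (auto simp: E0_def spK)
      obtain i where i: "0 < \<psi> i y" "0 < \<psi> i y'" using w xyz by (auto simp: E0_def)
      then have "gd_dist Y (c i) y < d" "gd_dist Y (c i) y' < d"
        using soft_cell_pos[OF _ d, of "gd_dist Y" c m i] unfolding \<psi>_def by auto
      then have "gd_dist Y y y' < 2 * d"
        using gd_dist_triangle[OF Y p(1) c(1) p(2), of i] gd_dist_commute[OF Y, of y "c i"] by linarith
      then have "\<bar>g y - g y'\<bar> < 2 * d" using closure_le_dist[OF Y g(1) p] by linarith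
      moreover have "\<bar>h z - g y'\<bar> \<le> e2/2" "\<bar>g y - f x\<bar> \<le> e1/2"
        using g(2) f(2) w xyz by (auto simp: E1_def E2_def)
      moreover have "(e1 + e2 + 4 * d)/2 = e1/2 + e2/2 + 2 * d" by simp
      moreover have "\<bar>f x - h z\<bar> \<le> \<bar>g y - f x\<bar> + \<bar>g y - g y'\<bar> + \<bar>h z - g y'\<bar>" by linarith
      ultimately have "\<bar>f x - h z\<bar> \<le> (e1 + e2 + 4 * d)/2" by linarith
      then show "\<bar>f ((fst \<circ> fst) w) - h ((snd \<circ> snd) w)\<bar> \<le> (e1 + e2 + 4 * d)/2"
        using xyz by simp
    qed
  qed
  then show "box_le Z X \<le> box_le Z Y + box_le Y X + d'" by (simp add: e1_def e2_def d_def)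
qed

section \<open>Vanishing one-sided box distance\<close>

lemma gd_open_ball:
  assumes "gd_set X" "openin (gd_top X) U" "x \<in> U"
  obtains r where "0 < r" "\<And>y. y \<in> pts X \<Longrightarrow> gd_dist X x y < r \<Longrightarrow> y \<in> U"
  using assms(2,3) unfolding gd_openin[OF assms(1)] by blast

lemma closure_tendsto_dense:
  assumes X: "gd_set X" and c: "\<And>n. c n \<in> pts X" "\<And>x e. x \<in> pts X \<Longrightarrow> 0 < e \<Longrightarrow> \<exists>n::nat. gd_dist X (c n) x < e"
    and fs: "\<And>n::nat. fs n \<in> gd_closure X" and f: "f \<in> gd_closure X"
    and conv: "\<And>j. (\<lambda>n. fs n (c j)) \<longlonglongrightarrow> f (c j)" and x: "x \<in> pts X"
  shows "(\<lambda>n. fs n x) \<longlonglongrightarrow> f x"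
proof (rule metric_LIMSEQ_I)
  fix e :: real assume e: "0 < e"
  obtain j where j: "gd_dist X (c j) x < e/3" using c(2)[OF x, of "e/3"] e by auto
  obtain N where N: "\<And>n. N \<le> n \<Longrightarrow> \<bar>fs n (c j) - f (c j)\<bar> < e/3"
    using metric_LIMSEQ_D[OF conv[of j], of "e/3"] e by (auto simp: dist_real_def)
  have "dist (fs n x) (f x) < e" if "N \<le> n" for n
    using N[OF that] closure_le_dist[OF X fs c(1) x, of n j] closure_le_dist[OF X f c(1) x, of j] j
    unfolding dist_real_def by linarith
  then show "\<exists>N. \<forall>n\<ge>N. dist (fs n x) (f x) < e" by blast
qed

text \<open>Restriction to a dense sequence maps the observables into
  \<open>nat \<Rightarrow> real\<close>, where every subset has a countable dense part. Lifting that
  part back gives the \<open>g i\<close>, since convergence on the dense sequence implies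
  convergence at every point.\<close>

lemma obs_dense_sequence:
  assumes Y: "gd_set Y"
  obtains g :: "nat \<Rightarrow> 'b \<Rightarrow> real" where "\<And>i. g i \<in> obs Y"
    "\<And>f. f \<in> obs Y \<Longrightarrow> \<exists>r. \<forall>y\<in>pts Y. (\<lambda>k. g (r k) y) \<longlonglongrightarrow> f y"
proof -
  obtain c where c: "\<And>n::nat. c n \<in> pts Y" "\<And>y e. y \<in> pts Y \<Longrightarrow> 0 < e \<Longrightarrow> \<exists>n. gd_dist Y (c n) y < e"
    by (rule gd_dense[OF Y]) blast
  define \<Phi> where "\<Phi> f = (\<lambda>j. f (c j))" for f :: "'b \<Rightarrow> real"
  obtain T where T: "countable T" "T \<subseteq> \<Phi> ` obs Y" "\<Phi> ` obs Y \<subseteq> closure T" by (rule separable)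
  obtain U where U: "countable U" "U \<subseteq> obs Y" "T = \<Phi> ` U"
    using T(1,2) by (meson countable_subset_image)
  have "T \<noteq> {}" using T(3) obs_nonempty[OF Y] by auto
  then have "U \<noteq> {}" using U(3) by auto
  define g where "g = from_nat_into U"
  have g: "g i \<in> obs Y" for i using from_nat_into[OF \<open>U \<noteq> {}\<close>] U(2) by (auto simp: g_def)
  have "\<exists>r. \<forall>y\<in>pts Y. (\<lambda>k. g (r k) y) \<longlonglongrightarrow> f y" if f: "f \<in> obs Y" for f
  proof -
    have "\<Phi> f \<in> closure T" using T(3) f by blast
    then obtain t where t: "\<And>k. t k \<in> T" "t \<longlonglongrightarrow> \<Phi> f" unfolding closure_sequential by blast
    have "\<exists>i. t k = \<Phi> (g i)" for k
      using t(1)[of k] U from_nat_into_surj[OF U(1)] unfolding g_def by (metis imageE)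
    then obtain r where r: "\<And>k. t k = \<Phi> (g (r k))" by metis
    have "(\<lambda>k. g (r k) (c j)) \<longlonglongrightarrow> f (c j)" for j
    proof -
      have "continuous_on UNIV (\<lambda>x::nat\<Rightarrow>real. x j)" by (rule continuous_on_product_coordinates)
      from continuous_on_tendsto_compose[OF this t(2)] show ?thesis by (simp add: r \<Phi>_def)
    qed
    then show ?thesis
      using closure_tendsto_dense[OF Y c, of "\<lambda>k. g (r k)" f] g f obs_subset_closure[OF Y] by blast
  qed
  then show thesis using that g by blast
qed

text \<open>Couplings concentrating near the graph of \<open>F n\<close> and \<open>G\<close> identify the law of the limit of \<open>F n\<close>
  with the law of \<open>G\<close>; no compactness of the couplings is needed.\<close>

lemma distr_eq_of_close_couplings:
  fixes F :: "'a \<Rightarrow> 'c::metric_space" and G :: "'b \<Rightarrow> 'c"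
  assumes \<mu>: "prob_space \<mu>" and \<nu>: "prob_space \<nu>"
    and F [measurable]: "F \<in> borel_measurable \<mu>" and G [measurable]: "G \<in> borel_measurable \<nu>"
    and Fn [measurable]: "\<And>n. Fn n \<in> borel_measurable \<mu>" and lim: "\<And>x. x \<in> space \<mu> \<Longrightarrow> (\<lambda>n. Fn n x) \<longlonglongrightarrow> F x"
    and p: "\<And>n. prob_space (p n)"
    and a: "\<And>n. a n \<in> p n \<rightarrow>\<^sub>M \<mu>" "\<And>n. distr (p n) \<mu> (a n) = \<mu>"
    and b: "\<And>n. b n \<in> p n \<rightarrow>\<^sub>M \<nu>" "\<And>n. distr (p n) \<nu> (b n) = \<nu>"
    and S: "\<And>n::nat. S n \<in> sets (p n)" "\<And>n. 1 - e n \<le> measure (p n) (S n)"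
      "\<And>n w. w \<in> S n \<Longrightarrow> dist (Fn n (a n w)) (G (b n w)) \<le> e n"
    and e: "e \<longlonglongrightarrow> 0"
  shows "distr \<mu> borel F = distr \<nu> borel G"
proof (rule measure_eqI_generator_eq[where E="Collect closed" and \<Omega>=UNIV and A="\<lambda>_. UNIV"])
  interpret \<mu>: prob_space \<mu> by (rule \<mu>)
  interpret \<nu>: prob_space \<nu> by (rule \<nu>)
  fix C :: "'c set" assume "C \<in> Collect closed"
  then have C: "closed C" by simp
  then have C' [measurable]: "C \<in> sets borel" by simp
  show "emeasure (distr \<mu> borel F) C = emeasure (distr \<nu> borel G) C"
  proof (cases "C = {}")
    \<comment> \<open>The distance \<open>infdist\<close> to the empty set is 0, so the functions
      \<open>\<phi>\<close> below would not approximate its indicator.\<close>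
    case False
    \<comment> \<open>Lipschitz functions that decrease to the indicator of the closed set
      \<open>C\<close>. The Lipschitz bound converts closeness of the maps on \<open>S n\<close>
      into closeness of the integrals.\<close>
    define \<phi> where "\<phi> k t = max 0 (1 - real k * infdist t C)" for k t
    have \<phi>m [measurable]: "\<phi> k \<in> borel_measurable borel" for k
      unfolding \<phi>_def by (intro borel_measurable_continuous_onI continuous_intros)
    have \<phi>1: "0 \<le> \<phi> k t" "\<phi> k t \<le> 1" for k t by (auto simp: \<phi>_def infdist_nonneg)
    have \<phi>L: "\<bar>\<phi> k s - \<phi> k t\<bar> \<le> real k * dist s t" for k s t
    proof -
      have "\<bar>\<phi> k s - \<phi> k t\<bar> \<le> \<bar>real k * infdist s C - real k * infdist t C\<bar>" unfolding \<phi>_def by linarith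
      also have "\<dots> = real k * \<bar>infdist s C - infdist t C\<bar>" by (simp add: abs_mult flip: right_diff_distrib)
      also have "\<dots> \<le> real k * dist s t" by (intro mult_left_mono infdist_triangle_abs) simp
      finally show ?thesis .
    qed
    have \<phi>lim: "(\<lambda>k. \<phi> k t) \<longlonglongrightarrow> indicator C t" for t
    proof (cases "t \<in> C")
      case True then show ?thesis using False by (simp add: \<phi>_def)
    next
      case nt: False
      have pos: "0 < infdist t C" using infdist_pos_not_in_closed[OF C False nt] .
      obtain k0 :: nat where k0: "1 / infdist t C < k0" using reals_Archimedean2 by blast
      have "eventually (\<lambda>k. \<phi> k t = 0) sequentially"
        using eventually_ge_at_top[of k0]
      proof eventually_elim
        case (elim k)
        then have "1 / infdist t C < real k" using k0 by linarith
        then have "1 < real k * infdist t C" using pos by (simp add: field_simps)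
        then show ?case by (simp add: \<phi>_def)
      qed
      then show ?thesis using nt by (simp add: tendsto_eventually)
    qed
    have eq: "(\<integral>x. \<phi> k (F x) \<partial>\<mu>) = (\<integral>y. \<phi> k (G y) \<partial>\<nu>)" for k
    proof -
      have cont: "isCont (\<phi> k) t" for t
      proof -
        have "continuous_on UNIV (\<phi> k)" unfolding \<phi>_def by (intro continuous_intros)
        then show ?thesis by (simp add: continuous_on_eq_continuous_at)
      qed
      have "(\<lambda>n. \<integral>x. \<phi> k (Fn n x) \<partial>\<mu>) \<longlonglongrightarrow> (\<integral>x. \<phi> k (F x) \<partial>\<mu>)"
        by (rule integral_dominated_convergence[where w="\<lambda>_. 1"])
           (auto simp: \<phi>1 abs_le_iff intro!: AE_I2 isCont_tendsto_compose[OF cont lim] order_trans[OF _ \<phi>1(2)])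
      moreover have "(\<lambda>n. \<integral>x. \<phi> k (Fn n x) \<partial>\<mu>) \<longlonglongrightarrow> (\<integral>y. \<phi> k (G y) \<partial>\<nu>)"
      proof (rule LIM_zero_cancel, rule Lim_null_comparison)
        show "(\<lambda>n. real k * \<bar>e n\<bar> + e n) \<longlonglongrightarrow> 0"
          using e by (auto intro!: tendsto_eq_intros)
        show "\<forall>\<^sub>F n in sequentially. norm ((\<integral>x. \<phi> k (Fn n x) \<partial>\<mu>) - (\<integral>y. \<phi> k (G y) \<partial>\<nu>)) \<le> real k * \<bar>e n\<bar> + e n"
        proof (intro always_eventually allI)
          fix n
          interpret p: prob_space "p n" by (rule p)
          note [measurable] = a(1)[of n] b(1)[of n] S(1)[of n]
          have i: "integrable (p n) (\<lambda>w. \<phi> k (Fn n (a n w)))" "integrable (p n) (\<lambda>w. \<phi> k (G (b n w)))"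
            by (rule p.integrable_const_bound[where B=1]; simp add: \<phi>1)+
          have "(\<integral>x. \<phi> k (Fn n x) \<partial>\<mu>) - (\<integral>y. \<phi> k (G y) \<partial>\<nu>)
            = (\<integral>w. \<phi> k (Fn n (a n w)) \<partial>p n) - (\<integral>w. \<phi> k (G (b n w)) \<partial>p n)"
            using integral_distr[OF a(1)[of n], of "\<lambda>x. \<phi> k (Fn n x)"] integral_distr[OF b(1)[of n], of "\<lambda>x. \<phi> k (G x)"]
            by (simp add: a(2) b(2))
          also have "\<dots> = (\<integral>w. \<phi> k (Fn n (a n w)) - \<phi> k (G (b n w)) \<partial>p n)"
            using i by simp
          also have "norm \<dots> \<le> (\<integral>w. norm (\<phi> k (Fn n (a n w)) - \<phi> k (G (b n w))) \<partial>p n)"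
            by (rule integral_norm_bound)
          also have "\<dots> \<le> (\<integral>w. real k * \<bar>e n\<bar> + indicator (space (p n) - S n) w \<partial>p n)"
          proof (rule integral_mono)
            show "integrable (p n) (\<lambda>w. norm (\<phi> k (Fn n (a n w)) - \<phi> k (G (b n w))))" using i by simp
            show "integrable (p n) (\<lambda>w. real k * \<bar>e n\<bar> + indicat_real (space (p n) - S n) w)"
              by (intro Bochner_Integration.integrable_add p.integrable_const integrable_real_indicator)
                 (auto simp: p.emeasure_eq_measure)
            fix w assume w: "w \<in> space (p n)"
            show "norm (\<phi> k (Fn n (a n w)) - \<phi> k (G (b n w))) \<le> real k * \<bar>e n\<bar> + indicat_real (space (p n) - S n) w"
            proof (cases "w \<in> S n")
              case True
              have "\<bar>\<phi> k (Fn n (a n w)) - \<phi> k (G (b n w))\<bar> \<le> real k * dist (Fn n (a n w)) (G (b n w))" by (rule \<phi>L)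
              also have "\<dots> \<le> real k * \<bar>e n\<bar>" using S(3)[OF True] by (intro mult_left_mono) auto
              finally show ?thesis using True by simp
            next
              case False
              have "\<bar>\<phi> k (Fn n (a n w)) - \<phi> k (G (b n w))\<bar> \<le> 1"
                using \<phi>1[of k "Fn n (a n w)"] \<phi>1[of k "G (b n w)"] by linarith
              then show ?thesis using False w by (simp add: add_increasing)
            qed
          qed
          also have "\<dots> = real k * \<bar>e n\<bar> + measure (p n) (space (p n) - S n)"
            by (subst Bochner_Integration.integral_add) (auto simp: p.prob_space p.emeasure_eq_measure)
          also have "\<dots> \<le> real k * \<bar>e n\<bar> + e n" using p.prob_compl[OF S(1)] S(2)[of n] by simp
          finally show "norm ((\<integral>x. \<phi> k (Fn n x) \<partial>\<mu>) - (\<integral>y. \<phi> k (G y) \<partial>\<nu>)) \<le> real k * \<bar>e n\<bar> + e n" .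
        qed
      qed
      ultimately show ?thesis by (rule LIMSEQ_unique)
    qed
    have l1: "(\<lambda>k. \<integral>x. \<phi> k (F x) \<partial>\<mu>) \<longlonglongrightarrow> (\<integral>x. indicator C (F x) \<partial>\<mu>)"
      by (rule integral_dominated_convergence[where w="\<lambda>_. 1"]) (auto simp: \<phi>1 \<phi>lim)
    have l2: "(\<lambda>k. \<integral>x. \<phi> k (G x) \<partial>\<nu>) \<longlonglongrightarrow> (\<integral>x. indicator C (G x) \<partial>\<nu>)"
      by (rule integral_dominated_convergence[where w="\<lambda>_. 1"]) (auto simp: \<phi>1 \<phi>lim)
    have "(\<integral>x. indicator C (F x) \<partial>\<mu>) = measure \<mu> (F -` C \<inter> space \<mu>)"
      using integral_distr[OF F, of "indicator C :: _ \<Rightarrow> real"] by (simp add: measure_distr)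
    moreover have "(\<integral>x. indicator C (G x) \<partial>\<nu>) = measure \<nu> (G -` C \<inter> space \<nu>)"
      using integral_distr[OF G, of "indicator C :: _ \<Rightarrow> real"] by (simp add: measure_distr)
    ultimately show ?thesis
      using LIMSEQ_unique[OF l1[unfolded eq] l2] by (simp add: emeasure_distr \<mu>.emeasure_eq_measure \<nu>.emeasure_eq_measure)
  qed simp
next
  show "emeasure (distr \<mu> borel F) UNIV \<noteq> \<infinity>"
    using prob_space.emeasure_space_1[OF prob_space.prob_space_distr[OF \<mu> F]] by simp
  show "sets (distr \<mu> borel F) = sigma_sets UNIV (Collect closed)"
    "sets (distr \<nu> borel G) = sigma_sets UNIV (Collect closed)"
    by (simp_all add: borel_eq_closed)
qed (auto simp: Int_stable_def)

lemma big_ball: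
  assumes X: "gd_set X" and x: "x \<in> pts X" and d: "0 < d"
  obtains R where "1 - d < measure (msr X) {y \<in> pts X. gd_dist X x y \<le> R}"
proof -
  interpret prob_space "msr X" by (rule gd_prob[OF X])
  note [measurable] = gd_dist_measurable[OF X x]
  define U where "U n = {y \<in> space (msr X). gd_dist X x y \<le> real n}" for n
  have "(\<lambda>m. prob (U m)) \<longlonglongrightarrow> prob (\<Union>m. U m)"
    by (rule finite_Lim_measure_incseq) (auto simp: U_def incseq_def)
  moreover have "(\<Union>m. U m) = space (msr X)" using real_arch_simple by (auto simp: U_def)
  ultimately have "(\<lambda>m. prob (U m)) \<longlonglongrightarrow> 1" by (simp add: prob_space)
  then have "eventually (\<lambda>m. 1 - d < prob (U m)) sequentially"
    by (rule order_tendstoD) (use d in simp)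
  then show thesis using that eventually_happens trivial_limit_sequentially X unfolding U_def by fastforce
qed

lemma tendsto_fun:
  fixes f :: "nat \<Rightarrow> nat \<Rightarrow> real"
  assumes "\<And>i. (\<lambda>n. f n i) \<longlonglongrightarrow> l i"
  shows "f \<longlonglongrightarrow> l"
proof -
  have "limitin (product_topology (\<lambda>_. euclidean) UNIV) f l sequentially"
    unfolding limitin_componentwise using assms by simp
  then show ?thesis by (simp add: euclidean_product_topology)
qed

text \<open>The distance of \<open>nat \<Rightarrow> real\<close> is a series of truncated
  coordinate distances with weights \<open>(1/2)^n\<close>, whose sum is 2.\<close>

lemma dist_fun_le:
  fixes s t :: "nat \<Rightarrow> real"
  assumes "\<And>i. \<bar>s i - t i\<bar> \<le> e"
  shows "dist s t \<le> 2 * e"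
proof -
  have "(\<lambda>n. (1/2::real)^n * e) sums (2 * e)" using sums_mult2[OF geometric_sums[of "1/2::real"], of e] by simp
  then have *: "summable (\<lambda>n. (1/2::real)^n * e)" "(\<Sum>n. (1/2::real)^n * e) = 2 * e"
    by (auto simp: sums_iff)
  have le: "(1/2)^n * min (dist (s (from_nat n)) (t (from_nat n))) 1 \<le> (1/2::real)^n * e" for n
    using assms[of "from_nat n"] by (intro mult_left_mono) (auto simp: dist_real_def)
  have "dist s t \<le> (\<Sum>n. (1/2::real)^n * e)"
    unfolding dist_fun_def
    by (rule suminf_le[OF le summable_comparison_test'[OF *(1)] *(1)]) (use le in auto)
  then show ?thesis using *(2) by simp
qed

text \<open>By equality of laws, \<open>x \<mapsto> (h i x)\<close> almost surely takes values that
  are uniform limits of sequences \<open>(g i y)\<close>. Full support of \<open>X\<close> extends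
  this from almost every to every \<open>x\<close>, and completeness of \<open>Y\<close> produces
  the point \<open>u x\<close> with these values. Since the \<open>g i\<close> compute the distance
  of \<open>Y\<close>, the map \<open>u\<close> is 1-Lipschitz and its law is the right one.\<close>

lemma dominated_of_equal_laws:
  assumes X: "gd_set X" and Y: "gd_set Y"
    and g: "\<And>i. g i \<in> obs Y" "\<And>f. f \<in> obs Y \<Longrightarrow> \<exists>r. \<forall>y\<in>pts Y. (\<lambda>k. g (r k) y) \<longlonglongrightarrow> f y"
    and h: "\<And>i. h i \<in> gd_closure X"
    and law: "distr (msr X) (borel :: (nat \<Rightarrow> real) measure) (\<lambda>x i. h i x) = distr (msr Y) borel (\<lambda>y i. g i y)"
  shows "dominated Y X"
proof -
  interpret X: prob_space "msr X" by (rule gd_prob[OF X])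
  interpret Y: prob_space "msr Y" by (rule gd_prob[OF Y])
  define F where "F x = (\<lambda>i. h i x)" for x
  define G where "G y = (\<lambda>i. g i y)" for y
  have [measurable]: "h i \<in> borel_measurable (msr X)" "g i \<in> borel_measurable (msr Y)" for i
    using closure_measurable[OF X h] closure_measurable[OF Y obs_subset_closure[OF Y g(1)]] by auto
  have F [measurable]: "F \<in> borel_measurable (msr X)" unfolding F_def by (rule measurable_coordinatewise_then_product) simp
  have G [measurable]: "G \<in> borel_measurable (msr Y)" unfolding G_def by (rule measurable_coordinatewise_then_product) simp
  have law': "emeasure (msr X) (F -` A \<inter> pts X) = emeasure (msr Y) (G -` A \<inter> pts Y)" if "A \<in> sets borel" for A
  proof -
    have "distr (msr X) borel F = distr (msr Y) borel G"
      using law unfolding F_def[abs_def] G_def[abs_def] .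
    then have "emeasure (distr (msr X) borel F) A = emeasure (distr (msr Y) borel G) A" by simp
    then show ?thesis by (simp add: emeasure_distr that X Y)
  qed
  \<comment> \<open>The distance of \<open>Y\<close> is a supremum over all observables; as
    pointwise limits of the \<open>g i\<close> these inherit any bound that the \<open>g i\<close>
    satisfy.\<close>
  have dist_le: "gd_dist Y y y' \<le> C" if y: "y \<in> pts Y" "y' \<in> pts Y" and le: "\<And>i. \<bar>g i y - g i y'\<bar> \<le> C" for y y' C
  proof (rule gd_dist_least[OF Y y])
    fix f assume "f \<in> obs Y"
    then obtain r where "\<And>y. y \<in> pts Y \<Longrightarrow> (\<lambda>k. g (r k) y) \<longlonglongrightarrow> f y" using g(2) by blast
    then have "(\<lambda>k. \<bar>g (r k) y - g (r k) y'\<bar>) \<longlonglongrightarrow> \<bar>f y - f y'\<bar>" using y by (intro tendsto_intros) auto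
    then show "\<bar>f y - f y'\<bar> \<le> C" by (rule LIMSEQ_le_const2) (use le in auto)
  qed
  obtain c where c: "\<And>n::nat. c n \<in> pts Y" "\<And>y e. y \<in> pts Y \<Longrightarrow> 0 < e \<Longrightarrow> \<exists>n. gd_dist Y (c n) y < e"
    by (rule gd_dense[OF Y]) blast
  \<comment> \<open>Balls for uniform distance about the image of a dense sequence. They describe
    the topology of \<open>Y\<close> and are still closed for coordinatewise convergence, hence
    Borel sets of sequences.\<close>
  define B where "B j k = {t :: nat \<Rightarrow> real. \<forall>i. \<bar>t i - g i (c j)\<bar> \<le> 1 / Suc k}" for j k :: nat
  have Bc: "closed (B j k)" for j k
    unfolding B_def
    by (intro closed_Collect_all closed_Collect_le continuous_intros continuous_on_product_coordinates)
  then have Bm: "B j k \<in> sets borel" for j k by simp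
  have GB: "\<exists>j. G y \<in> B j k" if y: "y \<in> pts Y" for y k
  proof -
    obtain j where "gd_dist Y (c j) y < 1 / Suc k" using c(2)[OF y, of "1 / Suc k"] by auto
    then have "\<bar>g i y - g i (c j)\<bar> \<le> 1 / Suc k" for i
      using obs_le_dist[OF Y g(1) c(1) y, of i j] by (simp add: abs_minus_commute)
    then show ?thesis by (auto simp: B_def G_def)
  qed
  \<comment> \<open>The sequences within every \<open>1 / (k + 1)\<close> of the image of
    \<open>Y\<close>, uniformly in \<open>i\<close>. All of \<open>Y\<close> is mapped into this
    Borel set, so almost all of \<open>X\<close> is.\<close>
  define E where "E = (\<Inter>k. \<Union>j. B j k)"
  have Em: "E \<in> sets borel" unfolding E_def using Bm by auto
  have "G -` E \<inter> pts Y = pts Y" using GB by (auto simp: E_def)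
  then have E1: "emeasure (msr X) (F -` E \<inter> pts X) = 1"
    using law'[OF Em] Y.emeasure_space_1 Y by simp
  \<comment> \<open>Each ball about \<open>x\<close> has positive mass and so contains a point
    mapped into \<open>E\<close>. The dense points found this way form a Cauchy sequence, and its
    limit is the point sought.\<close>
  have ex: "\<exists>y\<in>pts Y. \<forall>i. g i y = h i x" if x: "x \<in> pts X" for x
  proof -
    have "\<exists>j. \<forall>i. \<bar>g i (c j) - h i x\<bar> \<le> 2 / Suc k" for k
    proof -
      let ?U = "{z \<in> pts X. gd_dist X x z < 1 / Suc k}"
      have U: "openin (gd_top X) ?U" by (rule gd_ball_open[OF x X])
      have "0 < measure (msr X) ?U"
        by (rule gd_full_support[OF X U, of x]) (simp add: x gd_dist_self[OF X])
      have "?U \<inter> (F -` E \<inter> pts X) \<noteq> {}"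
      proof
        assume "?U \<inter> (F -` E \<inter> pts X) = {}"
        then have "?U \<subseteq> space (msr X) - (F -` E \<inter> pts X)" using X by auto
        moreover have m: "F -` E \<inter> pts X \<in> sets (msr X)" using measurable_sets[OF F Em] X by simp
        ultimately have "measure (msr X) ?U \<le> measure (msr X) (space (msr X) - (F -` E \<inter> pts X))"
          by (intro X.finite_measure_mono) auto
        also have "\<dots> = 0" using E1 X.prob_compl[OF m] by (simp add: X.emeasure_eq_measure)
        finally show False using \<open>0 < measure (msr X) ?U\<close> by simp
      qed
      then obtain z where z: "z \<in> pts X" "gd_dist X x z < 1 / Suc k" "F z \<in> E" by auto
      then obtain j where "F z \<in> B j k" by (auto simp: E_def)
      then have 1: "\<bar>h i z - g i (c j)\<bar> \<le> 1 / Suc k" for i by (simp add: B_def F_def)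
      have 2: "\<bar>h i x - h i z\<bar> \<le> 1 / Suc k" for i
        using closure_le_dist[OF X h x z(1), of i] z(2) by linarith
      have "\<bar>g i (c j) - h i x\<bar> \<le> 1 / Suc k + 1 / Suc k" for i using 1[of i] 2[of i] by linarith
      then show ?thesis by (intro exI[of _ j]) simp
    qed
    then obtain j where j: "\<And>k i. \<bar>g i (c (j k)) - h i x\<bar> \<le> 2 / Suc k" by metis
    interpret MY: Metric_space "pts Y" "gd_dist Y" by (rule gd_metric[OF Y])
    have z0: "(\<lambda>k. 2 / real (Suc k)) \<longlonglongrightarrow> 0"
      using tendsto_mult_right_zero[OF LIMSEQ_inverse_real_of_nat, of 2] by (simp add: divide_inverse)
    have "MY.MCauchy (\<lambda>k. c (j k))"
      unfolding MY.MCauchy_def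
    proof (intro conjI allI impI)
      show "range (\<lambda>k. c (j k)) \<subseteq> pts Y" using c(1) by auto
      fix e :: real assume e: "0 < e"
      then obtain N where N: "\<And>k. N \<le> k \<Longrightarrow> 2 / real (Suc k) < e/2"
        using LIMSEQ_D[OF z0, of "e/2"] by auto
      have "gd_dist Y (c (j k)) (c (j l)) < e" if "N \<le> k" "N \<le> l" for k l
      proof -
        have "gd_dist Y (c (j k)) (c (j l)) \<le> 2 / Suc k + 2 / Suc l"
        proof (rule dist_le[OF c(1) c(1)])
          fix i show "\<bar>g i (c (j k)) - g i (c (j l))\<bar> \<le> 2 / Suc k + 2 / Suc l"
            using j[of i k] j[of i l] by linarith
        qed
        then show ?thesis using N[OF that(1)] N[OF that(2)] by linarith
      qed
      then show "\<exists>N. \<forall>n n'. N \<le> n \<longrightarrow> N \<le> n' \<longrightarrow> gd_dist Y (c (j n)) (c (j n')) < e" by blast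
    qed
    moreover have "MY.mcomplete" using Y unfolding gd_set_def by blast
    ultimately obtain y where "limitin MY.mtopology (\<lambda>k. c (j k)) y sequentially"
      unfolding MY.mcomplete_def by blast
    then have y: "y \<in> pts Y" "\<And>e. 0 < e \<Longrightarrow> \<exists>N. \<forall>k\<ge>N. gd_dist Y (c (j k)) y < e"
      unfolding MY.limit_metric_sequentially by blast+
    have "g i y = h i x" for i
    proof (rule LIMSEQ_unique)
      show "(\<lambda>k. g i (c (j k))) \<longlonglongrightarrow> g i y"
      proof (rule metric_LIMSEQ_I)
        fix e :: real assume "0 < e"
        then obtain N where "\<forall>k\<ge>N. gd_dist Y (c (j k)) y < e" using y(2) by blast
        then show "\<exists>N. \<forall>k\<ge>N. dist (g i (c (j k))) (g i y) < e"
          using obs_le_dist[OF Y g(1) c(1) y(1)] unfolding dist_real_def by (meson le_less_trans)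
      qed
      show "(\<lambda>k. g i (c (j k))) \<longlonglongrightarrow> h i x"
        by (rule LIM_zero_cancel, rule Lim_null_comparison[OF _ z0]) (use j in auto)
    qed
    then show ?thesis using y(1) by blast
  qed
  define u where "u x = (SOME y. y \<in> pts Y \<and> (\<forall>i. g i y = h i x))" for x
  have u: "u x \<in> pts Y" "g i (u x) = h i x" if "x \<in> pts X" for x i
    using someI_ex[of "\<lambda>y. y \<in> pts Y \<and> (\<forall>i. g i y = h i x)"] ex[OF that] unfolding u_def by blast+
  have uL: "gd_dist Y (u x) (u x') \<le> gd_dist X x x'" if "x \<in> pts X" "x' \<in> pts X" for x x'
    by (rule dist_le) (use that u closure_le_dist[OF X h] in auto)
  have um: "u \<in> msr X \<rightarrow>\<^sub>M msr Y"
  proof (rule measurable_sigma_sets[OF gd_sets[OF Y]])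
    fix V assume V: "V \<in> {U. openin (gd_top Y) U}"
    have "openin (gd_top X) (u -` V \<inter> pts X)"
      unfolding gd_openin[OF X]
    proof (intro conjI ballI)
      fix x assume x: "x \<in> u -` V \<inter> pts X"
      then obtain r where "0 < r" "\<And>y. y \<in> pts Y \<Longrightarrow> gd_dist Y (u x) y < r \<Longrightarrow> y \<in> V"
        using gd_open_ball[OF Y, of V "u x"] V by auto
      then have "y \<in> u -` V \<inter> pts X" if "y \<in> pts X" "gd_dist X x y < r" for y
        using u(1)[OF that(1)] uL[of x y] x that by auto
      then show "\<exists>r>0. \<forall>y\<in>pts X. gd_dist X x y < r \<longrightarrow> y \<in> u -` V \<inter> pts X"
        using \<open>0 < r\<close> by blast
    qed auto
    then show "u -` V \<inter> space (msr X) \<in> sets (msr X)" using X by (simp add: gd_open_measurable)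
  next
    show "{U. openin (gd_top Y) U} \<subseteq> Pow (pts Y)" by (simp add: gd_openin[OF Y] subset_iff)
  qed (use X u(1) in auto)
  have "distr (msr X) (msr Y) u = msr Y"
  proof (rule measure_eqI_generator_eq)
    show "Int_stable {U. openin (gd_top Y) U}" by (auto simp: Int_stable_def)
    show "{U. openin (gd_top Y) U} \<subseteq> Pow (pts Y)" using openin_subset[of "gd_top Y"] Y by auto
    show "range (\<lambda>i::nat. pts Y) \<subseteq> {U. openin (gd_top Y) U}"
      using openin_topspace[of "gd_top Y"] Y by auto
    show "sets (distr (msr X) (msr Y) u) = sigma_sets (pts Y) {U. openin (gd_top Y) U}"
      "sets (msr Y) = sigma_sets (pts Y) {U. openin (gd_top Y) U}" using gd_sets[OF Y] by simp_all
    show "emeasure (distr (msr X) (msr Y) u) (pts Y) \<noteq> \<infinity>"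
      using prob_space.emeasure_space_1[OF X.prob_space_distr[OF um]] Y by simp
    fix V assume "V \<in> {U. openin (gd_top Y) U}"
    then have V: "openin (gd_top Y) V" by simp
    \<comment> \<open>This represents an open set \<open>V\<close> as the preimage under
      \<open>G\<close> of a Borel set \<open>W\<close> of sequences; the preimage of
      \<open>V\<close> under \<open>u\<close> is then the preimage of \<open>W\<close> under
      \<open>F\<close>, and the equality of laws applies.\<close>
    define I where "I = {(j, k). \<forall>y\<in>pts Y. G y \<in> B j k \<longrightarrow> y \<in> V}"
    define W where "W = (\<Union>(j, k)\<in>I. B j k)"
    have Wm: "W \<in> sets borel" unfolding W_def using Bm by (intro sets.countable_UN') auto
    have VW: "y \<in> V \<longleftrightarrow> G y \<in> W" if y: "y \<in> pts Y" for y
    proof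
      assume "y \<in> V"
      then obtain r where r: "0 < r" "\<And>z. z \<in> pts Y \<Longrightarrow> gd_dist Y y z < r \<Longrightarrow> z \<in> V"
        using gd_open_ball[OF Y V] by auto
      obtain k where k: "1 / real (Suc k) < r / 2" using nat_approx_posE[of "r/2"] r(1) by auto
      obtain j where j: "G y \<in> B j k" using GB[OF y] by blast
      have "z \<in> V" if z: "z \<in> pts Y" "G z \<in> B j k" for z
      proof (rule r(2)[OF z(1)])
        have "gd_dist Y y z \<le> 1 / Suc k + 1 / Suc k"
        proof (rule dist_le[OF y z(1)])
          fix i
          have "\<bar>g i z - g i (c j)\<bar> \<le> 1 / Suc k" "\<bar>g i y - g i (c j)\<bar> \<le> 1 / Suc k"
            using z(2) j by (auto simp: B_def G_def)
          then show "\<bar>g i y - g i z\<bar> \<le> 1 / Suc k + 1 / Suc k" by linarith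
        qed
        then show "gd_dist Y y z < r" using k by linarith
      qed
      then have "(j, k) \<in> I" by (auto simp: I_def)
      then show "G y \<in> W" using j unfolding W_def by blast
    next
      assume "G y \<in> W" then show "y \<in> V" using y by (auto simp: W_def I_def)
    qed
    have "V = G -` W \<inter> pts Y" using VW openin_subset[OF V] Y by auto
    moreover have "u -` V \<inter> pts X = F -` W \<inter> pts X"
      using VW[OF u(1)] u(2) by (auto simp: F_def G_def)
    ultimately show "emeasure (distr (msr X) (msr Y) u) V = emeasure (msr Y) V"
      using law'[OF Wm] X gd_open_measurable[OF Y V] by (simp add: emeasure_distr[OF um])
  qed auto
  moreover have "compose (pts X) f u \<in> gd_closure X" if f: "f \<in> obs Y" for f
  proof -
    obtain r where r: "\<And>y. y \<in> pts Y \<Longrightarrow> (\<lambda>k. g (r k) y) \<longlonglongrightarrow> f y" using g(2) f by blast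
    show ?thesis
    proof (rule gd_closure_limit[OF X, where fs="\<lambda>k. h (r k)"])
      fix x assume x: "x \<in> pts X"
      show "(\<lambda>n. h (r n) x) \<longlonglongrightarrow> compose (pts X) f u x"
        using r[OF u(1)[OF x]] u(2)[OF x] x by (simp add: compose_def)
    qed (use h in \<open>auto simp: compose_def\<close>)
  qed
  ultimately have "domination X Y u" using um by (simp add: domination_def)
  then show ?thesis by (auto simp: dominated_def)
qed

lemma box_le_zero_imp_dominated:
  assumes X: "gd_set X" and Y: "gd_set Y" and z: "box_le Y X = 0"
  shows "dominated Y X"
proof -
  \<comment> \<open>The shift by 4 gives \<open>e n \<le> 1/4\<close>. Two events of probability
    above 3/4 and the event \<open>S n\<close> of probability at least 3/4 then have a common
    point.\<close>
  define e where "e n = 1 / real (n + 4)" for n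
  have e: "0 < e n" "e n \<le> 1/4" for n by (auto simp: e_def divide_le_eq)
  have e0: "e \<longlonglongrightarrow> 0" unfolding e_def
    using LIMSEQ_ignore_initial_segment[OF lim_inverse_n', of 4] by (simp add: divide_inverse)
  have "\<exists>p S. p \<in> couplings X Y \<and> closedin (gd_prod_top X Y) S \<and> 1 - e n \<le> measure p S \<and>
      near (S\<inverse>) (e n/2) (gd_closure Y) (gd_closure X)" for n
    by (rule box_leD[OF X Y, of "e n"]) (use z e in auto)
  then obtain p S where p: "\<And>n. p n \<in> couplings X Y" and cl: "\<And>n. closedin (gd_prod_top X Y) (S n)"
    and mS: "\<And>n. 1 - e n \<le> measure (p n) (S n)" and nr: "\<And>n. near ((S n)\<inverse>) (e n/2) (gd_closure Y) (gd_closure X)"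
    by metis
  have Sm: "S n \<in> sets (p n)" for n by (rule closed_measurable[OF X Y p cl])
  obtain g :: "nat \<Rightarrow> 'b \<Rightarrow> real" where g: "\<And>i. g i \<in> obs Y" "\<And>f. f \<in> obs Y \<Longrightarrow> \<exists>r. \<forall>y\<in>pts Y. (\<lambda>k. g (r k) y) \<longlonglongrightarrow> f y"
    by (rule obs_dense_sequence[OF Y]) (rule that)
  have "\<exists>f\<in>gd_closure X. \<forall>(y, x)\<in>(S n)\<inverse>. \<bar>g i y - f x\<bar> \<le> e n/2" for i n
    using nr[of n] obs_subset_closure[OF Y g(1)[of i]] unfolding near_def by blast
  then obtain f where f: "\<And>i n. f i n \<in> gd_closure X" "\<And>i n. \<forall>(y, x)\<in>(S n)\<inverse>. \<bar>g i y - f i n x\<bar> \<le> e n/2"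
    by metis
  have f2: "\<bar>f i n x - g i y\<bar> \<le> e n/2" if "(x, y) \<in> S n" for i n x y
    using f(2)[of n i] that by (auto simp: abs_minus_commute)
  obtain x0 where x0: "x0 \<in> pts X" using gd_nonempty[OF X] by blast
  obtain y0 where y0: "y0 \<in> pts Y" using gd_nonempty[OF Y] by blast
  obtain R where R: "1 - 1/4 < measure (msr X) {y \<in> pts X. gd_dist X x0 y \<le> R}"
    by (rule big_ball[OF X x0, of "1/4"]) auto
  obtain R' where R': "1 - 1/4 < measure (msr Y) {y \<in> pts Y. gd_dist Y y0 y \<le> R'}"
    by (rule big_ball[OF Y y0, of "1/4"]) auto
  \<comment> \<open>The matched observables vary with \<open>n\<close>, but \<open>S n\<close>
    always meets the product of two fixed large balls. Comparing with \<open>g i\<close> at such a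
    point bounds \<open>f i n x0\<close> independently of \<open>n\<close>, as compactness
    requires.\<close>
  have bd: "\<bar>f i n x0\<bar> \<le> R + R' + 1 + \<bar>g i y0\<bar>" for i n
  proof -
    note c = couplingD[OF X Y p[of n]]
    interpret p: prob_space "p n" by (rule c(1))
    let ?A = "{y \<in> pts X. gd_dist X x0 y \<le> R}" and ?B = "{y \<in> pts Y. gd_dist Y y0 y \<le> R'}"
    have A: "?A \<in> sets (msr X)"
      using gd_dist_measurable[OF X x0] gd_space[OF X] borel_measurable_le[of "gd_dist X x0" "msr X" "\<lambda>_. R"] by simp
    have B: "?B \<in> sets (msr Y)"
      using gd_dist_measurable[OF Y y0] gd_space[OF Y] borel_measurable_le[of "gd_dist Y y0" "msr Y" "\<lambda>_. R'"] by simp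
    let ?A' = "fst -` ?A \<inter> space (p n)" and ?B' = "snd -` ?B \<inter> space (p n)"
    have "measure (p n) ?A' = measure (msr X) ?A" "measure (p n) ?B' = measure (msr Y) ?B"
      using measure_distr[OF c(4) A] measure_distr[OF c(5) B] c(6,7) by simp_all
    then have "0 < measure (p n) (?A' \<inter> (?B' \<inter> S n))"
      using R R' mS[of n] e(2)[of n] p.prob_Int_ge[of ?A' "?B' \<inter> S n"] p.prob_Int_ge[of ?B' "S n"]
        measurable_sets[OF c(4) A] measurable_sets[OF c(5) B] Sm[of n] by auto
    then have "?A' \<inter> (?B' \<inter> S n) \<noteq> {}" by (metis less_irrefl measure_empty)
    then obtain x y where xy: "x \<in> pts X" "gd_dist X x0 x \<le> R" "y \<in> pts Y" "gd_dist Y y0 y \<le> R'" "(x, y) \<in> S n"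
      by auto
    show ?thesis
      using closure_le_dist[OF X f(1) x0 xy(1), of i n] obs_le_dist[OF Y g(1) y0 xy(3), of i] f2[OF xy(5), of i] xy e(2)[of n]
      by linarith
  qed
  have "\<exists>x\<in>pts X. bounded (range (\<lambda>n. f i n x))" for i
    using x0 bd[of i] by (auto simp: bounded_iff intro!: bexI[of _ x0])
  then obtain r h where r: "strict_mono (r :: nat \<Rightarrow> nat)" and h: "\<And>i::nat. h i \<in> gd_closure X"
    "\<And>i x. x \<in> pts X \<Longrightarrow> (\<lambda>n. f i (r n) x) \<longlonglongrightarrow> h i x"
    using gd_closure_compact[OF X, where fs=f] f(1) by metis
  have gm: "g i \<in> borel_measurable (msr Y)" for i using closure_measurable[OF Y obs_subset_closure[OF Y g(1)]] .
  have "distr (msr X) (borel :: (nat \<Rightarrow> real) measure) (\<lambda>x i. h i x) = distr (msr Y) borel (\<lambda>y i. g i y)"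
  proof (rule distr_eq_of_close_couplings[where Fn="\<lambda>n x i. f i (r n) x" and p="\<lambda>n. p (r n)" and a="\<lambda>_. fst"
        and b="\<lambda>_. snd" and S="\<lambda>n. S (r n)" and e="\<lambda>n. e (r n)"])
    show "(\<lambda>n i. f i (r n) x) \<longlonglongrightarrow> (\<lambda>i. h i x)" if "x \<in> space (msr X)" for x
      using h(2) that X by (intro tendsto_fun) simp
    show "(\<lambda>n. e (r n)) \<longlonglongrightarrow> 0" using LIMSEQ_subseq_LIMSEQ[OF e0 r] by (simp add: o_def)
    show "dist (\<lambda>i. f i (r n) (fst w)) (\<lambda>i. g i (snd w)) \<le> e (r n)" if "w \<in> S (r n)" for n w
      using dist_fun_le[of "\<lambda>i. f i (r n) (fst w)" "\<lambda>i. g i (snd w)" "e (r n) / 2"] f2[of "fst w" "snd w"] that by simp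
  qed (use couplingD[OF X Y p] gd_prob[OF X] gd_prob[OF Y] mS Sm closure_measurable[OF X h(1)] gm closure_measurable[OF X f(1)]
        in \<open>auto intro!: measurable_coordinatewise_then_product\<close>)
  then show ?thesis using dominated_of_equal_laws[OF X Y, of g h] g h(1) by blast
qed

lemma dominated_imp_box_le_zero:
  assumes X: "gd_set X" and Y: "gd_set Y" and d: "dominated Y X"
  shows "box_le Y X = 0"
proof -
  obtain u where u: "domination X Y u" using d by (auto simp: dominated_def)
  interpret XY: gd_pair X Y "msr X" "\<lambda>x. x" u
    by (rule gd_pair.intro[OF X Y gd_prob[OF X]]) (use u in \<open>auto simp: domination_def distr_id2\<close>)
  have "box_le Y X \<le> 0"
  proof (rule XY.box_le_pair)
    show "space (msr X) \<in> sets (msr X)" by simp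
    show "1 - 0 \<le> measure (msr X) (space (msr X))" using prob_space.prob_space[OF gd_prob[OF X]] by simp
    fix g assume "g \<in> obs Y"
    then have "compose (pts X) g u \<in> gd_closure X" using u by (auto simp: domination_def)
    then show "\<exists>f\<in>gd_closure X. \<forall>w\<in>space (msr X). \<bar>f w - g (u w)\<bar> \<le> 0 / 2"
      using X by (intro bexI[of _ "compose (pts X) g u"]) (auto simp: compose_def)
  qed simp
  then show ?thesis using box_le_nonneg[OF X Y] by simp
qed

lemma box_le_zero_iff: "gd_set X \<Longrightarrow> gd_set Y \<Longrightarrow> box_le Y X = 0 \<longleftrightarrow> dominated Y X"
  using box_le_zero_imp_dominated dominated_imp_box_le_zero by blast

lemma dominated_of_box_limits:
  assumes Xs: "\<And>n. gd_set (Xs n)" and Ys: "\<And>n. gd_set (Ys n)" and X: "gd_set X" and Y: "gd_set Y"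
    and \<delta>: "\<And>n. 0 \<le> \<delta> n" "\<delta> \<longlonglongrightarrow> 0" and d: "\<And>n. dominated_upto (\<delta> n) (Ys n) (Xs n)"
    and bX: "(\<lambda>n. gd_box (Xs n) X) \<longlonglongrightarrow> 0" and bY: "(\<lambda>n. gd_box (Ys n) Y) \<longlonglongrightarrow> 0"
  shows "dominated Y X"
proof -
  have "box_le Y X \<le> gd_box (Ys n) Y + \<delta> n + gd_box (Xs n) X" for n
  proof -
    have "box_le Y X \<le> box_le Y (Ys n) + box_le (Ys n) X" by (rule box_le_triangle[OF X Ys Y])
    moreover have "box_le (Ys n) X \<le> box_le (Ys n) (Xs n) + box_le (Xs n) X" by (rule box_le_triangle[OF X Xs Ys])
    moreover have "box_le Y (Ys n) \<le> gd_box (Ys n) Y" by (rule box_le_le_gd_box[OF Ys Y])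
    moreover have "box_le (Xs n) X \<le> gd_box (Xs n) X"
      using box_le_le_gd_box[OF X Xs] gd_box_commute_le[OF Xs X] by (rule order_trans)
    moreover have "box_le (Ys n) (Xs n) \<le> \<delta> n" by (rule box_le_le[OF d \<delta>(1)])
    ultimately show ?thesis by linarith
  qed
  moreover have "(\<lambda>n. gd_box (Ys n) Y + \<delta> n + gd_box (Xs n) X) \<longlonglongrightarrow> 0 + 0 + 0"
    by (intro tendsto_add bX bY \<delta>)
  ultimately have "box_le Y X \<le> 0" by (intro LIMSEQ_le_const[of _ 0]) auto
  then have "box_le Y X = 0" using box_le_nonneg[OF X Y] by simp
  then show ?thesis by (rule box_le_zero_imp_dominated[OF X Y])
qed

section \<open>Constructing gd-sets\<close>

text \<open>The topology depends only on the points and the observables, so an arbitrary measure may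
  stand in the auxiliary record that supplies the Borel sets.\<close>

definition gd_build :: "'b set \<Rightarrow> ('b \<Rightarrow> real) set \<Rightarrow> 'w measure \<Rightarrow> ('w \<Rightarrow> 'b) \<Rightarrow> 'b gdset" where
  "gd_build P \<Phi> M q = \<lparr>pts = P, obs = \<Phi>,
     msr = distr M (borel_on (gd_top \<lparr>pts = P, obs = \<Phi>, msr = undefined\<rparr>)) q\<rparr>"

text \<open>The hypotheses speak of uniform bounds over all observables because the metric is only
  defined by them. Measurability of \<open>q\<close> is required on closed balls, which suffices by
  separability.\<close>

lemma gd_build_gd_set:
  fixes P :: "'b set" and \<Phi> :: "('b \<Rightarrow> real) set" and M :: "'w measure" and q :: "'w \<Rightarrow> 'b" and c :: "nat \<Rightarrow> 'b"
  assumes ne: "\<Phi> \<noteq> {}" and exten: "\<Phi> \<subseteq> extensional P"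
    and bd: "\<And>x y. x \<in> P \<Longrightarrow> y \<in> P \<Longrightarrow> \<exists>C. \<forall>f\<in>\<Phi>. \<bar>f x - f y\<bar> \<le> C"
    and sep: "\<And>x y. x \<in> P \<Longrightarrow> y \<in> P \<Longrightarrow> (\<And>f. f \<in> \<Phi> \<Longrightarrow> f x = f y) \<Longrightarrow> x = y"
    and comp: "\<And>\<sigma>::nat \<Rightarrow> 'b. (\<And>n. \<sigma> n \<in> P) \<Longrightarrow>
       (\<And>e. 0 < e \<Longrightarrow> \<exists>N. \<forall>m\<ge>N. \<forall>n\<ge>N. \<forall>f\<in>\<Phi>. \<bar>f (\<sigma> m) - f (\<sigma> n)\<bar> \<le> e) \<Longrightarrow>
       \<exists>x\<in>P. \<forall>e>0. \<exists>N. \<forall>n\<ge>N. \<forall>f\<in>\<Phi>. \<bar>f (\<sigma> n) - f x\<bar> \<le> e"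
    and c: "\<And>n. c n \<in> P" "\<And>x e. x \<in> P \<Longrightarrow> 0 < e \<Longrightarrow> \<exists>n. \<forall>f\<in>\<Phi>. \<bar>f (c n) - f x\<bar> \<le> e"
    and M: "prob_space M" and q: "\<And>w. w \<in> space M \<Longrightarrow> q w \<in> P"
    and ball: "\<And>x e. x \<in> P \<Longrightarrow> 0 < e \<Longrightarrow> {w \<in> space M. \<forall>f\<in>\<Phi>. \<bar>f (q w) - f x\<bar> \<le> e} \<in> sets M"
      "\<And>x e. x \<in> P \<Longrightarrow> 0 < e \<Longrightarrow> 0 < measure M {w \<in> space M. \<forall>f\<in>\<Phi>. \<bar>f (q w) - f x\<bar> \<le> e}"
  shows "gd_set (gd_build P \<Phi> M q) \<and> q \<in> M \<rightarrow>\<^sub>M msr (gd_build P \<Phi> M q) \<and>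
    distr M (msr (gd_build P \<Phi> M q)) q = msr (gd_build P \<Phi> M q)"
proof -
  interpret M: prob_space M by (rule M)
  define X where "X = gd_build P \<Phi> M q"
  have [simp]: "pts X = P" "obs X = \<Phi>" by (simp_all add: X_def gd_build_def)
  define d where "d = gd_dist X"
  have bdd: "bdd_above ((\<lambda>f. \<bar>f x - f y\<bar>) ` \<Phi>)" if "x \<in> P" "y \<in> P" for x y
    using bd[OF that] by (auto simp: bdd_above_def)
  have up: "\<bar>f x - f y\<bar> \<le> d x y" if "x \<in> P" "y \<in> P" "f \<in> \<Phi>" for x y f
    using that cSUP_upper[OF that(3) bdd[OF that(1,2)]] by (simp add: d_def gd_dist_def)
  have least: "d x y \<le> C" if "x \<in> P" "y \<in> P" "\<And>f. f \<in> \<Phi> \<Longrightarrow> \<bar>f x - f y\<bar> \<le> C" for x y C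
    using that cSUP_least[OF ne, of "\<lambda>f. \<bar>f x - f y\<bar>" C] by (simp add: d_def gd_dist_def)
  have nn: "0 \<le> d x y" for x y
  proof (cases "x \<in> P \<and> y \<in> P")
    case True
    obtain f where "f \<in> \<Phi>" using ne by blast
    then show ?thesis using up[of x y f] True by linarith
  qed (auto simp: d_def gd_dist_def)
  have com: "d x y = d y x" for x y by (simp add: d_def gd_dist_def abs_minus_commute)
  have met: "Metric_space P d"
  proof
    show "d x y = 0 \<longleftrightarrow> x = y" if "x \<in> P" "y \<in> P" for x y
    proof
      assume "d x y = 0"
      then show "x = y" using up[OF that] by (intro sep that) fastforce
    next
      assume "x = y"
      then have "d x y \<le> 0" by (intro least that) auto
      then show "d x y = 0" using nn[of x y] by simp
    qed
    show "d x z \<le> d x y + d y z" if "x \<in> P" "y \<in> P" "z \<in> P" for x y z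
    proof (rule least[OF that(1,3)])
      fix f assume "f \<in> \<Phi>"
      then show "\<bar>f x - f z\<bar> \<le> d x y + d y z" using up[OF that(1,2)] up[OF that(2,3)] by fastforce
    qed
  qed (rule nn com)+
  then interpret Metric_space P d .
  have top: "gd_top X = mtopology" by (simp add: gd_top_def d_def)
  have top': "gd_top \<lparr>pts = P, obs = \<Phi>, msr = undefined\<rparr> = mtopology"
  proof -
    have "gd_dist \<lparr>pts = P, obs = \<Phi>, msr = undefined\<rparr> = d"
      by (intro ext) (simp add: d_def gd_dist_def)
    then show ?thesis by (simp add: gd_top_def)
  qed
  have msr: "msr X = distr M (borel_on mtopology) q" by (simp add: X_def gd_build_def top')
  have sb: "sets (borel_on mtopology) = sigma_sets P {U. openin mtopology U}" by (simp add: sets_borel_on)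
  have qm: "q \<in> M \<rightarrow>\<^sub>M borel_on mtopology"
  proof (rule measurable_sigma_sets[OF sb])
    show "{U. openin mtopology U} \<subseteq> Pow P" using openin_subset[of mtopology] by auto
    show "q \<in> space M \<rightarrow> P" using q by auto
    fix U assume "U \<in> {U. openin mtopology U}"
    then have U: "openin mtopology U" by simp
    \<comment> \<open>The countably many closed balls about dense points that lie inside
      \<open>U\<close> already cover it.\<close>
    define I where "I = {(n, k). {x \<in> P. \<forall>f\<in>\<Phi>. \<bar>f x - f (c n)\<bar> \<le> 1 / Suc k} \<subseteq> U}"
    have "q -` U \<inter> space M = (\<Union>(n, k)\<in>I. {w \<in> space M. \<forall>f\<in>\<Phi>. \<bar>f (q w) - f (c n)\<bar> \<le> 1 / Suc k})"
    proof (intro equalityI subsetI)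
      fix w assume w: "w \<in> q -` U \<inter> space M"
      then obtain r where r: "0 < r" "mball (q w) r \<subseteq> U" using U unfolding openin_mtopology by auto
      obtain k where k: "1 / real (Suc k) < r / 3" using nat_approx_posE[of "r/3"] r(1) by auto
      obtain n where n: "\<forall>f\<in>\<Phi>. \<bar>f (c n) - f (q w)\<bar> \<le> 1 / Suc k" using c(2)[OF q, of w "1 / Suc k"] w by auto
      have "x \<in> U" if x: "x \<in> P" "\<forall>f\<in>\<Phi>. \<bar>f x - f (c n)\<bar> \<le> 1 / Suc k" for x
      proof -
        have "d (q w) x \<le> 1 / Suc k + 1 / Suc k"
        proof (rule least[OF q x(1)])
          fix f assume "f \<in> \<Phi>"
          then have "\<bar>f (c n) - f (q w)\<bar> \<le> 1 / Suc k" "\<bar>f x - f (c n)\<bar> \<le> 1 / Suc k" using n x by auto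
          then show "\<bar>f (q w) - f x\<bar> \<le> 1 / Suc k + 1 / Suc k" by linarith
        qed (use w in auto)
        then show ?thesis using r k x(1) q w by (auto simp: subset_iff)
      qed
      then have "(n, k) \<in> I" by (auto simp: I_def)
      then show "w \<in> (\<Union>(n, k)\<in>I. {w \<in> space M. \<forall>f\<in>\<Phi>. \<bar>f (q w) - f (c n)\<bar> \<le> 1 / Suc k})"
        using n w by (auto simp: abs_minus_commute intro!: bexI[of _ "(n, k)"])
    qed (use q in \<open>auto simp: I_def\<close>)
    also have "\<dots> \<in> sets M" using ball(1)[OF c(1)] by (intro sets.countable_UN') (auto simp: split_beta)
    finally show "q -` U \<inter> space M \<in> sets M" .
  qed
  have prob: "prob_space (msr X)" unfolding msr by (rule M.prob_space_distr[OF qm])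
  have sep: "separable_space mtopology"
    unfolding separable_space_def
  proof (intro exI conjI)
    show "mtopology closure_of range c = topspace mtopology"
      unfolding metric_closure_of topspace_mtopology
    proof (intro equalityI subsetI CollectI conjI allI impI)
      fix x and r :: real assume x: "x \<in> P" and r: "0 < r"
      obtain n where "\<forall>f\<in>\<Phi>. \<bar>f (c n) - f x\<bar> \<le> r / 2" using c(2)[OF x, of "r/2"] r by auto
      then have "d x (c n) \<le> r / 2" by (intro least x c) (auto simp: abs_minus_commute)
      then show "\<exists>y\<in>range c. y \<in> mball x r" using r x c(1) by (intro bexI[of _ "c n"]) auto
    qed auto
  qed (use c in auto)
  have complete: "mcomplete"
    unfolding mcomplete_def
  proof (intro allI impI)
    fix \<sigma> assume s: "MCauchy \<sigma>"
    have sP: "\<sigma> n \<in> P" for n using s by (auto simp: MCauchy_def)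
    have "\<exists>x\<in>P. \<forall>e>0. \<exists>N. \<forall>n\<ge>N. \<forall>f\<in>\<Phi>. \<bar>f (\<sigma> n) - f x\<bar> \<le> e"
    proof (rule comp[OF sP])
      fix e :: real assume "0 < e"
      then obtain N where N: "\<And>m n. N \<le> m \<Longrightarrow> N \<le> n \<Longrightarrow> d (\<sigma> m) (\<sigma> n) < e" using s unfolding MCauchy_def by blast
      show "\<exists>N. \<forall>m\<ge>N. \<forall>n\<ge>N. \<forall>f\<in>\<Phi>. \<bar>f (\<sigma> m) - f (\<sigma> n)\<bar> \<le> e"
      proof (intro exI[of _ N] allI impI ballI)
        fix m n f assume "N \<le> m" "N \<le> n" "f \<in> \<Phi>"
        then show "\<bar>f (\<sigma> m) - f (\<sigma> n)\<bar> \<le> e" using up[OF sP sP, of f m n] N[of m n] by linarith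
      qed
    qed
    then obtain x where x: "x \<in> P" "\<And>e. 0 < e \<Longrightarrow> \<exists>N. \<forall>n\<ge>N. \<forall>f\<in>\<Phi>. \<bar>f (\<sigma> n) - f x\<bar> \<le> e" by blast
    have "limitin mtopology \<sigma> x sequentially"
      unfolding limit_metric_sequentially
    proof (intro conjI allI impI x(1))
      fix e :: real assume e: "0 < e"
      then obtain N where N: "\<forall>n\<ge>N. \<forall>f\<in>\<Phi>. \<bar>f (\<sigma> n) - f x\<bar> \<le> e / 2" using x(2)[of "e/2"] by auto
      have "d (\<sigma> n) x < e" if "N \<le> n" for n
        using least[OF sP x(1), of n "e/2"] N that e by fastforce
      then show "\<exists>N. \<forall>n\<ge>N. \<sigma> n \<in> P \<and> d (\<sigma> n) x < e" using sP by blast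
    qed
    then show "\<exists>x. limitin mtopology \<sigma> x sequentially" ..
  qed
  have full: "measure (msr X) U > 0" if U: "openin mtopology U" "U \<noteq> {}" for U
  proof -
    obtain x where x: "x \<in> U" using U by blast
    then have xP: "x \<in> P" using openin_subset[OF U(1)] by auto
    obtain r where r: "0 < r" "mball x r \<subseteq> U" using U(1) x unfolding openin_mtopology by blast
    let ?B = "{w \<in> space M. \<forall>f\<in>\<Phi>. \<bar>f (q w) - f x\<bar> \<le> r / 2}"
    have Us: "U \<in> sets (borel_on mtopology)" using U(1) by (simp add: sb sigma_sets.Basic)
    have "?B \<subseteq> q -` U \<inter> space M"
    proof
      fix w assume w: "w \<in> ?B"
      then have "d x (q w) \<le> r / 2" by (intro least xP q) (auto simp: abs_minus_commute)
      then have "q w \<in> mball x r" using r xP q w by auto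
      then show "w \<in> q -` U \<inter> space M" using r w by auto
    qed
    then have "measure M ?B \<le> measure M (q -` U \<inter> space M)"
      by (intro M.finite_measure_mono measurable_sets[OF qm Us])
    then show ?thesis using ball(2)[OF xP, of "r/2"] r by (simp add: msr measure_distr[OF qm Us])
  qed
  have "gd_set (gd_build P \<Phi> M q)"
    unfolding X_def[symmetric] gd_set_def full_support_prob_def top d_def[symmetric]
    using ne exten bdd met complete sep prob full by (auto simp: msr space_borel_on)
  moreover have "q \<in> M \<rightarrow>\<^sub>M msr (gd_build P \<Phi> M q)"
    unfolding X_def[symmetric] msr using qm by simp
  moreover have "distr M (msr (gd_build P \<Phi> M q)) q = msr (gd_build P \<Phi> M q)"
    unfolding X_def[symmetric] msr by (rule distr_cong) simp_all
  ultimately show ?thesis by blast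
qed

text \<open>This places the points of a quotient in \<open>real\<close>, the type over which
  pyramids are formed.\<close>

lemma inj_on_real_of_nat_sets:
  fixes code :: "'a \<Rightarrow> nat set"
  assumes "inj_on code T"
  obtains e :: "'a \<Rightarrow> real" where "inj_on e T"
proof -
  obtain h :: "nat set \<Rightarrow> real" where h: "bij h"
    using nat_sets_eqpoll_reals unfolding eqpoll_def by blast
  then have "inj_on (h \<circ> code) T"
    using assms by (metis bij_is_inj comp_inj_on inj_on_subset subset_UNIV)
  then show thesis using that by blast
qed

text \<open>The quotient of a probability space by a separable family \<open>F\<close> of real functions, completed and restricted
  to its support. Its points are functions on \<open>F\<close>, encoded as reals.\<close>

lemma real_quotient:
  fixes M :: "'a measure" and F :: "('a \<Rightarrow> real) set" and c :: "nat \<Rightarrow> 'a"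
  assumes M: "prob_space M" and ne: "F \<noteq> {}"
    and bd: "\<And>x y. x \<in> space M \<Longrightarrow> y \<in> space M \<Longrightarrow> \<exists>C. \<forall>f\<in>F. \<bar>f x - f y\<bar> \<le> C"
    and c: "\<And>n. c n \<in> space M" "\<And>x e. x \<in> space M \<Longrightarrow> 0 < e \<Longrightarrow> \<exists>n. \<forall>f\<in>F. \<bar>f x - f (c n)\<bar> \<le> e"
    and ball: "\<And>t e. {x \<in> space M. \<forall>f\<in>F. \<bar>f x - t f\<bar> \<le> e} \<in> sets M"
  obtains W :: "real gdset" and q :: "'a \<Rightarrow> real" and evl G where "gd_set W" "q \<in> M \<rightarrow>\<^sub>M msr W" "distr M (msr W) q = msr W"
    "obs W = evl ` F" "G \<in> sets M" "measure M G = 1" "\<And>x f. x \<in> G \<Longrightarrow> f \<in> F \<Longrightarrow> evl f (q x) = f x"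
    "(\<And>x e. x \<in> space M \<Longrightarrow> 0 < e \<Longrightarrow> 0 < measure M {y \<in> space M. \<forall>f\<in>F. \<bar>f y - f x\<bar> \<le> e}) \<Longrightarrow> G = space M"
    "\<And>w e. w \<in> pts W \<Longrightarrow> 0 < e \<Longrightarrow> \<exists>x\<in>space M. \<forall>f\<in>F. \<bar>f x - evl f w\<bar> \<le> e"
proof -
  interpret M: prob_space M by (rule M)
  define B where "B t e = {x \<in> space M. \<forall>f\<in>F. \<bar>f x - t f\<bar> \<le> e}" for t :: "('a \<Rightarrow> real) \<Rightarrow> real" and e :: real
  have Bm [measurable]: "B t e \<in> sets M" for t e unfolding B_def by (rule ball)
  define pt where "pt x = (\<lambda>f\<in>F. f x)" for x :: 'a
  \<comment> \<open>A point is a function on \<open>F\<close> all of whose uniform neighbourhoods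
    have positive mass. This adds the missing limits and removes everything off the support in one
    stroke.\<close>
  define T where "T = {t \<in> extensional F. \<forall>e>0. 0 < measure M (B t e)}"
  have near: "\<exists>x\<in>space M. \<forall>f\<in>F. \<bar>f x - t f\<bar> \<le> e" if "t \<in> T" "0 < e" for t e
  proof -
    have "B t e \<noteq> {}" using that by (auto simp: T_def)
    then show ?thesis by (auto simp: B_def)
  qed
  \<comment> \<open>A function is recorded by the set of those balls of radius
    \<open>1 / (k + 1)\<close> about dense points that contain it; small radii separate any two
    functions.\<close>
  define code where "code t = {k. \<forall>f\<in>F. \<bar>t f - f (c (fst (prod_decode k)))\<bar> \<le> 1 / Suc (snd (prod_decode k))}"
    for t :: "('a \<Rightarrow> real) \<Rightarrow> real"
  have nearc: "\<exists>n. \<forall>f\<in>F. \<bar>t f - f (c n)\<bar> \<le> e" if t: "t \<in> T" and e: "0 < e" for t e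
  proof -
    have e2: "0 < e/2" using e by simp
    obtain x where x: "x \<in> space M" "\<forall>f\<in>F. \<bar>f x - t f\<bar> \<le> e/2" using near[OF t e2] by blast
    obtain n where n: "\<forall>f\<in>F. \<bar>f x - f (c n)\<bar> \<le> e/2" using c(2)[OF x(1) e2] by blast
    have "\<bar>t f - f (c n)\<bar> \<le> e" if "f \<in> F" for f
    proof -
      have "\<bar>f x - t f\<bar> \<le> e/2" "\<bar>f x - f (c n)\<bar> \<le> e/2" using x n that by auto
      then show ?thesis by linarith
    qed
    then show ?thesis by blast
  qed
  have "inj_on code T"
  proof (rule inj_onI)
    fix t t' assume t: "t \<in> T" "t' \<in> T" and eq: "code t = code t'"
    have "t f = t' f" if f: "f \<in> F" for f
    proof (rule ccontr)
      assume "t f \<noteq> t' f"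
      then obtain k where k: "1 / real (Suc k) < \<bar>t f - t' f\<bar> / 2" using nat_approx_posE[of "\<bar>t f - t' f\<bar> / 2"] by auto
      obtain n where "\<forall>f\<in>F. \<bar>t f - f (c n)\<bar> \<le> 1 / Suc k" using nearc[OF t(1), of "1 / Suc k"] by auto
      then have "prod_encode (n, k) \<in> code t" by (simp add: code_def)
      then have "prod_encode (n, k) \<in> code t" "prod_encode (n, k) \<in> code t'" using eq by auto
      then have "\<bar>t f - f (c n)\<bar> \<le> 1 / Suc k" "\<bar>t' f - f (c n)\<bar> \<le> 1 / Suc k" using f by (auto simp: code_def)
      then have "\<bar>t f - t' f\<bar> \<le> 1 / Suc k + 1 / Suc k" by linarith
      moreover define D a where "D = \<bar>t f - t' f\<bar>" and "a = 1 / real (Suc k)"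
      ultimately have "D \<le> a + a" "a < D / 2" using k by simp_all
      then show False by linarith
    qed
    then show "t = t'" using t by (intro extensionalityI[of _ F]) (auto simp: T_def)
  qed
  then obtain i :: "(('a \<Rightarrow> real) \<Rightarrow> real) \<Rightarrow> real" where i: "inj_on i T" by (rule inj_on_real_of_nat_sets)
  define P where "P = i ` T"
  define j where "j = inv_into T i"
  have j: "j w \<in> T" "i (j w) = w" if "w \<in> P" for w
    using that by (auto simp: P_def j_def inv_into_into f_inv_into_f)
  have ji: "j (i t) = t" if "t \<in> T" for t using that i by (simp add: j_def)
  define evl where "evl f = (\<lambda>w\<in>P. j w f)" for f
  define \<Phi> where "\<Phi> = evl ` F"
  \<comment> \<open>Off the union of the null balls with dense centres, every neighbourhood of a
    point has positive mass. Only countably many balls are removed, hence a null set.\<close>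
  define G where "G = space M - (\<Union>n. \<Union>k. if measure M (B (pt (c n)) (1 / Suc k)) = 0 then B (pt (c n)) (1 / Suc k) else {})"
  have Gm: "G \<in> sets M" unfolding G_def by (auto intro!: sets.Diff sets.countable_UN)
  have "(\<Union>n. \<Union>k. if measure M (B (pt (c n)) (1 / Suc k)) = 0 then B (pt (c n)) (1 / Suc k) else {}) \<in> null_sets M"
    by (intro null_sets_UN) (auto simp: null_sets_def M.emeasure_eq_measure)
  then have G1: "measure M G = 1"
    unfolding G_def by (subst M.prob_compl) (auto simp: null_sets_def M.emeasure_eq_measure)
  have atT: "pt x \<in> T" if x: "x \<in> G" for x
  proof -
    have xM: "x \<in> space M" using x by (auto simp: G_def)
    have "0 < measure M (B (pt x) e)" if e: "0 < e" for e
    proof -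
      obtain k where k: "1 / real (Suc k) < e / 2" using nat_approx_posE[of "e/2"] e by auto
      obtain n where n: "\<forall>f\<in>F. \<bar>f x - f (c n)\<bar> \<le> 1 / Suc k" using c(2)[OF xM, of "1 / Suc k"] by auto
      have "x \<in> B (pt (c n)) (1 / Suc k)" using n xM by (auto simp: B_def pt_def)
      then have "measure M (B (pt (c n)) (1 / Suc k)) \<noteq> 0" using x unfolding G_def by (auto split: if_splits)
      then have "0 < measure M (B (pt (c n)) (1 / Suc k))" using measure_nonneg[of M] by (metis less_eq_real_def)
      also have "\<dots> \<le> measure M (B (pt x) e)"
      proof (rule M.finite_measure_mono)
        show "B (pt (c n)) (1 / Suc k) \<subseteq> B (pt x) e"
        proof
          fix y assume y: "y \<in> B (pt (c n)) (1 / Suc k)"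
          have "\<bar>f y - f x\<bar> \<le> e" if f: "f \<in> F" for f
          proof -
            have "\<bar>f y - f (c n)\<bar> \<le> 1 / Suc k" "\<bar>f x - f (c n)\<bar> \<le> 1 / Suc k" using y n f by (auto simp: B_def pt_def)
            then show ?thesis using k by linarith
          qed
          then show "y \<in> B (pt x) e" using y by (auto simp: B_def pt_def)
        qed
      qed simp
      finally show ?thesis .
    qed
    then show ?thesis by (simp add: T_def pt_def)
  qed
  have "G \<noteq> {}" using G1 by auto
  then have "T \<noteq> {}" using atT by blast
  \<comment> \<open>On the null set outside \<open>G\<close> the value is a fixed but arbitrary
    point of the quotient.\<close>
  define q where "q x = (if x \<in> G then i (pt x) else i (SOME t. t \<in> T))" for x
  have qP: "q x \<in> P" for x using atT \<open>T \<noteq> {}\<close> by (auto simp: q_def P_def some_in_eq)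
  have evq: "evl f (q x) = f x" if "x \<in> G" "f \<in> F" for x f
    using that atT[OF that(1)] qP[of x] by (simp add: evl_def q_def ji pt_def)
  have evj: "evl f w = j w f" if "w \<in> P" for f w using that by (simp add: evl_def)
  have ballq: "AE x in M. x \<in> B (j w) e \<longleftrightarrow> (x \<in> space M \<and> (\<forall>f\<in>\<Phi>. \<bar>f (q x) - f w\<bar> \<le> e))" if "w \<in> P" for w e
  proof -
    have "AE x in M. x \<in> G" using G1 Gm M.prob_eq_1 by auto
    then show ?thesis
      by eventually_elim (use that sets.sets_into_space[OF Gm] in \<open>auto simp: B_def \<Phi>_def evq evj\<close>)
  qed
  have "\<exists>b::nat \<Rightarrow> real. (\<forall>n. b n \<in> P) \<and> (\<forall>w\<in>P. \<forall>e>0. \<exists>n. \<forall>f\<in>\<Phi>. \<bar>f (b n) - f w\<bar> \<le> e)"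
  proof -
    \<comment> \<open>The dense points \<open>c n\<close> may lie off the support, so they cannot
      serve as dense points of the quotient. For each \<open>c n\<close> and radius a quotient point
      within that radius is chosen instead, if there is one.\<close>
    define R where "R k w \<longleftrightarrow> w \<in> P \<and> (\<forall>f\<in>F. \<bar>evl f w - f (c (fst (prod_decode k)))\<bar> \<le> 1 / Suc (snd (prod_decode k)))" for k w
    obtain w0 where w0: "w0 \<in> P" using \<open>T \<noteq> {}\<close> by (auto simp: P_def)
    define b where "b k = (if \<exists>w. R k w then SOME w. R k w else w0)" for k
    have bP: "b k \<in> P" for k using w0 someI_ex[of "R k"] by (auto simp: b_def R_def)
    have "\<exists>n. \<forall>f\<in>\<Phi>. \<bar>f (b n) - f w\<bar> \<le> e" if w: "w \<in> P" and e: "0 < e" for w e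
    proof -
      obtain k where k: "1 / real (Suc k) < e / 2" using nat_approx_posE[of "e/2"] e by auto
      obtain n where n: "\<forall>f\<in>F. \<bar>j w f - f (c n)\<bar> \<le> 1 / Suc k" using nearc[OF j(1)[OF w], of "1 / Suc k"] by auto
      let ?k = "prod_encode (n, k)"
      have "R ?k w" using n w by (simp add: R_def evj)
      then have "R ?k (b ?k)" unfolding b_def using someI[of "R ?k" w] by auto
      have "\<bar>evl f (b ?k) - evl f w\<bar> \<le> e" if f: "f \<in> F" for f
      proof -
        have "\<bar>evl f (b ?k) - f (c n)\<bar> \<le> 1 / Suc k" "\<bar>evl f w - f (c n)\<bar> \<le> 1 / Suc k"
          using \<open>R ?k w\<close> \<open>R ?k (b ?k)\<close> f by (auto simp: R_def)
        then show ?thesis using k by linarith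
      qed
      then show ?thesis by (auto simp: \<Phi>_def)
    qed
    then show ?thesis using bP by blast
  qed
  then obtain b :: "nat \<Rightarrow> real" where b: "\<And>n. b n \<in> P" "\<And>w e. w \<in> P \<Longrightarrow> 0 < e \<Longrightarrow> \<exists>n. \<forall>f\<in>\<Phi>. \<bar>f (b n) - f w\<bar> \<le> e" by blast
  have "gd_set (gd_build P \<Phi> M q) \<and> q \<in> M \<rightarrow>\<^sub>M msr (gd_build P \<Phi> M q) \<and> distr M (msr (gd_build P \<Phi> M q)) q = msr (gd_build P \<Phi> M q)"
  proof (rule gd_build_gd_set[where c=b])
    show "\<Phi> \<noteq> {}" using ne by (simp add: \<Phi>_def)
    show "\<Phi> \<subseteq> extensional P" by (auto simp: \<Phi>_def evl_def)
    show "\<exists>C. \<forall>f\<in>\<Phi>. \<bar>f x - f y\<bar> \<le> C" if xy: "x \<in> P" "y \<in> P" for x y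
    proof -
      obtain x' where x': "x' \<in> space M" "\<forall>f\<in>F. \<bar>f x' - j x f\<bar> \<le> 1" using near[OF j(1)[OF xy(1)], of 1] by auto
      obtain y' where y': "y' \<in> space M" "\<forall>f\<in>F. \<bar>f y' - j y f\<bar> \<le> 1" using near[OF j(1)[OF xy(2)], of 1] by auto
      obtain C where C: "\<forall>f\<in>F. \<bar>f x' - f y'\<bar> \<le> C" using bd[OF x'(1) y'(1)] by blast
      have "\<bar>evl f x - evl f y\<bar> \<le> C + 2" if f: "f \<in> F" for f
      proof -
        have "\<bar>f x' - j x f\<bar> \<le> 1" "\<bar>f y' - j y f\<bar> \<le> 1" "\<bar>f x' - f y'\<bar> \<le> C" using x' y' C f by auto
        then show ?thesis using xy by (simp add: evj)
      qed
      then show ?thesis by (auto simp: \<Phi>_def)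
    qed
    show "x = y" if xy: "x \<in> P" "y \<in> P" and eq: "\<And>f. f \<in> \<Phi> \<Longrightarrow> f x = f y" for x y
    proof -
      have "j x f = j y f" if "f \<in> F" for f using eq[of "evl f"] that xy by (simp add: \<Phi>_def evj)
      then have "j x = j y" using j(1)[OF xy(1)] j(1)[OF xy(2)] by (intro extensionalityI[of _ F]) (auto simp: T_def)
      then show ?thesis using j(2) xy by metis
    qed
    show "q w \<in> P" for w by (rule qP)
    fix x :: real and e :: real assume x: "x \<in> P" and e: "0 < e"
    let ?A = "{w \<in> space M. \<forall>f\<in>\<Phi>. \<bar>f (q w) - f x\<bar> \<le> e}"
    \<comment> \<open>Measurability has to hold exactly and not only up to a null set. Outside
      \<open>G\<close> the map \<open>q\<close> is constant, so that part is either everything or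
      nothing.\<close>
    have eq: "?A = (B (j x) e \<inter> G) \<union> (if (\<forall>f\<in>\<Phi>. \<bar>f (i (SOME t. t \<in> T)) - f x\<bar> \<le> e) then space M - G else {})"
      (is "_ = ?R")
    proof (rule set_eqI)
      fix w
      show "w \<in> ?A \<longleftrightarrow> w \<in> ?R"
      proof (cases "w \<in> G")
        case True
        then show ?thesis using sets.sets_into_space[OF Gm] x by (auto simp: B_def \<Phi>_def evj evq)
      next
        case False
        then have "q w = i (SOME t. t \<in> T)" by (simp add: q_def)
        then show ?thesis using False by auto
      qed
    qed
    show Am: "?A \<in> sets M" unfolding eq using Gm by auto
    have "0 < measure M (B (j x) e)" using j(1)[OF x] e by (auto simp: T_def)
    also have "measure M (B (j x) e) = measure M ?A"
      by (rule M.finite_measure_eq_AE) (use ballq[OF x, of e] Am in auto)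
    finally show "0 < measure M ?A" .
  next
    fix \<sigma> :: "nat \<Rightarrow> real" assume s: "\<And>n. \<sigma> n \<in> P"
      and C: "\<And>e. 0 < e \<Longrightarrow> \<exists>N. \<forall>m\<ge>N. \<forall>n\<ge>N. \<forall>f\<in>\<Phi>. \<bar>f (\<sigma> m) - f (\<sigma> n)\<bar> \<le> e"
    have C': "\<exists>N. \<forall>m\<ge>N. \<forall>n\<ge>N. \<forall>f\<in>F. \<bar>j (\<sigma> m) f - j (\<sigma> n) f\<bar> \<le> e" if "0 < e" for e
      using C[OF that] s by (auto simp: \<Phi>_def evj)
    have "Cauchy (\<lambda>n. j (\<sigma> n) f)" if f: "f \<in> F" for f
    proof (rule metric_CauchyI)
      fix e :: real assume "0 < e"
      then obtain N where N: "\<forall>m\<ge>N. \<forall>n\<ge>N. \<forall>f\<in>F. \<bar>j (\<sigma> m) f - j (\<sigma> n) f\<bar> \<le> e/2" using C'[of "e/2"] by auto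
      show "\<exists>M. \<forall>m\<ge>M. \<forall>n\<ge>M. dist (j (\<sigma> m) f) (j (\<sigma> n) f) < e"
      proof (intro exI[of _ N] allI impI)
        fix m n assume "N \<le> m" "N \<le> n"
        then have "\<bar>j (\<sigma> m) f - j (\<sigma> n) f\<bar> \<le> e/2" using N f by blast
        then show "dist (j (\<sigma> m) f) (j (\<sigma> n) f) < e" using \<open>0 < e\<close> by (simp add: dist_real_def)
      qed
    qed
    then have lim: "(\<lambda>n. j (\<sigma> n) f) \<longlonglongrightarrow> lim (\<lambda>n. j (\<sigma> n) f)" if "f \<in> F" for f
      using that Cauchy_convergent convergent_LIMSEQ_iff by blast
    define t where "t = (\<lambda>f\<in>F. lim (\<lambda>n. j (\<sigma> n) f))"
    have u: "\<exists>N. \<forall>n\<ge>N. \<forall>f\<in>F. \<bar>j (\<sigma> n) f - t f\<bar> \<le> e" if e: "0 < e" for e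
    proof -
      obtain N where N: "\<forall>m\<ge>N. \<forall>n\<ge>N. \<forall>f\<in>F. \<bar>j (\<sigma> m) f - j (\<sigma> n) f\<bar> \<le> e" using C'[OF e] by blast
      have "\<bar>j (\<sigma> n) f - t f\<bar> \<le> e" if "N \<le> n" "f \<in> F" for n f
      proof (rule LIMSEQ_le_const2)
        show "(\<lambda>m. \<bar>j (\<sigma> n) f - j (\<sigma> m) f\<bar>) \<longlonglongrightarrow> \<bar>j (\<sigma> n) f - t f\<bar>"
          using lim[OF that(2)] that(2) by (intro tendsto_intros) (simp add: t_def)
        show "\<exists>M. \<forall>m\<ge>M. \<bar>j (\<sigma> n) f - j (\<sigma> m) f\<bar> \<le> e" using N that by blast
      qed
      then show ?thesis by blast
    qed
    have "0 < measure M (B t e)" if e: "0 < e" for e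
    proof -
      obtain n where n: "\<forall>f\<in>F. \<bar>j (\<sigma> n) f - t f\<bar> \<le> e/2" using u[of "e/2"] e by auto
      have "0 < measure M (B (j (\<sigma> n)) (e/2))" using j(1)[OF s[of n]] e by (auto simp: T_def)
      also have "\<dots> \<le> measure M (B t e)"
      proof (rule M.finite_measure_mono)
        show "B (j (\<sigma> n)) (e/2) \<subseteq> B t e"
        proof
          fix y assume y: "y \<in> B (j (\<sigma> n)) (e/2)"
          have "\<bar>f y - t f\<bar> \<le> e" if f: "f \<in> F" for f
          proof -
            have "\<bar>f y - j (\<sigma> n) f\<bar> \<le> e/2" "\<bar>j (\<sigma> n) f - t f\<bar> \<le> e/2" using y n f by (auto simp: B_def)
            then show ?thesis by linarith
          qed
          then show "y \<in> B t e" using y by (auto simp: B_def)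
        qed
      qed simp
      finally show ?thesis .
    qed
    then have tT: "t \<in> T" by (simp add: T_def t_def)
    have iP: "i t \<in> P" using tT by (simp add: P_def)
    show "\<exists>x\<in>P. \<forall>e>0. \<exists>N. \<forall>n\<ge>N. \<forall>f\<in>\<Phi>. \<bar>f (\<sigma> n) - f x\<bar> \<le> e"
      using u by (intro bexI[OF _ iP]) (auto simp: \<Phi>_def evj s iP ji[OF tT])
  qed (use M b in auto)
  moreover have "G = space M" if "\<And>x e. x \<in> space M \<Longrightarrow> 0 < e \<Longrightarrow> 0 < measure M {y \<in> space M. \<forall>f\<in>F. \<bar>f y - f x\<bar> \<le> e}"
  proof -
    have "0 < measure M (B (pt (c n)) (1 / Suc k))" for n k
      using that[OF c(1), of "1 / Suc k" n] by (simp add: B_def pt_def cong: ball_cong)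
    then have "measure M (B (pt (c n)) (1 / Suc k)) \<noteq> 0" for n k by (metis less_irrefl)
    then show ?thesis by (simp add: G_def)
  qed
  moreover have "\<exists>x\<in>space M. \<forall>f\<in>F. \<bar>f x - evl f w\<bar> \<le> e" if "w \<in> P" "0 < e" for w e
    using near[OF j(1)[OF that(1)] that(2)] that by (simp add: evj)
  ultimately show thesis
    using Gm G1 evq by (intro that[of "gd_build P \<Phi> M q" q evl G]) (auto simp: gd_build_def \<Phi>_def)
qed

section \<open>Quotients of gd-sets by families of observables\<close>

lemma Lip1_R_le: "\<phi> \<in> Lip1_R \<Longrightarrow> \<bar>\<phi> s - \<phi> t\<bar> \<le> \<bar>s - t\<bar>"
  using lipschitz_onD[of 1 UNIV \<phi> s t] by (auto simp: Lip1_R_def dist_real_def)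

lemma Lip1_R_tendsto:
  assumes "\<phi> \<in> Lip1_R" "(f \<longlongrightarrow> l) F"
  shows "((\<lambda>x. \<phi> (f x)) \<longlongrightarrow> \<phi> l) F"
proof (rule tendsto_compose[OF _ assms(2)])
  have "continuous_on UNIV \<phi>" using assms(1) by (auto simp: Lip1_R_def intro: lipschitz_on_continuous_on)
  then show "(\<phi> \<longlongrightarrow> \<phi> l) (at l)" by (simp add: continuous_on_def)
qed

lemma L_gd_setI:
  assumes X: "gd_set X" and L: "L \<subseteq> Lip1_R"
    and inv: "\<And>\<phi> f. \<phi> \<in> L \<Longrightarrow> f \<in> obs X \<Longrightarrow> compose (pts X) \<phi> f \<in> gd_closure X"
  shows "L_gd_set L X"
  unfolding L_gd_set_def
proof (intro conjI X ballI)
  fix \<phi> f assume \<phi>: "\<phi> \<in> L" and f: "f \<in> gd_closure X"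
  obtain fs where fs: "\<And>n::nat. fs n \<in> obs X" "\<And>x. x \<in> pts X \<Longrightarrow> (\<lambda>n. fs n x) \<longlonglongrightarrow> f x"
    by (rule gd_closure_limit_of_obs[OF X f]) blast
  show "compose (pts X) \<phi> f \<in> gd_closure X"
  proof (rule gd_closure_limit[OF X, where fs="\<lambda>n. compose (pts X) \<phi> (fs n)"])
    show "(\<lambda>n. compose (pts X) \<phi> (fs n) x) \<longlonglongrightarrow> compose (pts X) \<phi> f x" if x: "x \<in> pts X" for x
    proof -
      have "\<phi> \<in> Lip1_R" using \<phi> L by blast
      from Lip1_R_tendsto[OF this fs(2)[OF x]] show ?thesis using x by (simp add: compose_def)
    qed
  qed (use inv \<phi> fs(1) in \<open>auto simp: compose_def\<close>)
qed

text \<open>Points of \<open>W\<close> need not come from points of \<open>S\<close>; they are only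
  approximated by them, uniformly over \<open>F\<close>. The relation between \<open>f'\<close> and
  \<open>f\<close> on \<open>S\<close> therefore passes to \<open>W\<close> by approximation,
  \<open>\<phi>\<close> being 1-Lipschitz.\<close>

lemma real_quotient_L_gd_set:
  assumes W: "gd_set W" and obs: "obs W = evl ` F" and L: "L \<subseteq> Lip1_R"
    and near: "\<And>w e. w \<in> pts W \<Longrightarrow> 0 < e \<Longrightarrow> \<exists>x\<in>S. \<forall>f\<in>F. \<bar>f x - evl f w\<bar> \<le> e"
    and inv: "\<And>\<phi> f. \<phi> \<in> L \<Longrightarrow> f \<in> F \<Longrightarrow> \<exists>f'\<in>F. \<forall>x\<in>S. f' x = \<phi> (f x)"
  shows "L_gd_set L W"
proof (rule L_gd_setI[OF W L])
  fix \<phi> g assume \<phi>: "\<phi> \<in> L" and "g \<in> obs W"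
  then obtain f where f: "f \<in> F" "g = evl f" using obs by auto
  obtain f' where f': "f' \<in> F" "\<And>x. x \<in> S \<Longrightarrow> f' x = \<phi> (f x)" using inv[OF \<phi> f(1)] by blast
  have "\<phi> (evl f w) = evl f' w" if w: "w \<in> pts W" for w
  proof (rule ccontr)
    assume n: "\<phi> (evl f w) \<noteq> evl f' w"
    define e where "e = \<bar>\<phi> (evl f w) - evl f' w\<bar> / 3"
    have "0 < e" using n by (simp add: e_def)
    then obtain x where x: "x \<in> S" "\<forall>f\<in>F. \<bar>f x - evl f w\<bar> \<le> e"
      using near[OF w] by blast
    have "\<bar>f x - evl f w\<bar> \<le> e" using x(2) f(1) by blast
    moreover have "\<bar>f' x - evl f' w\<bar> \<le> e" using x(2) f'(1) by blast
    then have "\<bar>\<phi> (f x) - evl f' w\<bar> \<le> e" using f'(2)[OF x(1)] by simp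
    moreover have "\<bar>\<phi> (f x) - \<phi> (evl f w)\<bar> \<le> \<bar>f x - evl f w\<bar>" using Lip1_R_le \<phi> L by blast
    ultimately have "\<bar>\<phi> (evl f w) - evl f' w\<bar> \<le> 2 * e" by linarith
    moreover have "\<bar>\<phi> (evl f w) - evl f' w\<bar> = 3 * e" by (simp add: e_def)
    ultimately show False using \<open>0 < e\<close> by simp
  qed
  moreover have "evl f' \<in> extensional (pts W)" using obs_extensional[OF W] obs f'(1) by auto
  ultimately have "compose (pts W) \<phi> g = evl f'"
    by (intro extensionalityI[of _ "pts W"]) (auto simp: compose_def f(2))
  then show "compose (pts W) \<phi> g \<in> gd_closure W" using obs_subset_closure[OF W] obs f'(1) by auto
qed

text \<open>Full support of \<open>X\<close> means that no point is discarded, so the observables of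
  \<open>W\<close> pull back to the functions in \<open>F\<close> at every point and
  \<open>q\<close> is a domination.\<close>

lemma gd_quotient:
  fixes X :: "'a gdset"
  assumes X: "gd_set X" and F: "F \<subseteq> gd_closure X" "F \<noteq> {}"
  obtains W :: "real gdset" and q evl where "gd_set W" "domination X W q" "obs W = evl ` F"
    "\<And>x f. x \<in> pts X \<Longrightarrow> f \<in> F \<Longrightarrow> evl f (q x) = f x"
    "\<And>w e. w \<in> pts W \<Longrightarrow> 0 < e \<Longrightarrow> \<exists>x\<in>pts X. \<forall>f\<in>F. \<bar>f x - evl f w\<bar> \<le> e"
    "\<And>L. L \<subseteq> Lip1_R \<Longrightarrow> (\<And>\<phi> f. \<phi> \<in> L \<Longrightarrow> f \<in> F \<Longrightarrow> compose (pts X) \<phi> f \<in> F) \<Longrightarrow> L_gd_set L W"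
proof -
  interpret prob_space "msr X" by (rule gd_prob[OF X])
  obtain c where c: "\<And>n::nat. c n \<in> pts X" "\<And>x e. x \<in> pts X \<Longrightarrow> 0 < e \<Longrightarrow> \<exists>n. gd_dist X (c n) x < e"
    by (rule gd_dense[OF X]) blast
  have le: "\<bar>f x - f y\<bar> \<le> gd_dist X x y" if "f \<in> F" "x \<in> pts X" "y \<in> pts X" for f x y
    using closure_le_dist[OF X] F that by blast
  have ball: "{x \<in> space (msr X). \<forall>f\<in>F. \<bar>f x - t f\<bar> \<le> e} \<in> sets (msr X)" for t e
  proof -
    have "openin (gd_top X) (pts X - {x \<in> pts X. \<forall>f\<in>F. \<bar>f x - t f\<bar> \<le> e})"
      unfolding gd_openin[OF X]
    proof (intro conjI ballI)
      fix x assume "x \<in> pts X - {x \<in> pts X. \<forall>f\<in>F. \<bar>f x - t f\<bar> \<le> e}"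
      then obtain f where f: "x \<in> pts X" "f \<in> F" "e < \<bar>f x - t f\<bar>" by auto
      have "e < \<bar>f y - t f\<bar>" if "y \<in> pts X" "gd_dist X x y < \<bar>f x - t f\<bar> - e" for y
        using le[OF f(2,1) that(1)] that(2) by linarith
      then show "\<exists>r>0. \<forall>y\<in>pts X. gd_dist X x y < r \<longrightarrow> y \<in> pts X - {x \<in> pts X. \<forall>f\<in>F. \<bar>f x - t f\<bar> \<le> e}"
        using f by (intro exI[of _ "\<bar>f x - t f\<bar> - e"]) force
    qed auto
    then have "space (msr X) - (pts X - {x \<in> pts X. \<forall>f\<in>F. \<bar>f x - t f\<bar> \<le> e}) \<in> sets (msr X)"
      by (intro sets.compl_sets gd_open_measurable X)
    moreover have "space (msr X) - (pts X - {x \<in> pts X. \<forall>f\<in>F. \<bar>f x - t f\<bar> \<le> e}) = {x \<in> space (msr X). \<forall>f\<in>F. \<bar>f x - t f\<bar> \<le> e}"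
      using X by auto
    ultimately show ?thesis by simp
  qed
  have pos: "0 < measure (msr X) {y \<in> space (msr X). \<forall>f\<in>F. \<bar>f y - f x\<bar> \<le> e}" if x: "x \<in> space (msr X)" and e: "0 < e" for x e
  proof -
    have x': "x \<in> pts X" using x X by simp
    have U: "openin (gd_top X) {y \<in> pts X. gd_dist X x y < e}" by (rule gd_ball_open[OF x' X])
    have "0 < measure (msr X) {y \<in> pts X. gd_dist X x y < e}"
      by (rule gd_full_support[OF X U, of x]) (simp add: x' e gd_dist_self[OF X])
    also have "\<dots> \<le> measure (msr X) {y \<in> space (msr X). \<forall>f\<in>F. \<bar>f y - f x\<bar> \<le> e}"
      using le x' X ball[of "\<lambda>f. f x"] by (intro finite_measure_mono) (fastforce simp: abs_minus_commute)+
    finally show ?thesis .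
  qed
  have bd: "\<exists>C. \<forall>f\<in>F. \<bar>f x - f y\<bar> \<le> C" if "x \<in> space (msr X)" "y \<in> space (msr X)" for x y
    using le that X by auto
  have dn: "\<exists>n. \<forall>f\<in>F. \<bar>f x - f (c n)\<bar> \<le> e" if x: "x \<in> space (msr X)" and e: "0 < e" for x e
  proof -
    have x': "x \<in> pts X" using x X by simp
    obtain n where "gd_dist X (c n) x < e" using c(2)[OF x' e] by blast
    then show ?thesis using le[OF _ c(1) x', of _ n] by (intro exI[of _ n]) (force simp: abs_minus_commute)
  qed
  obtain W :: "real gdset" and q evl G where W: "gd_set W" "q \<in> msr X \<rightarrow>\<^sub>M msr W" "distr (msr X) (msr W) q = msr W"
    "obs W = evl ` F" "\<And>x f. x \<in> G \<Longrightarrow> f \<in> F \<Longrightarrow> evl f (q x) = f x" "G = space (msr X)"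
    "\<And>w e. w \<in> pts W \<Longrightarrow> 0 < e \<Longrightarrow> \<exists>x\<in>space (msr X). \<forall>f\<in>F. \<bar>f x - evl f w\<bar> \<le> e"
  proof (rule real_quotient[of "msr X" F c])
    show "c n \<in> space (msr X)" for n using c(1) X by simp
  qed (use gd_prob[OF X] F(2) bd dn ball pos in auto)
  have evq: "evl f (q x) = f x" if "x \<in> pts X" "f \<in> F" for x f using W(5,6) X that by simp
  have near: "\<exists>x\<in>pts X. \<forall>f\<in>F. \<bar>f x - evl f w\<bar> \<le> e" if "w \<in> pts W" "0 < e" for w e using W(7)[OF that] X by simp
  have "compose (pts X) (evl f) q = f" if f: "f \<in> F" for f
    using evq f F(1) gd_closure_extensional[OF X] by (intro extensionalityI[of _ "pts X"]) (auto simp: compose_def)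
  then have dom: "domination X W q" using W F(1) by (auto simp: domination_def)
  have "L_gd_set L W" if L: "L \<subseteq> Lip1_R" and inv: "\<And>\<phi> f. \<phi> \<in> L \<Longrightarrow> f \<in> F \<Longrightarrow> compose (pts X) \<phi> f \<in> F" for L
  proof (rule real_quotient_L_gd_set[OF W(1,4) L near])
    fix \<phi> f assume "\<phi> \<in> L" "f \<in> F"
    then show "\<exists>f'\<in>F. \<forall>x\<in>pts X. f' x = \<phi> (f x)"
      by (intro bexI[OF _ inv]) (auto simp: compose_def)
  qed
  then show thesis using that[OF W(1) dom W(4) evq near] by blast
qed

text \<open>Maps in \<open>L\<close> do not expand distances and preserve both closures, so a pair
  \<open>f\<close>, \<open>g\<close> matched on \<open>S\<close> stays matched after composition
  with such a map. Hence \<open>F\<close> is closed under \<open>L\<close> and the quotient remains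
  in the category.\<close>

lemma dominated_approx:
  fixes X :: "'a gdset" and Y :: "'b gdset"
  assumes X: "L_gd_set L X" and Y: "L_gd_set L Y" and L: "L \<subseteq> Lip1_R" and le: "box_le Y X < e"
  obtains W where "W \<in> LD L" "dominated W X" "gd_box Y W \<le> e"
proof -
  have gX: "gd_set X" and gY: "gd_set Y" using X Y by (auto simp: L_gd_set_def)
  obtain p S where p: "p \<in> couplings X Y" "closedin (gd_prod_top X Y) S" "1 - e \<le> measure p S" "0 < e"
    "near (S\<inverse>) (e/2) (gd_closure Y) (gd_closure X)" by (rule box_leD[OF gX gY le]) blast
  note c = couplingD[OF gX gY p(1)]
  have S: "S \<subseteq> pts X \<times> pts Y" using closedin_subset[OF p(2)] gd_prod_topspace[OF gX gY] by simp
  define F where "F = {f \<in> gd_closure X. \<exists>g\<in>gd_closure Y. \<forall>(x, y)\<in>S. \<bar>f x - g y\<bar> \<le> e/2}"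
  have nr: "\<exists>f\<in>F. \<forall>(x, y)\<in>S. \<bar>f x - g y\<bar> \<le> e/2" if g: "g \<in> gd_closure Y" for g
  proof -
    obtain f where f: "f \<in> gd_closure X" "\<forall>(y, x)\<in>S\<inverse>. \<bar>g y - f x\<bar> \<le> e/2" using p(5) g unfolding near_def by blast
    then have "\<forall>(x, y)\<in>S. \<bar>f x - g y\<bar> \<le> e/2" by (auto simp: abs_minus_commute)
    then show ?thesis using f(1) g by (auto simp: F_def)
  qed
  have "F \<noteq> {}" using nr gd_closure_nonempty[OF gY] by blast
  moreover have "F \<subseteq> gd_closure X" by (auto simp: F_def)
  ultimately obtain W :: "real gdset" and q evl where W: "gd_set W" "domination X W q" "obs W = evl ` F"
    "\<And>x f. x \<in> pts X \<Longrightarrow> f \<in> F \<Longrightarrow> evl f (q x) = f x"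
    and inv: "L \<subseteq> Lip1_R \<Longrightarrow> (\<And>\<phi> f. \<phi> \<in> L \<Longrightarrow> f \<in> F \<Longrightarrow> compose (pts X) \<phi> f \<in> F) \<Longrightarrow> L_gd_set L W"
    using gd_quotient[OF gX] by metis
  have LW: "L_gd_set L W"
  proof (rule inv[OF L])
    fix \<phi> f assume \<phi>: "\<phi> \<in> L" and f: "f \<in> F"
    obtain g where g: "g \<in> gd_closure Y" "\<And>x y. (x, y) \<in> S \<Longrightarrow> \<bar>f x - g y\<bar> \<le> e/2" using f by (auto simp: F_def)
    have "\<bar>compose (pts X) \<phi> f x - compose (pts Y) \<phi> g y\<bar> \<le> e/2" if xy: "(x, y) \<in> S" for x y
    proof -
      have "\<bar>\<phi> (f x) - \<phi> (g y)\<bar> \<le> \<bar>f x - g y\<bar>" using Lip1_R_le \<phi> L by blast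
      then show ?thesis using g(2)[OF xy] xy S by (auto simp: compose_def)
    qed
    moreover have "compose (pts X) \<phi> f \<in> gd_closure X" using X \<phi> f by (auto simp: L_gd_set_def F_def)
    moreover have "compose (pts Y) \<phi> g \<in> gd_closure Y" using Y \<phi> g by (auto simp: L_gd_set_def)
    ultimately show "compose (pts X) \<phi> f \<in> F" unfolding F_def by blast
  qed
  have q: "q \<in> msr X \<rightarrow>\<^sub>M msr W" "distr (msr X) (msr W) q = msr W" using W(2) by (auto simp: domination_def)
  interpret YW: gd_pair Y W p snd "q \<circ> fst"
  proof (rule gd_pair.intro[OF gY W(1) c(1) c(5) c(7)])
    show "q \<circ> fst \<in> p \<rightarrow>\<^sub>M msr W" by (rule measurable_comp[OF c(4) q(1)])
    show "distr p (msr W) (q \<circ> fst) = msr W" using distr_distr[OF q(1) c(4)] c(6) q(2) by simp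
  qed
  have "gd_box Y W \<le> e"
  proof (rule YW.gd_box_pair)
    show "S \<in> sets p" by (rule closed_measurable[OF gX gY p(1,2)])
    fix g assume "g \<in> obs Y"
    then obtain f where f: "f \<in> F" "\<forall>(x, y)\<in>S. \<bar>f x - g y\<bar> \<le> e/2" using nr obs_subset_closure[OF gY] by blast
    have "\<bar>g (snd w) - evl f ((q \<circ> fst) w)\<bar> \<le> e/2" if "w \<in> S" for w
    proof (cases w)
      case (Pair x y)
      then have "\<bar>f x - g y\<bar> \<le> e/2" "x \<in> pts X" using that f(2) S by auto
      then show ?thesis using W(4)[of x f] f(1) Pair by (simp add: abs_minus_commute)
    qed
    then show "\<exists>h\<in>gd_closure W. \<forall>w\<in>S. \<bar>g (snd w) - h ((q \<circ> fst) w)\<bar> \<le> e/2"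
      using f(1) W(3) obs_subset_closure[OF W(1), of "evl f"] by blast
  next
    fix h assume "h \<in> obs W"
    then obtain f where f: "f \<in> F" "h = evl f" using W(3) by auto
    then obtain g where g: "g \<in> gd_closure Y" "\<forall>(x, y)\<in>S. \<bar>f x - g y\<bar> \<le> e/2" by (auto simp: F_def)
    have "\<bar>g (snd w) - h ((q \<circ> fst) w)\<bar> \<le> e/2" if "w \<in> S" for w
    proof (cases w)
      case (Pair x y)
      then have "\<bar>f x - g y\<bar> \<le> e/2" "x \<in> pts X" using that g(2) S by auto
      then show ?thesis using W(4)[of x f] f Pair by (simp add: abs_minus_commute)
    qed
    then show "\<exists>g\<in>gd_closure Y. \<forall>w\<in>S. \<bar>g (snd w) - h ((q \<circ> fst) w)\<bar> \<le> e/2" using g(1) by blast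
  qed (use p in auto)
  moreover have "W \<in> LD L" using LW by (simp add: LD_def)
  moreover have "dominated W X" using W(2) by (auto simp: dominated_def)
  ultimately show thesis using that by blast
qed

text \<open>The quotient by the whole closure is isometric. Its points are limits of images of
  points of \<open>Y\<close>, and since \<open>Y\<close> is complete they are images
  themselves.\<close>

lemma real_copy:
  fixes Y :: "'b gdset"
  assumes Y: "L_gd_set L Y" and L: "L \<subseteq> Lip1_R"
  obtains Z where "Z \<in> LD L" "gd_iso Z Y"
proof -
  have gY: "gd_set Y" using Y by (simp add: L_gd_set_def)
  obtain W :: "real gdset" and q evl where W: "gd_set W" "domination Y W q" "obs W = evl ` gd_closure Y"
    "\<And>x f. x \<in> pts Y \<Longrightarrow> f \<in> gd_closure Y \<Longrightarrow> evl f (q x) = f x"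
    and near: "\<And>w e. w \<in> pts W \<Longrightarrow> 0 < e \<Longrightarrow> \<exists>x\<in>pts Y. \<forall>f\<in>gd_closure Y. \<bar>f x - evl f w\<bar> \<le> e"
    and inv: "L \<subseteq> Lip1_R \<Longrightarrow> (\<And>\<phi> f. \<phi> \<in> L \<Longrightarrow> f \<in> gd_closure Y \<Longrightarrow> compose (pts Y) \<phi> f \<in> gd_closure Y) \<Longrightarrow> L_gd_set L W"
    using gd_quotient[OF gY subset_refl gd_closure_nonempty[OF gY]] by metis
  have LW: "W \<in> LD L" using inv[OF L] Y by (auto simp: LD_def L_gd_set_def)
  have q: "q \<in> msr Y \<rightarrow>\<^sub>M msr W" "distr (msr Y) (msr W) q = msr W" using W(2) by (auto simp: domination_def)
  have qP: "q y \<in> pts W" if "y \<in> pts Y" for y using measurable_space[OF q(1)] that gY W(1) by simp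
  have dq: "gd_dist W (q x) (q y) = gd_dist Y x y" if xy: "x \<in> pts Y" "y \<in> pts Y" for x y
  proof (rule antisym)
    show "gd_dist W (q x) (q y) \<le> gd_dist Y x y"
      using W(3,4) xy closure_le_dist[OF gY _ xy] by (intro gd_dist_least W(1) qP) auto
    show "gd_dist Y x y \<le> gd_dist W (q x) (q y)"
    proof (rule gd_dist_least[OF gY xy])
      fix f assume "f \<in> obs Y"
      then have f: "f \<in> gd_closure Y" by (rule obs_subset_closure[OF gY])
      then have "evl f \<in> obs W" using W(3) by auto
      from obs_le_dist[OF W(1) this qP[OF xy(1)] qP[OF xy(2)]]
      show "\<bar>f x - f y\<bar> \<le> gd_dist W (q x) (q y)" using W(4)[OF xy(1) f] W(4)[OF xy(2) f] by simp
    qed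
  qed
  interpret MY: Metric_space "pts Y" "gd_dist Y" by (rule gd_metric[OF gY])
  interpret MW: Metric_space "pts W" "gd_dist W" by (rule gd_metric[OF W(1)])
  have inj: "x = y" if "x \<in> pts Y" "y \<in> pts Y" "q x = q y" for x y
    using dq[OF that(1,2)] that gd_dist_self[OF W(1) qP] by simp
  have surj: "\<exists>y\<in>pts Y. q y = w" if w: "w \<in> pts W" for w
  proof -
    have "\<exists>y\<in>pts Y. \<forall>f\<in>gd_closure Y. \<bar>f y - evl f w\<bar> \<le> 1 / Suc k" for k by (rule near[OF w]) simp
    then obtain s where s: "\<And>k. s k \<in> pts Y" "\<And>k f. f \<in> gd_closure Y \<Longrightarrow> \<bar>f (s k) - evl f w\<bar> \<le> 1 / Suc k" by metis
    have dw: "gd_dist W (q (s k)) w \<le> 1 / Suc k" for k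
      using W(3,4) s by (intro gd_dist_least W(1) qP w) auto
    have z0: "(\<lambda>k. 1 / real (Suc k)) \<longlonglongrightarrow> 0"
      using LIMSEQ_inverse_real_of_nat by (simp add: divide_inverse)
    have "MY.MCauchy s"
      unfolding MY.MCauchy_def
    proof (intro conjI allI impI)
      fix e :: real assume e: "0 < e"
      then obtain N where N: "\<And>k. N \<le> k \<Longrightarrow> 1 / real (Suc k) < e/2"
        using LIMSEQ_D[OF z0, of "e/2"] by auto
      have "gd_dist Y (s k) (s l) < e" if "N \<le> k" "N \<le> l" for k l
        using MW.triangle[OF qP[OF s(1)] w qP[OF s(1)], of k l] dw[of k] dw[of l] MW.commute[of w "q (s l)"]
          dq[OF s(1) s(1), of k l] N[OF that(1)] N[OF that(2)] by linarith
      then show "\<exists>N. \<forall>n n'. N \<le> n \<longrightarrow> N \<le> n' \<longrightarrow> gd_dist Y (s n) (s n') < e" by blast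
    qed (use s in auto)
    moreover have "MY.mcomplete" using gY unfolding gd_set_def by blast
    ultimately obtain y where "limitin MY.mtopology s y sequentially"
      unfolding MY.mcomplete_def by blast
    then have y: "y \<in> pts Y" "\<And>e. 0 < e \<Longrightarrow> \<exists>N. \<forall>k\<ge>N. gd_dist Y (s k) y < e"
      unfolding MY.limit_metric_sequentially by blast+
    have "gd_dist W (q y) w \<le> e" if e: "0 < e" for e
    proof -
      obtain N where N: "\<And>k. N \<le> k \<Longrightarrow> gd_dist Y (s k) y < e/2" using y(2)[of "e/2"] e by auto
      obtain K where K: "\<And>k. K \<le> k \<Longrightarrow> 1 / real (Suc k) < e/2" using LIMSEQ_D[OF z0, of "e/2"] e by auto
      let ?k = "max N K"
      show ?thesis
        using MW.triangle[OF qP[OF y(1)] qP[OF s(1)] w, of ?k] dq[OF s(1) y(1), of ?k] MW.commute[of "q y" "q (s ?k)"]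
          dw[of ?k] N[of ?k] K[of ?k] by simp
    qed
    then have "gd_dist W (q y) w \<le> 0" by (rule field_le_epsilon) simp
    then have "q y = w" using MW.zero[OF qP[OF y(1)] w] MW.nonneg[of "q y" w] by simp
    then show ?thesis using y(1) by blast
  qed
  define v where "v w = (SOME y. y \<in> pts Y \<and> q y = w)" for w
  have v: "v w \<in> pts Y" "q (v w) = w" if "w \<in> pts W" for w
    using someI_ex[of "\<lambda>y. y \<in> pts Y \<and> q y = w"] surj[OF that] unfolding v_def by blast+
  have vq: "v (q y) = y" if "y \<in> pts Y" for y
    using inj[OF v(1)[OF qP[OF that]] that v(2)[OF qP[OF that]]] .
  have vm: "v \<in> msr W \<rightarrow>\<^sub>M msr Y"
  proof (rule measurable_sigma_sets[OF gd_sets[OF gY]])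
    show "{U. openin (gd_top Y) U} \<subseteq> Pow (pts Y)" by (simp add: gd_openin[OF gY] subset_iff)
    show "v \<in> space (msr W) \<rightarrow> pts Y" using v(1) W(1) by auto
    fix V assume "V \<in> {U. openin (gd_top Y) U}"
    then have V: "openin (gd_top Y) V" by simp
    have "openin (gd_top W) (v -` V \<inter> pts W)"
      unfolding gd_openin[OF W(1)]
    proof (intro conjI ballI)
      fix x assume x: "x \<in> v -` V \<inter> pts W"
      then obtain r where "0 < r" "\<And>y. y \<in> pts Y \<Longrightarrow> gd_dist Y (v x) y < r \<Longrightarrow> y \<in> V"
        using gd_open_ball[OF gY V, of "v x"] by auto
      then have "y \<in> v -` V \<inter> pts W" if "y \<in> pts W" "gd_dist W x y < r" for y
        using dq[OF v(1) v(1), of x y] v x that by auto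
      then show "\<exists>r>0. \<forall>y\<in>pts W. gd_dist W x y < r \<longrightarrow> y \<in> v -` V \<inter> pts W"
        using \<open>0 < r\<close> by blast
    qed auto
    then show "v -` V \<inter> space (msr W) \<in> sets (msr W)" using W(1) by (simp add: gd_open_measurable)
  qed
  have "distr (msr W) (msr Y) v = distr (msr Y) (msr Y) (v \<circ> q)"
    using distr_distr[OF vm q(1)] q(2) by simp
  also have "\<dots> = distr (msr Y) (msr Y) (\<lambda>y. y)" using vq gY by (intro distr_cong) auto
  finally have vd: "distr (msr W) (msr Y) v = msr Y" by (simp add: distr_id2)
  have "compose (pts W) f v \<in> gd_closure W" if "f \<in> obs Y" for f
  proof -
    have f: "f \<in> gd_closure Y" using that by (rule obs_subset_closure[OF gY])
    then have o: "evl f \<in> obs W" using W(3) by auto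
    have "compose (pts W) f v w = evl f w" if w: "w \<in> pts W" for w
      using W(4)[OF v(1)[OF w] f] v(2)[OF w] w by (simp add: compose_def)
    then have "compose (pts W) f v = evl f"
      using obs_extensional[OF W(1) o] by (intro extensionalityI[of _ "pts W"]) (auto simp: compose_def)
    then show ?thesis using obs_subset_closure[OF W(1) o] by simp
  qed
  then have "domination W Y v" using vm vd by (simp add: domination_def)
  then have "gd_iso W Y"
    unfolding gd_iso_def using W(2) v(2) vq by (intro exI[of _ v] exI[of _ q]) auto
  then show thesis using that LW by blast
qed

text \<open>A gd-set outside the limit stays at a definite distance from all late
  \<open>P n\<close>. It is therefore enough to be close to infinitely many of them, which is what
  arguments along subsequences provide.\<close>

lemma pyramid_conv_mem:
  assumes conv: "pyramid_conv L P Q" and Z: "Z \<in> LD L" and P: "\<And>n W. W \<in> P n \<Longrightarrow> gd_set W"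
    and fr: "\<And>e. 0 < e \<Longrightarrow> \<exists>\<^sub>F n in sequentially. \<exists>W\<in>P n. gd_box Z W \<le> e"
  shows "Z \<in> Q"
proof (rule ccontr)
  assume "Z \<notin> Q"
  then have "0 < liminf (\<lambda>n. ereal (INF Y\<in>P n. gd_box Z Y))" using conv Z by (auto simp: pyramid_conv_def)
  then obtain c' :: ereal where c': "0 < c'" "c' < liminf (\<lambda>n. ereal (INF Y\<in>P n. gd_box Z Y))" using dense by blast
  have ev': "eventually (\<lambda>n. c' < ereal (INF Y\<in>P n. gd_box Z Y)) sequentially" by (rule less_LiminfD) (rule c'(2))
  obtain c where c: "0 < c" "ereal c < c'" using c'(1) ereal_dense2[of 0 c'] by (auto simp: zero_ereal_def)
  have evc: "eventually (\<lambda>n. ereal c < ereal (INF Y\<in>P n. gd_box Z Y)) sequentially"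
    using ev' by (rule eventually_mono) (rule less_trans[OF c(2)])
  have gZ: "gd_set Z" using Z by (auto simp: LD_def L_gd_set_def)
  have "\<exists>\<^sub>F n in sequentially. False"
    using frequently_eventually_frequently[OF fr[OF c(1)] evc]
  proof (rule frequently_elim1)
    fix n assume "(\<exists>W\<in>P n. gd_box Z W \<le> c) \<and> ereal c < ereal (INF Y\<in>P n. gd_box Z Y)"
    then obtain W where W: "W \<in> P n" "gd_box Z W \<le> c" "c < (INF Y\<in>P n. gd_box Z Y)" by auto
    have "(INF Y\<in>P n. gd_box Z Y) \<le> gd_box Z W"
      by (rule cINF_lower[OF _ W(1)]) (use gd_box_nonneg[OF gZ P] in \<open>auto intro!: bdd_belowI[of _ 0]\<close>)
    then show False using W by linarith
  qed
  then show False by simp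
qed

section \<open>qm-spaces\<close>

lemma Lip1p_dist:
  assumes X: "qm_space X" and x: "x \<in> qpts X"
  shows "restrict (qdist X x) (qpts X) \<in> Lip1p X"
  using assms unfolding Lip1p_def qm_space_def by (auto simp: algebra_simps)

lemma Rep_plus_simps [simp]:
  "pts (Rep_plus X) = qpts X" "obs (Rep_plus X) = Lip1p X" "msr (Rep_plus X) = qmsr X"
  by (simp_all add: Rep_plus_def)

lemma Lip1p_abs_le:
  assumes "f \<in> Lip1p X" "x \<in> qpts X" "y \<in> qpts X"
  shows "\<bar>f x - f y\<bar> \<le> max (qdist X x y) (qdist X y x)"
proof -
  have "f y - f x \<le> qdist X x y" "f x - f y \<le> qdist X y x" using assms by (auto simp: Lip1p_def)
  then show ?thesis by linarith
qed

text \<open>The observables \<open>qdist X x\<close> and \<open>qdist X y\<close> attain the two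
  terms of the maximum.\<close>

lemma gd_dist_Rep_plus:
  assumes X: "qm_space X"
  shows "gd_dist (Rep_plus X) = qm_symdist X"
proof (intro ext)
  fix x y
  show "gd_dist (Rep_plus X) x y = qm_symdist X x y"
  proof (cases "x \<in> qpts X \<and> y \<in> qpts X")
    case True
    have ne: "Lip1p X \<noteq> {}" using Lip1p_dist[OF X] True by blast
    have bd: "bdd_above ((\<lambda>f. \<bar>f x - f y\<bar>) ` Lip1p X)"
      using Lip1p_abs_le[of _ X x y] True by (auto intro!: bdd_aboveI2)
    have "(SUP f\<in>Lip1p X. \<bar>f x - f y\<bar>) = max (qdist X x y) (qdist X y x)"
    proof (rule antisym)
      show "(SUP f\<in>Lip1p X. \<bar>f x - f y\<bar>) \<le> max (qdist X x y) (qdist X y x)"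
        using Lip1p_abs_le[of _ X x y] True by (intro cSUP_least ne) auto
      have z: "qdist X x x = 0" "qdist X y y = 0" "0 \<le> qdist X x y" "0 \<le> qdist X y x"
        using X True by (auto simp: qm_space_def)
      have "qdist X x y \<le> (SUP f\<in>Lip1p X. \<bar>f x - f y\<bar>)"
        by (rule cSUP_upper2[OF bd Lip1p_dist[OF X, of x]]) (use True z in auto)
      moreover have "qdist X y x \<le> (SUP f\<in>Lip1p X. \<bar>f x - f y\<bar>)"
        by (rule cSUP_upper2[OF bd Lip1p_dist[OF X, of y]]) (use True z in auto)
      ultimately show "max (qdist X x y) (qdist X y x) \<le> (SUP f\<in>Lip1p X. \<bar>f x - f y\<bar>)" by simp
    qed
    then show ?thesis using True by (simp add: gd_dist_def qm_symdist_def)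
  qed (auto simp: gd_dist_def qm_symdist_def)
qed

lemma gd_top_Rep_plus: "qm_space X \<Longrightarrow> gd_top (Rep_plus X) = qm_top X"
  by (simp add: gd_top_def qm_top_def gd_dist_Rep_plus)

lemma gd_set_Rep_plus:
  assumes X: "qm_space X"
  shows "gd_set (Rep_plus X)"
proof -
  have "qpts X \<noteq> {}"
  proof -
    have "prob_space (qmsr X)" "space (qmsr X) = topspace (qm_top X)" "Metric_space (qpts X) (qm_symdist X)"
      using X unfolding qm_space_def full_support_prob_def by blast+
    then show ?thesis using prob_space.not_empty[of "qmsr X"] by (simp add: qm_top_def Metric_space.topspace_mtopology)
  qed
  then have ne: "Lip1p X \<noteq> {}" using Lip1p_dist[OF X] by blast
  have bd: "\<forall>x\<in>qpts X. \<forall>y\<in>qpts X. bdd_above ((\<lambda>f. \<bar>f x - f y\<bar>) ` Lip1p X)"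
    using Lip1p_abs_le[of _ X] by (auto intro!: bdd_aboveI2)
  have sub: "Lip1p X \<subseteq> extensional (qpts X)" by (auto simp: Lip1p_def)
  show ?thesis
    unfolding gd_set_def Rep_plus_simps gd_dist_Rep_plus[OF X] gd_top_Rep_plus[OF X]
    using X ne bd sub unfolding qm_space_def by blast
qed

text \<open>The 1-Lipschitz bound alone handles an increase of \<open>f\<close>. For a decrease it
  would involve the distance in the opposite direction; monotonicity makes the left-hand side
  nonpositive instead.\<close>

lemma L_gd_set_Rep_plus:
  assumes X: "qm_space X" and L: "L \<subseteq> Lip1p_R"
  shows "L_gd_set L (Rep_plus X)"
proof (rule L_gd_setI[OF gd_set_Rep_plus[OF X]])
  show "L \<subseteq> Lip1_R" using L by (auto simp: Lip1p_R_def)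
  fix \<phi> f assume \<phi>: "\<phi> \<in> L" and f: "f \<in> obs (Rep_plus X)"
  have m: "mono \<phi>" "\<phi> \<in> Lip1_R" using L \<phi> by (auto simp: Lip1p_R_def)
  have "compose (qpts X) \<phi> f \<in> Lip1p X"
    unfolding Lip1p_def
  proof (intro CollectI conjI ballI)
    fix x y assume xy: "x \<in> qpts X" "y \<in> qpts X"
    have d: "0 \<le> qdist X x y" "f y - f x \<le> qdist X x y" using X f xy by (auto simp: qm_space_def Lip1p_def)
    have "\<phi> (f y) - \<phi> (f x) \<le> qdist X x y"
    proof (cases "f x \<le> f y")
      case True
      then show ?thesis using Lip1_R_le[OF m(2), of "f y" "f x"] d by linarith
    next
      case False
      then show ?thesis using monoD[OF m(1), of "f y" "f x"] d by linarith
    qed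
    then show "compose (qpts X) \<phi> f y - compose (qpts X) \<phi> f x \<le> qdist X x y" using xy by (simp add: compose_def)
  qed (simp add: compose_def)
  then show "compose (pts (Rep_plus X)) \<phi> f \<in> gd_closure (Rep_plus X)"
    using obs_subset_closure[OF gd_set_Rep_plus[OF X]] by simp
qed

text \<open>The McShane-type extension of \<open>g \<circ> p\<close> from \<open>A\<close>.\<close>

lemma qm_extension:
  assumes X: "qm_space X" and Y: "qm_space Y" and A: "A \<subseteq> qpts X" "A \<noteq> {}" and p: "\<And>x. x \<in> A \<Longrightarrow> p x \<in> qpts Y"
    and le: "\<And>x y. x \<in> A \<Longrightarrow> y \<in> A \<Longrightarrow> qdist Y (p x) (p y) \<le> qdist X x y + \<epsilon>"
    and g: "g \<in> Lip1p Y"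
  obtains f where "f \<in> Lip1p X" "\<And>x. x \<in> A \<Longrightarrow> \<bar>f x - g (p x)\<bar> \<le> \<epsilon>"
proof -
  have tri: "qdist X x z \<le> qdist X x y + qdist X y z" if "x \<in> qpts X" "y \<in> qpts X" "z \<in> qpts X" for x y z
    using X that by (auto simp: qm_space_def)
  have z: "qdist X x x = 0" if "x \<in> qpts X" for x using X that by (auto simp: qm_space_def)
  have gp: "g (p x) - g (p a) \<le> qdist X a x + \<epsilon>" if "a \<in> A" "x \<in> A" for a x
  proof -
    have "g (p x) - g (p a) \<le> qdist Y (p a) (p x)" using g p that by (auto simp: Lip1p_def)
    then show ?thesis using le[OF that] by linarith
  qed
  define f where "f = (\<lambda>x\<in>qpts X. INF a\<in>A. g (p a) + qdist X a x)"
  obtain a0 where a0: "a0 \<in> A" using A by blast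
  have bd: "bdd_below ((\<lambda>a. g (p a) + qdist X a x) ` A)" if x: "x \<in> qpts X" for x
  proof (rule bdd_belowI2)
    fix a assume a: "a \<in> A"
    show "g (p a0) - qdist X x a0 - \<epsilon> \<le> g (p a) + qdist X a x"
      using gp[OF a a0] tri[of a x a0] a a0 A x by (auto simp: subset_iff)
  qed
  have "f \<in> Lip1p X"
    unfolding Lip1p_def
  proof (intro CollectI conjI ballI)
    fix x y assume xy: "x \<in> qpts X" "y \<in> qpts X"
    have "f y - qdist X x y \<le> (INF a\<in>A. g (p a) + qdist X a x)"
    proof (rule cINF_greatest[OF A(2)])
      fix a assume a: "a \<in> A"
      have "f y \<le> g (p a) + qdist X a y" using cINF_lower[OF bd[OF xy(2)] a] xy by (simp add: f_def)
      also have "qdist X a y \<le> qdist X a x + qdist X x y" using a A xy by (intro tri) auto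
      finally show "f y - qdist X x y \<le> g (p a) + qdist X a x" by simp
    qed
    then show "f y - f x \<le> qdist X x y" using xy by (simp add: f_def)
  qed (simp add: f_def)
  moreover have "\<bar>f x - g (p x)\<bar> \<le> \<epsilon>" if x: "x \<in> A" for x
  proof -
    have xX: "x \<in> qpts X" using x A by auto
    have "f x \<le> g (p x) + qdist X x x" using cINF_lower[OF bd[OF xX] x] xX by (simp add: f_def)
    moreover have "g (p x) - \<epsilon> \<le> f x"
    proof -
      have "g (p x) - \<epsilon> \<le> (INF a\<in>A. g (p a) + qdist X a x)"
      proof (rule cINF_greatest[OF A(2)])
        fix a assume "a \<in> A"
        then show "g (p x) - \<epsilon> \<le> g (p a) + qdist X a x" using gp[OF _ x] by fastforce
      qed
      then show ?thesis using xX by (simp add: f_def)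
    qed
    moreover have "0 \<le> \<epsilon>"
      using le[OF x x] Y z[OF xX] p[OF x] by (auto simp: qm_space_def)
    ultimately show ?thesis using z[OF xX] by linarith
  qed
  ultimately show thesis using that by blast
qed

section \<open>Almost Lipschitz maps with weakly convergent images\<close>

lemma gd_dist_continuous:
  assumes X: "gd_set X" and c: "c \<in> pts X"
  shows "continuous_map (gd_top X) euclideanreal (gd_dist X c)"
  unfolding continuous_map_upper_lower_semicontinuous_lt gd_topspace[OF X]
proof (intro conjI allI)
  fix a
  show "openin (gd_top X) {x \<in> pts X. a < gd_dist X c x}"
    unfolding gd_openin[OF X]
  proof (intro conjI ballI)
    fix x assume x: "x \<in> {x \<in> pts X. a < gd_dist X c x}"
    have "a < gd_dist X c y" if "y \<in> pts X" "gd_dist X x y < gd_dist X c x - a" for y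
      using gd_dist_Lipschitz[OF X c, of x y] that x by auto
    then show "\<exists>r>0. \<forall>y\<in>pts X. gd_dist X x y < r \<longrightarrow> y \<in> {x \<in> pts X. a < gd_dist X c x}"
      using x by (intro exI[of _ "gd_dist X c x - a"]) auto
  qed auto
  show "openin (gd_top X) {x \<in> pts X. gd_dist X c x < a}" by (rule gd_ball_open[OF c X])
qed

lemma soft_cell_continuous:
  assumes "\<And>j. continuous_map T euclideanreal (D (c j))" "0 < e"
  shows "continuous_map T euclideanreal (soft_cell D e c m i)"
  using assms unfolding soft_cell_def[abs_def] continuous_map_atin
  by (intro ballI tendsto_divide tendsto_max tendsto_sum tendsto_diff tendsto_const limitin_canonical_iff[THEN iffD2])
     (auto simp: max_def)

lemma soft_cell_le_1: "soft_cell D e c m i y \<le> 1" if "i < m"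
  using member_le_sum[of i "{..<m}" "\<lambda>i. soft_cell D e c m i y"] that soft_cell_nonneg[of D e c m _ y]
    soft_cell_sum_le[of D e c m y] by (auto intro: order_trans)

text \<open>Cells of \<open>Y\<close> are compared with their pullbacks under \<open>p n\<close>.
  Weak convergence makes the integrals of these finitely many continuous functions converge, so for
  late \<open>n\<close> there is a coupling under which \<open>p n x\<close> and \<open>y\<close>
  mostly share a cell. An observable of \<open>Y\<close> is then matched by the extension of its
  pullback from \<open>A n\<close>.\<close>

lemma box_le_Rep_plus_tendsto:
  fixes X :: "nat \<Rightarrow> 'a qmspace" and Y :: "'b qmspace"
  assumes X: "\<And>n. qm_space (X n)" and Y: "qm_space Y" and A: "\<And>n. A n \<in> sets (qmsr (X n))"
    and p: "\<And>n. p n \<in> restrict_space (qmsr (X n)) (A n) \<rightarrow>\<^sub>M qmsr Y" and \<epsilon>: "\<epsilon> \<longlonglongrightarrow> 0"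
    and wc: "weakly_converges_on (qm_top Y) (\<lambda>n. distr (restrict_space (qmsr (X n)) (A n)) (qmsr Y) (p n)) (qmsr Y)"
    and le: "\<And>n x y. x \<in> A n \<Longrightarrow> y \<in> A n \<Longrightarrow> qdist Y (p n x) (p n y) \<le> qdist (X n) x y + \<epsilon> n"
    and e: "0 < e"
  shows "\<forall>\<^sub>F n in sequentially. box_le (Rep_plus Y) (Rep_plus (X n)) \<le> e"
proof -
  define RY where "RY = Rep_plus Y"
  have gY: "gd_set RY" unfolding RY_def by (rule gd_set_Rep_plus[OF Y])
  have gX: "gd_set (Rep_plus (X n))" for n by (rule gd_set_Rep_plus[OF X])
  have [simp]: "pts RY = qpts Y" "msr RY = qmsr Y" "obs RY = Lip1p Y" by (simp_all add: RY_def)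
  have pY: "prob_space (qmsr Y)" using gd_prob[OF gY] by simp
  have pX: "prob_space (qmsr (X n))" for n using gd_prob[OF gX[of n]] by simp
  have sX: "space (qmsr (X n)) = qpts (X n)" for n using gd_space[OF gX[of n]] by simp
  have sY: "space (qmsr Y) = qpts Y" using gd_space[OF gY] by simp
  \<comment> \<open>Here \<open>e / 2\<close> equals \<open>3 * d\<close>: up to
    \<open>2 * d\<close> between two points of one cell, and up to \<open>d\<close> for the
    extension error \<open>\<epsilon> n\<close>.\<close>
  define d where "d = e / 6"
  have d: "0 < d" using e by (simp add: d_def)
  obtain c where c: "\<And>n::nat. c n \<in> pts RY" "\<And>y e. y \<in> pts RY \<Longrightarrow> 0 < e \<Longrightarrow> \<exists>n. gd_dist RY (c n) y < e"
    by (rule gd_dense[OF gY]) blast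
  have Dm: "gd_dist RY (c j) \<in> borel_measurable (qmsr Y)" for j using gd_dist_measurable[OF gY c(1)] by simp
  obtain m where m: "1 - d \<le> (\<Sum>i<m. \<integral>y. soft_cell (gd_dist RY) d c m i y \<partial>qmsr Y)"
    by (rule soft_cells_exhaust[of "qmsr Y" "gd_dist RY" c d d]) (use pY Dm c d sY in auto)
  define \<psi> where "\<psi> = soft_cell (gd_dist RY) d c m"
  have \<psi>m [measurable]: "\<psi> i \<in> borel_measurable (qmsr Y)" for i unfolding \<psi>_def by (rule soft_cell_measurable) (rule Dm)
  have AX: "A n \<subseteq> qpts (X n)" for n using sets.sets_into_space[OF A] sX by simp
  have spA: "space (restrict_space (qmsr (X n)) (A n)) = A n" for n
    using AX[of n] sX[of n] by (auto simp: space_restrict_space)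
  have pA: "p n x \<in> qpts Y" if "x \<in> A n" for n x
    using measurable_space[OF p] that spA sY by metis
  have An: "A n \<inter> space (qmsr (X n)) \<in> sets (qmsr (X n))" for n using A by auto
  \<comment> \<open>Points off \<open>A n\<close> belong to no cell, so on the event
    \<open>E\<close> below the first coordinate automatically lies in \<open>A n\<close>.\<close>
  define \<xi> where "\<xi> n i x = (if x \<in> A n then \<psi> i (p n x) else 0)" for n i x
  have \<xi>m: "\<xi> n i \<in> borel_measurable (qmsr (X n))" for n i
  proof -
    have "(\<lambda>x. \<psi> i (p n x)) \<in> borel_measurable (restrict_space (qmsr (X n)) (A n))"
      by (rule measurable_compose[OF p \<psi>m])
    then show ?thesis unfolding \<xi>_def[abs_def] by (subst (asm) measurable_restrict_space_iff[OF An, where c=0]) auto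
  qed
  have \<xi>int: "(\<integral>x. \<xi> n i x \<partial>qmsr (X n)) = (\<integral>y. \<psi> i y \<partial>distr (restrict_space (qmsr (X n)) (A n)) (qmsr Y) (p n))" for n i
    unfolding integral_distr[OF p \<psi>m] integral_restrict_space[OF An]
    by (intro Bochner_Integration.integral_cong) (auto simp: \<xi>_def indicator_def)
  have conv: "(\<lambda>n. \<integral>x. \<xi> n i x \<partial>qmsr (X n)) \<longlonglongrightarrow> (\<integral>y. \<psi> i y \<partial>qmsr Y)" if i: "i < m" for i
  proof -
    have "continuous_map (qm_top Y) euclideanreal (\<psi> i)"
      unfolding \<psi>_def using gd_dist_continuous[OF gY c(1)] gd_top_Rep_plus[OF Y]
      by (intro soft_cell_continuous d) (simp add: RY_def)
    moreover have "bounded (\<psi> i ` topspace (qm_top Y))"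
      using soft_cell_nonneg[of "gd_dist RY" d c m i] soft_cell_le_1[OF i, of "gd_dist RY" d c]
      by (auto simp: bounded_iff \<psi>_def intro!: exI[of _ 1])
    ultimately show ?thesis using wc unfolding weakly_converges_on_def \<xi>int by blast
  qed
  have "(\<lambda>n. \<Sum>i<m. min (\<integral>x. \<xi> n i x \<partial>qmsr (X n)) (\<integral>y. \<psi> i y \<partial>qmsr Y))
      \<longlonglongrightarrow> (\<Sum>i<m. min (\<integral>y. \<psi> i y \<partial>qmsr Y) (\<integral>y. \<psi> i y \<partial>qmsr Y))"
    by (intro tendsto_sum tendsto_min tendsto_const conv) simp
  then have "\<forall>\<^sub>F n in sequentially. 1 - 2 * d < (\<Sum>i<m. min (\<integral>x. \<xi> n i x \<partial>qmsr (X n)) (\<integral>y. \<psi> i y \<partial>qmsr Y))"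
    by (rule order_tendstoD) (use m d in \<open>simp add: \<psi>_def\<close>)
  moreover have "\<forall>\<^sub>F n in sequentially. \<epsilon> n < d" by (rule order_tendstoD(2)[OF \<epsilon> d])
  ultimately show ?thesis
  proof eventually_elim
    case (elim n)
    obtain K where K: "prob_space K" "sets K = sets (qmsr (X n) \<Otimes>\<^sub>M qmsr Y)" "distr K (qmsr (X n)) fst = qmsr (X n)"
      "distr K (qmsr Y) snd = qmsr Y"
      "\<And>E. E \<in> sets (qmsr (X n) \<Otimes>\<^sub>M qmsr Y) \<Longrightarrow>
        (\<And>x y i. i < m \<Longrightarrow> x \<in> space (qmsr (X n)) \<Longrightarrow> y \<in> space (qmsr Y) \<Longrightarrow> 0 < \<xi> n i x \<Longrightarrow> 0 < \<psi> i y \<Longrightarrow> (x, y) \<in> E) \<Longrightarrow>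
        (\<Sum>i<m. min (\<integral>x. \<xi> n i x \<partial>qmsr (X n)) (\<integral>y. \<psi> i y \<partial>qmsr Y)) \<le> measure K E"
    proof (rule soft_coupling[OF pX pY, where \<xi>="\<xi> n" and \<psi>=\<psi> and m=m])
      show "(\<Sum>i<m. \<xi> n i x) \<le> 1" for x
        using soft_cell_sum_le[of "gd_dist RY" d c m "p n x"] by (cases "x \<in> A n") (simp_all add: \<xi>_def \<psi>_def)
    qed (use \<xi>m \<psi>m in \<open>auto simp: \<xi>_def \<psi>_def soft_cell_nonneg soft_cell_sum_le\<close>)
    have spK: "space K = qpts (X n) \<times> qpts Y" using sets_eq_imp_space_eq[OF K(2)] by (simp add: space_pair_measure sX sY)
    have fK: "fst \<in> K \<rightarrow>\<^sub>M qmsr (X n)" "snd \<in> K \<rightarrow>\<^sub>M qmsr Y" unfolding measurable_cong_sets[OF K(2) refl] by simp_all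
    define E where "E = {z \<in> space K. \<exists>i\<in>{..<m}. 0 < \<xi> n i (fst z) \<and> 0 < \<psi> i (snd z)}"
    have [measurable]: "(\<lambda>z. \<xi> n i (fst z)) \<in> borel_measurable K" "(\<lambda>z. \<psi> i (snd z)) \<in> borel_measurable K" for i
      by (rule measurable_compose[OF fK(1) \<xi>m], rule measurable_compose[OF fK(2) \<psi>m])
    have E: "E \<in> sets K" unfolding E_def by measurable
    have "(\<Sum>i<m. min (\<integral>x. \<xi> n i x \<partial>qmsr (X n)) (\<integral>y. \<psi> i y \<partial>qmsr Y)) \<le> measure K E"
      by (rule K(5)) (use E K(2) in \<open>auto simp: E_def spK sX sY\<close>)
    then have mE: "1 - e \<le> measure K E" using elim d by (simp add: d_def)
    interpret XY: gd_pair "Rep_plus (X n)" RY K fst snd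
      by (rule gd_pair.intro[OF gX gY K(1)]) (use fK K(3,4) in simp_all)
    show ?case unfolding RY_def[symmetric]
    proof (rule XY.box_le_pair[OF E mE])
      show "0 \<le> e" using e by simp
      fix g assume "g \<in> obs RY"
      then have g: "g \<in> Lip1p Y" by simp
      show "\<exists>f\<in>gd_closure (Rep_plus (X n)). \<forall>w\<in>E. \<bar>f (fst w) - g (snd w)\<bar> \<le> e / 2"
      proof (cases "A n = {}")
        case True
        then have "E = {}" by (auto simp: E_def \<xi>_def)
        then show ?thesis using gd_closure_nonempty[OF gX] by auto
      next
        case False
        obtain f where f: "f \<in> Lip1p (X n)" "\<And>x. x \<in> A n \<Longrightarrow> \<bar>f x - g (p n x)\<bar> \<le> \<epsilon> n"
          by (rule qm_extension[OF X Y AX False, where p="p n" and \<epsilon>="\<epsilon> n" and g=g]) (use pA le g in auto)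
        have "f \<in> gd_closure (Rep_plus (X n))" using obs_subset_closure[OF gX] f(1) by simp
        moreover have "\<bar>f (fst w) - g (snd w)\<bar> \<le> e / 2" if w: "w \<in> E" for w
        proof -
          obtain x y where xy: "w = (x, y)" by force
          obtain i where i: "0 < \<xi> n i x" "0 < \<psi> i y" using w xy by (auto simp: E_def)
          have xA: "x \<in> A n" using i(1) by (auto simp: \<xi>_def split: if_splits)
          have y: "y \<in> pts RY" using w xy by (auto simp: E_def spK)
          have px: "p n x \<in> pts RY" using pA[OF xA] by simp
          have "gd_dist RY (c i) y < d" "gd_dist RY (c i) (p n x) < d"
            using i xA soft_cell_pos[OF _ d, of "gd_dist RY" c m i] by (auto simp: \<psi>_def \<xi>_def)
          then have "gd_dist RY y (p n x) < 2 * d"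
            using gd_dist_triangle[OF gY y c(1) px, of i] gd_dist_commute[OF gY, of y "c i"] by linarith
          moreover have "\<bar>g y - g (p n x)\<bar> \<le> gd_dist RY y (p n x)"
            using obs_le_dist[OF gY _ y px, of g] g by simp
          moreover have "\<bar>f x - g (p n x)\<bar> \<le> \<epsilon> n" by (rule f(2)[OF xA])
          moreover have "e / 2 = 3 * d" by (simp add: d_def)
          moreover have "\<bar>f x - g y\<bar> \<le> \<bar>f x - g (p n x)\<bar> + \<bar>g y - g (p n x)\<bar>" by linarith
          ultimately show ?thesis using elim(2) xy by simp
        qed
        ultimately show ?thesis by blast
      qed
    qed
  qed
qed

text \<open>A copy \<open>Z\<close> of \<open>Rep_plus Y\<close> over \<open>real\<close> has the
  same one-sided distances. Along the subsequence these become small, and \<open>Z\<close> is then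
  close to gd-sets dominated by \<open>Rep_plus (X (r k))\<close>.\<close>

lemma Rep_plus_mem_limit:
  fixes X :: "nat \<Rightarrow> 'a qmspace" and Y :: "'b qmspace"
  assumes X: "\<And>n. qm_space (X n)" and Y: "qm_space Y" and L: "L \<subseteq> Lip1p_R"
    and bl: "\<And>e. 0 < e \<Longrightarrow> \<forall>\<^sub>F n in sequentially. box_le (Rep_plus Y) (Rep_plus (X n)) \<le> e"
    and r: "strict_mono (r :: nat \<Rightarrow> nat)"
    and conv: "pyramid_conv L (\<lambda>k. generated_pyramid L (Rep_plus (X (r k)))) P"
  shows "class_in (Rep_plus Y) P"
proof -
  have L1: "L \<subseteq> Lip1_R" using L by (auto simp: Lip1p_R_def)
  have LY: "L_gd_set L (Rep_plus Y)" by (rule L_gd_set_Rep_plus[OF Y L])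
  have gY: "gd_set (Rep_plus Y)" by (rule gd_set_Rep_plus[OF Y])
  have gX: "gd_set (Rep_plus (X n))" for n by (rule gd_set_Rep_plus[OF X])
  obtain Z where Z: "Z \<in> LD L" "gd_iso Z (Rep_plus Y)" by (rule real_copy[OF LY L1])
  have LZ: "L_gd_set L Z" and gZ: "gd_set Z" using Z(1) by (auto simp: LD_def L_gd_set_def)
  have "dominated Z (Rep_plus Y)" using Z(2) by (auto simp: gd_iso_def dominated_def)
  then have bZ: "box_le Z (Rep_plus Y) = 0" by (rule dominated_imp_box_le_zero[OF gY gZ])
  have "Z \<in> P"
  proof (rule pyramid_conv_mem[OF conv Z(1)])
    show "gd_set W" if "W \<in> generated_pyramid L (Rep_plus (X (r n)))" for n W
      using that by (auto simp: generated_pyramid_def LD_def L_gd_set_def)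
    fix e :: real assume e: "0 < e"
    have "\<forall>\<^sub>F k in sequentially. box_le (Rep_plus Y) (Rep_plus (X (r k))) \<le> e/2"
      using eventually_subseq[OF r bl[of "e/2"]] e by simp
    then have "\<forall>\<^sub>F k in sequentially. \<exists>W\<in>generated_pyramid L (Rep_plus (X (r k))). gd_box Z W \<le> e"
    proof eventually_elim
      case (elim k)
      have "box_le Z (Rep_plus (X (r k))) < e"
        using box_le_triangle[OF gX gY gZ, of "r k"] elim bZ e by linarith
      then obtain W where "W \<in> LD L" "dominated W (Rep_plus (X (r k)))" "gd_box Z W \<le> e"
        by (rule dominated_approx[OF L_gd_set_Rep_plus[OF X L] LZ L1])
      then show ?case by (auto simp: generated_pyramid_def)
    qed
    then show "\<exists>\<^sub>F k in sequentially. \<exists>W\<in>generated_pyramid L (Rep_plus (X (r k))). gd_box Z W \<le> e"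
      by (rule eventually_frequently[rotated]) simp
  qed
  then show ?thesis using Z(2) by (auto simp: class_in_def)
qed

section \<open>Weak compactness for bounded random sequences\<close>

text \<open>Bounded sequences are encoded in the ternary Cantor set through their interleaved binary digits.
  Decoding extends continuously to the whole line: \<open>digit\<close> and \<open>shift\<close> read off and remove the first
  ternary digit. This reduces weak compactness to Helly's theorem on the line.\<close>

definition digit :: "real \<Rightarrow> real" where
  "digit c = max 0 (min 1 (3 * c - 1))"

definition shift :: "real \<Rightarrow> real" where
  "shift c = 3 * c - 2 * digit c"

definition decode :: "real \<Rightarrow> nat \<Rightarrow> real" where
  "decode c i = (\<Sum>j. digit ((shift ^^ prod_encode (i, j)) c) / 2 ^ Suc j)"

definition encode :: "(nat \<Rightarrow> real) \<Rightarrow> real" where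
  "encode \<beta> = (\<Sum>k. 2 * \<beta> k / 3 ^ Suc k)"

text \<open>For \<open>x\<close> in \<open>[0, 1)\<close> this is the binary digit of weight
  \<open>1 / 2 ^ Suc j\<close>.\<close>

definition bit :: "nat \<Rightarrow> real \<Rightarrow> real" where
  "bit j x = real_of_int (\<lfloor>2 ^ Suc j * x\<rfloor> - 2 * \<lfloor>2 ^ j * x\<rfloor>)"

definition encode_seq :: "(nat \<Rightarrow> real) \<Rightarrow> real" where
  "encode_seq t = encode (\<lambda>k. bit (snd (prod_decode k)) (t (fst (prod_decode k))))"

lemma bit_cases: "bit j x = 0 \<or> bit j x = 1"
proof -
  have "\<lfloor>2 * y\<rfloor> - 2 * \<lfloor>y\<rfloor> = 0 \<or> \<lfloor>2 * y\<rfloor> - 2 * \<lfloor>y\<rfloor> = 1" for y :: real by linarith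
  from this[of "2 ^ j * x"] show ?thesis by (auto simp: bit_def mult.assoc)
qed

text \<open>The partial sums telescope to \<open>x\<close> rounded down to a multiple of
  \<open>1 / 2 ^ n\<close>; the bound \<open>x < 1\<close> makes the integer part vanish at the
  start.\<close>

lemma bit_sums:
  assumes "0 \<le> x" "x < 1"
  shows "(\<lambda>j. bit j x / 2 ^ Suc j) sums x"
proof -
  have eq: "(\<Sum>j<n. bit j x / 2 ^ Suc j) = \<lfloor>2 ^ n * x\<rfloor> / 2 ^ n" for n
  proof (induction n)
    case 0
    have "\<lfloor>x\<rfloor> = 0" using assms by linarith
    then show ?case by simp
  next
    case (Suc n)
    then show ?case by (simp add: bit_def field_simps)
  qed
  have "(\<lambda>n. \<lfloor>2 ^ n * x\<rfloor> / 2 ^ n) \<longlonglongrightarrow> x"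
  proof (rule LIM_zero_cancel, rule Lim_null_comparison)
    show "\<forall>\<^sub>F n in sequentially. norm (\<lfloor>2 ^ n * x\<rfloor> / 2 ^ n - x) \<le> (1/2) ^ n"
    proof (intro always_eventually allI)
      fix n
      have "\<bar>real_of_int \<lfloor>2 ^ n * x\<rfloor> - 2 ^ n * x\<bar> \<le> 1" by linarith
      then have "\<bar>real_of_int \<lfloor>2 ^ n * x\<rfloor> - 2 ^ n * x\<bar> / 2 ^ n \<le> 1 / 2 ^ n" by (intro divide_right_mono) auto
      moreover have "\<lfloor>2 ^ n * x\<rfloor> / 2 ^ n - x = (real_of_int \<lfloor>2 ^ n * x\<rfloor> - 2 ^ n * x) / 2 ^ n" by (simp add: field_simps)
      ultimately show "norm (\<lfloor>2 ^ n * x\<rfloor> / 2 ^ n - x) \<le> (1/2) ^ n" by (simp add: abs_divide power_divide)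
    qed
    show "(\<lambda>n. (1/2::real) ^ n) \<longlonglongrightarrow> 0" by (rule LIMSEQ_realpow_zero) auto
  qed
  then show ?thesis unfolding sums_def eq .
qed

lemma encode_summable:
  fixes \<beta> :: "nat \<Rightarrow> real"
  assumes "\<And>k. 0 \<le> \<beta> k" "\<And>k. \<beta> k \<le> 1"
  shows "summable (\<lambda>k. 2 * \<beta> k / 3 ^ Suc k)"
proof (rule summable_comparison_test'[where g="\<lambda>k. (1/3::real) ^ k"])
  show "summable (\<lambda>k. (1/3::real) ^ k)" by (rule summable_geometric) simp
  show "norm (2 * \<beta> k / 3 ^ Suc k) \<le> (1/3) ^ k" for k
    using assms(1)[of k] assms(2)[of k] by (simp add: power_divide field_simps)
qed

lemma encode_bounds:
  fixes \<beta> :: "nat \<Rightarrow> real"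
  assumes "\<And>k. 0 \<le> \<beta> k" "\<And>k. \<beta> k \<le> 1"
  shows "0 \<le> encode \<beta>" "encode \<beta> \<le> 1"
proof -
  show "0 \<le> encode \<beta>"
    unfolding encode_def by (rule suminf_nonneg[OF encode_summable[OF assms]]) (use assms in auto)
  have s: "(\<lambda>k. (2/3) * (1/3::real) ^ k) sums 1"
    using sums_mult[OF geometric_sums[of "1/3::real"], of "2/3"] by simp
  have "encode \<beta> \<le> (\<Sum>k. (2/3) * (1/3::real) ^ k)"
    unfolding encode_def
  proof (rule suminf_le[OF _ encode_summable[OF assms] sums_summable[OF s]])
    show "2 * \<beta> k / 3 ^ Suc k \<le> (2/3) * (1/3) ^ k" for k
      using assms(2)[of k] by (simp add: power_divide field_simps)
  qed
  then show "encode \<beta> \<le> 1" using sums_unique[OF s] by simp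
qed

lemma encode_Suc:
  fixes \<beta> :: "nat \<Rightarrow> real"
  assumes "\<And>k. 0 \<le> \<beta> k" "\<And>k. \<beta> k \<le> 1"
  shows "encode \<beta> = (2 * \<beta> 0 + encode (\<lambda>k. \<beta> (Suc k))) / 3"
proof -
  have "encode \<beta> = 2 * \<beta> 0 / 3 + (\<Sum>k. 2 * \<beta> (Suc k) / 3 ^ Suc (Suc k))"
    unfolding encode_def using suminf_split_head[OF encode_summable[of \<beta>, OF assms]] by simp
  also have "(\<Sum>k. 2 * \<beta> (Suc k) / 3 ^ Suc (Suc k)) = (\<Sum>k. 2 * \<beta> (Suc k) / 3 ^ Suc k) / 3"
    using suminf_divide[OF encode_summable[of "\<lambda>k. \<beta> (Suc k)"], of 3] assms by (simp add: field_simps)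
  finally show ?thesis by (simp add: encode_def field_simps)
qed

text \<open>The tail is encoded in \<open>[0, 1]\<close>, so the code lies in
  \<open>[0, 1/3]\<close> or in \<open>[2/3, 1]\<close> according to the first digit. On these two
  intervals the clamp in \<open>digit\<close> is constantly 0 or 1.\<close>

lemma digit_shift_encode:
  assumes "\<And>k. \<beta> k = 0 \<or> \<beta> k = 1"
  shows "digit (encode \<beta>) = \<beta> 0" "shift (encode \<beta>) = encode (\<lambda>k. \<beta> (Suc k))"
proof -
  have b: "0 \<le> \<beta> k" "\<beta> k \<le> 1" for k using assms[of k] by auto
  have e: "encode \<beta> = (2 * \<beta> 0 + encode (\<lambda>k. \<beta> (Suc k))) / 3" by (rule encode_Suc[OF b])
  have "0 \<le> encode (\<lambda>k. \<beta> (Suc k))" "encode (\<lambda>k. \<beta> (Suc k)) \<le> 1" by (rule encode_bounds; rule b)+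
  then show d: "digit (encode \<beta>) = \<beta> 0" using e assms[of 0] by (auto simp: digit_def)
  show "shift (encode \<beta>) = encode (\<lambda>k. \<beta> (Suc k))" unfolding shift_def d using e by simp
qed

lemma digit_shift_power_encode:
  assumes "\<And>k. \<beta> k = 0 \<or> \<beta> k = 1"
  shows "(shift ^^ n) (encode \<beta>) = encode (\<lambda>k. \<beta> (n + k))" "digit ((shift ^^ n) (encode \<beta>)) = \<beta> n"
proof -
  show *: "(shift ^^ n) (encode \<beta>) = encode (\<lambda>k. \<beta> (n + k))"
  proof (induction n)
    case (Suc n)
    then show ?case using digit_shift_encode(2)[of "\<lambda>k. \<beta> (n + k)"] assms by simp
  qed simp
  show "digit ((shift ^^ n) (encode \<beta>)) = \<beta> n"
    unfolding * using digit_shift_encode(1)[of "\<lambda>k. \<beta> (n + k)"] assms by simp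
qed

lemma decode_encode_seq:
  assumes "\<And>i. 0 \<le> t i" "\<And>i. t i < 1"
  shows "decode (encode_seq t) = t"
proof
  fix i
  have "digit ((shift ^^ prod_encode (i, j)) (encode_seq t)) = bit j (t i)" for j
    unfolding encode_seq_def by (subst digit_shift_power_encode(2)) (auto simp: bit_cases)
  then show "decode (encode_seq t) i = t i"
    unfolding decode_def using sums_unique[OF bit_sums[OF assms, of i]] by simp
qed

text \<open>On the gap between 1/3 and 2/3 the function \<open>digit\<close> interpolates linearly,
  so each summand is continuous; the weights \<open>1 / 2 ^ Suc j\<close> make the series converge
  uniformly.\<close>

lemma decode_continuous: "continuous_on UNIV decode"
proof (rule continuous_on_coordinatewise_then_product)
  fix i
  have sc: "continuous_on UNIV (shift ^^ n)" for n
  proof (induction n)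
    case (Suc n)
    have "continuous_on UNIV shift" unfolding shift_def digit_def by (intro continuous_intros)
    then show ?case using Suc by (auto intro: continuous_on_compose2)
  qed (simp add: continuous_on_id id_def)
  have dc: "continuous_on UNIV (\<lambda>c. digit ((shift ^^ n) c))" for n
    unfolding digit_def by (intro continuous_intros continuous_on_compose2[OF sc]) auto
  have "uniform_limit UNIV (\<lambda>n c. \<Sum>j<n. digit ((shift ^^ prod_encode (i, j)) c) / 2 ^ Suc j)
      (\<lambda>c. \<Sum>j. digit ((shift ^^ prod_encode (i, j)) c) / 2 ^ Suc j) sequentially"
  proof (rule Weierstrass_m_test[where M="\<lambda>j. (1/2) ^ Suc j"])
    show "norm (digit ((shift ^^ prod_encode (i, j)) c) / 2 ^ Suc j) \<le> (1/2) ^ Suc j" for j c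
      by (simp add: digit_def power_divide field_simps)
    show "summable (\<lambda>j. (1/2::real) ^ Suc j)" by (subst summable_Suc_iff) (rule summable_geometric, simp)
  qed
  then have "continuous_on UNIV (\<lambda>c. \<Sum>j. digit ((shift ^^ prod_encode (i, j)) c) / 2 ^ Suc j)"
    by (rule uniform_limit_theorem[rotated]) (auto intro!: always_eventually continuous_on_sum continuous_on_divide dc)
  then show "continuous_on UNIV (\<lambda>c. decode c i)" by (simp add: decode_def)
qed

lemma encode_seq_bounds: "0 \<le> encode_seq t" "encode_seq t \<le> 1"
proof -
  have "0 \<le> bit j x \<and> bit j x \<le> 1" for j x using bit_cases[of j x] by auto
  then show "0 \<le> encode_seq t" "encode_seq t \<le> 1" unfolding encode_seq_def by (intro encode_bounds; simp)+
qed

lemma encode_seq_measurable: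
  assumes [measurable]: "\<And>i. (\<lambda>x. F x i) \<in> borel_measurable M"
  shows "(\<lambda>x. encode_seq (F x)) \<in> borel_measurable M"
proof -
  have [measurable]: "(\<lambda>x. bit j (F x i)) \<in> borel_measurable M" for i j unfolding bit_def by measurable
  show ?thesis unfolding encode_seq_def encode_def by measurable
qed

text \<open>Encoding is measurable but not continuous. This suffices, because only decoding has to
  be compatible with weak limits: the codes have laws on \<open>[0, 1]\<close>, a subsequence of
  these converges weakly, and the limit is pushed forward by the continuous decoding.\<close>

lemma bounded_laws_convergent_subsequence:
  fixes M :: "nat \<Rightarrow> 'a measure" and F :: "nat \<Rightarrow> 'a \<Rightarrow> nat \<Rightarrow> real"
  assumes M: "\<And>n. prob_space (M n)" and Fm: "\<And>n i. (\<lambda>x. F n x i) \<in> borel_measurable (M n)"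
    and b: "\<And>n x i. x \<in> space (M n) \<Longrightarrow> 0 \<le> F n x i" "\<And>n x i. x \<in> space (M n) \<Longrightarrow> F n x i \<le> C"
  obtains r and \<nu> :: "(nat \<Rightarrow> real) measure" where "strict_mono (r :: nat \<Rightarrow> nat)" "prob_space \<nu>" "sets \<nu> = sets borel"
    "\<And>(\<phi> :: (nat \<Rightarrow> real) \<Rightarrow> real) B. continuous_on UNIV \<phi> \<Longrightarrow> (\<And>t. \<bar>\<phi> t\<bar> \<le> B) \<Longrightarrow>
      (\<lambda>k. \<integral>x. \<phi> (F (r k) x) \<partial>M (r k)) \<longlonglongrightarrow> (\<integral>t. \<phi> t \<partial>\<nu>)"
proof -
  \<comment> \<open>The extra 1 brings the scaled values strictly below 1, where the binary digits
    recover them.\<close>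
  define c where "c = \<bar>C\<bar> + 1"
  have c: "0 < c" by (simp add: c_def)
  define f where "f n x = encode_seq (\<lambda>i. F n x i / c)" for n x
  have fm: "f n \<in> borel_measurable (M n)" for n
    unfolding f_def[abs_def] by (rule encode_seq_measurable) (use Fm in measurable)
  have df: "c * decode (f n x) i = F n x i" if x: "x \<in> space (M n)" for n x i
  proof -
    have "decode (f n x) = (\<lambda>i. F n x i / c)"
      unfolding f_def
    proof (rule decode_encode_seq)
      fix i
      show "0 \<le> F n x i / c" using b(1)[OF x] c by simp
      show "F n x i / c < 1" using b(2)[OF x, of i] c by (simp add: c_def field_simps abs_le_iff)
    qed
    then show ?thesis using c by simp
  qed
  define \<theta> where "\<theta> n = distr (M n) borel (f n)" for n
  have rd: "real_distribution (\<theta> n)" for n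
    unfolding \<theta>_def by (rule prob_space.real_distribution_distr[OF M fm])
  have "tight \<theta>"
    unfolding tight_def
  proof (intro conjI allI impI rd)
    fix e :: real assume e: "0 < e"
    have "measure (\<theta> n) {-1<..1} = 1" for n
    proof -
      have "-1 < f n x \<and> f n x \<le> 1" for x
        using encode_seq_bounds[of "\<lambda>i. F n x i / c"] unfolding f_def by linarith
      then have "f n -` {-1<..1} \<inter> space (M n) = space (M n)" by auto
      then show ?thesis unfolding \<theta>_def using measure_distr[OF fm] prob_space.prob_space[OF M] by simp
    qed
    then show "\<exists>a b. a < b \<and> (\<forall>n. 1 - e < measure (\<theta> n) {a<..b})" using e by (intro exI[of _ "-1"] exI[of _ 1]) auto
  qed
  from tight_imp_convergent_subsubsequence[OF this strict_mono_id]
  obtain r \<theta>' where r: "strict_mono (r :: nat \<Rightarrow> nat)" and \<theta>': "real_distribution \<theta>'" "weak_conv_m (\<theta> \<circ> id \<circ> r) \<theta>'"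
    by blast
  interpret T: real_distribution \<theta>' by (rule \<theta>'(1))
  define g where "g x = (\<lambda>i. c * decode x i)" for x
  have dc: "continuous_on UNIV (\<lambda>x. decode x i)" for i
    using continuous_on_product_then_coordinatewise[OF decode_continuous] .
  have gc: "continuous_on UNIV g"
    unfolding g_def by (intro continuous_on_coordinatewise_then_product continuous_intros dc)
  have gm: "g \<in> borel_measurable borel" by (rule borel_measurable_continuous_onI[OF gc])
  have gm': "g \<in> borel_measurable \<theta>'" using gm by simp
  show thesis
  proof (rule that[OF r, of "distr \<theta>' borel g"])
    show "prob_space (distr \<theta>' borel g)" by (rule T.prob_space_distr[OF gm'])
    fix \<phi> :: "(nat \<Rightarrow> real) \<Rightarrow> real" and B assume \<phi>: "continuous_on UNIV \<phi>" "\<And>t. \<bar>\<phi> t\<bar> \<le> B"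
    have \<phi>m: "\<phi> \<in> borel_measurable borel" by (rule borel_measurable_continuous_onI[OF \<phi>(1)])
    have "continuous_on UNIV (\<lambda>x. \<phi> (g x))" by (rule continuous_on_compose2[OF \<phi>(1) gc]) simp
    then have ic: "isCont (\<lambda>x. \<phi> (g x)) x" for x by (simp add: continuous_on_eq_continuous_at)
    have lim: "(\<lambda>k. integral\<^sup>L ((\<theta> \<circ> id \<circ> r) k) (\<lambda>x. \<phi> (g x))) \<longlonglongrightarrow> integral\<^sup>L \<theta>' (\<lambda>x. \<phi> (g x))"
      by (rule weak_conv_imp_integral_bdd_continuous_conv[where B=B, OF _ \<theta>'(1) \<theta>'(2)])
         (auto simp: rd ic \<phi>(2))
    have e1: "(\<lambda>k. integral\<^sup>L ((\<theta> \<circ> id \<circ> r) k) (\<lambda>x. \<phi> (g x))) = (\<lambda>k. \<integral>x. \<phi> (F (r k) x) \<partial>M (r k))"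
    proof
      fix k
      have "integral\<^sup>L (\<theta> (r k)) (\<lambda>x. \<phi> (g x)) = (\<integral>x. \<phi> (g (f (r k) x)) \<partial>M (r k))"
        unfolding \<theta>_def by (rule integral_distr[OF fm]) (rule measurable_compose[OF gm \<phi>m])
      also have "\<dots> = (\<integral>x. \<phi> (F (r k) x) \<partial>M (r k))"
        by (intro Bochner_Integration.integral_cong refl arg_cong[where f=\<phi>]) (auto simp: g_def df)
      finally show "integral\<^sup>L ((\<theta> \<circ> id \<circ> r) k) (\<lambda>x. \<phi> (g x)) = (\<integral>x. \<phi> (F (r k) x) \<partial>M (r k))" by simp
    qed
    have e2: "integral\<^sup>L \<theta>' (\<lambda>x. \<phi> (g x)) = (\<integral>t. \<phi> t \<partial>distr \<theta>' borel g)"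
      by (rule integral_distr[OF gm' \<phi>m, symmetric])
    show "(\<lambda>k. \<integral>x. \<phi> (F (r k) x) \<partial>M (r k)) \<longlonglongrightarrow> (\<integral>t. \<phi> t \<partial>distr \<theta>' borel g)"
      using lim unfolding e1 e2 .
  qed simp
qed

section \<open>Limits of bounded observables along a convergent sequence of pyramids\<close>

lemma soft_cell_continuous_on:
  assumes "\<And>j. continuous_on UNIV (D (c j))" "0 < e"
  shows "continuous_on UNIV (soft_cell D e c m i)"
  using soft_cell_continuous[of euclidean D c e m i] assms by simp

text \<open>The limit of the joint laws is a law on sequences. Its quotient \<open>Z\<close> by the
  functions \<open>\<phi> (t i)\<close> with \<open>\<phi>\<close> in \<open>L\<close> is compared
  with the quotients of the \<open>X (s k)\<close> by the corresponding functions
  \<open>\<phi> \<circ> h (s k) i\<close>. These belong to the given pyramids and are close to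
  \<open>Z\<close>, so \<open>Z\<close> lies in the limit.\<close>

lemma pyramid_limit_observables:
  fixes X :: "nat \<Rightarrow> real gdset" and h :: "nat \<Rightarrow> nat \<Rightarrow> real \<Rightarrow> real"
  assumes L: "L \<subseteq> Lip1_R" "(\<lambda>t. t) \<in> L" "\<And>\<phi> \<psi>. \<phi> \<in> L \<Longrightarrow> \<psi> \<in> L \<Longrightarrow> \<phi> \<circ> \<psi> \<in> L"
    and P: "\<And>n. pyramid L (P n)" and conv: "pyramid_conv L P Q" and r: "strict_mono r"
    and X: "\<And>k. X k \<in> P (r k)" and m: "0 < m" and h: "\<And>k i. i < m \<Longrightarrow> h k i \<in> gd_closure (X k)"
    and hb: "\<And>k i x. i < m \<Longrightarrow> x \<in> pts (X k) \<Longrightarrow> 0 \<le> h k i x \<and> h k i x \<le> C"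
  obtains Z g s where "Z \<in> Q" "gd_set Z" "strict_mono (s :: nat \<Rightarrow> nat)" "\<And>i. i < m \<Longrightarrow> g i \<in> gd_closure Z"
    "\<And>e. 0 < e \<Longrightarrow> \<forall>\<^sub>F k in sequentially. \<exists>(M :: (real \<times> (nat \<Rightarrow> real)) measure) a b E.
      gd_pair (X (s k)) Z M a b \<and> E \<in> sets M \<and> 1 - e \<le> measure M E \<and>
      (\<forall>w\<in>E. \<forall>i<m. \<bar>h (s k) i (a w) - g i (b w)\<bar> \<le> e)"
proof -
  have LX: "X k \<in> LD L" for k using P X unfolding pyramid_def by blast
  have gX: "gd_set (X k)" and LgX: "L_gd_set L (X k)" for k using LX[of k] by (auto simp: LD_def L_gd_set_def)
  have pX: "prob_space (msr (X k))" for k by (rule gd_prob[OF gX])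
  define F where "F k x = (\<lambda>i. if i < m then h k i x else 0)" for k x
  have Fm: "(\<lambda>x. F k x i) \<in> borel_measurable (msr (X k))" for k i
    unfolding F_def by (cases "i < m") (auto intro: closure_measurable[OF gX h])
  obtain s and \<nu> :: "(nat \<Rightarrow> real) measure" where s: "strict_mono (s :: nat \<Rightarrow> nat)" and \<nu>: "prob_space \<nu>" "sets \<nu> = sets borel"
    and wc: "\<And>(\<phi> :: (nat \<Rightarrow> real) \<Rightarrow> real) B. continuous_on UNIV \<phi> \<Longrightarrow> (\<And>t. \<bar>\<phi> t\<bar> \<le> B) \<Longrightarrow>
      (\<lambda>k. \<integral>x. \<phi> (F (s k) x) \<partial>msr (X (s k))) \<longlonglongrightarrow> (\<integral>t. \<phi> t \<partial>\<nu>)"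
  proof (rule bounded_laws_convergent_subsequence[where M="\<lambda>k. msr (X k)" and F=F and C="\<bar>C\<bar>", OF pX Fm])
    show "0 \<le> F n x i" "F n x i \<le> \<bar>C\<bar>" if "x \<in> space (msr (X n))" for n x i
      using that gX hb[of i x n] by (auto simp: F_def)
  qed blast
  have sp\<nu>: "space \<nu> = UNIV" using sets_eq_imp_space_eq[OF \<nu>(2)] by simp
  \<comment> \<open>A pseudometric that sees the first \<open>m\<close> coordinates, those on which
    the observables depend.\<close>
  define D where "D x y = (\<Sum>i<m. \<bar>x i - y i\<bar>)" for x y :: "nat \<Rightarrow> real"
  have Dc: "continuous_on UNIV (D x)" for x
    unfolding D_def by (intro continuous_intros continuous_on_product_coordinates)
  have Di: "\<bar>x i - y i\<bar> \<le> D x y" if "i < m" for x y i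
    unfolding D_def by (rule member_le_sum[where f="\<lambda>i. \<bar>x i - y i\<bar>"]) (use that in auto)
  obtain c :: "nat \<Rightarrow> nat \<Rightarrow> real" where c: "\<And>x e. 0 < e \<Longrightarrow> \<exists>n. D (c n) x < e"
  proof -
    obtain T :: "(nat \<Rightarrow> real) set" where T: "countable T" "UNIV \<subseteq> closure T" using separable[of UNIV] by metis
    have "T \<noteq> {}" using T(2) by auto
    have "\<exists>n. D (from_nat_into T n) x < e" if e: "0 < e" for x and e :: real
    proof -
      have "open {y. D x y < e}" using Dc[of x] by (intro open_Collect_less continuous_intros)
      moreover have "x \<in> {y. D x y < e}" using e by (simp add: D_def)
      ultimately obtain y where "y \<in> T" "D x y < e"
        using T(2) open_Int_closure_eq_empty[of "{y. D x y < e}" T] by auto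
      moreover obtain n where "from_nat_into T n = y" using from_nat_into_surj[OF T(1) \<open>y \<in> T\<close>] by blast
      moreover have "D y x = D x y" by (simp add: D_def abs_minus_commute)
      ultimately show ?thesis by (intro exI[of _ n]) simp
    qed
    then show thesis using that by blast
  qed
  \<comment> \<open>The coordinates themselves need not form a family invariant under
    \<open>L\<close>. All their images under \<open>L\<close> do, as \<open>L\<close> is closed
    under composition, and the identity in \<open>L\<close> keeps the coordinates among
    them.\<close>
  define \<Phi> where "\<Phi> = {f. \<exists>\<phi>\<in>L. \<exists>i<m. f = (\<lambda>t :: nat \<Rightarrow> real. \<phi> (t i))}"
  have \<Phi>D: "\<bar>f x - f y\<bar> \<le> D x y" if f: "f \<in> \<Phi>" for f x y
  proof -
    obtain \<phi> i where "\<phi> \<in> L" "i < m" "f = (\<lambda>t. \<phi> (t i))" using f by (auto simp: \<Phi>_def)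
    then show ?thesis using Lip1_R_le[of \<phi> "x i" "y i"] Di[of i x y] L(1) by auto
  qed
  have \<Phi>c: "continuous_on UNIV f" if f': "f \<in> \<Phi>" for f
  proof -
    obtain \<phi> i where f: "\<phi> \<in> L" "f = (\<lambda>t. \<phi> (t i))" using f' by (auto simp: \<Phi>_def)
    have "continuous_on UNIV \<phi>" using f(1) L(1) by (auto simp: Lip1_R_def intro: lipschitz_on_continuous_on)
    then show ?thesis unfolding f(2) by (rule continuous_on_compose2) (auto intro: continuous_on_product_coordinates)
  qed
  have id: "(\<lambda>t. t i) \<in> \<Phi>" if "i < m" for i using that L(2) by (force simp: \<Phi>_def)
  obtain Z :: "real gdset" and q ev' G where Z: "gd_set Z" "q \<in> \<nu> \<rightarrow>\<^sub>M msr Z" "distr \<nu> (msr Z) q = msr Z"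
    "obs Z = ev' ` \<Phi>" and G: "G \<in> sets \<nu>" "measure \<nu> G = 1" "\<And>x f. x \<in> G \<Longrightarrow> f \<in> \<Phi> \<Longrightarrow> ev' f (q x) = f x"
    and nr: "\<And>w e. w \<in> pts Z \<Longrightarrow> 0 < e \<Longrightarrow> \<exists>x\<in>space \<nu>. \<forall>f\<in>\<Phi>. \<bar>f x - ev' f w\<bar> \<le> e"
  proof (rule real_quotient[of \<nu> \<Phi> c])
    show "prob_space \<nu>" by (rule \<nu>(1))
    show "\<Phi> \<noteq> {}" using id[OF m] by auto
    show "\<exists>C. \<forall>f\<in>\<Phi>. \<bar>f x - f y\<bar> \<le> C" for x y using \<Phi>D by blast
    show "\<exists>n. \<forall>f\<in>\<Phi>. \<bar>f x - f (c n)\<bar> \<le> e" if e: "0 < e" for x e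
    proof -
      obtain n where "D (c n) x < e" using c[OF e] by blast
      then show ?thesis using \<Phi>D[of _ "c n" x] by (intro exI[of _ n]) (force simp: abs_minus_commute)
    qed
    show "{x \<in> space \<nu>. \<forall>f\<in>\<Phi>. \<bar>f x - t f\<bar> \<le> e} \<in> sets \<nu>" for t e
    proof -
      have "closed {x. \<forall>f\<in>\<Phi>. \<bar>f x - t f\<bar> \<le> e}"
      proof -
        have "{x. \<forall>f\<in>\<Phi>. \<bar>f x - t f\<bar> \<le> e} = (\<Inter>f\<in>\<Phi>. {x. \<bar>f x - t f\<bar> \<le> e})" by auto
        also have "closed \<dots>" by (intro closed_INT ballI closed_Collect_le continuous_intros \<Phi>c)
        finally show ?thesis .
      qed
      then show ?thesis using \<nu>(2) sp\<nu> by simp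
    qed
  qed (auto simp: sp\<nu>)
  have "L_gd_set L Z"
  proof (rule real_quotient_L_gd_set[OF Z(1,4) L(1) nr])
    fix \<phi> f assume \<phi>: "\<phi> \<in> L" and "f \<in> \<Phi>"
    then obtain \<psi> i where f: "\<psi> \<in> L" "i < m" "f = (\<lambda>t. \<psi> (t i))" by (auto simp: \<Phi>_def)
    have "(\<lambda>t. (\<phi> \<circ> \<psi>) (t i)) \<in> \<Phi>" using L(3)[OF \<phi> f(1)] f(2) unfolding \<Phi>_def by blast
    then show "\<exists>f'\<in>\<Phi>. \<forall>x\<in>space \<nu>. f' x = \<phi> (f x)" using f(3) by auto
  qed
  then have ZL: "Z \<in> LD L" by (simp add: LD_def)
  define g where "g i = ev' (\<lambda>t. t i)" for i :: nat
  have g: "g i \<in> gd_closure Z" if "i < m" for i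
    using obs_subset_closure[OF Z(1)] Z(4) id[OF that] by (auto simp: g_def)
  \<comment> \<open>The same coupling serves twice, for the membership of \<open>Z\<close> in
    \<open>Q\<close> and for the comparison of \<open>h\<close> with \<open>g\<close>.\<close>
  have main: "\<forall>\<^sub>F k in sequentially. \<exists>(K :: (real \<times> (nat \<Rightarrow> real)) measure) E.
      gd_pair (X (s k)) Z K fst (q \<circ> snd) \<and> E \<in> sets K \<and> 1 - e \<le> measure K E \<and>
      (\<forall>(x, t)\<in>E. x \<in> pts (X (s k)) \<and> t \<in> G \<and> (\<forall>i<m. \<bar>h (s k) i x - t i\<bar> \<le> e))" if e: "0 < e" for e
  proof -
    \<comment> \<open>Two points of a common cell of radius \<open>d\<close> differ by less than
      \<open>2 * d = e\<close> in each of the first \<open>m\<close> coordinates.\<close>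
    define d where "d = e / 2"
    have d: "0 < d" using e by (simp add: d_def)
    have Dm: "D (c j) \<in> borel_measurable \<nu>" for j
      using borel_measurable_continuous_onI[OF Dc] \<nu>(2) measurable_cong_sets by blast
    obtain n where n: "1 - d \<le> (\<Sum>j<n. \<integral>y. soft_cell D d c n j y \<partial>\<nu>)"
      by (rule soft_cells_exhaust[of \<nu> D c d d]) (use \<nu> Dm c d in auto)
    define \<psi> where "\<psi> = soft_cell D d c n"
    have \<psi>c: "continuous_on UNIV (\<psi> j)" for j unfolding \<psi>_def by (rule soft_cell_continuous_on) (rule Dc, rule d)
    have \<psi>m: "\<psi> j \<in> borel_measurable borel" for j by (rule borel_measurable_continuous_onI[OF \<psi>c])
    have \<psi>m': "\<psi> j \<in> borel_measurable \<nu>" for j using \<psi>m \<nu>(2) measurable_cong_sets by blast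
    have Fm': "F k \<in> borel_measurable (msr (X k))" for k by (rule measurable_coordinatewise_then_product) (rule Fm)
    have "(\<lambda>k. \<integral>x. \<psi> j (F (s k) x) \<partial>msr (X (s k))) \<longlonglongrightarrow> (\<integral>t. \<psi> j t \<partial>\<nu>)" if j: "j < n" for j
    proof (rule wc[OF \<psi>c])
      show "\<bar>\<psi> j t\<bar> \<le> 1" for t
        using soft_cell_nonneg[of D d c n j t] soft_cell_le_1[OF j, of D d c t] by (simp add: \<psi>_def)
    qed
    then have "(\<lambda>k. \<Sum>j<n. min (\<integral>x. \<psi> j (F (s k) x) \<partial>msr (X (s k))) (\<integral>t. \<psi> j t \<partial>\<nu>))
        \<longlonglongrightarrow> (\<Sum>j<n. min (\<integral>t. \<psi> j t \<partial>\<nu>) (\<integral>t. \<psi> j t \<partial>\<nu>))"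
      by (intro tendsto_sum tendsto_min tendsto_const) simp
    then have "\<forall>\<^sub>F k in sequentially. 1 - 2 * d < (\<Sum>j<n. min (\<integral>x. \<psi> j (F (s k) x) \<partial>msr (X (s k))) (\<integral>t. \<psi> j t \<partial>\<nu>))"
      by (rule order_tendstoD) (use n d in \<open>simp add: \<psi>_def\<close>)
    then show ?thesis
    proof eventually_elim
      case (elim k)
      let ?X = "X (s k)"
      have m1: "(\<lambda>x. \<psi> j (F (s k) x)) \<in> borel_measurable (msr ?X)" for j by (rule measurable_compose[OF Fm' \<psi>m])
      obtain K where K: "prob_space K" "sets K = sets (msr ?X \<Otimes>\<^sub>M \<nu>)" "distr K (msr ?X) fst = msr ?X"
        "distr K \<nu> snd = \<nu>"
        "\<And>E. E \<in> sets (msr ?X \<Otimes>\<^sub>M \<nu>) \<Longrightarrow>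
          (\<And>x y i. i < n \<Longrightarrow> x \<in> space (msr ?X) \<Longrightarrow> y \<in> space \<nu> \<Longrightarrow> 0 < \<psi> i (F (s k) x) \<Longrightarrow> 0 < \<psi> i y \<Longrightarrow> (x, y) \<in> E) \<Longrightarrow>
          (\<Sum>i<n. min (\<integral>x. \<psi> i (F (s k) x) \<partial>msr ?X) (\<integral>y. \<psi> i y \<partial>\<nu>)) \<le> measure K E"
        by (rule soft_coupling[OF pX[of "s k"] \<nu>(1), where \<xi>="\<lambda>i x. \<psi> i (F (s k) x)" and \<psi>=\<psi> and m=n])
           (use m1 \<psi>m' in \<open>auto simp: \<psi>_def soft_cell_nonneg soft_cell_sum_le\<close>)
      interpret K: prob_space K by (rule K(1))
      have spK: "space K = pts ?X \<times> UNIV" using sets_eq_imp_space_eq[OF K(2)] gX[of "s k"] by (simp add: space_pair_measure sp\<nu>)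
      have fK: "fst \<in> K \<rightarrow>\<^sub>M msr ?X" "snd \<in> K \<rightarrow>\<^sub>M \<nu>" unfolding measurable_cong_sets[OF K(2) refl] by simp_all
      define E0 where "E0 = {z \<in> space K. \<exists>i\<in>{..<n}. 0 < \<psi> i (F (s k) (fst z)) \<and> 0 < \<psi> i (snd z)}"
      have [measurable]: "(\<lambda>z. \<psi> i (F (s k) (fst z))) \<in> borel_measurable K" "(\<lambda>z. \<psi> i (snd z)) \<in> borel_measurable K" for i
        by (rule measurable_compose[OF fK(1) m1], rule measurable_compose[OF fK(2) \<psi>m'])
      have E0: "E0 \<in> sets K" unfolding E0_def by measurable
      have "(\<Sum>i<n. min (\<integral>x. \<psi> i (F (s k) x) \<partial>msr ?X) (\<integral>y. \<psi> i y \<partial>\<nu>)) \<le> measure K E0"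
        by (rule K(5)) (use E0 K(2) gX[of "s k"] in \<open>auto simp: E0_def spK\<close>)
      then have mE0: "1 - e \<le> measure K E0" using elim by (simp add: d_def)
      \<comment> \<open>The observables of \<open>Z\<close> return the coordinates only on
        \<open>G\<close>, which has full measure; the intersection with \<open>E1\<close> loses no
        mass.\<close>
      define E1 where "E1 = snd -` G \<inter> space K"
      have E1: "E1 \<in> sets K" unfolding E1_def by (rule measurable_sets[OF fK(2) G(1)])
      have "measure K E1 = 1" using measure_distr[OF fK(2) G(1)] K(4) G(2) by (simp add: E1_def)
      then have mE: "1 - e \<le> measure K (E0 \<inter> E1)" using K.prob_Int_ge[OF E0 E1] mE0 by linarith
      have "gd_pair ?X Z K fst (q \<circ> snd)"
      proof (rule gd_pair.intro[OF gX Z(1) K(1) fK(1) K(3)])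
        show "q \<circ> snd \<in> K \<rightarrow>\<^sub>M msr Z" by (rule measurable_comp[OF fK(2) Z(2)])
        show "distr K (msr Z) (q \<circ> snd) = msr Z" using distr_distr[OF Z(2) fK(2)] K(4) Z(3) by simp
      qed
      moreover have "x \<in> pts ?X \<and> t \<in> G \<and> (\<forall>i<m. \<bar>h (s k) i x - t i\<bar> \<le> e)" if w: "(x, t) \<in> E0 \<inter> E1" for x t
      proof (intro conjI allI impI)
        show "x \<in> pts ?X" "t \<in> G" using w by (auto simp: E1_def spK)
        fix i assume i: "i < m"
        obtain j where j: "0 < \<psi> j (F (s k) x)" "0 < \<psi> j t" using w by (auto simp: E0_def)
        then have "D (c j) (F (s k) x) < d" "D (c j) t < d"
          using soft_cell_pos[OF _ d, of D c n j] by (auto simp: \<psi>_def)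
        then have "\<bar>c j i - F (s k) x i\<bar> < d" "\<bar>c j i - t i\<bar> < d"
          using Di[OF i, of "c j" "F (s k) x"] Di[OF i, of "c j" t] by auto
        then have "\<bar>F (s k) x i - t i\<bar> < d + d" by linarith
        then show "\<bar>h (s k) i x - t i\<bar> \<le> e" using i by (simp add: F_def d_def)
      qed
      ultimately show ?case using E0 E1 mE by (intro exI[of _ K] exI[of _ "E0 \<inter> E1"]) auto
    qed
  qed
  have "Z \<in> Q"
  proof (rule pyramid_conv_mem[OF conv ZL])
    show "gd_set W" if "W \<in> P n" for n W using that P[of n] by (auto simp: pyramid_def LD_def L_gd_set_def)
    fix e :: real assume e: "0 < e"
    have "\<forall>\<^sub>F k in sequentially. \<exists>W\<in>P (r (s k)). gd_box Z W \<le> e"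
      using main[OF half_gt_zero[OF e]]
    proof eventually_elim
      case (elim k)
      let ?X = "X (s k)"
      obtain K :: "(real \<times> (nat \<Rightarrow> real)) measure" and E where K: "gd_pair ?X Z K fst (q \<circ> snd)" "E \<in> sets K"
        "1 - e / 2 \<le> measure K E"
        and E: "\<And>x t. (x, t) \<in> E \<Longrightarrow> x \<in> pts ?X \<and> t \<in> G \<and> (\<forall>i<m. \<bar>h (s k) i x - t i\<bar> \<le> e / 2)"
        using elim by blast
      interpret XZ: gd_pair ?X Z K fst "q \<circ> snd" by (rule K(1))
      \<comment> \<open>The counterpart of \<open>\<Phi>\<close> on \<open>X (s k)\<close>. Equal
        labels \<open>\<phi>\<close>, \<open>i\<close> match its members with the observables of
        \<open>Z\<close>, and \<open>\<phi>\<close> does not enlarge the error.\<close>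
      define H where "H = {f. \<exists>\<phi>\<in>L. \<exists>i<m. f = compose (pts ?X) \<phi> (h (s k) i)}"
      have Hs: "H \<subseteq> gd_closure ?X" using LgX[of "s k"] h by (auto simp: H_def L_gd_set_def)
      have Hn: "H \<noteq> {}" using L(2) m by (auto simp: H_def)
      obtain W :: "real gdset" and u evW where W: "gd_set W" "domination ?X W u" "obs W = evW ` H"
        "\<And>x f. x \<in> pts ?X \<Longrightarrow> f \<in> H \<Longrightarrow> evW f (u x) = f x"
        and inv: "L \<subseteq> Lip1_R \<Longrightarrow> (\<And>\<phi> f. \<phi> \<in> L \<Longrightarrow> f \<in> H \<Longrightarrow> compose (pts ?X) \<phi> f \<in> H) \<Longrightarrow> L_gd_set L W"
        using gd_quotient[OF gX Hs Hn] by metis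
      have "L_gd_set L W"
      proof (rule inv[OF L(1)])
        fix \<phi> f assume \<phi>: "\<phi> \<in> L" and "f \<in> H"
        then obtain \<psi> i where f: "\<psi> \<in> L" "i < m" "f = compose (pts ?X) \<psi> (h (s k) i)" by (auto simp: H_def)
        have "compose (pts ?X) \<phi> f = compose (pts ?X) (\<phi> \<circ> \<psi>) (h (s k) i)"
          unfolding f(3) by (auto simp: compose_def fun_eq_iff)
        then show "compose (pts ?X) \<phi> f \<in> H" using L(3)[OF \<phi> f(1)] f(2) unfolding H_def by blast
      qed
      then have "W \<in> LD L" by (simp add: LD_def)
      moreover have "dominated W ?X" using W(2) by (auto simp: dominated_def)
      ultimately have WP: "W \<in> P (r (s k))" using P[of "r (s k)"] X[of "s k"] unfolding pyramid_def by blast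
      have u: "u \<in> msr ?X \<rightarrow>\<^sub>M msr W" "distr (msr ?X) (msr W) u = msr W" using W(2) by (auto simp: domination_def)
      interpret ZW: gd_pair Z W K "q \<circ> snd" "u \<circ> fst"
      proof (rule gd_pair.intro[OF Z(1) W(1) XZ.M XZ.b])
        show "u \<circ> fst \<in> K \<rightarrow>\<^sub>M msr W" by (rule measurable_comp[OF XZ.a(1) u(1)])
        show "distr K (msr W) (u \<circ> fst) = msr W" using distr_distr[OF u(1) XZ.a(1)] XZ.a(2) u(2) by simp
      qed
      have key: "\<bar>ev' (\<lambda>t. \<phi> (t i)) ((q \<circ> snd) w) - evW (compose (pts ?X) \<phi> (h (s k) i)) ((u \<circ> fst) w)\<bar> \<le> e / 2"
        if \<phi>: "\<phi> \<in> L" "i < m" and w: "w \<in> E" for \<phi> i w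
      proof -
        obtain x t where xt: "w = (x, t)" by force
        have *: "x \<in> pts ?X" "t \<in> G" "\<bar>h (s k) i x - t i\<bar> \<le> e / 2" using E w xt \<phi>(2) by auto
        have "(\<lambda>t. \<phi> (t i)) \<in> \<Phi>" "compose (pts ?X) \<phi> (h (s k) i) \<in> H" using \<phi> unfolding \<Phi>_def H_def by blast+
        then have "ev' (\<lambda>t. \<phi> (t i)) (q t) = \<phi> (t i)" "evW (compose (pts ?X) \<phi> (h (s k) i)) (u x) = \<phi> (h (s k) i x)"
          using G(3)[OF *(2)] W(4)[OF *(1)] *(1) by (auto simp: compose_def)
        moreover have "\<bar>\<phi> (t i) - \<phi> (h (s k) i x)\<bar> \<le> \<bar>t i - h (s k) i x\<bar>" using Lip1_R_le \<phi>(1) L(1) by blast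
        moreover have "\<bar>t i - h (s k) i x\<bar> \<le> e / 2" using *(3) by linarith
        ultimately show ?thesis using xt by simp
      qed
      have "gd_box Z W \<le> e"
      proof (rule ZW.gd_box_pair[OF K(2)])
        fix f assume "f \<in> obs Z"
        then obtain \<phi> i where f: "\<phi> \<in> L" "i < m" "f = ev' (\<lambda>t. \<phi> (t i))" using Z(4) by (auto simp: \<Phi>_def)
        have "evW (compose (pts ?X) \<phi> (h (s k) i)) \<in> gd_closure W"
          using obs_subset_closure[OF W(1)] W(3) f(1,2) unfolding H_def by blast
        then show "\<exists>g\<in>gd_closure W. \<forall>w\<in>E. \<bar>f ((q \<circ> snd) w) - g ((u \<circ> fst) w)\<bar> \<le> e / 2"
          using key[OF f(1,2)] f(3) by blast
      next
        fix f assume "f \<in> obs W"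
        then obtain \<phi> i where f: "\<phi> \<in> L" "i < m" "f = evW (compose (pts ?X) \<phi> (h (s k) i))" using W(3) by (auto simp: H_def)
        have "ev' (\<lambda>t. \<phi> (t i)) \<in> gd_closure Z"
          using obs_subset_closure[OF Z(1)] Z(4) f(1,2) unfolding \<Phi>_def by blast
        then show "\<exists>g\<in>gd_closure Z. \<forall>w\<in>E. \<bar>g ((q \<circ> snd) w) - f ((u \<circ> fst) w)\<bar> \<le> e / 2"
          using key[OF f(1,2)] f(3) by blast
      qed (use K(3) e in auto)
      then show ?case using WP by blast
    qed
    then have fs: "\<exists>\<^sub>F k in sequentially. \<exists>W\<in>P (r (s k)). gd_box Z W \<le> e"
      by (rule eventually_frequently[rotated]) simp
    \<comment> \<open>Closeness is known along the indices \<open>r (s k)\<close> only, which are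
      infinitely many because the composition is strictly increasing.\<close>
    show "\<exists>\<^sub>F n in sequentially. \<exists>W\<in>P n. gd_box Z W \<le> e"
    proof (rule ccontr)
      assume "\<not> (\<exists>\<^sub>F n in sequentially. \<exists>W\<in>P n. gd_box Z W \<le> e)"
      then have "\<forall>\<^sub>F n in sequentially. \<not> (\<exists>W\<in>P n. gd_box Z W \<le> e)" by (simp add: not_frequently)
      from eventually_subseq[OF strict_mono_o[OF r s] this] fs show False
        by (simp add: frequently_def o_def)
    qed
  qed
  moreover have "\<forall>\<^sub>F k in sequentially. \<exists>(M :: (real \<times> (nat \<Rightarrow> real)) measure) a b E.
      gd_pair (X (s k)) Z M a b \<and> E \<in> sets M \<and> 1 - e \<le> measure M E \<and>
      (\<forall>w\<in>E. \<forall>i<m. \<bar>h (s k) i (a w) - g i (b w)\<bar> \<le> e)" if e: "0 < e" for e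
    using main[OF e]
  proof eventually_elim
    case (elim k)
    then obtain K :: "(real \<times> (nat \<Rightarrow> real)) measure" and E where K: "gd_pair (X (s k)) Z K fst (q \<circ> snd)" "E \<in> sets K"
        "1 - e \<le> measure K E"
        and E: "\<And>x t. (x, t) \<in> E \<Longrightarrow> x \<in> pts (X (s k)) \<and> t \<in> G \<and> (\<forall>i<m. \<bar>h (s k) i x - t i\<bar> \<le> e)" by blast
    have "\<bar>h (s k) i (fst w) - g i ((q \<circ> snd) w)\<bar> \<le> e" if w: "w \<in> E" and i: "i < m" for w i
    proof -
      obtain x t where "w = (x, t)" by force
      then show ?thesis using E[of x t] w i G(3)[of t "\<lambda>t. t i"] id[OF i] by (auto simp: g_def)
    qed
    then show ?case using K by blast
  qed
  ultimately show thesis using that[of Z s g] Z(1) s g by blast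
qed

section \<open>Observable diameter\<close>

lemma ediam_le: "(\<And>s t. s \<in> B \<Longrightarrow> t \<in> B \<Longrightarrow> \<bar>s - t\<bar> \<le> c) \<Longrightarrow> ediam B \<le> ennreal c"
  unfolding ediam_def by (intro SUP_least ennreal_leI) auto

lemma PartDiam_interval_le:
  assumes "sets \<nu> = sets borel" "\<alpha> \<le> measure \<nu> {l..l + D}" "0 \<le> D"
  shows "PartDiam \<nu> \<alpha> \<le> ennreal D"
proof -
  have "PartDiam \<nu> \<alpha> \<le> ediam {l..l + D}" unfolding PartDiam_def by (rule Inf_lower) (use assms in auto)
  also have "\<dots> \<le> ennreal D" by (rule ediam_le) (auto simp: abs_le_iff)
  finally show ?thesis .
qed

text \<open>Passing from a set to its closed interval hull does not change the diameter and can only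
  increase the mass. Positivity of \<open>\<alpha>\<close> excludes the empty set, which has no
  hull.\<close>

lemma PartDiam_less_interval:
  assumes \<nu>: "prob_space \<nu>" "sets \<nu> = sets borel" and less: "PartDiam \<nu> \<alpha> < ennreal c" and \<alpha>: "0 < \<alpha>"
  obtains l D where "0 \<le> D" "D < c" "\<alpha> \<le> measure \<nu> {l..l + D}"
proof -
  interpret prob_space \<nu> by (rule \<nu>(1))
  obtain B where B: "B \<in> sets borel" "\<alpha> \<le> measure \<nu> B" "ediam B < ennreal c"
    using less unfolding PartDiam_def Inf_less_iff by auto
  have "B \<noteq> {}" using B(2) \<alpha> by auto
  then obtain b0 where b0: "b0 \<in> B" by blast
  have "ediam B \<noteq> top" using less_le_trans[OF B(3) top_greatest] by simp
  then obtain D where D: "ediam B = ennreal D" "0 \<le> D" by (cases "ediam B") auto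
  have le: "\<bar>s - t\<bar> \<le> D" if "s \<in> B" "t \<in> B" for s t
  proof -
    have "ennreal \<bar>s - t\<bar> \<le> ediam B" unfolding ediam_def using that by (intro SUP_upper2[of s] SUP_upper2[of t]) auto
    then show ?thesis using D by simp
  qed
  have bb: "bdd_below B" using le[OF b0] by (intro bdd_belowI[of _ "b0 - D"]) (fastforce simp: abs_le_iff)
  have "B \<subseteq> {Inf B..Inf B + D}"
  proof
    fix b assume b: "b \<in> B"
    have "b - D \<le> Inf B"
    proof (rule cInf_greatest[OF \<open>B \<noteq> {}\<close>])
      fix x assume "x \<in> B"
      then show "b - D \<le> x" using le[OF b, of x] by (simp add: abs_le_iff)
    qed
    then show "b \<in> {Inf B..Inf B + D}" using cInf_lower[OF b bb] by auto
  qed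
  then have "measure \<nu> B \<le> measure \<nu> {Inf B..Inf B + D}" by (intro finite_measure_mono) (use \<nu> in auto)
  moreover have "D < c" using B(3) D by (simp add: ennreal_less_iff)
  ultimately show thesis using that[of D "Inf B"] D(2) B(2) by linarith
qed

lemma PartDiam_mono: "\<alpha> \<le> \<beta> \<Longrightarrow> PartDiam \<nu> \<alpha> \<le> PartDiam \<nu> \<beta>"
  unfolding PartDiam_def by (rule Inf_superset_mono) auto

lemma PartDiam_close:
  assumes M: "prob_space M" and f: "f \<in> borel_measurable M" and g: "g \<in> borel_measurable M"
    and E: "E \<in> sets M" "1 - d \<le> measure M E" and le: "\<And>w. w \<in> E \<Longrightarrow> \<bar>f w - g w\<bar> \<le> \<eta>"
    and \<eta>: "0 \<le> \<eta>" and less: "PartDiam (distr M borel f) \<alpha> < ennreal c" and \<alpha>: "0 < \<alpha>"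
  shows "PartDiam (distr M borel g) (\<alpha> - d) \<le> ennreal (c + 2 * \<eta>)"
proof -
  interpret prob_space M by (rule M)
  obtain l D where D: "0 \<le> D" "D < c" "\<alpha> \<le> measure (distr M borel f) {l..l + D}"
    by (rule PartDiam_less_interval[OF prob_space_distr[OF f] _ less \<alpha>]) auto
  have "\<alpha> \<le> prob (f -` {l..l + D} \<inter> space M)" using D(3) by (simp add: measure_distr[OF f])
  then have "\<alpha> - d \<le> prob ((f -` {l..l + D} \<inter> space M) \<inter> E)"
    using prob_Int_ge[of "f -` {l..l + D} \<inter> space M" E] E measurable_sets[OF f, of "{l..l + D}"] by simp
  also have "\<dots> \<le> prob (g -` {l - \<eta>..l - \<eta> + (D + 2 * \<eta>)} \<inter> space M)"
  proof (rule finite_measure_mono)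
    show "f -` {l..l + D} \<inter> space M \<inter> E \<subseteq> g -` {l - \<eta>..l - \<eta> + (D + 2 * \<eta>)} \<inter> space M"
    proof
      fix w assume w: "w \<in> f -` {l..l + D} \<inter> space M \<inter> E"
      then have "\<bar>f w - g w\<bar> \<le> \<eta>" "l \<le> f w" "f w \<le> l + D" using le by auto
      then have "l - \<eta> \<le> g w" "g w \<le> l - \<eta> + (D + 2 * \<eta>)" by linarith+
      then show "w \<in> g -` {l - \<eta>..l - \<eta> + (D + 2 * \<eta>)} \<inter> space M" using w by auto
    qed
  qed (use measurable_sets[OF g] in auto)
  also have "\<dots> = measure (distr M borel g) {l - \<eta>..l - \<eta> + (D + 2 * \<eta>)}" by (simp add: measure_distr[OF g])
  finally have "PartDiam (distr M borel g) (\<alpha> - d) \<le> ennreal (D + 2 * \<eta>)"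
    by (rule PartDiam_interval_le[rotated]) (use D \<eta> in auto)
  also have "\<dots> \<le> ennreal (c + 2 * \<eta>)" using D by (intro ennreal_leI) auto
  finally show ?thesis .
qed

text \<open>Intervals of length almost \<open>c\<close> and mass almost \<open>\<alpha>\<close>
  cannot run off to infinity, as a bounded interval carries most of the mass. A limit of their left
  ends gives an interval of length \<open>c\<close> with mass at least
  \<open>\<alpha>\<close>.\<close>

lemma PartDiam_left_continuous:
  assumes \<nu>: "prob_space \<nu>" "sets \<nu> = sets borel" and \<alpha>: "0 < \<alpha>" and c: "0 \<le> c"
    and le: "\<And>\<beta>. 0 < \<beta> \<Longrightarrow> \<beta> < \<alpha> \<Longrightarrow> PartDiam \<nu> \<beta> \<le> ennreal c"
  shows "PartDiam \<nu> \<alpha> \<le> ennreal c"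
proof -
  interpret prob_space \<nu> by (rule \<nu>(1))
  \<comment> \<open>Starting at \<open>\<alpha> / 2\<close>, these levels force every chosen
    interval to meet an interval \<open>{- real n..real n}\<close> of mass greater than
    \<open>1 - \<alpha> / 2\<close>.\<close>
  define \<beta> where "\<beta> k = \<alpha> - \<alpha> / (real k + 2)" for k :: nat
  have \<beta>: "0 < \<beta> k" "\<beta> k < \<alpha>" "\<alpha> / 2 \<le> \<beta> k" for k
  proof -
    have "\<alpha> / (real k + 2) \<le> \<alpha> / 2" using \<alpha> by (intro divide_left_mono) auto
    then show "0 < \<beta> k" "\<alpha> / 2 \<le> \<beta> k" unfolding \<beta>_def using \<alpha> by linarith+
    show "\<beta> k < \<alpha>" using \<alpha> by (simp add: \<beta>_def)
  qed
  have z: "(\<lambda>k. inverse (real (Suc k))) \<longlonglongrightarrow> 0" by (rule LIMSEQ_inverse_real_of_nat)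
  have "(\<lambda>k. \<alpha> - \<alpha> * inverse (real (Suc (Suc k)))) \<longlonglongrightarrow> \<alpha> - \<alpha> * 0"
    by (intro tendsto_intros LIMSEQ_Suc[OF z])
  then have \<beta>lim: "\<beta> \<longlonglongrightarrow> \<alpha>" by (simp add: \<beta>_def[abs_def] divide_inverse add.commute)
  define R where "R k p \<longleftrightarrow> 0 \<le> snd p \<and> snd p < c + inverse (real (Suc k)) \<and> \<beta> k \<le> prob {fst p..fst p + snd p}" for k p
  have "\<exists>p. R k p" for k
  proof -
    have "PartDiam \<nu> (\<beta> k) \<le> ennreal c" by (rule le[OF \<beta>(1) \<beta>(2)])
    also have "ennreal c < ennreal (c + inverse (real (Suc k)))" using c add_nonneg_pos[of c "inverse (real (Suc k))"] by (intro ennreal_lessI) (simp_all del: of_nat_Suc)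
    finally have lt: "PartDiam \<nu> (\<beta> k) < ennreal (c + inverse (real (Suc k)))" .
    obtain l D where "0 \<le> D" "D < c + inverse (real (Suc k))" "\<beta> k \<le> prob {l..l + D}"
      by (rule PartDiam_less_interval[OF \<nu> lt \<beta>(1)])
    then have "R k (l, D)" by (simp add: R_def)
    then show ?thesis ..
  qed
  then obtain p where p: "\<And>k. R k (p k)" by metis
  define l where "l k = fst (p k)" for k
  define D where "D k = snd (p k)" for k
  have D: "\<And>k. 0 \<le> D k" "\<And>k. D k < c + inverse (real (Suc k))" "\<And>k. \<beta> k \<le> prob {l k..l k + D k}"
    using p unfolding R_def l_def D_def by blast+
  have "(\<lambda>n. prob {- real n..real n}) \<longlonglongrightarrow> prob (\<Union>n. {- real n..real n})"
    by (rule finite_Lim_measure_incseq) (simp_all add: incseq_def \<nu>(2) image_subset_iff)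
  moreover have "(\<Union>n. {- real n..real n}) = space \<nu>"
  proof -
    have "\<exists>n. x \<in> {- real n..real n}" for x
      using real_arch_simple[of "\<bar>x\<bar>"] by (auto simp: abs_le_iff minus_le_iff)
    then show ?thesis using sets_eq_imp_space_eq[OF \<nu>(2)] by auto
  qed
  ultimately have "(\<lambda>n. prob {- real n..real n}) \<longlonglongrightarrow> 1" by (simp add: prob_space)
  then have "\<forall>\<^sub>F n in sequentially. 1 - \<alpha> / 2 < prob {- real n..real n}" by (rule order_tendstoD) (use \<alpha> in simp)
  then obtain n where n: "1 - \<alpha> / 2 < prob {- real n..real n}" using eventually_happens trivial_limit_sequentially by blast
  have lb: "\<bar>l k\<bar> \<le> real n + c + 1" for k
  proof -
    have "0 < prob ({- real n..real n} \<inter> {l k..l k + D k})"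
      using prob_Int_ge[of "{- real n..real n}" "{l k..l k + D k}"] n D(3)[of k] \<beta>(3)[of k] \<nu>(2) by simp
    then have "{- real n..real n} \<inter> {l k..l k + D k} \<noteq> {}" by (metis less_irrefl measure_empty)
    then obtain x where "x \<in> {- real n..real n}" "x \<in> {l k..l k + D k}" by blast
    moreover have "D k \<le> c + 1" using D(2)[of k] by (smt (verit) inverse_le_1_iff of_nat_Suc of_nat_0_le_iff)
    ultimately show ?thesis using c by auto
  qed
  have "seq_compact {- (real n + c + 1)..real n + c + 1}" by (simp add: seq_compact_eq_compact)
  moreover have "- (real n + c + 1) \<le> l k \<and> l k \<le> real n + c + 1" for k using lb[of k] by linarith
  then have "\<forall>k. l k \<in> {- (real n + c + 1)..real n + c + 1}" by simp
  ultimately obtain l' r where r: "strict_mono (r :: nat \<Rightarrow> nat)" "(l \<circ> r) \<longlonglongrightarrow> l'" unfolding seq_compact_def by metis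
  \<comment> \<open>Closed neighbourhoods that shrink to the limit interval. Half of the margin
    absorbs the displacement of the left end, the other half the excess length.\<close>
  define J where "J j = {l' - inverse (real (Suc j))..l' + c + inverse (real (Suc j))}" for j
  have J: "\<alpha> \<le> prob (J j)" for j
  proof -
    define e where "e = inverse (real (Suc j)) / 2"
    have e: "0 < e" by (simp add: e_def)
    have "\<forall>\<^sub>F k in sequentially. dist (l (r k)) l' < e" using tendstoD[OF r(2) e] by simp
    moreover have "(\<lambda>k. inverse (real (Suc (r k)))) \<longlonglongrightarrow> 0" using LIMSEQ_subseq_LIMSEQ[OF z r(1)] by (simp add: o_def)
    then have "\<forall>\<^sub>F k in sequentially. inverse (real (Suc (r k))) < e" by (rule order_tendstoD) (rule e)
    ultimately have "\<forall>\<^sub>F k in sequentially. \<beta> (r k) \<le> prob (J j)"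
    proof eventually_elim
      case (elim k)
      have "\<beta> (r k) \<le> prob {l (r k)..l (r k) + D (r k)}" by (rule D(3))
      also have "\<dots> \<le> prob (J j)"
      proof (rule finite_measure_mono)
        have "inverse (real (Suc j)) = e + e" by (simp add: e_def)
        then show "{l (r k)..l (r k) + D (r k)} \<subseteq> J j"
          using elim D(2)[of "r k"] unfolding J_def dist_real_def by (intro subsetI) auto
      qed (simp add: J_def \<nu>)
      finally show ?case .
    qed
    moreover have "(\<lambda>k. \<beta> (r k)) \<longlonglongrightarrow> \<alpha>" using LIMSEQ_subseq_LIMSEQ[OF \<beta>lim r(1)] by (simp add: o_def)
    ultimately show ?thesis by (intro tendsto_upperbound[of _ _ sequentially]) auto
  qed
  have "(\<lambda>j. prob (J j)) \<longlonglongrightarrow> prob (\<Inter>j. J j)"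
  proof (rule finite_Lim_measure_decseq)
    show "decseq J"
      unfolding decseq_def
    proof (intro allI impI)
      fix i j :: nat assume "i \<le> j"
      then have "inverse (real (Suc j)) \<le> inverse (real (Suc i))" by (intro le_imp_inverse_le) auto
      then show "J j \<subseteq> J i" by (auto simp: J_def)
    qed
  qed (auto simp: J_def \<nu>)
  moreover have "(\<Inter>j. J j) = {l'..l' + c}"
  proof (intro equalityI subsetI)
    fix x assume x: "x \<in> (\<Inter>j. J j)"
    have "l' - x \<le> inverse (real (Suc j))" "x - (l' + c) \<le> inverse (real (Suc j))" for j
    proof -
      have "x \<in> J j" using x by blast
      then have "l' - inverse (real (Suc j)) \<le> x" "x \<le> l' + c + inverse (real (Suc j))" by (simp_all add: J_def)
      then show "l' - x \<le> inverse (real (Suc j))" "x - (l' + c) \<le> inverse (real (Suc j))" by linarith+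
    qed
    then have "l' - x \<le> 0" "x - (l' + c) \<le> 0" using LIMSEQ_le_const[OF z] by blast+
    then show "x \<in> {l'..l' + c}" by auto
  next
    fix x assume "x \<in> {l'..l' + c}"
    then show "x \<in> (\<Inter>j. J j)" by (auto simp: J_def) (smt (verit) inverse_nonnegative_iff_nonnegative of_nat_0_le_iff)+
  qed
  ultimately have "(\<lambda>j. prob (J j)) \<longlonglongrightarrow> prob {l'..l' + c}" by simp
  then have "\<alpha> \<le> prob {l'..l' + c}" by (rule LIMSEQ_le_const) (use J in auto)
  then show ?thesis by (rule PartDiam_interval_le[OF \<nu>(2) _ c])
qed

lemma quantile_set:
  assumes \<nu>: "prob_space \<nu>" "sets \<nu> = sets borel" and N: "0 < N"
  obtains T :: "real set" where "finite T" "card T \<le> N"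
    "\<And>a b. {a..b} \<inter> T = {} \<Longrightarrow> measure \<nu> {a..b} \<le> 1 / real N"
proof -
  interpret prob_space \<nu> by (rule \<nu>(1))
  have [measurable]: "{..t} \<in> sets \<nu>" "{..<t} \<in> sets \<nu>" "{a..b} \<in> sets \<nu>" for a b t using \<nu>(2) by auto
  \<comment> \<open>For \<open>i = 0\<close> the set is the whole line and its \<open>Inf\<close> is
    an unspecified number; an additional point in \<open>T\<close> does no harm.\<close>
  define S where "S i = {t. real i / real N \<le> prob {..t}}" for i :: nat
  define T where "T = (\<lambda>i. Inf (S i)) ` {..<N}"
  have "prob {a..b} \<le> 1 / real N" if ab: "{a..b} \<inter> T = {}" for a b
  proof (rule ccontr)
    assume n: "\<not> prob {a..b} \<le> 1 / real N"
    then have "{a..b} \<noteq> {}" by (metis divide_nonneg_nonneg measure_empty of_nat_0_le_iff zero_le_one)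
    then have le: "a \<le> b" by simp
    define G where "G = prob {..<a}"
    have "{..b} = {..<a} \<union> {a..b}" using le by auto
    then have Fb: "prob {..b} = G + prob {a..b}" unfolding G_def by (subst finite_measure_Union[symmetric]) auto
    \<comment> \<open>The least integer with \<open>i / N\<close> above the mass \<open>G\<close> to
      the left of \<open>a\<close>. If \<open>{a..b}\<close> had mass more than
      \<open>1 / N\<close>, the quantile of order \<open>i / N\<close> would lie in it.\<close>
    define i where "i = nat \<lfloor>G * N\<rfloor> + 1"
    have "0 \<le> G * N" by (simp add: G_def)
    then have "real i = real_of_int \<lfloor>G * N\<rfloor> + 1" by (simp add: i_def)
    then have i: "G * N < i" "i \<le> G * N + 1" by linarith+
    then have i': "G < i / N" "i / N \<le> G + 1 / N" using N by (auto simp: field_simps)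
    then have ib: "i / N < prob {..b}" using n Fb by linarith
    then have "i / N < 1" using prob_le_1[of "{..b}"] by linarith
    then have "i < N" using N by (simp add: field_simps)
    have "b \<in> S i" using ib by (simp add: S_def)
    moreover have lb: "a \<le> t" if "t \<in> S i" for t
    proof (rule ccontr)
      assume "\<not> a \<le> t"
      then have "prob {..t} \<le> G" unfolding G_def by (intro finite_measure_mono) auto
      then show False using that i' by (simp add: S_def)
    qed
    ultimately have "Inf (S i) \<in> {a..b}"
      by (auto intro!: cInf_greatest cInf_lower bdd_belowI[of _ a])
    then show False using ab \<open>i < N\<close> by (auto simp: T_def)
  qed
  moreover have "card T \<le> N" unfolding T_def using card_image_le[of "{..<N}"] by simp
  ultimately show thesis using that[of T] by (simp add: T_def)
qed

text \<open>The map \<open>\<phi>\<close> has slope 1 on \<open>[q, q + D]\<close> for the quantiles \<open>q\<close> of order \<open>i / N\<close>, and slope 0 elsewhere.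
  Without such a compression, limits of laws of observables could lose mass at infinity.\<close>

lemma PartDiam_compress:
  assumes \<nu>: "prob_space \<nu>" "sets \<nu> = sets borel" and \<alpha>: "0 < \<alpha>" and D: "0 < D" and N: "0 < N"
    and less: "ennreal D < PartDiam \<nu> \<alpha>"
  obtains \<phi> where "\<phi> \<in> Lip1p_R" "\<And>t. 0 \<le> \<phi> t" "\<And>t. \<phi> t \<le> real N * D"
    "ennreal D \<le> PartDiam (distr \<nu> borel \<phi>) (\<alpha> + 3 / real N)"
proof -
  interpret prob_space \<nu> by (rule \<nu>(1))
  have ms [measurable]: "A \<in> sets borel \<Longrightarrow> A \<in> events" for A using \<nu>(2) by simp
  obtain T where T: "finite T" "card T \<le> N" "\<And>a b. {a..b} \<inter> T = {} \<Longrightarrow> prob {a..b} \<le> 1 / real N"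
    by (rule quantile_set[OF \<nu> N]) blast
  define U where "U = (\<Union>q\<in>T. {q..q + D})"
  have Ub: "U \<in> sets lborel" unfolding U_def using T(1) by auto
  have eU: "emeasure lborel U \<le> ennreal (real N * D)"
  proof -
    have "emeasure lborel U \<le> (\<Sum>q\<in>T. emeasure lborel {q..q + D})"
      unfolding U_def by (rule emeasure_subadditive_finite[OF T(1)]) auto
    also have "\<dots> = ennreal (real (card T) * D)" using D by (simp add: ennreal_mult ennreal_of_nat_eq_real_of_nat)
    also have "\<dots> \<le> ennreal (real N * D)" using T(2) D by (intro ennreal_leI mult_right_mono) auto
    finally show ?thesis .
  qed
  then have fU: "emeasure lborel U < top" by (rule le_less_trans) simp
  have fm: "A \<inter> U \<in> fmeasurable lborel" if "A \<in> sets borel" for A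
    by (rule fmeasurableI2[of U]) (use that Ub fU in \<open>simp_all add: fmeasurable_def sets.Int\<close>)
  \<comment> \<open>The primitive of the indicator of \<open>U\<close>; its range is bounded by the
    total length of the windows.\<close>
  define \<phi> where "\<phi> t = measure lborel ({..t} \<inter> U)" for t
  have step: "\<phi> t = \<phi> s + measure lborel ({s<..t} \<inter> U)" if "s \<le> t" for s t
  proof -
    have disj: "({..s} \<inter> U) \<inter> ({s<..t} \<inter> U) = {}" by auto
    have "{..t} \<inter> U = ({..s} \<inter> U) \<union> ({s<..t} \<inter> U)" using that by auto
    also have "measure lborel \<dots> = measure lborel ({..s} \<inter> U) + measure lborel ({s<..t} \<inter> U)"
      using measure_Un3[OF fm[of "{..s}"] fm[of "{s<..t}"]] unfolding disj by simp
    finally show ?thesis by (simp add: \<phi>_def)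
  qed
  have upp: "\<phi> t - \<phi> s \<le> t - s" if "s \<le> t" for s t
  proof -
    have "measure lborel ({s<..t} \<inter> U) \<le> measure lborel {s<..t}"
      by (rule measure_mono_fmeasurable) (use Ub that in \<open>auto simp: fmeasurable_def\<close>)
    then show ?thesis using step[OF that] that by simp
  qed
  have mono: "mono \<phi>" by (rule monoI) (use step in simp)
  have Lip: "\<phi> \<in> Lip1_R"
    unfolding Lip1_R_def
  proof (intro CollectI lipschitz_onI)
    show "dist (\<phi> s) (\<phi> t) \<le> 1 * dist s t" for s t
      using upp[of s t] upp[of t s] monoD[OF mono, of s t] monoD[OF mono, of t s]
      by (cases "s \<le> t") (auto simp: dist_real_def)
  qed simp
  have nn: "0 \<le> \<phi> t" for t by (simp add: \<phi>_def)
  have ub: "\<phi> t \<le> real N * D" for t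
  proof -
    have "emeasure lborel ({..t} \<inter> U) \<le> ennreal (real N * D)"
      using eU by (rule order_trans[rotated]) (intro emeasure_mono, use Ub in auto)
    then show ?thesis unfolding \<phi>_def measure_def using D by (intro enn2real_leI) auto
  qed
  have slope: "\<phi> (q + D) - \<phi> q = D" if "q \<in> T" for q
  proof -
    have "{q<..q + D} \<inter> U = {q<..q + D}" using that by (auto simp: U_def)
    then show ?thesis using step[of q "q + D"] D by simp
  qed
  have \<phi>m: "\<phi> \<in> borel_measurable borel" by (rule borel_measurable_mono[OF mono])
  have \<phi>m': "\<phi> \<in> borel_measurable \<nu>" using \<phi>m \<nu>(2) measurable_cong_sets by blast
  have \<phi>c: "continuous_on UNIV \<phi>" using Lip by (auto simp: Lip1_R_def intro: lipschitz_on_continuous_on)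
  have subl: "{a..q - inverse (real (Suc j))} \<subseteq> {a..<q}" and subr: "{q + inverse (real (Suc j))..b} \<subseteq> {q<..b}" for a b q :: real and j
  proof -
    have pos: "0 < inverse (real (Suc j))" by simp
    show "{a..q - inverse (real (Suc j))} \<subseteq> {a..<q}"
    proof
      fix x assume "x \<in> {a..q - inverse (real (Suc j))}"
      then have "a \<le> x" "x \<le> q - inverse (real (Suc j))" by simp_all
      then have "a \<le> x" "x < q" using pos by linarith+
      then show "x \<in> {a..<q}" by simp
    qed
    show "{q + inverse (real (Suc j))..b} \<subseteq> {q<..b}"
    proof
      fix x assume "x \<in> {q + inverse (real (Suc j))..b}"
      then have "q + inverse (real (Suc j)) \<le> x" "x \<le> b" by simp_all
      then have "q < x" "x \<le> b" using pos by linarith+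
      then show "x \<in> {q<..b}" by simp
    qed
  qed
  \<comment> \<open>The quantile bound concerns closed intervals; half-open ones are exhausted by
    them.\<close>
  have halfl: "prob {a..<q} \<le> 1 / real N" if "{a..<q} \<inter> T = {}" for a q
  proof -
    have "(\<lambda>j. prob {a..q - inverse (real (Suc j))}) \<longlonglongrightarrow> prob (\<Union>j. {a..q - inverse (real (Suc j))})"
    proof (rule finite_Lim_measure_incseq)
      show "incseq (\<lambda>j. {a..q - inverse (real (Suc j))})"
        unfolding incseq_def
      proof (intro allI impI)
        fix i j :: nat assume "i \<le> j"
        then have "inverse (real (Suc j)) \<le> inverse (real (Suc i))" by (intro le_imp_inverse_le) auto
        then show "{a..q - inverse (real (Suc i))} \<subseteq> {a..q - inverse (real (Suc j))}" by auto
      qed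
    qed (auto intro: ms)
    moreover have "(\<Union>j. {a..q - inverse (real (Suc j))}) = {a..<q}"
    proof (intro equalityI subsetI)
      fix x assume x: "x \<in> {a..<q}"
      then obtain j where "inverse (real (Suc j)) < q - x" using reals_Archimedean[of "q - x"] by auto
      then show "x \<in> (\<Union>j. {a..q - inverse (real (Suc j))})" using x by (auto intro!: exI[of _ j])
    qed (use subl in blast)
    ultimately have "(\<lambda>j. prob {a..q - inverse (real (Suc j))}) \<longlonglongrightarrow> prob {a..<q}" by simp
    moreover have "prob {a..q - inverse (real (Suc j))} \<le> 1 / real N" for j
    proof (rule T(3))
      show "{a..q - inverse (real (Suc j))} \<inter> T = {}" using that subl by blast
    qed
    ultimately show ?thesis by (intro LIMSEQ_le_const2) auto
  qed
  have halfr: "prob {q<..b} \<le> 1 / real N" if "{q<..b} \<inter> T = {}" for b q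
  proof -
    have "(\<lambda>j. prob {q + inverse (real (Suc j))..b}) \<longlonglongrightarrow> prob (\<Union>j. {q + inverse (real (Suc j))..b})"
    proof (rule finite_Lim_measure_incseq)
      show "incseq (\<lambda>j. {q + inverse (real (Suc j))..b})"
        unfolding incseq_def
      proof (intro allI impI)
        fix i j :: nat assume "i \<le> j"
        then have "inverse (real (Suc j)) \<le> inverse (real (Suc i))" by (intro le_imp_inverse_le) auto
        then show "{q + inverse (real (Suc i))..b} \<subseteq> {q + inverse (real (Suc j))..b}" by auto
      qed
    qed (auto intro: ms)
    moreover have "(\<Union>j. {q + inverse (real (Suc j))..b}) = {q<..b}"
    proof (intro equalityI subsetI)
      fix x assume x: "x \<in> {q<..b}"
      then obtain j where "inverse (real (Suc j)) < x - q" using reals_Archimedean[of "x - q"] by auto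
      then show "x \<in> (\<Union>j. {q + inverse (real (Suc j))..b})" using x by (auto intro!: exI[of _ j])
    qed (use subr in blast)
    ultimately have "(\<lambda>j. prob {q + inverse (real (Suc j))..b}) \<longlonglongrightarrow> prob {q<..b}" by simp
    moreover have "prob {q + inverse (real (Suc j))..b} \<le> 1 / real N" for j
    proof (rule T(3))
      show "{q + inverse (real (Suc j))..b} \<inter> T = {}" using that subr by blast
    qed
    ultimately show ?thesis by (intro LIMSEQ_le_const2) auto
  qed
  \<comment> \<open>The surplus \<open>3 / N\<close> pays for three losses: one for cutting a
    preimage down to a bounded set, and one at each end, beyond the extreme quantiles
    \<open>q1\<close> and \<open>q2\<close> that it spans.\<close>
  have "ennreal D \<le> PartDiam (distr \<nu> borel \<phi>) (\<alpha> + 3 / real N)"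
  proof (rule ccontr)
    assume "\<not> ennreal D \<le> PartDiam (distr \<nu> borel \<phi>) (\<alpha> + 3 / real N)"
    then have lt: "PartDiam (distr \<nu> borel \<phi>) (\<alpha> + 3 / real N) < ennreal D" by simp
    have pos: "0 < \<alpha> + 3 / real N" using \<alpha> N by (intro add_pos_pos divide_pos_pos) auto
    have sb: "sets (distr \<nu> borel \<phi>) = sets borel" by simp
    obtain l D0 where D0: "0 \<le> D0" "D0 < D" "\<alpha> + 3 / real N \<le> measure (distr \<nu> borel \<phi>) {l..l + D0}"
      by (rule PartDiam_less_interval[OF prob_space_distr[OF \<phi>m'] sb lt pos])
    define A where "A = \<phi> -` {l..l + D0}"
    have spn: "space \<nu> = UNIV" using sets_eq_imp_space_eq[OF \<nu>(2)] by simp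
    have Ac: "closed A" unfolding A_def by (rule closed_vimage[OF closed_atLeastAtMost \<phi>c])
    have Am: "\<alpha> + 3 / real N \<le> prob A" using D0(3) by (simp add: measure_distr[OF \<phi>m'] A_def spn)
    have "(\<lambda>n. prob (A \<inter> {- real n..real n})) \<longlonglongrightarrow> prob (\<Union>n. A \<inter> {- real n..real n})"
      by (rule finite_Lim_measure_incseq) (use Ac in \<open>fastforce simp: incseq_def intro!: ms sets.Int\<close>)+
    moreover have "(\<Union>n. A \<inter> {- real n..real n}) = A"
    proof -
      have "\<exists>n. x \<in> {- real n..real n}" for x
        using real_arch_simple[of "\<bar>x\<bar>"] by (auto simp: abs_le_iff minus_le_iff)
      then show ?thesis by auto
    qed
    ultimately have "(\<lambda>n. prob (A \<inter> {- real n..real n})) \<longlonglongrightarrow> prob A" by simp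
    then have "\<forall>\<^sub>F n in sequentially. \<alpha> + 2 / real N < prob (A \<inter> {- real n..real n})"
    proof (rule order_tendstoD)
      have "2 / real N < 3 / real N" using N by (simp add: divide_strict_right_mono)
      then show "\<alpha> + 2 / real N < prob A" using Am by linarith
    qed
    then obtain n where n: "\<alpha> + 2 / real N < prob (A \<inter> {- real n..real n})" using eventually_happens trivial_limit_sequentially by blast
    let ?B = "A \<inter> {- real n..real n}"
    have Bc: "closed ?B" using Ac by auto
    have "0 \<le> 2 / real N" by simp
    then have "0 < \<alpha> + 2 / real N" using \<alpha> by linarith
    then have "0 < prob ?B" using n by linarith
    then have Bne: "?B \<noteq> {}" by (metis less_irrefl measure_empty)
    have bdd: "bdd_below ?B" "bdd_above ?B" by (auto intro!: bdd_belowI[of _ "- real n"] bdd_aboveI[of _ "real n"])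
    define a where "a = Inf ?B"
    define b where "b = Sup ?B"
    have aA: "a \<in> A" "b \<in> A" using closed_contains_Inf[OF Bne bdd(1) Bc] closed_contains_Sup[OF Bne bdd(2) Bc] by (auto simp: a_def b_def)
    have "?B \<subseteq> {a..b}" using cInf_lower[OF _ bdd(1)] cSup_upper[OF _ bdd(2)] by (auto simp: a_def b_def)
    then have "prob ?B \<le> prob {a..b}" by (intro finite_measure_mono ms) auto
    then have ab: "\<alpha> + 2 / real N < prob {a..b}" using n by linarith
    have \<phi>ab: "\<phi> b - \<phi> a \<le> D0" using aA by (auto simp: A_def)
    have "1 / real N \<le> 2 / real N" by (simp add: divide_right_mono)
    then have Tne: "{a..b} \<inter> T \<noteq> {}" using T(3)[of a b] ab \<alpha> by auto
    have fin: "finite ({a..b} \<inter> T)" using T(1) by simp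
    define q1 where "q1 = Min ({a..b} \<inter> T)"
    define q2 where "q2 = Max ({a..b} \<inter> T)"
    have q: "q1 \<in> {a..b}" "q1 \<in> T" "q2 \<in> {a..b}" "q2 \<in> T" using Min_in[OF fin Tne] Max_in[OF fin Tne] by (auto simp: q1_def q2_def)
    \<comment> \<open>Otherwise the whole window from \<open>q1\<close> to \<open>q1 + D\<close>
      would lie between \<open>a\<close> and \<open>b\<close>, and \<open>\<phi>\<close> would
      increase by at least \<open>D\<close> there, against \<open>\<phi>ab\<close>.\<close>
    have "q2 \<le> q1 + D"
    proof (rule ccontr)
      assume "\<not> q2 \<le> q1 + D"
      then have "q1 + D \<le> b" using q by auto
      then have "\<phi> (q1 + D) \<le> \<phi> b" "\<phi> a \<le> \<phi> q1" using monoD[OF mono] q by auto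
      then show False using slope[OF q(2)] \<phi>ab D0(2) by linarith
    qed
    have l: "{a..<q1} \<inter> T = {}"
    proof (rule ccontr)
      assume "{a..<q1} \<inter> T \<noteq> {}"
      then obtain t where "t \<in> T" "a \<le> t" "t < q1" by auto
      then show False using Min_le[OF fin, of t] q(1) by (auto simp: q1_def[symmetric])
    qed
    have r: "{q2<..b} \<inter> T = {}"
    proof (rule ccontr)
      assume "{q2<..b} \<inter> T \<noteq> {}"
      then obtain t where "t \<in> T" "q2 < t" "t \<le> b" by auto
      then show False using Max_ge[OF fin, of t] q(3) by (auto simp: q2_def[symmetric])
    qed
    have "{a..b} \<subseteq> {a..<q1} \<union> ({q1..q1 + D} \<union> {q2<..b})" using \<open>q2 \<le> q1 + D\<close> by auto
    then have "prob {a..b} \<le> prob ({a..<q1} \<union> ({q1..q1 + D} \<union> {q2<..b}))" by (intro finite_measure_mono ms) auto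
    also have "\<dots> \<le> prob {a..<q1} + prob ({q1..q1 + D} \<union> {q2<..b})" by (intro measure_Un_le ms) auto
    also have "prob ({q1..q1 + D} \<union> {q2<..b}) \<le> prob {q1..q1 + D} + prob {q2<..b}" by (intro measure_Un_le ms) auto
    finally have "prob {a..b} \<le> 1 / real N + (prob {q1..q1 + D} + 1 / real N)" using halfl[OF l] halfr[OF r] by linarith
    moreover have "2 / real N = 1 / real N + 1 / real N" by simp
    ultimately have "\<alpha> \<le> prob {q1..q1 + D}" using ab by linarith
    then have "PartDiam \<nu> \<alpha> \<le> ennreal D" by (intro PartDiam_interval_le \<nu>) (use D in auto)
    then show False using less by simp
  qed
  then show thesis using that[of \<phi>] mono Lip nn ub by (auto simp: Lip1p_R_def)
qed

section \<open>Observable diameters along convergent pyramids\<close>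

lemma frequently_subsequence:
  assumes "\<And>k. \<exists>\<^sub>F n in sequentially. R k n"
  obtains r where "strict_mono (r :: nat \<Rightarrow> nat)" "\<And>k. R k (r k)"
proof -
  have ex: "\<exists>n>m. R k n" for k m using assms[of k] unfolding frequently_sequentially by (meson Suc_le_eq)
  have "\<exists>r. \<forall>k. R k (r k) \<and> r k < r (Suc k)"
  proof (rule dependent_nat_choice)
    show "\<exists>x. R 0 x" using ex by blast
    show "\<exists>y. R (Suc n) y \<and> x < y" if "R n x" for x n using ex by blast
  qed
  then show thesis using that by (metis strict_mono_Suc_iff)
qed

lemma pyramid_conv_approx:
  assumes P: "\<And>n. pyramid L (P n)" and Q: "pyramid L Q" and conv: "pyramid_conv L P Q" and X: "X \<in> Q" and e: "0 < e"
  shows "\<forall>\<^sub>F n in sequentially. \<exists>Y\<in>P n. gd_box X Y < e"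
proof -
  have "(\<lambda>n. INF Y\<in>P n. gd_box X Y) \<longlonglongrightarrow> 0" using conv X by (auto simp: pyramid_conv_def)
  then have "\<forall>\<^sub>F n in sequentially. (INF Y\<in>P n. gd_box X Y) < e" by (rule order_tendstoD) (rule e)
  then show ?thesis
  proof eventually_elim
    case (elim n)
    have gX: "gd_set X" using Q X by (auto simp: pyramid_def LD_def L_gd_set_def)
    have gY: "gd_set Y" if "Y \<in> P n" for Y using P[of n] that by (auto simp: pyramid_def LD_def L_gd_set_def)
    have ne: "P n \<noteq> {}" using P[of n] by (auto simp: pyramid_def)
    have "bdd_below (gd_box X ` P n)" using gd_box_nonneg[OF gX gY] by (auto intro!: bdd_belowI[of _ 0])
    then show ?case using elim cINF_less_iff[OF ne] by blast
  qed
qed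

text \<open>An observable of a member of \<open>Q\<close> is matched by observables of nearby
  members of the \<open>P n\<close>. The match loses some mass and some diameter; the first loss is
  covered by left continuity of the partial diameter in the level, the second by the gap between
  \<open>c\<close> and \<open>c'\<close>.\<close>

lemma ObsDiam_liminf_ge:
  assumes P: "\<And>n. pyramid L (P n)" and Q: "pyramid L Q" and conv: "pyramid_conv L P Q"
    and \<kappa>: "0 < \<kappa>" "\<kappa> < 1" and less: "x < ObsDiam_family Q \<kappa>"
  shows "\<exists>d>0. \<forall>\<epsilon>. 0 < \<epsilon> \<longrightarrow> \<epsilon> < d \<longrightarrow> x < liminf (\<lambda>n. ObsDiam_family (P n) (\<kappa> + \<epsilon>))"
proof -
  obtain X f where X: "X \<in> Q" and f: "f \<in> gd_closure X" and lt: "x < PartDiam (distr (msr X) borel f) (1 - \<kappa>)"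
    using less unfolding ObsDiam_family_def ObsDiam_def less_SUP_iff by blast
  have gX: "gd_set X" using Q X by (auto simp: pyramid_def LD_def L_gd_set_def)
  have fm: "f \<in> borel_measurable (msr X)" by (rule closure_measurable[OF gX f])
  have pf: "prob_space (distr (msr X) borel f)" by (rule prob_space.prob_space_distr[OF gd_prob[OF gX] fm])
  obtain y where y: "x < y" "y < PartDiam (distr (msr X) borel f) (1 - \<kappa>)" using lt dense by blast
  obtain y' where y': "y < y'" "y' < PartDiam (distr (msr X) borel f) (1 - \<kappa>)" using y(2) dense by blast
  obtain c where c: "y = ennreal c" "0 \<le> c" using y by (cases y) (auto simp: top_unique)
  obtain c' where c': "y' = ennreal c'" "0 \<le> c'" using y' by (cases y') (auto simp: top_unique)
  have cc: "c < c'" using y'(1) c c' by (simp add: ennreal_less_iff)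
  \<comment> \<open>The room between \<open>\<beta>\<close> and \<open>1 - \<kappa>\<close> is
    shared equally by \<open>\<epsilon>\<close> and the lost mass \<open>\<eta>\<close>, each at
    most \<open>d\<close>.\<close>
  obtain \<beta> where \<beta>: "0 < \<beta>" "\<beta> < 1 - \<kappa>" "ennreal c' < PartDiam (distr (msr X) borel f) \<beta>"
    using PartDiam_left_continuous[OF pf _ _ c'(2), of "1 - \<kappa>"] \<kappa> y'(2) c'(1) by (auto simp: not_le[symmetric])
  define d where "d = (1 - \<kappa> - \<beta>) / 2"
  have d: "0 < d" using \<beta> by (simp add: d_def)
  show ?thesis
  proof (intro exI[of _ d] conjI d allI impI)
    fix \<epsilon> :: real assume \<epsilon>: "0 < \<epsilon>" "\<epsilon> < d"
    define \<eta> where "\<eta> = min d (c' - c)"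
    have \<eta>: "0 < \<eta>" using d cc by (simp add: \<eta>_def)
    have "\<forall>\<^sub>F n in sequentially. ennreal c \<le> ObsDiam_family (P n) (\<kappa> + \<epsilon>)"
      using pyramid_conv_approx[OF P Q conv X \<eta>]
    proof eventually_elim
      case (elim n)
      then obtain Y where Y: "Y \<in> P n" "gd_box X Y < \<eta>" by blast
      have gY: "gd_set Y" using P[of n] Y(1) by (auto simp: pyramid_def LD_def L_gd_set_def)
      obtain p S where p: "p \<in> couplings X Y" "closedin (gd_prod_top X Y) S" "1 - \<eta> \<le> measure p S"
        "near S (\<eta>/2) (gd_closure X) (gd_closure Y)"
        by (rule gd_boxD[OF gX gY Y(2)]) blast
      obtain g where g: "g \<in> gd_closure Y" "\<forall>(x, y)\<in>S. \<bar>f x - g y\<bar> \<le> \<eta>/2" using p(4) f unfolding near_def by blast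
      note cp = couplingD[OF gX gY p(1)]
      have gm: "g \<in> borel_measurable (msr Y)" by (rule closure_measurable[OF gY g(1)])
      have "ennreal c \<le> PartDiam (distr (msr Y) borel g) (1 - (\<kappa> + \<epsilon>))"
      proof (rule ccontr)
        assume "\<not> ennreal c \<le> PartDiam (distr (msr Y) borel g) (1 - (\<kappa> + \<epsilon>))"
        then have lt: "PartDiam (distr (msr Y) borel g) (1 - (\<kappa> + \<epsilon>)) < ennreal c" by simp
        have dg: "distr p borel (\<lambda>w. g (snd w)) = distr (msr Y) borel g"
          using distr_distr[OF gm cp(5)] cp(7) by (simp add: o_def)
        have df: "distr p borel (\<lambda>w. f (fst w)) = distr (msr X) borel f"
          using distr_distr[OF fm cp(4)] cp(6) by (simp add: o_def)
        have "PartDiam (distr p borel (\<lambda>w. f (fst w))) (1 - (\<kappa> + \<epsilon>) - \<eta>) \<le> ennreal (c + 2 * (\<eta>/2))"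
        proof (rule PartDiam_close[OF cp(1), where f="\<lambda>w. g (snd w)" and E=S])
          show "(\<lambda>w. g (snd w)) \<in> borel_measurable p" "(\<lambda>w. f (fst w)) \<in> borel_measurable p"
            using measurable_compose[OF cp(5) gm] measurable_compose[OF cp(4) fm] by auto
          show "S \<in> sets p" by (rule closed_measurable[OF gX gY p(1,2)])
          show "\<bar>g (snd w) - f (fst w)\<bar> \<le> \<eta>/2" if "w \<in> S" for w
            using g(2) that by (auto simp: abs_minus_commute split: prod.splits)
          show "0 < 1 - (\<kappa> + \<epsilon>)" using \<epsilon> \<beta> by (simp add: d_def)
        qed (use p \<eta> lt dg in auto)
        also have "\<dots> \<le> ennreal c'" by (intro ennreal_leI) (simp add: \<eta>_def)
        finally have "PartDiam (distr (msr X) borel f) (1 - (\<kappa> + \<epsilon>) - \<eta>) \<le> ennreal c'" unfolding df .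
        moreover have "\<beta> \<le> 1 - (\<kappa> + \<epsilon>) - \<eta>"
        proof -
          have "\<eta> \<le> d" by (simp add: \<eta>_def)
          moreover have "2 * d = 1 - \<kappa> - \<beta>" by (simp add: d_def)
          ultimately show ?thesis using \<epsilon> by linarith
        qed
        ultimately show False using PartDiam_mono[of \<beta> "1 - (\<kappa> + \<epsilon>) - \<eta>" "distr (msr X) borel f"] \<beta>(3)
          by (meson not_le order_trans)
      qed
      also have "\<dots> \<le> ObsDiam_family (P n) (\<kappa> + \<epsilon>)"
        unfolding ObsDiam_family_def ObsDiam_def by (rule SUP_upper2[OF Y(1)], rule SUP_upper[OF g(1)])
      finally show ?case .
    qed
    then have "ennreal c \<le> liminf (\<lambda>n. ObsDiam_family (P n) (\<kappa> + \<epsilon>))" by (rule Liminf_bounded)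
    then show "x < liminf (\<lambda>n. ObsDiam_family (P n) (\<kappa> + \<epsilon>))" using y(1) c(1) by simp
  qed
qed

lemma Lip1p_R_monoidal:
  "Lip1p_R \<subseteq> Lip1_R" "(\<lambda>t. t) \<in> Lip1p_R" "\<And>\<phi> \<psi>. \<phi> \<in> Lip1p_R \<Longrightarrow> \<psi> \<in> Lip1p_R \<Longrightarrow> \<phi> \<circ> \<psi> \<in> Lip1p_R"
proof -
  show "Lip1p_R \<subseteq> Lip1_R" by (auto simp: Lip1p_R_def)
  show "(\<lambda>t. t) \<in> Lip1p_R" by (auto simp: Lip1p_R_def Lip1_R_def mono_def intro!: lipschitz_onI)
  fix \<phi> \<psi> assume *: "\<phi> \<in> Lip1p_R" "\<psi> \<in> Lip1p_R"
  have "\<phi> \<circ> \<psi> \<in> Lip1_R"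
    unfolding Lip1_R_def
  proof (intro CollectI lipschitz_onI)
    show "dist ((\<phi> \<circ> \<psi>) s) ((\<phi> \<circ> \<psi>) t) \<le> 1 * dist s t" for s t
      using Lip1_R_le[of \<phi> "\<psi> s" "\<psi> t"] Lip1_R_le[of \<psi> s t] * by (auto simp: Lip1p_R_def dist_real_def)
  qed simp
  then show "\<phi> \<circ> \<psi> \<in> Lip1p_R" using * by (auto simp: Lip1p_R_def mono_def)
qed

text \<open>If the inequality failed, infinitely many \<open>P n\<close> would have observables of
  partial diameter above \<open>D\<close>. Compressed into a bounded range they have a limit on some
  \<open>Z\<close> in \<open>Q\<close>, whose partial diameter is then too large.\<close>

lemma ObsDiam_limsup_le:
  assumes P: "\<And>n. pyramid Lip1p_R (P n)" and Q: "pyramid Lip1p_R Q" and conv: "pyramid_conv Lip1p_R P Q"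
    and \<kappa>: "0 < \<kappa>" and \<epsilon>: "0 < \<epsilon>" "\<epsilon> < 1 - \<kappa>"
  shows "limsup (\<lambda>n. ObsDiam_family (P n) (\<kappa> + \<epsilon>)) \<le> ObsDiam_family Q \<kappa>"
proof (rule ccontr)
  assume "\<not> ?thesis"
  then have "ObsDiam_family Q \<kappa> < limsup (\<lambda>n. ObsDiam_family (P n) (\<kappa> + \<epsilon>))" by simp
  then obtain y where y: "ObsDiam_family Q \<kappa> < y" "y < limsup (\<lambda>n. ObsDiam_family (P n) (\<kappa> + \<epsilon>))" using dense by blast
  obtain D where D: "y = ennreal D" "0 \<le> D" using y by (cases y) (auto simp: top_unique)
  have D0: "0 < D" using y(1) D by (metis ennreal_0 less_eq_real_def not_less_zero)
  have fr: "\<exists>\<^sub>F n in sequentially. ennreal D < ObsDiam_family (P n) (\<kappa> + \<epsilon>)"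
  proof (rule ccontr)
    assume "\<not> ?thesis"
    then have "\<forall>\<^sub>F n in sequentially. ObsDiam_family (P n) (\<kappa> + \<epsilon>) \<le> ennreal D" by (simp add: not_frequently not_less)
    then have "limsup (\<lambda>n. ObsDiam_family (P n) (\<kappa> + \<epsilon>)) \<le> ennreal D" by (rule Limsup_bounded)
    then show False using y(2) D(1) by simp
  qed
  obtain r where r: "strict_mono (r :: nat \<Rightarrow> nat)" "\<And>k. ennreal D < ObsDiam_family (P (r k)) (\<kappa> + \<epsilon>)"
    by (rule frequently_subsequence[of "\<lambda>_ n. ennreal D < ObsDiam_family (P n) (\<kappa> + \<epsilon>)", OF fr]) blast
  define \<alpha> where "\<alpha> = 1 - (\<kappa> + \<epsilon>)"
  have \<alpha>: "0 < \<alpha>" using \<epsilon> by (simp add: \<alpha>_def)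
  have "\<exists>X f. X \<in> P (r k) \<and> f \<in> gd_closure X \<and> ennreal D < PartDiam (distr (msr X) borel f) \<alpha>" for k
    using r(2)[of k] unfolding ObsDiam_family_def ObsDiam_def less_SUP_iff \<alpha>_def by blast
  then obtain X f where X: "\<And>k. X k \<in> P (r k)" and f: "\<And>k. f k \<in> gd_closure (X k)"
    and Df: "\<And>k. ennreal D < PartDiam (distr (msr (X k)) borel (f k)) \<alpha>" by metis
  have LX: "L_gd_set Lip1p_R (X k)" and gX: "gd_set (X k)" for k
    using P[of "r k"] X[of k] by (auto simp: pyramid_def LD_def L_gd_set_def)
  have fm: "f k \<in> borel_measurable (msr (X k))" for k by (rule closure_measurable[OF gX f])
  \<comment> \<open>With this \<open>N\<close> the compression uses at most
    \<open>\<epsilon> / 2\<close> of the level; the other half is left for the mass lost in the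
    coupling.\<close>
  obtain N :: nat where N: "6 / \<epsilon> < real N" using reals_Archimedean2 by blast
  have "0 < 6 / \<epsilon>" using \<epsilon> by simp
  then have N0: "0 < real N" using N by linarith
  then have N0': "0 < N" by simp
  have N3: "3 / real N \<le> \<epsilon> / 2" using N N0 \<epsilon> by (simp add: field_simps)
  have "\<exists>\<phi>. \<phi> \<in> Lip1p_R \<and> (\<forall>t. 0 \<le> \<phi> t \<and> \<phi> t \<le> real N * D) \<and>
      ennreal D \<le> PartDiam (distr (distr (msr (X k)) borel (f k)) borel \<phi>) (\<alpha> + 3 / real N)" for k
    by (rule PartDiam_compress[OF prob_space.prob_space_distr[OF gd_prob[OF gX] fm] _ \<alpha> D0 N0' Df, of k]) auto
  then obtain \<phi> where \<phi>: "\<And>k. \<phi> k \<in> Lip1p_R" "\<And>k t. 0 \<le> \<phi> k t" "\<And>k t. \<phi> k t \<le> real N * D"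
    and D\<phi>: "\<And>k. ennreal D \<le> PartDiam (distr (distr (msr (X k)) borel (f k)) borel (\<phi> k)) (\<alpha> + 3 / real N)" by metis
  define h where "h k = compose (pts (X k)) (\<phi> k) (f k)" for k
  have h: "h k \<in> gd_closure (X k)" for k using LX[of k] \<phi>(1)[of k] f[of k] by (auto simp: L_gd_set_def h_def)
  have hm: "h k \<in> borel_measurable (msr (X k))" for k by (rule closure_measurable[OF gX h])
  have Dh: "ennreal D \<le> PartDiam (distr (msr (X k)) borel (h k)) (\<alpha> + 3 / real N)" for k
  proof -
    have "mono (\<phi> k)" using \<phi>(1)[of k] by (auto simp: Lip1p_R_def)
    then have "\<phi> k \<in> borel_measurable borel" by (rule borel_measurable_mono)
    then have "distr (distr (msr (X k)) borel (f k)) borel (\<phi> k) = distr (msr (X k)) borel (\<phi> k \<circ> f k)"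
      by (rule distr_distr[OF _ fm])
    also have "\<dots> = distr (msr (X k)) borel (h k)"
      by (rule distr_cong) (use gX in \<open>auto simp: h_def compose_def\<close>)
    finally show ?thesis using D\<phi>[of k] by simp
  qed
  obtain Z g s where Z: "Z \<in> Q" "gd_set Z" "strict_mono (s :: nat \<Rightarrow> nat)" "\<And>i. i < 1 \<Longrightarrow> g i \<in> gd_closure Z"
    and cpl: "\<And>e. 0 < e \<Longrightarrow> \<forall>\<^sub>F k in sequentially. \<exists>(M :: (real \<times> (nat \<Rightarrow> real)) measure) a b E.
      gd_pair (X (s k)) Z M a b \<and> E \<in> sets M \<and> 1 - e \<le> measure M E \<and>
      (\<forall>w\<in>E. \<forall>i<(1::nat). \<bar>h (s k) (a w) - g i (b w)\<bar> \<le> e)"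
  proof (rule pyramid_limit_observables[OF Lip1p_R_monoidal P conv r(1) X, of 1 "\<lambda>k i. h k" "real N * D"])
    show "0 \<le> h k x \<and> h k x \<le> real N * D" if "x \<in> pts (X k)" for k and i :: nat and x
      using \<phi>(2,3) that by (simp add: h_def compose_def)
  qed (use h in auto)
  have g0: "g 0 \<in> gd_closure Z" using Z(4) by simp
  have gm: "g 0 \<in> borel_measurable (msr Z)" by (rule closure_measurable[OF Z(2) g0])
  have "PartDiam (distr (msr Z) borel (g 0)) (1 - \<kappa>) \<le> ObsDiam_family Q \<kappa>"
    unfolding ObsDiam_family_def ObsDiam_def by (rule SUP_upper2[OF Z(1)], rule SUP_upper[OF g0])
  then obtain y' where y': "PartDiam (distr (msr Z) borel (g 0)) (1 - \<kappa>) < y'" "y' < ennreal D"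
    using y(1) D(1) dense by (metis le_less_trans)
  obtain c where c: "y' = ennreal c" "0 \<le> c" using y' by (cases y') (auto simp: top_unique)
  have cD: "c < D" using y'(2) c by (simp add: ennreal_less_iff)
  \<comment> \<open>The error enters the diameter as \<open>2 * \<eta>\<close>, at most half of the
    gap between \<open>c\<close> and \<open>D\<close>.\<close>
  define \<eta> where "\<eta> = min (\<epsilon> / 2) ((D - c) / 4)"
  have \<eta>: "0 < \<eta>" using \<epsilon> cD by (simp add: \<eta>_def)
  obtain k and M :: "(real \<times> (nat \<Rightarrow> real)) measure" and a b E where M: "gd_pair (X (s k)) Z M a b" "E \<in> sets M"
    "1 - \<eta> \<le> measure M E" and E: "\<forall>w\<in>E. \<forall>i<(1::nat). \<bar>h (s k) (a w) - g i (b w)\<bar> \<le> \<eta>"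
    using eventually_happens'[OF sequentially_bot cpl[OF \<eta>]] by blast
  interpret XZ: gd_pair "X (s k)" Z M a b by (rule M(1))
  have dg: "distr M borel (\<lambda>w. g 0 (b w)) = distr (msr Z) borel (g 0)"
    using distr_distr[OF gm XZ.b(1)] XZ.b(2) by (simp add: o_def)
  have dh: "distr M borel (\<lambda>w. h (s k) (a w)) = distr (msr (X (s k))) borel (h (s k))"
    using distr_distr[OF hm XZ.a(1)] XZ.a(2) by (simp add: o_def)
  have "PartDiam (distr M borel (\<lambda>w. h (s k) (a w))) (1 - \<kappa> - \<eta>) \<le> ennreal (c + 2 * \<eta>)"
  proof (rule PartDiam_close[OF XZ.M, where f="\<lambda>w. g 0 (b w)" and E=E])
    show "(\<lambda>w. g 0 (b w)) \<in> borel_measurable M" "(\<lambda>w. h (s k) (a w)) \<in> borel_measurable M"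
      using measurable_compose[OF XZ.b(1) gm] measurable_compose[OF XZ.a(1) hm] by auto
    show "\<bar>g 0 (b w) - h (s k) (a w)\<bar> \<le> \<eta>" if "w \<in> E" for w
      using E that by (auto simp: abs_minus_commute)
  qed (use M \<eta> dg y'(1) c(1) \<epsilon> in auto)
  also have "\<dots> < ennreal D"
  proof -
    have "\<eta> \<le> (D - c) / 4" unfolding \<eta>_def by (rule min.cobounded2)
    then have "4 * \<eta> \<le> D - c" by simp
    then have "c + 2 * \<eta> < D" using cD \<eta> by linarith
    moreover have "0 \<le> c + 2 * \<eta>" using c(2) \<eta> by linarith
    ultimately show ?thesis by (simp only: ennreal_less_iff)
  qed
  finally have "PartDiam (distr (msr (X (s k))) borel (h (s k))) (1 - \<kappa> - \<eta>) < ennreal D" unfolding dh .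
  moreover have "\<alpha> + 3 / real N \<le> 1 - \<kappa> - \<eta>"
  proof -
    have "\<eta> \<le> \<epsilon> / 2" by (simp add: \<eta>_def)
    then show ?thesis using N3 by (simp add: \<alpha>_def)
  qed
  ultimately show False
    using Dh[of "s k"] PartDiam_mono[of "\<alpha> + 3 / real N" "1 - \<kappa> - \<eta>" "distr (msr (X (s k))) borel (h (s k))"]
    by (meson not_le order_trans)
qed

lemma ObsDiam_family_tendsto:
  assumes P: "\<And>n. pyramid Lip1p_R (P n)" and Q: "pyramid Lip1p_R Q" and conv: "pyramid_conv Lip1p_R P Q"
    and \<kappa>: "0 < \<kappa>" "\<kappa> < 1"
  shows "((\<lambda>\<epsilon>. liminf (\<lambda>n. ObsDiam_family (P n) (\<kappa> + \<epsilon>))) \<longlongrightarrow> ObsDiam_family Q \<kappa>) (at 0 within {0<..<1 - \<kappa>})"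
    and "((\<lambda>\<epsilon>. limsup (\<lambda>n. ObsDiam_family (P n) (\<kappa> + \<epsilon>))) \<longlongrightarrow> ObsDiam_family Q \<kappa>) (at 0 within {0<..<1 - \<kappa>})"
proof -
  let ?F = "at 0 within {0<..<1 - \<kappa>}"
  have lsup: "\<forall>\<^sub>F \<epsilon> in ?F. limsup (\<lambda>n. ObsDiam_family (P n) (\<kappa> + \<epsilon>)) \<le> ObsDiam_family Q \<kappa>"
    unfolding eventually_at_filter by (rule always_eventually) (use ObsDiam_limsup_le[OF P Q conv \<kappa>(1)] in auto)
  have le: "liminf (\<lambda>n. ObsDiam_family (P n) (\<kappa> + \<epsilon>)) \<le> limsup (\<lambda>n. ObsDiam_family (P n) (\<kappa> + \<epsilon>))" for \<epsilon>
    by (rule Liminf_le_Limsup) simp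
  have linf: "\<forall>\<^sub>F \<epsilon> in ?F. x < liminf (\<lambda>n. ObsDiam_family (P n) (\<kappa> + \<epsilon>))" if x: "x < ObsDiam_family Q \<kappa>" for x
  proof -
    obtain d where "0 < d" "\<And>\<epsilon>. 0 < \<epsilon> \<Longrightarrow> \<epsilon> < d \<Longrightarrow> x < liminf (\<lambda>n. ObsDiam_family (P n) (\<kappa> + \<epsilon>))"
      using ObsDiam_liminf_ge[OF P Q conv \<kappa> x] by blast
    then show ?thesis unfolding eventually_at by (intro exI[of _ d]) (auto simp: dist_real_def)
  qed
  show "((\<lambda>\<epsilon>. liminf (\<lambda>n. ObsDiam_family (P n) (\<kappa> + \<epsilon>))) \<longlongrightarrow> ObsDiam_family Q \<kappa>) ?F"
  proof (rule order_tendstoI)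
    fix x assume x: "ObsDiam_family Q \<kappa> < x"
    show "\<forall>\<^sub>F \<epsilon> in ?F. liminf (\<lambda>n. ObsDiam_family (P n) (\<kappa> + \<epsilon>)) < x"
      using lsup by (rule eventually_mono) (use le x in \<open>meson le_less_trans\<close>)
  qed (rule linf)
  show "((\<lambda>\<epsilon>. limsup (\<lambda>n. ObsDiam_family (P n) (\<kappa> + \<epsilon>))) \<longlongrightarrow> ObsDiam_family Q \<kappa>) ?F"
  proof (rule order_tendstoI)
    fix x assume x: "ObsDiam_family Q \<kappa> < x"
    show "\<forall>\<^sub>F \<epsilon> in ?F. limsup (\<lambda>n. ObsDiam_family (P n) (\<kappa> + \<epsilon>)) < x"
      using lsup by (rule eventually_mono) (use x in \<open>meson le_less_trans\<close>)
  next
    fix x assume x: "x < ObsDiam_family Q \<kappa>"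
    show "\<forall>\<^sub>F \<epsilon> in ?F. x < limsup (\<lambda>n. ObsDiam_family (P n) (\<kappa> + \<epsilon>))"
      using linf[OF x] by (rule eventually_mono) (use le in \<open>meson less_le_trans\<close>)
  qed
qed

section \<open>Multi-directed separation\<close>

text \<open>The clamped value is finite even when a bound is infinite, so
  \<open>real_of_ereal\<close> never falls back to its default 0.\<close>

lemma TB_ereal:
  assumes "l < \<infinity>" "- \<infinity> < u"
  shows "ereal (real_of_ereal (max l (min (ereal t) u))) = max l (min (ereal t) u)"
proof -
  have "max l (min (ereal t) u) < \<infinity>" using assms(1) unfolding max_less_iff_conj min_less_iff_disj by simp
  moreover have "- \<infinity> < max l (min (ereal t) u)" using assms(2) unfolding less_max_iff_disj min_less_iff_conj by simp
  ultimately show ?thesis by (intro ereal_real') auto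
qed

text \<open>Compositions are computed in \<open>ereal\<close>, where finite and infinite bounds can
  be treated together. Two nested clamps merge into one whose bounds are the inner bounds clamped by
  the outer ones.\<close>

lemma TB_monoidal:
  "TB \<subseteq> Lip1_R" "(\<lambda>t. t) \<in> TB" "\<And>\<phi> \<psi>. \<phi> \<in> TB \<Longrightarrow> \<psi> \<in> TB \<Longrightarrow> \<phi> \<circ> \<psi> \<in> TB"
proof -
  show "TB \<subseteq> Lip1_R"
  proof
    fix \<phi> assume "\<phi> \<in> TB"
    then obtain c l u where \<phi>: "\<phi> = (\<lambda>t. real_of_ereal (max l (min (ereal (t + c)) u)))" "l < \<infinity>" "- \<infinity> < u" "l \<le> u"
      by (auto simp: TB_def)
    have "\<bar>\<phi> s - \<phi> t\<bar> \<le> \<bar>s - t\<bar>" for s t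
      unfolding \<phi>(1) using \<phi>(2-4) by (cases l; cases u) (auto simp: max_def min_def split: if_splits)
    then show "\<phi> \<in> Lip1_R" by (auto simp: Lip1_R_def dist_real_def intro!: lipschitz_onI)
  qed
  show "(\<lambda>t. t) \<in> TB"
    unfolding TB_def by (intro CollectI exI[of _ 0] exI[of _ "- \<infinity>"] exI[of _ \<infinity>]) auto
  fix \<phi> \<psi> assume "\<phi> \<in> TB" "\<psi> \<in> TB"
  then obtain c l u c' l' u' where \<phi>: "\<phi> = (\<lambda>t. real_of_ereal (max l (min (ereal (t + c)) u)))" "l < \<infinity>" "- \<infinity> < u" "l \<le> u"
    and \<psi>: "\<psi> = (\<lambda>t. real_of_ereal (max l' (min (ereal (t + c')) u')))" "l' < \<infinity>" "- \<infinity> < u'" "l' \<le> u'"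
    unfolding TB_def by blast
  define a where "a = l' + ereal c"
  define b where "b = u' + ereal c"
  have ab: "a \<le> b" "a < \<infinity>" "- \<infinity> < b" using \<psi>(2-4) by (auto simp: a_def b_def intro: add_right_mono)
  \<comment> \<open>The outer translation is moved inside by translating the bounds of the inner
    clamp.\<close>
  have e: "ereal (\<psi> t + c) = max a (min (ereal (t + (c' + c))) b)" for t
  proof -
    have "ereal (\<psi> t) = max l' (min (ereal (t + c')) u')" unfolding \<psi>(1) by (rule TB_ereal[OF \<psi>(2,3)])
    then have "ereal (\<psi> t + c) = max l' (min (ereal (t + c')) u') + ereal c" by (metis plus_ereal.simps(1))
    also have "\<dots> = max a (min (ereal (t + (c' + c))) b)"
      unfolding a_def b_def using \<psi>(2-4) by (cases l'; cases u') (auto simp: max_def min_def)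
    finally show ?thesis .
  qed
  have "(\<phi> \<circ> \<psi>) t = real_of_ereal (max (max l (min a u)) (min (ereal (t + (c' + c))) (max l (min b u))))" for t
    unfolding \<phi>(1) comp_def e using \<phi>(4) ab(1) by (intro arg_cong[where f=real_of_ereal]) (auto simp: max_def min_def)
  moreover have "max l (min a u) < \<infinity>" "- \<infinity> < max l (min b u)" "max l (min a u) \<le> max l (min b u)"
    using \<phi>(2-4) ab by (auto simp: max_def min_def)
  ultimately show "\<phi> \<circ> \<psi> \<in> TB"
    unfolding TB_def
    by (intro CollectI exI[of _ "c' + c"] exI[of _ "max l (min a u)"] exI[of _ "max l (min b u)"] conjI) (blast intro: HOL.ext)+
qed

lemma TB_clamp: "a \<le> b \<Longrightarrow> (\<lambda>t. max a (min (t + c) b)) \<in> TB"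
  unfolding TB_def by (intro CollectI exI[of _ c] exI[of _ "ereal a"] exI[of _ "ereal b"]) (auto simp: fun_eq_iff max_def min_def)

lemma less_dsepD:
  assumes "ereal s < dsep X A B"
  shows "\<exists>f\<in>gd_closure X. \<forall>a\<in>A. \<forall>b\<in>B. s \<le> f b - f a"
proof -
  obtain f where f: "f \<in> gd_closure X" "ereal s < (INF a\<in>A. INF b\<in>B. ereal (f b - f a))"
    using assms unfolding dsep_def less_SUP_iff by blast
  have "s \<le> f b - f a" if "a \<in> A" "b \<in> B" for a b
  proof -
    have "(INF a\<in>A. INF b\<in>B. ereal (f b - f a)) \<le> ereal (f b - f a)"
      by (rule INF_lower2[OF that(1)], rule INF_lower[OF that(2)])
    then have "ereal s < ereal (f b - f a)" using f(2) by (rule less_le_trans[rotated])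
    then show ?thesis by simp
  qed
  then show ?thesis using f(1) by blast
qed

lemma dsep_ge:
  assumes "f \<in> gd_closure X" "\<And>a b. a \<in> A \<Longrightarrow> b \<in> B \<Longrightarrow> s \<le> f b - f a"
  shows "ereal s \<le> dsep X A B"
  unfolding dsep_def by (rule SUP_upper2[OF assms(1)], intro INF_greatest) (use assms(2) in auto)

lemma dsep_pairs_finite: "finite {dsep X (A i) (A j) | i j. i < j \<and> j \<le> (N :: nat)}"
proof (rule finite_subset)
  show "{dsep X (A i) (A j) | i j. i < j \<and> j \<le> N} \<subseteq> (\<lambda>(i, j). dsep X (A i) (A j)) ` ({..N} \<times> {..N})"
    by (fastforce intro: rev_image_eqI)
qed (intro finite_imageI finite_cartesian_product finite_atMost)

lemma Sep_ge:
  assumes N: "0 < N" and A: "A \<in> sep_tuples X N \<kappa>" and le: "\<And>i j. i < j \<Longrightarrow> j \<le> N \<Longrightarrow> s \<le> dsep X (A i) (A j)"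
  shows "s \<le> Sep X N \<kappa>"
proof -
  have "dsep X (A 0) (A N) \<in> {dsep X (A i) (A j) | i j. i < j \<and> j \<le> N}" using N by blast
  then have "s \<le> Min {dsep X (A i) (A j) | i j. i < j \<and> j \<le> N}"
    using le by (subst Min_ge_iff[OF dsep_pairs_finite]) auto
  also have "\<dots> \<le> (SUP A\<in>sep_tuples X N \<kappa>. Min {dsep X (A i) (A j) | i j. i < j \<and> j \<le> N})" by (rule SUP_upper[OF A])
  finally show ?thesis using A by (auto simp: Sep_def)
qed

lemma less_SepD:
  assumes "s < Sep X N \<kappa>" "0 \<le> s"
  obtains A where "A \<in> sep_tuples X N \<kappa>" "\<And>i j. i < j \<Longrightarrow> j \<le> N \<Longrightarrow> s < dsep X (A i) (A j)"
proof -
  have "sep_tuples X N \<kappa> \<noteq> {}" using assms by (auto simp: Sep_def)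
  then have "s < (SUP A\<in>sep_tuples X N \<kappa>. Min {dsep X (A i) (A j) | i j. i < j \<and> j \<le> N})" using assms(1) by (simp add: Sep_def)
  then obtain A where A: "A \<in> sep_tuples X N \<kappa>" "s < Min {dsep X (A i) (A j) | i j. i < j \<and> j \<le> N}"
    unfolding less_SUP_iff by blast
  have "s < dsep X (A i) (A j)" if "i < j" "j \<le> N" for i j
  proof (rule less_le_trans[OF A(2)])
    show "Min {dsep X (A i) (A j) | i j. i < j \<and> j \<le> N} \<le> dsep X (A i) (A j)"
      by (rule Min_le[OF dsep_pairs_finite]) (use that in blast)
  qed
  then show thesis using that A(1) by blast
qed

text \<open>A clamp with both bounds 0 turns any observable into the constant 0, which separates all
  sets by 0.\<close>

lemma Sep_nonneg:
  assumes X: "L_gd_set TB X" and N: "0 < N"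
  shows "0 \<le> Sep X N \<kappa>"
proof (cases "sep_tuples X N \<kappa> = {}")
  case True then show ?thesis by (simp add: Sep_def)
next
  case False
  then obtain A where A: "A \<in> sep_tuples X N \<kappa>" by blast
  have gX: "gd_set X" using X by (simp add: L_gd_set_def)
  obtain f where f: "f \<in> gd_closure X" using gd_closure_nonempty[OF gX] by blast
  have k: "(\<lambda>t. max 0 (min (t + 0) 0)) \<in> TB" by (rule TB_clamp) simp
  define h where "h = compose (pts X) (\<lambda>t. max 0 (min (t + 0) 0)) f"
  have h: "h \<in> gd_closure X" using X k f by (auto simp: L_gd_set_def h_def)
  have hz: "h x = 0" if "x \<in> pts X" for x using that by (simp add: h_def compose_def)
  have "ereal 0 \<le> dsep X (A i) (A j)" if "i < j" "j \<le> N" for i j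
  proof (rule dsep_ge[OF h])
    have "A i \<in> sets (msr X)" "A j \<in> sets (msr X)" using A that by (auto simp: sep_tuples_def)
    then have "A i \<subseteq> pts X" "A j \<subseteq> pts X" using sets.sets_into_space gX by fastforce+
    then show "0 \<le> h b - h a" if "a \<in> A i" "b \<in> A j" for a b using hz that by (auto simp: subset_iff)
  qed
  then show ?thesis using Sep_ge[OF N A, of "ereal 0"] by (simp add: zero_ereal_def)
qed

text \<open>Sets cut out by thresholds: \<open>f i j\<close> is at most \<open>c i j\<close> on the
  \<open>i\<close>-th set and at least \<open>c i j + s\<close> on the \<open>j\<close>-th, for
  \<open>i < j\<close>. They contain any tuple separated by these observables at these thresholds,
  and their non-strict inequalities survive limits.\<close>

definition level :: "'a gdset \<Rightarrow> nat \<Rightarrow> (nat \<Rightarrow> nat \<Rightarrow> 'a \<Rightarrow> real) \<Rightarrow> (nat \<Rightarrow> nat \<Rightarrow> real) \<Rightarrow> real \<Rightarrow> nat \<Rightarrow> 'a set" where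
  "level X N f c s i = {x \<in> pts X. (\<forall>j\<le>N. i < j \<longrightarrow> f i j x \<le> c i j) \<and> (\<forall>k<i. c k i + s \<le> f k i x)}"

lemma level_measurable:
  assumes X: "gd_set X" and f: "\<And>i j. f i j \<in> gd_closure X"
  shows "level X N f c s i \<in> sets (msr X)"
proof -
  have m: "f i j \<in> borel_measurable (msr X)" for i j by (rule closure_measurable[OF X f])
  have "{x \<in> space (msr X). (\<forall>j\<in>{i<..N}. f i j x \<le> c i j) \<and> (\<forall>k\<in>{..<i}. c k i + s \<le> f k i x)} \<in> sets (msr X)"
    by (intro sets.sets_Collect_conj sets.sets_Collect_finite_All borel_measurable_le borel_measurable_const m) auto
  moreover have "level X N f c s i
      = {x \<in> space (msr X). (\<forall>j\<in>{i<..N}. f i j x \<le> c i j) \<and> (\<forall>k\<in>{..<i}. c k i + s \<le> f k i x)}"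
    using X by (auto simp: level_def)
  ultimately show ?thesis by simp
qed

text \<open>Since \<open>s\<close> is positive, the two threshold conditions on \<open>f i j\<close>
  exclude each other, which makes the levels disjoint.\<close>

lemma level_imp_Sep_ge:
  assumes X: "gd_set X" and f: "\<And>i j. f i j \<in> gd_closure X" and N: "0 < N" and s: "0 < s"
    and \<kappa>: "\<And>i. i \<le> N \<Longrightarrow> \<kappa> i \<le> measure (msr X) (level X N f c s i)"
  shows "ereal s \<le> Sep X N \<kappa>"
proof (rule Sep_ge[OF N])
  have dj: "level X N f c s i \<inter> level X N f c s j = {}" if "i < j" "j \<le> N" for i j
    using that s by (fastforce simp: level_def)
  have "level X N f c s i \<inter> level X N f c s j = {}" if "i \<le> N" "j \<le> N" "i \<noteq> j" for i j
    using dj[of i j] dj[of j i] that by (cases "i < j") auto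
  then show "level X N f c s \<in> sep_tuples X N \<kappa>"
    unfolding sep_tuples_def disjoint_family_on_def using \<kappa> level_measurable[OF X f] by auto
  show "ereal s \<le> dsep X (level X N f c s i) (level X N f c s j)" if "i < j" "j \<le> N" for i j
  proof (rule dsep_ge[OF f[of i j]])
    fix a b assume "a \<in> level X N f c s i" "b \<in> level X N f c s j"
    then have "f i j a \<le> c i j" "c i j + s \<le> f i j b" using that by (auto simp: level_def)
    then show "s \<le> f i j b - f i j a" by linarith
  qed
qed

lemma Sep_imp_level:
  assumes X: "gd_set X" and s: "0 \<le> s" and less: "ereal s < Sep X N \<kappa>" and \<kappa>: "\<And>i. i \<le> N \<Longrightarrow> 0 < \<kappa> i"
  obtains f c where "\<And>i j. f i j \<in> gd_closure X" "\<And>i. i \<le> N \<Longrightarrow> \<kappa> i \<le> measure (msr X) (level X N f c s i)"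
proof -
  interpret prob_space "msr X" by (rule gd_prob[OF X])
  obtain A where A: "A \<in> sep_tuples X N \<kappa>" and d: "\<And>i j. i < j \<Longrightarrow> j \<le> N \<Longrightarrow> ereal s < dsep X (A i) (A j)"
    using less_SepD[OF less] s by auto
  have Am: "A i \<in> sets (msr X)" "\<kappa> i \<le> measure (msr X) (A i)" if "i \<le> N" for i using A that by (auto simp: sep_tuples_def)
  have Ane: "A i \<noteq> {}" if "i \<le> N" for i using Am(2)[OF that] \<kappa>[OF that] by auto
  obtain f0 where f0: "f0 \<in> gd_closure X" using gd_closure_nonempty[OF X] by blast
  have "\<forall>i j. \<exists>f. f \<in> gd_closure X \<and> (i < j \<and> j \<le> N \<longrightarrow> (\<forall>a\<in>A i. \<forall>b\<in>A j. s \<le> f b - f a))"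
    using less_dsepD[OF d] f0 by blast
  then obtain f where f: "\<And>i j. f i j \<in> gd_closure X"
    "\<And>i j a b. i < j \<Longrightarrow> j \<le> N \<Longrightarrow> a \<in> A i \<Longrightarrow> b \<in> A j \<Longrightarrow> s \<le> f i j b - f i j a" by metis
  \<comment> \<open>The supremum is finite because a point of the nonempty set \<open>A j\<close>
    bounds \<open>f i j\<close> on \<open>A i\<close> from above; the \<open>A j\<close> are
    nonempty as \<open>\<kappa>\<close> is positive.\<close>
  define c where "c i j = (SUP a\<in>A i. f i j a)" for i j
  have bdd: "bdd_above (f i j ` A i)" if "i < j" "j \<le> N" for i j
  proof -
    have "A j \<noteq> {}" using that by (intro Ane)
    then obtain b where "b \<in> A j" by blast
    then show ?thesis using f(2)[OF \<open>i < j\<close> \<open>j \<le> N\<close>] by (intro bdd_aboveI2[of _ _ "f i j b - s"]) force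
  qed
  have "A i \<subseteq> level X N f c s i" if i: "i \<le> N" for i
  proof
    fix x assume x: "x \<in> A i"
    have "x \<in> pts X" using x sets.sets_into_space[OF Am(1)[OF i]] X by auto
    moreover have "f i j x \<le> c i j" if "i < j" "j \<le> N" for j
      unfolding c_def by (rule cSUP_upper[OF x bdd[OF that]])
    moreover have "c k i + s \<le> f k i x" if "k < i" for k
    proof -
      have "c k i \<le> f k i x - s"
        unfolding c_def
      proof (rule cSUP_least)
        show "A k \<noteq> {}" using Ane that i by simp
        show "f k i a \<le> f k i x - s" if "a \<in> A k" for a using f(2)[OF \<open>k < i\<close> i that x] by linarith
      qed
      then show ?thesis by linarith
    qed
    ultimately show "x \<in> level X N f c s i" by (auto simp: level_def)
  qed
  then have "\<kappa> i \<le> measure (msr X) (level X N f c s i)" if "i \<le> N" for i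
    using Am(2)[OF that] finite_measure_mono[OF _ level_measurable[OF X f(1)]] that by (meson order_trans)
  then show thesis using that f(1) by blast
qed

text \<open>An error \<open>\<eta>\<close> raises the upper threshold to
  \<open>c i j + \<eta>\<close> and lowers the other to \<open>c i j + s - \<eta>\<close>, so the
  gap shrinks by \<open>2 * \<eta>\<close>.\<close>

lemma level_transfer:
  assumes XY: "gd_pair X Y M a b" and f: "\<And>i j. f i j \<in> gd_closure X" and g: "\<And>i j. g i j \<in> gd_closure Y"
    and E: "E \<in> sets M" "1 - d \<le> measure M E" and i: "i \<le> N"
    and le: "\<And>i j w. i \<le> N \<Longrightarrow> j \<le> N \<Longrightarrow> w \<in> E \<Longrightarrow> \<bar>f i j (a w) - g i j (b w)\<bar> \<le> \<eta>"
  shows "measure (msr X) (level X N f c s i) - d \<le> measure (msr Y) (level Y N g (\<lambda>i j. c i j + \<eta>) (s - 2 * \<eta>) i)"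
proof -
  interpret XY: gd_pair X Y M a b by (rule XY)
  interpret prob_space M by (rule XY.M)
  let ?A = "level X N f c s i" and ?B = "level Y N g (\<lambda>i j. c i j + \<eta>) (s - 2 * \<eta>) i"
  have A: "?A \<in> sets (msr X)" by (rule level_measurable[OF XY.X f])
  have B: "?B \<in> sets (msr Y)" by (rule level_measurable[OF XY.Y g])
  have "measure (msr X) ?A = prob (a -` ?A \<inter> space M)" using measure_distr[OF XY.a(1) A] XY.a(2) by simp
  then have "measure (msr X) ?A - d \<le> prob ((a -` ?A \<inter> space M) \<inter> E)"
    using prob_Int_ge[OF measurable_sets[OF XY.a(1) A] E(1)] E(2) by linarith
  also have "\<dots> \<le> prob (b -` ?B \<inter> space M)"
  proof (rule finite_measure_mono[OF _ measurable_sets[OF XY.b(1) B]])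
    show "(a -` ?A \<inter> space M) \<inter> E \<subseteq> b -` ?B \<inter> space M"
    proof
      fix w assume w: "w \<in> (a -` ?A \<inter> space M) \<inter> E"
      have "b w \<in> pts Y" using measurable_space[OF XY.b(1)] w XY.Y by auto
      moreover have "g i j (b w) \<le> c i j + \<eta>" if "j \<le> N" "i < j" for j
      proof -
        have "f i j (a w) \<le> c i j" using w that by (auto simp: level_def)
        then show ?thesis using le[of i j w] w that i by auto
      qed
      moreover have "(c k i + \<eta>) + (s - 2 * \<eta>) \<le> g k i (b w)" if "k < i" for k
      proof -
        have "c k i + s \<le> f k i (a w)" using w that by (auto simp: level_def)
        moreover have "\<bar>f k i (a w) - g k i (b w)\<bar> \<le> \<eta>" using le[of k i w] w that i by auto
        ultimately show ?thesis by linarith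
      qed
      ultimately show "w \<in> b -` ?B \<inter> space M" using w by (simp add: level_def)
    qed
  qed
  also have "\<dots> = measure (msr Y) ?B" using measure_distr[OF XY.b(1) B] XY.b(2) by simp
  finally show ?thesis .
qed

section \<open>Separation along convergent pyramids\<close>

lemma Sep_family_nonneg:
  assumes P: "pyramid TB P" and N: "0 < N"
  shows "0 \<le> Sep_family P N \<kappa>"
proof -
  obtain X where X: "X \<in> P" using P by (auto simp: pyramid_def)
  then have "L_gd_set TB X" using P by (auto simp: pyramid_def LD_def)
  then show ?thesis unfolding Sep_family_def by (intro SUP_upper2[OF X] Sep_nonneg N)
qed

text \<open>Lowering the masses by \<open>\<epsilon>\<close> leaves room for the mass lost in the
  coupling, and \<open>s'\<close> below \<open>s\<close> leaves room for the shrinking gap. A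
  negative \<open>x\<close> is covered by nonnegativity.\<close>

lemma Sep_liminf_ge:
  assumes P: "\<And>n. pyramid TB (P n)" and Q: "pyramid TB Q" and conv: "pyramid_conv TB P Q" and N: "0 < N"
    and \<kappa>: "\<And>i. i \<le> N \<Longrightarrow> 0 < \<kappa> i" and \<epsilon>: "0 < \<epsilon>" and less: "x < Sep_family Q N \<kappa>"
  shows "x < liminf (\<lambda>n. Sep_family (P n) N (\<lambda>i. \<kappa> i - \<epsilon>))"
proof (cases "x < 0")
  case True
  have "0 \<le> liminf (\<lambda>n. Sep_family (P n) N (\<lambda>i. \<kappa> i - \<epsilon>))"
    by (intro Liminf_bounded always_eventually allI Sep_family_nonneg[OF P N])
  then show ?thesis using True by (rule less_le_trans[rotated])
next
  case False
  then have x0: "0 \<le> x" by simp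
  obtain X where X: "X \<in> Q" "x < Sep X N \<kappa>" using less unfolding Sep_family_def less_SUP_iff by blast
  have gX: "gd_set X" using Q X by (auto simp: pyramid_def LD_def L_gd_set_def)
  obtain s where s: "x < ereal s" "ereal s < Sep X N \<kappa>" using X(2) ereal_dense2 by blast
  obtain s' where s': "x < ereal s'" "ereal s' < ereal s" using s(1) ereal_dense2 by blast
  have "0 < ereal s'" using x0 s'(1) by (rule le_less_trans)
  then have s'0: "0 < s'" by simp
  have ss: "s' < s" using s'(2) by simp
  have s0: "0 \<le> s" using s'0 ss by simp
  obtain f c where f: "\<And>i j. f i j \<in> gd_closure X"
    and lv: "\<And>i. i \<le> N \<Longrightarrow> \<kappa> i \<le> measure (msr X) (level X N f c s i)"
    by (rule Sep_imp_level[OF gX s0 s(2) \<kappa>]) blast+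
  define \<eta> where "\<eta> = min \<epsilon> (s - s')"
  have \<eta>: "0 < \<eta>" "\<eta> \<le> \<epsilon>" "\<eta> \<le> s - s'" using \<epsilon> ss by (auto simp: \<eta>_def)
  have "\<forall>\<^sub>F n in sequentially. ereal s' \<le> Sep_family (P n) N (\<lambda>i. \<kappa> i - \<epsilon>)"
    using pyramid_conv_approx[OF P Q conv X(1) \<eta>(1)]
  proof eventually_elim
    case (elim n)
    then obtain Y where Y: "Y \<in> P n" "gd_box X Y < \<eta>" by blast
    have gY: "gd_set Y" using P[of n] Y(1) by (auto simp: pyramid_def LD_def L_gd_set_def)
    obtain p S where p: "p \<in> couplings X Y" "closedin (gd_prod_top X Y) S" "1 - \<eta> \<le> measure p S"
      "near S (\<eta>/2) (gd_closure X) (gd_closure Y)"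
      by (rule gd_boxD[OF gX gY Y(2)]) blast
    have "\<forall>i j. \<exists>g. g \<in> gd_closure Y \<and> (\<forall>(x, y)\<in>S. \<bar>f i j x - g y\<bar> \<le> \<eta>/2)"
      using p(4) f unfolding near_def by blast
    then obtain g where g: "\<And>i j. g i j \<in> gd_closure Y" "\<And>i j. \<forall>(x, y)\<in>S. \<bar>f i j x - g i j y\<bar> \<le> \<eta>/2" by metis
    have Sm: "S \<in> sets p" by (rule closed_measurable[OF gX gY p(1,2)])
    have "ereal (s - 2 * (\<eta>/2)) \<le> Sep Y N (\<lambda>i. \<kappa> i - \<epsilon>)"
    proof (rule level_imp_Sep_ge[OF gY g(1) N])
      show "0 < s - 2 * (\<eta>/2)" using \<eta>(3) s'0 by simp
      fix i assume i: "i \<le> N"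
      have "measure (msr X) (level X N f c s i) - \<eta> \<le> measure (msr Y) (level Y N g (\<lambda>i j. c i j + \<eta>/2) (s - 2 * (\<eta>/2)) i)"
        by (rule level_transfer[OF coupling_gd_pair[OF gX gY p(1)] f g(1) Sm p(3) i]) (use g(2) in fastforce)
      then show "\<kappa> i - \<epsilon> \<le> measure (msr Y) (level Y N g (\<lambda>i j. c i j + \<eta>/2) (s - 2 * (\<eta>/2)) i)"
        using lv[OF i] \<eta>(2) by linarith
    qed
    then have "ereal s' \<le> Sep Y N (\<lambda>i. \<kappa> i - \<epsilon>)" by (rule order_trans[rotated]) (use \<eta>(3) in simp)
    also have "\<dots> \<le> Sep_family (P n) N (\<lambda>i. \<kappa> i - \<epsilon>)" unfolding Sep_family_def by (rule SUP_upper[OF Y(1)])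
    finally show ?case .
  qed
  then have "ereal s' \<le> liminf (\<lambda>n. Sep_family (P n) N (\<lambda>i. \<kappa> i - \<epsilon>))" by (rule Liminf_bounded)
  then show ?thesis using s'(1) by (rule less_le_trans[rotated])
qed

text \<open>The relaxed levels decrease to a subset of the exact level as \<open>\<eta>\<close>
  tends to 0, so continuity from above applies.\<close>

lemma measure_level_limit:
  assumes Z: "gd_set Z" and g: "\<And>i j. g i j \<in> gd_closure Z"
    and le: "\<And>\<eta>. 0 < \<eta> \<Longrightarrow> \<alpha> - 2 * \<eta> \<le> measure (msr Z) (level Z N g (\<lambda>_ _. 0 + \<eta>) (s - 2 * \<eta>) i)"
  shows "\<alpha> \<le> measure (msr Z) (level Z N g (\<lambda>_ _. 0) s i)"
proof -
  interpret prob_space "msr Z" by (rule gd_prob[OF Z])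
  define e where "e k = inverse (real (Suc k))" for k
  have e: "0 < e k" for k by (simp add: e_def)
  have elim: "e \<longlonglongrightarrow> 0" unfolding e_def by (rule LIMSEQ_inverse_real_of_nat)
  define J where "J k = level Z N g (\<lambda>_ _. 0 + e k) (s - 2 * e k) i" for k
  have "(\<lambda>k. prob (J k)) \<longlonglongrightarrow> prob (\<Inter>k. J k)"
  proof (rule finite_Lim_measure_decseq)
    show "range J \<subseteq> events" using level_measurable[OF Z g] by (auto simp: J_def)
    show "decseq J"
      unfolding decseq_def
    proof (intro allI impI subsetI)
      fix k l x assume "k \<le> l" and x: "x \<in> J l"
      then have "e l \<le> e k" unfolding e_def by (intro le_imp_inverse_le) auto
      then show "x \<in> J k" using x unfolding J_def level_def by force
    qed
  qed
  moreover have "(\<Inter>k. J k) \<subseteq> level Z N g (\<lambda>_ _. 0) s i"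
  proof
    fix x assume x: "x \<in> (\<Inter>k. J k)"
    have xJ: "x \<in> J k" for k using x by blast
    have "x \<in> pts Z" using xJ[of 0] by (simp add: J_def level_def)
    moreover have "g i j x \<le> 0" if "j \<le> N" "i < j" for j
    proof (rule LIMSEQ_le_const[OF elim])
      show "\<exists>M. \<forall>k\<ge>M. g i j x \<le> e k" using xJ that by (auto simp: J_def level_def)
    qed
    moreover have "0 + s \<le> g k i x" if "k < i" for k
    proof -
      have "s - g k i x \<le> 0"
      proof (rule LIMSEQ_le_const[OF elim])
        have "e l + (s - 2 * e l) \<le> g k i x" for l using xJ[of l] that by (simp add: J_def level_def)
        then have "s - g k i x \<le> e l" for l by (simp add: algebra_simps)
        then show "\<exists>M. \<forall>l\<ge>M. s - g k i x \<le> e l" by blast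
      qed
      then show ?thesis by simp
    qed
    ultimately show "x \<in> level Z N g (\<lambda>_ _. 0) s i" by (simp add: level_def)
  qed
  then have "prob (\<Inter>k. J k) \<le> prob (level Z N g (\<lambda>_ _. 0) s i)"
    by (rule finite_measure_mono[OF _ level_measurable[OF Z g]])
  moreover have "\<alpha> - 2 * e k \<le> prob (J k)" for k unfolding J_def by (rule le[OF e])
  moreover have "(\<lambda>k. \<alpha> - 2 * e k) \<longlonglongrightarrow> \<alpha> - 2 * 0" by (intro tendsto_intros elim)
  ultimately have "\<alpha> - 2 * 0 \<le> prob (\<Inter>k. J k)" by (intro LIMSEQ_le) auto
  then show ?thesis using \<open>prob (\<Inter>k. J k) \<le> _\<close> by simp
qed

text \<open>If every \<open>k\<close> failed, a diagonal choice would give \<open>X k\<close> with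
  separation above \<open>s\<close> at masses reduced by only \<open>m / (real k + 1)\<close>. As
  this reduction tends to 0, the limit \<open>Z\<close> has separation at least \<open>s\<close> at
  the full masses.\<close>

lemma Sep_limsup_less:
  assumes P: "\<And>n. pyramid TB (P n)" and Q: "pyramid TB Q" and conv: "pyramid_conv TB P Q" and N: "0 < N"
    and \<kappa>: "\<And>i. i \<le> N \<Longrightarrow> m < \<kappa> i" and m: "0 < m" and less: "Sep_family Q N \<kappa> < x"
  shows "\<exists>k. limsup (\<lambda>n. Sep_family (P n) N (\<lambda>i. \<kappa> i - m / (real k + 1))) < x"
proof (rule ccontr)
  assume "\<not> ?thesis"
  then have ge: "x \<le> limsup (\<lambda>n. Sep_family (P n) N (\<lambda>i. \<kappa> i - m / (real k + 1)))" for k by (simp add: not_less)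
  obtain s where s: "Sep_family Q N \<kappa> < ereal s" "ereal s < x" using less ereal_dense2 by blast
  have "0 < ereal s" using Sep_family_nonneg[OF Q N] s(1) by (rule le_less_trans)
  then have s0: "0 < s" by simp
  have fr: "\<exists>\<^sub>F n in sequentially. ereal s < Sep_family (P n) N (\<lambda>i. \<kappa> i - m / (real k + 1))" for k
  proof (rule ccontr)
    assume "\<not> ?thesis"
    then have "\<forall>\<^sub>F n in sequentially. Sep_family (P n) N (\<lambda>i. \<kappa> i - m / (real k + 1)) \<le> ereal s" by (simp add: not_frequently not_less)
    then have "limsup (\<lambda>n. Sep_family (P n) N (\<lambda>i. \<kappa> i - m / (real k + 1))) \<le> ereal s" by (rule Limsup_bounded)
    then show False using ge[of k] s(2) by simp
  qed
  obtain r where r: "strict_mono (r :: nat \<Rightarrow> nat)" "\<And>k. ereal s < Sep_family (P (r k)) N (\<lambda>i. \<kappa> i - m / (real k + 1))"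
    by (rule frequently_subsequence[of "\<lambda>k n. ereal s < Sep_family (P n) N (\<lambda>i. \<kappa> i - m / (real k + 1))", OF fr]) blast
  have "\<exists>X. X \<in> P (r k) \<and> ereal s < Sep X N (\<lambda>i. \<kappa> i - m / (real k + 1))" for k
    using r(2)[of k] unfolding Sep_family_def less_SUP_iff by blast
  then obtain X where X: "\<And>k. X k \<in> P (r k)" and SX: "\<And>k. ereal s < Sep (X k) N (\<lambda>i. \<kappa> i - m / (real k + 1))" by metis
  have LX: "L_gd_set TB (X k)" and gX: "gd_set (X k)" for k
    using P[of "r k"] X[of k] by (auto simp: pyramid_def LD_def L_gd_set_def)
  have "\<exists>f c. (\<forall>i j. f i j \<in> gd_closure (X k)) \<and>
      (\<forall>i\<le>N. \<kappa> i - m / (real k + 1) \<le> measure (msr (X k)) (level (X k) N f c s i))" for k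
  proof -
    have "m / (real k + 1) \<le> m" using m by (simp add: divide_le_eq)
    then have "0 < \<kappa> i - m / (real k + 1)" if "i \<le> N" for i using \<kappa>[OF that] by linarith
    then obtain f c where "\<And>i j. f i j \<in> gd_closure (X k)"
      "\<And>i. i \<le> N \<Longrightarrow> \<kappa> i - m / (real k + 1) \<le> measure (msr (X k)) (level (X k) N f c s i)"
      using Sep_imp_level[OF gX less_imp_le[OF s0] SX] by metis
    then show ?thesis by (intro exI[of _ f] exI[of _ c]) simp
  qed
  then obtain f c where f: "\<And>k i j. f k i j \<in> gd_closure (X k)"
    and lv: "\<And>k i. i \<le> N \<Longrightarrow> \<kappa> i - m / (real k + 1) \<le> measure (msr (X k)) (level (X k) N (f k) (c k) s i)" by metis
  \<comment> \<open>Translating by the threshold and clamping to \<open>[0, s]\<close> makes the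
    observables uniformly bounded and moves all thresholds to 0 and \<open>s\<close>. The possibly
    unbounded \<open>c k i j\<close> disappear before the limit is taken.\<close>
  define h where "h k i j = compose (pts (X k)) (\<lambda>t. max 0 (min (t + (- c k i j)) s)) (f k i j)" for k i j
  have h: "h k i j \<in> gd_closure (X k)" for k i j
    using LX[of k] TB_clamp[of 0 s "- c k i j"] s0 f[of k i j] by (auto simp: L_gd_set_def h_def)
  have lvh: "\<kappa> i - m / (real k + 1) \<le> measure (msr (X k)) (level (X k) N (h k) (\<lambda>_ _. 0) s i)" if i: "i \<le> N" for k i
  proof -
    interpret prob_space "msr (X k)" by (rule gd_prob[OF gX])
    have "level (X k) N (f k) (c k) s i \<subseteq> level (X k) N (h k) (\<lambda>_ _. 0) s i"
      using s0 by (auto simp: level_def h_def compose_def max_def min_def)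
    then have "prob (level (X k) N (f k) (c k) s i) \<le> prob (level (X k) N (h k) (\<lambda>_ _. 0) s i)"
      by (rule finite_measure_mono[OF _ level_measurable[OF gX h]])
    then show ?thesis using lv[OF i, of k] by linarith
  qed
  \<comment> \<open>The pairs \<open>(i, j)\<close> with entries up to \<open>N\<close> are numbered
    consecutively as \<open>i * (N + 1) + j\<close>.\<close>
  define K where "K = (N + 1) * (N + 1)"
  obtain Z g' s' where Z: "Z \<in> Q" "gd_set Z" "strict_mono (s' :: nat \<Rightarrow> nat)" "\<And>l. l < K \<Longrightarrow> g' l \<in> gd_closure Z"
    and cpl: "\<And>e. 0 < e \<Longrightarrow> \<forall>\<^sub>F k in sequentially. \<exists>(M :: (real \<times> (nat \<Rightarrow> real)) measure) a b E.
      gd_pair (X (s' k)) Z M a b \<and> E \<in> sets M \<and> 1 - e \<le> measure M E \<and>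
      (\<forall>w\<in>E. \<forall>l<K. \<bar>h (s' k) (l div (N + 1)) (l mod (N + 1)) (a w) - g' l (b w)\<bar> \<le> e)"
  proof (rule pyramid_limit_observables[OF TB_monoidal P conv r(1) X, of K "\<lambda>k l. h k (l div (N + 1)) (l mod (N + 1))" s])
    show "0 \<le> h k (l div (N + 1)) (l mod (N + 1)) x \<and> h k (l div (N + 1)) (l mod (N + 1)) x \<le> s" if "x \<in> pts (X k)" for k l x
      using s0 that by (simp add: h_def compose_def)
  qed (use h in \<open>auto simp: K_def\<close>)
  define g where "g i j = (if i \<le> N \<and> j \<le> N then g' (i * (N + 1) + j) else g' 0)" for i j
  have idx: "i * (N + 1) + j < K" "(i * (N + 1) + j) div (N + 1) = i" "(i * (N + 1) + j) mod (N + 1) = j" if "i \<le> N" "j \<le> N" for i j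
  proof -
    have "i * (N + 1) + j < i * (N + 1) + (N + 1)" using that by simp
    also have "\<dots> = (i + 1) * (N + 1)" by simp
    also have "\<dots> \<le> K" unfolding K_def using that by (intro mult_right_mono) auto
    finally show "i * (N + 1) + j < K" .
    show "(i * (N + 1) + j) div (N + 1) = i" "(i * (N + 1) + j) mod (N + 1) = j"
      using that by (simp_all add: div_mult_self3[of "N + 1" j i, simplified] del: mult_Suc_right)
  qed
  have g: "g i j \<in> gd_closure Z" for i j using Z(4) idx by (auto simp: g_def K_def)
  have "\<kappa> i \<le> measure (msr Z) (level Z N g (\<lambda>_ _. 0) s i)" if i: "i \<le> N" for i
  proof (rule measure_level_limit[OF Z(2) g])
    fix \<eta> :: real assume \<eta>: "0 < \<eta>"
    have "(\<lambda>k. m * inverse (real (Suc (s' k)))) \<longlonglongrightarrow> m * 0"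
      using LIMSEQ_subseq_LIMSEQ[OF LIMSEQ_inverse_real_of_nat Z(3)] by (intro tendsto_mult tendsto_const) (simp add: o_def)
    then have "\<forall>\<^sub>F k in sequentially. m * inverse (real (Suc (s' k))) < \<eta>" by (rule order_tendstoD) (use \<eta> in simp)
    \<comment> \<open>One \<open>\<eta>\<close> accounts for the mass lost in the coupling, the
      other for the reduction \<open>m / (real (s' k) + 1)\<close>.\<close>
    with cpl[OF \<eta>] have "\<forall>\<^sub>F k in sequentially. \<kappa> i - 2 * \<eta> \<le> measure (msr Z) (level Z N g (\<lambda>_ _. 0 + \<eta>) (s - 2 * \<eta>) i)"
    proof eventually_elim
      case (elim k)
      then obtain M :: "(real \<times> (nat \<Rightarrow> real)) measure" and a b E where M: "gd_pair (X (s' k)) Z M a b" "E \<in> sets M" "1 - \<eta> \<le> measure M E"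
        and E: "\<And>w l. w \<in> E \<Longrightarrow> l < K \<Longrightarrow> \<bar>h (s' k) (l div (N + 1)) (l mod (N + 1)) (a w) - g' l (b w)\<bar> \<le> \<eta>" by blast
      have "measure (msr (X (s' k))) (level (X (s' k)) N (h (s' k)) (\<lambda>_ _. 0) s i) - \<eta>
          \<le> measure (msr Z) (level Z N g (\<lambda>_ _. 0 + \<eta>) (s - 2 * \<eta>) i)"
      proof (rule level_transfer[OF M(1) h g M(2,3) i])
        show "\<bar>h (s' k) i j (a w) - g i j (b w)\<bar> \<le> \<eta>" if "i \<le> N" "j \<le> N" "w \<in> E" for i j w
          using E[OF that(3) idx(1)[OF that(1,2)]] idx(2,3)[OF that(1,2)] that by (simp add: g_def)
      qed
      moreover have "m / (real (s' k) + 1) < \<eta>" using elim(2) by (simp add: divide_inverse add.commute)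
      ultimately show ?case using lvh[OF i, of "s' k"] by linarith
    qed
    then show "\<kappa> i - 2 * \<eta> \<le> measure (msr Z) (level Z N g (\<lambda>_ _. 0 + \<eta>) (s - 2 * \<eta>) i)"
      using eventually_happens'[OF sequentially_bot] by blast
  qed
  then have "ereal s \<le> Sep Z N \<kappa>" by (rule level_imp_Sep_ge[OF Z(2) g N s0])
  also have "\<dots> \<le> Sep_family Q N \<kappa>" unfolding Sep_family_def by (rule SUP_upper[OF Z(1)])
  finally show False using s(1) by simp
qed

text \<open>Smaller masses admit more tuples. If the larger masses admit none, the conventional
  value 0 is compared with a nonnegative one.\<close>

lemma Sep_family_mono:
  assumes le: "\<And>i. i \<le> N \<Longrightarrow> \<kappa>' i \<le> \<kappa> i" and P: "pyramid TB P" and N: "0 < N"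
  shows "Sep_family P N \<kappa> \<le> Sep_family P N \<kappa>'"
  unfolding Sep_family_def
proof (rule SUP_mono)
  fix X assume X: "X \<in> P"
  have L: "L_gd_set TB X" using P X by (auto simp: pyramid_def LD_def)
  have sub: "sep_tuples X N \<kappa> \<subseteq> sep_tuples X N \<kappa>'" using le by (auto simp: sep_tuples_def intro: order_trans)
  have "Sep X N \<kappa> \<le> Sep X N \<kappa>'"
  proof (cases "sep_tuples X N \<kappa> = {}")
    case True
    then show ?thesis using Sep_nonneg[OF L N, of \<kappa>'] by (simp add: Sep_def)
  next
    case False
    then have "sep_tuples X N \<kappa>' \<noteq> {}" using sub by auto
    then show ?thesis using False sub by (simp add: Sep_def SUP_subset_mono)
  qed
  then show "\<exists>Y\<in>P. Sep X N \<kappa> \<le> Sep Y N \<kappa>'" using X by blast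
qed

lemma Sep_family_tendsto:
  assumes P: "\<And>n. pyramid TB (P n)" and Q: "pyramid TB Q" and conv: "pyramid_conv TB P Q" and N: "0 < N"
    and \<kappa>: "\<And>i. i \<le> N \<Longrightarrow> 0 < \<kappa> i"
  shows "((\<lambda>\<epsilon>. liminf (\<lambda>n. Sep_family (P n) N (\<lambda>i. \<kappa> i - \<epsilon>))) \<longlongrightarrow> Sep_family Q N \<kappa>) (at 0 within {0<..<Min (\<kappa> ` {..N})})"
    and "((\<lambda>\<epsilon>. limsup (\<lambda>n. Sep_family (P n) N (\<lambda>i. \<kappa> i - \<epsilon>))) \<longlongrightarrow> Sep_family Q N \<kappa>) (at 0 within {0<..<Min (\<kappa> ` {..N})})"
proof -
  let ?F = "at 0 within {0<..<Min (\<kappa> ` {..N})}"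
  \<comment> \<open>Half of the minimum keeps every reduced mass
    \<open>\<kappa> i - m / (real k + 1)\<close> positive.\<close>
  define m where "m = Min (\<kappa> ` {..N}) / 2"
  have m: "0 < m" "\<And>i. i \<le> N \<Longrightarrow> m < \<kappa> i"
  proof -
    have p: "0 < Min (\<kappa> ` {..N})" using \<kappa> by (subst Min_gr_iff) auto
    then show "0 < m" by (simp add: m_def)
    show "m < \<kappa> i" if "i \<le> N" for i
    proof -
      have "Min (\<kappa> ` {..N}) \<le> \<kappa> i" using that by (intro Min_le) auto
      then show ?thesis using p unfolding m_def by linarith
    qed
  qed
  have le: "liminf (\<lambda>n. Sep_family (P n) N (\<lambda>i. \<kappa> i - \<epsilon>)) \<le> limsup (\<lambda>n. Sep_family (P n) N (\<lambda>i. \<kappa> i - \<epsilon>))" for \<epsilon>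
    by (rule Liminf_le_Limsup) simp
  have linf: "\<forall>\<^sub>F \<epsilon> in ?F. x < liminf (\<lambda>n. Sep_family (P n) N (\<lambda>i. \<kappa> i - \<epsilon>))" if x: "x < Sep_family Q N \<kappa>" for x
    unfolding eventually_at_filter by (rule always_eventually) (use Sep_liminf_ge[OF P Q conv N \<kappa> _ x] in auto)
  have lsup: "\<forall>\<^sub>F \<epsilon> in ?F. limsup (\<lambda>n. Sep_family (P n) N (\<lambda>i. \<kappa> i - \<epsilon>)) < x" if x: "Sep_family Q N \<kappa> < x" for x
  proof -
    obtain k where k: "limsup (\<lambda>n. Sep_family (P n) N (\<lambda>i. \<kappa> i - m / (real k + 1))) < x"
      using Sep_limsup_less[OF P Q conv N m(2,1) x] by blast
    \<comment> \<open>Separation grows as the masses are lowered, so a bound at one value of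
      \<open>\<epsilon>\<close> holds at all smaller ones.\<close>
    have "limsup (\<lambda>n. Sep_family (P n) N (\<lambda>i. \<kappa> i - \<epsilon>)) < x" if "\<epsilon> < m / (real k + 1)" for \<epsilon>
    proof -
      have "limsup (\<lambda>n. Sep_family (P n) N (\<lambda>i. \<kappa> i - \<epsilon>)) \<le> limsup (\<lambda>n. Sep_family (P n) N (\<lambda>i. \<kappa> i - m / (real k + 1)))"
        using that by (intro Limsup_mono always_eventually allI Sep_family_mono P N) auto
      then show ?thesis using k by (rule le_less_trans)
    qed
    moreover have "0 < m / (real k + 1)" using m(1) by simp
    ultimately show ?thesis unfolding eventually_at by (intro exI[of _ "m / (real k + 1)"]) (auto simp: dist_real_def)
  qed
  show "((\<lambda>\<epsilon>. liminf (\<lambda>n. Sep_family (P n) N (\<lambda>i. \<kappa> i - \<epsilon>))) \<longlongrightarrow> Sep_family Q N \<kappa>) ?F"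
  proof (rule order_tendstoI)
    fix x assume x: "Sep_family Q N \<kappa> < x"
    show "\<forall>\<^sub>F \<epsilon> in ?F. liminf (\<lambda>n. Sep_family (P n) N (\<lambda>i. \<kappa> i - \<epsilon>)) < x"
      using lsup[OF x] by (rule eventually_mono) (rule le_less_trans[OF le])
  qed (rule linf)
  show "((\<lambda>\<epsilon>. limsup (\<lambda>n. Sep_family (P n) N (\<lambda>i. \<kappa> i - \<epsilon>))) \<longlongrightarrow> Sep_family Q N \<kappa>) ?F"
  proof (rule order_tendstoI)
    fix x assume x: "x < Sep_family Q N \<kappa>"
    show "\<forall>\<^sub>F \<epsilon> in ?F. x < limsup (\<lambda>n. Sep_family (P n) N (\<lambda>i. \<kappa> i - \<epsilon>))"
      using linf[OF x] by (rule eventually_mono) (rule less_le_trans[OF _ le])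
  qed (rule lsup)
qed

theorem theorem1p1:
  shows
   "\<comment> \<open>(i)\<close>
    (\<forall>(X::'a gdset) (Y::'b gdset). gd_set X \<and> gd_set Y \<longrightarrow>
        box_le Y X \<le> gd_box X Y \<and> (box_le Y X = 0 \<longleftrightarrow> dominated Y X)) \<and>
    (\<forall>(X::'a gdset) (Y::'b gdset) (Z::'c gdset). gd_set X \<and> gd_set Y \<and> gd_set Z \<longrightarrow>
        box_le Z X \<le> box_le Z Y + box_le Y X) \<and>
    (\<forall>(Xs::nat \<Rightarrow> 'a gdset) (Ys::nat \<Rightarrow> 'b gdset) (X::'c gdset) (Y::'d gdset) (\<delta>::nat \<Rightarrow> real).
        (\<forall>n. gd_set (Xs n)) \<and> (\<forall>n. gd_set (Ys n)) \<and> gd_set X \<and> gd_set Y \<and>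
        (\<forall>n. 0 \<le> \<delta> n) \<and> \<delta> \<longlonglongrightarrow> 0 \<and>
        (\<forall>n. dominated_upto (\<delta> n) (Ys n) (Xs n)) \<and>
        (\<lambda>n. gd_box (Xs n) X) \<longlonglongrightarrow> 0 \<and> (\<lambda>n. gd_box (Ys n) Y) \<longlonglongrightarrow> 0
        \<longrightarrow> dominated Y X) \<and>
    \<comment> \<open>(ii)\<close>
    (\<forall>(X::nat \<Rightarrow> 'a qmspace) (Y::'b qmspace) (A::nat \<Rightarrow> 'a set) (p::nat \<Rightarrow> 'a \<Rightarrow> 'b)
        (\<epsilon>::nat \<Rightarrow> real) (L::(real \<Rightarrow> real) set).
        (\<forall>n. qm_space (X n)) \<and> qm_space Y \<and>
        (\<forall>n. A n \<in> sets (qmsr (X n))) \<and>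
        (\<forall>n. p n \<in> restrict_space (qmsr (X n)) (A n) \<rightarrow>\<^sub>M qmsr Y) \<and>
        (\<forall>n. 0 \<le> \<epsilon> n) \<and> \<epsilon> \<longlonglongrightarrow> 0 \<and>
        (\<lambda>n. measure (qmsr (X n)) (A n)) \<longlonglongrightarrow> 1 \<and>
        weakly_converges_on (qm_top Y)
          (\<lambda>n. distr (restrict_space (qmsr (X n)) (A n)) (qmsr Y) (p n)) (qmsr Y) \<and>
        (\<forall>n. \<forall>x\<in>A n. \<forall>y\<in>A n. qdist Y (p n x) (p n y) \<le> qdist (X n) x y + \<epsilon> n) \<and>
        monoidal L \<and> TB \<subseteq> L \<and> L \<subseteq> Lip1p_R
        \<longrightarrow> (\<forall>(r::nat \<Rightarrow> nat) P. strict_mono r \<and> pyramid L P \<and>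
               pyramid_conv L (\<lambda>k. generated_pyramid L (Rep_plus (X (r k)))) P
               \<longrightarrow> class_in (Rep_plus Y) P)) \<and>
    \<comment> \<open>(iii) (a)\<close>
    (\<forall>(P::nat \<Rightarrow> real gdset set) Q (\<kappa>::real).
        (\<forall>n. pyramid Lip1p_R (P n)) \<and> pyramid Lip1p_R Q \<and> pyramid_conv Lip1p_R P Q \<and>
        0 < \<kappa> \<and> \<kappa> < 1
        \<longrightarrow> ((\<lambda>\<epsilon>. liminf (\<lambda>n. ObsDiam_family (P n) (\<kappa> + \<epsilon>))) \<longlongrightarrow> ObsDiam_family Q \<kappa>)
              (at 0 within {0<..<1 - \<kappa>}) \<and>
            ((\<lambda>\<epsilon>. limsup (\<lambda>n. ObsDiam_family (P n) (\<kappa> + \<epsilon>))) \<longlongrightarrow> ObsDiam_family Q \<kappa>)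
              (at 0 within {0<..<1 - \<kappa>})) \<and>
    \<comment> \<open>(iii) (b)\<close>
    (\<forall>(P::nat \<Rightarrow> real gdset set) Q (N::nat) (\<kappa>::nat \<Rightarrow> real).
        (\<forall>n. pyramid TB (P n)) \<and> pyramid TB Q \<and> pyramid_conv TB P Q \<and>
        0 < N \<and> (\<forall>i\<le>N. 0 < \<kappa> i \<and> \<kappa> i < 1)
        \<longrightarrow> ((\<lambda>\<epsilon>. liminf (\<lambda>n. Sep_family (P n) N (\<lambda>i. \<kappa> i - \<epsilon>))) \<longlongrightarrow> Sep_family Q N \<kappa>)
              (at 0 within {0<..<Min (\<kappa> ` {..N})}) \<and>
            ((\<lambda>\<epsilon>. limsup (\<lambda>n. Sep_family (P n) N (\<lambda>i. \<kappa> i - \<epsilon>))) \<longlongrightarrow> Sep_family Q N \<kappa>)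
              (at 0 within {0<..<Min (\<kappa> ` {..N})}))"
proof (intro conjI allI impI; elim conjE)
  show "box_le Y X \<le> gd_box X Y" if "gd_set X" "gd_set Y" for X :: "'a gdset" and Y :: "'b gdset"
    by (rule box_le_le_gd_box[OF that])
  show "box_le Y X = 0 \<longleftrightarrow> dominated Y X" if "gd_set X" "gd_set Y" for X :: "'a gdset" and Y :: "'b gdset"
    by (rule box_le_zero_iff[OF that])
  show "box_le Z X \<le> box_le Z Y + box_le Y X" if "gd_set X" "gd_set Y" "gd_set Z"
    for X :: "'a gdset" and Y :: "'b gdset" and Z :: "'c gdset"
    by (rule box_le_triangle[OF that])
next
  fix Xs :: "nat \<Rightarrow> 'a gdset" and Ys :: "nat \<Rightarrow> 'b gdset" and X :: "'c gdset" and Y :: "'d gdset" and \<delta> :: "nat \<Rightarrow> real"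
  assume "\<forall>n. gd_set (Xs n)" "\<forall>n. gd_set (Ys n)" "gd_set X" "gd_set Y" "\<forall>n. 0 \<le> \<delta> n" "\<delta> \<longlonglongrightarrow> 0"
    "\<forall>n. dominated_upto (\<delta> n) (Ys n) (Xs n)" "(\<lambda>n. gd_box (Xs n) X) \<longlonglongrightarrow> 0" "(\<lambda>n. gd_box (Ys n) Y) \<longlonglongrightarrow> 0"
  then show "dominated Y X" by (intro dominated_of_box_limits[of Xs Ys X Y \<delta>]) auto
next
  fix X :: "nat \<Rightarrow> 'a qmspace" and Y :: "'b qmspace" and A :: "nat \<Rightarrow> 'a set" and p :: "nat \<Rightarrow> 'a \<Rightarrow> 'b"
    and \<epsilon> :: "nat \<Rightarrow> real" and L :: "(real \<Rightarrow> real) set" and r :: "nat \<Rightarrow> nat" and P :: "real gdset set"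
  assume X: "\<forall>n. qm_space (X n)" and Y: "qm_space Y" and A: "\<forall>n. A n \<in> sets (qmsr (X n))"
    and p: "\<forall>n. p n \<in> restrict_space (qmsr (X n)) (A n) \<rightarrow>\<^sub>M qmsr Y" and \<epsilon>: "\<epsilon> \<longlonglongrightarrow> 0"
    and wc: "weakly_converges_on (qm_top Y) (\<lambda>n. distr (restrict_space (qmsr (X n)) (A n)) (qmsr Y) (p n)) (qmsr Y)"
    and le: "\<forall>n. \<forall>x\<in>A n. \<forall>y\<in>A n. qdist Y (p n x) (p n y) \<le> qdist (X n) x y + \<epsilon> n"
    and L: "L \<subseteq> Lip1p_R" and r: "strict_mono r"
    and conv: "pyramid_conv L (\<lambda>k. generated_pyramid L (Rep_plus (X (r k)))) P"
  have "\<forall>\<^sub>F n in sequentially. box_le (Rep_plus Y) (Rep_plus (X n)) \<le> e" if "0 < e" for e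
    by (rule box_le_Rep_plus_tendsto[of X Y A p \<epsilon>]) (use X Y A p \<epsilon> wc le that in auto)
  then show "class_in (Rep_plus Y) P" by (rule Rep_plus_mem_limit[OF spec[OF X] Y L _ r conv])
next
  fix P :: "nat \<Rightarrow> real gdset set" and Q and \<kappa> :: real
  assume *: "\<forall>n. pyramid Lip1p_R (P n)" "pyramid Lip1p_R Q" "pyramid_conv Lip1p_R P Q" "0 < \<kappa>" "\<kappa> < 1"
  show "((\<lambda>\<epsilon>. liminf (\<lambda>n. ObsDiam_family (P n) (\<kappa> + \<epsilon>))) \<longlongrightarrow> ObsDiam_family Q \<kappa>) (at 0 within {0<..<1 - \<kappa>})"
    and "((\<lambda>\<epsilon>. limsup (\<lambda>n. ObsDiam_family (P n) (\<kappa> + \<epsilon>))) \<longlongrightarrow> ObsDiam_family Q \<kappa>) (at 0 within {0<..<1 - \<kappa>})"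
    by (rule ObsDiam_family_tendsto[OF spec[OF *(1)] *(2-)])+
next
  fix P :: "nat \<Rightarrow> real gdset set" and Q and N :: nat and \<kappa> :: "nat \<Rightarrow> real"
  assume *: "\<forall>n. pyramid TB (P n)" "pyramid TB Q" "pyramid_conv TB P Q" "0 < N" "\<forall>i\<le>N. 0 < \<kappa> i \<and> \<kappa> i < 1"
  have \<kappa>: "0 < \<kappa> i" if "i \<le> N" for i using *(5) that by blast
  show "((\<lambda>\<epsilon>. liminf (\<lambda>n. Sep_family (P n) N (\<lambda>i. \<kappa> i - \<epsilon>))) \<longlongrightarrow> Sep_family Q N \<kappa>) (at 0 within {0<..<Min (\<kappa> ` {..N})})"
    and "((\<lambda>\<epsilon>. limsup (\<lambda>n. Sep_family (P n) N (\<lambda>i. \<kappa> i - \<epsilon>))) \<longlongrightarrow> Sep_family Q N \<kappa>) (at 0 within {0<..<Min (\<kappa> ` {..N})})"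
    by (rule Sep_family_tendsto[OF spec[OF *(1)] *(2-4) \<kappa>]; assumption)+
qed

end
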